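(* Assume the hypotheses [Convexity], [Dynamics], [Running cost], [Terminal cost] and [Inner ball] stated in the context, that $g$ is locally semiconcave, that the value function $V$ is continuous, and that both $H$ and $H^0$ are $C^{1,1}$ on $\mathbb{R}^d\times(\mathbb{R}^d\setminus\{0\})$. For every $x\in\mathcal R\setminus\mathcal S$: (a) if $\mathrm{hypo}(V)$ is differentiable at $(x,V(x))$, then there is a unique optimal trajectory steering $x$ to $\mathcal S$; (b) if the boundary of $\mathcal S$ is $C^{1,1}$ and $g$ is differentiable on $\partial\mathcal S$, then the reverse implication also holds: if there is a unique optimal trajectory steering $x$ to $\mathcal S$, then $\mathrm{hypo}(V)$ is differentiable at $(x,V(x))$.
   Context: Setting. $U\subset\mathbb{R}^m$ is nonempty and compact, $\mathcal S\subseteq\mathbb{R}^d$ is nonempty and closed (the target), $\mathcal S^c=\mathbb{R}^d\setminus\mathcal S$, and $f:\mathbb{R}^d\times U\to\mathbb{R}^d$, $r:\mathbb{R}^d\times U\to\mathbb{R}$, $g:\mathbb{R}^d\to\mathbb{R}$ are given. For $x\in\mathbb{R}^d$ and a measurable control $u:[0,\infty)\to U$, $y^{x,u}$ is the Carath\'eodory solution of $y'(s)=f(y(s),u(s))$, $y(0)=x$, and $\tau^{x,u}=\min\{t\ge 0:y^{x,u}(t)\in\mathcal S\}$ ($+\infty$ if $\mathcal S$ is never reached). The value function is $V(x)=\inf_u\big(\int_0^{\tau^{x,u}}r(y^{x,u}(s),u(s))\,ds+g(y^{x,u}(\tau^{x,u}))\big)$, the infimum being over measurable controls with $\tau^{x,u}<\infty$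 ($V(x)=+\infty$ if there are none). $\mathcal R=\{x:\tau^{x,u}<\infty\text{ for some }u\}$. "$V$ is continuous" means continuous on $\mathcal R$. A control $u^*$ is optimal for $x$ if $\tau^{x,u^*}<\infty$ and it attains the infimum; then $y^{x,u^*}$ restricted to $[0,\tau^{x,u^*}]$ is an optimal trajectory steering $x$ to $\mathcal S$. $H(x,p)=\max_{\omega\in U}\{-p\cdot f(x,\omega)-r(x,\omega)\}$ and $H^0(x,p)=\max_{\omega\in U}\{-p\cdot f(x,\omega)\}$. $C^{1,1}$ means differentiable with locally Lipschitz gradient. Hypotheses (with constants $N,L,r_0,\rho_0>0$). [Convexity] For every $x$ the set $\{(v,\lambda)\in\mathbb{R}^d\times\mathbb{R}:\exists\omega\in U,\ v=f(x,\omega),\ \lambda\ge r(x,\omega)\}$ is convex. [Dynamics] $f$ is continuous, $|f|<N$; $D_xf$ exists everywhere and is continuous in $(x,u)$; $|f(y,\omega)-f(x,\omega)|\le L|y-x|$ and $|D_xf(y,\omega)-D_xf(x,\omega)|\le L|y-x|$ for all $x,y\in\mathbb{R}^d$, $\omega\in U$. [Running cost] $r$ is continuous and differentiable in $x$, $D_xr$ is continuous, $|r(y,\omega)-r(x,\omega)|+|D_xr(y,\omega)-D_xr(x,\omega)|\le L|y-x|$ for all $x,y,\omega$, and $r(x,\omega)\ge r_0$ for all $x,\omega$. [Terminal cost] There are a neighborhood $\mathcal N$ of $\partial\mathcal S$ and $0\le G<r_0/N$ with $|g(y)-g(x)|\le G|y-x|$ for $x,y\in\mathcal N$. [Inner ball]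 For every $x\in\partial\mathcal S$ there is a unit vector $\xi_x$ with $\xi_x\cdot(y-x)\le\frac1{2\rho_0}|y-x|^2$ for all $y\in\overline{\mathcal S^c}$. Notions. $g$ is locally semiconcave if every point has a ball $B$ and $c>0$ with $(1-\lambda)g(x_0)+\lambda g(x_1)-g((1-\lambda)x_0+\lambda x_1)\le c\lambda(1-\lambda)|x_0-x_1|^2$ for $x_0,x_1\in B$, $\lambda\in[0,1]$. $\mathrm{hypo}(V)=\{(z,\beta)\in\overline{\mathcal S^c}\times\mathbb{R}:\beta\le V(z)\}$. For a set $Q$ and $q\in Q$, the Fr\'echet normal cone is $N^F_Q(q)=\{v:\limsup_{Q\ni q'\to q}v\cdot\frac{q'-q}{|q'-q|}\le0\}$. $\mathrm{hypo}(V)$ is differentiable at $(x,V(x))$ if $N^F_{\mathrm{hypo}(V)}(x,V(x))=\{sv_x:s\ge0\}$ for some unit vector $v_x\in\mathbb{R}^{d+1}$ satisfying $v_x\cdot(y-x,V(y)-V(x))=o(|y-x|+|V(y)-V(x)|)$ for $y\in\overline{\mathcal S^c}\cap\mathcal R$, as $|y-x|+|V(y)-V(x)|\to0$. *)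

theory Defs
  imports "HOL-Analysis.Analysis"
begin

definition measurable_controls :: "'b::euclidean_space set \<Rightarrow> (real \<Rightarrow> 'b) set" where
  "measurable_controls U = {u. u \<in> borel_measurable (lebesgue_on {0..}) \<and> (\<forall>t\<ge>0. u t \<in> U)}"

text \<open>
  Absolute continuity of a curve on a compact interval \<open>{a..b}\<close>: the elements of a
  division are non-overlapping compact intervals \<open>K = {Inf K..Sup K}\<close>.
\<close>

definition abs_continuous_on_interval :: "real \<Rightarrow> real \<Rightarrow> (real \<Rightarrow> 'a::real_normed_vector) \<Rightarrow> bool" where
  "abs_continuous_on_interval a b y \<longleftrightarrow>
     (\<forall>\<epsilon>>0. \<exists>\<delta>>0. \<forall>D. D division_of \<Union>D \<and> \<Union>D \<subseteq> {a..b} \<and> (\<Sum>K\<in>D. Sup K - Inf K) < \<delta> \<longrightarrow>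
        (\<Sum>K\<in>D. norm (y (Sup K) - y (Inf K))) < \<epsilon>)"

definition caratheodory_solution ::
    "('a::euclidean_space \<Rightarrow> 'b::euclidean_space \<Rightarrow> 'a) \<Rightarrow> 'a \<Rightarrow> (real \<Rightarrow> 'b) \<Rightarrow> (real \<Rightarrow> 'a) \<Rightarrow> bool" where
  "caratheodory_solution f x u y \<longleftrightarrow>
     y 0 = x \<and> (\<forall>T\<ge>0. abs_continuous_on_interval 0 T y) \<and>
     (AE s in lebesgue_on {0..}. (y has_vector_derivative f (y s) (u s)) (at s within {0..}))"

text \<open>
  \<open>trajectory f x u\<close> is the curve $y^{x,u}$. Curves live on \<open>{0..}\<close>; \<open>extensional\<close> fixes
  the irrelevant values at negative times, so that the description is unique.
\<close>

definition trajectory ::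
    "('a::euclidean_space \<Rightarrow> 'b::euclidean_space \<Rightarrow> 'a) \<Rightarrow> 'a \<Rightarrow> (real \<Rightarrow> 'b) \<Rightarrow> real \<Rightarrow> 'a" where
  "trajectory f x u = (THE y. y \<in> extensional {0..} \<and> caratheodory_solution f x u y)"

text \<open>
  The infimum is \<open>\<infinity>\<close> when the target is never reached; otherwise it is a minimum, since the
  target is closed and trajectories are continuous.
\<close>

definition hitting_time :: "'a set \<Rightarrow> (real \<Rightarrow> 'a) \<Rightarrow> ereal" where
  "hitting_time S y = (INF t\<in>{t. 0 \<le> t \<and> y t \<in> S}. ereal t)"

definition reaching_controls ::
    "'b::euclidean_space set \<Rightarrow> 'a::euclidean_space set \<Rightarrow> ('a \<Rightarrow> 'b \<Rightarrow> 'a) \<Rightarrow> 'a \<Rightarrow> (real \<Rightarrow> 'b) set" where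
  "reaching_controls U S f x =
     {u \<in> measurable_controls U. hitting_time S (trajectory f x u) < \<infinity>}"

definition reachable_set ::
    "'b::euclidean_space set \<Rightarrow> 'a::euclidean_space set \<Rightarrow> ('a \<Rightarrow> 'b \<Rightarrow> 'a) \<Rightarrow> 'a set" where
  "reachable_set U S f = {x. reaching_controls U S f x \<noteq> {}}"

definition cost ::
    "'a::euclidean_space set \<Rightarrow> ('a \<Rightarrow> 'b::euclidean_space \<Rightarrow> 'a) \<Rightarrow> ('a \<Rightarrow> 'b \<Rightarrow> real) \<Rightarrow> ('a \<Rightarrow> real) \<Rightarrow>
     'a \<Rightarrow> (real \<Rightarrow> 'b) \<Rightarrow> real" where
  "cost S f r g x u =
     (let y = trajectory f x u; \<tau> = real_of_ereal (hitting_time S y)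
      in (LINT s:{0..\<tau>}|lebesgue. r (y s) (u s)) + g (y \<tau>))"

definition value_function ::
    "'b::euclidean_space set \<Rightarrow> 'a::euclidean_space set \<Rightarrow> ('a \<Rightarrow> 'b \<Rightarrow> 'a) \<Rightarrow> ('a \<Rightarrow> 'b \<Rightarrow> real) \<Rightarrow>
     ('a \<Rightarrow> real) \<Rightarrow> 'a \<Rightarrow> ereal" where
  "value_function U S f r g x = (INF u\<in>reaching_controls U S f x. ereal (cost S f r g x u))"

definition optimal_control ::
    "'b::euclidean_space set \<Rightarrow> 'a::euclidean_space set \<Rightarrow> ('a \<Rightarrow> 'b \<Rightarrow> 'a) \<Rightarrow> ('a \<Rightarrow> 'b \<Rightarrow> real) \<Rightarrow>
     ('a \<Rightarrow> real) \<Rightarrow> 'a \<Rightarrow> (real \<Rightarrow> 'b) \<Rightarrow> bool" where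
  "optimal_control U S f r g x u \<longleftrightarrow>
     u \<in> reaching_controls U S f x \<and> ereal (cost S f r g x u) = value_function U S f r g x"

text \<open>
  An optimal trajectory is a curve on a compact interval \<open>{0..\<tau>}\<close>, encoded as the pair of
  \<open>\<tau>\<close> and the curve restricted to \<open>{0..\<tau>}\<close>. Different optimal controls may
  thus induce the same optimal trajectory.
\<close>

definition optimal_trajectories ::
    "'b::euclidean_space set \<Rightarrow> 'a::euclidean_space set \<Rightarrow> ('a \<Rightarrow> 'b \<Rightarrow> 'a) \<Rightarrow> ('a \<Rightarrow> 'b \<Rightarrow> real) \<Rightarrow>
     ('a \<Rightarrow> real) \<Rightarrow> 'a \<Rightarrow> (real \<times> (real \<Rightarrow> 'a)) set" where
  "optimal_trajectories U S f r g x =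
     {(\<tau>, y). \<exists>u. optimal_control U S f r g x u \<and>
        ereal \<tau> = hitting_time S (trajectory f x u) \<and> y = restrict (trajectory f x u) {0..\<tau>}}"

text \<open>The suprema are maxima for nonempty compact \<open>U\<close> and continuous \<open>f\<close>, \<open>r\<close>.\<close>

definition hamiltonian ::
    "'b set \<Rightarrow> ('a::euclidean_space \<Rightarrow> 'b \<Rightarrow> 'a) \<Rightarrow> ('a \<Rightarrow> 'b \<Rightarrow> real) \<Rightarrow> 'a \<Rightarrow> 'a \<Rightarrow> real" where
  "hamiltonian U f r x p = (SUP \<omega>\<in>U. - (p \<bullet> f x \<omega>) - r x \<omega>)"

definition hamiltonian0 ::
    "'b set \<Rightarrow> ('a::euclidean_space \<Rightarrow> 'b \<Rightarrow> 'a) \<Rightarrow> 'a \<Rightarrow> 'a \<Rightarrow> real" where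
  "hamiltonian0 U f x p = (SUP \<omega>\<in>U. - (p \<bullet> f x \<omega>))"

definition C11_with_gradient :: "'c::real_inner set \<Rightarrow> ('c \<Rightarrow> real) \<Rightarrow> ('c \<Rightarrow> 'c) \<Rightarrow> bool" where
  "C11_with_gradient W h Dh \<longleftrightarrow>
     (\<forall>z\<in>W. GDERIV h z :> Dh z) \<and>
     (\<forall>z\<in>W. \<exists>e>0. \<exists>C. C-lipschitz_on (ball z e \<inter> W) Dh)"

definition C11_on :: "'c::real_inner set \<Rightarrow> ('c \<Rightarrow> real) \<Rightarrow> bool" where
  "C11_on W h \<longleftrightarrow> (\<exists>Dh. C11_with_gradient W h Dh)"

text \<open>
  The boundary is a hypersurface of class $C^{1,1}$: locally a regular level set of a
  $C^{1,1}$ function.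
\<close>

definition C11_boundary :: "'a::euclidean_space set \<Rightarrow> bool" where
  "C11_boundary S \<longleftrightarrow>
     (\<forall>x\<in>frontier S. \<exists>W \<phi> D\<phi>. open W \<and> x \<in> W \<and> C11_with_gradient W \<phi> D\<phi> \<and>
        (\<forall>z\<in>W. D\<phi> z \<noteq> 0) \<and> frontier S \<inter> W = {z \<in> W. \<phi> z = 0})"

definition locally_semiconcave :: "('a::real_normed_vector \<Rightarrow> real) \<Rightarrow> bool" where
  "locally_semiconcave g \<longleftrightarrow>
     (\<forall>z. \<exists>e>0. \<exists>c>0. \<forall>x0\<in>ball z e. \<forall>x1\<in>ball z e. \<forall>\<mu>\<in>{0..1}.
        (1 - \<mu>) * g x0 + \<mu> * g x1 - g ((1 - \<mu>) *\<^sub>R x0 + \<mu> *\<^sub>R x1)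
          \<le> c * \<mu> * (1 - \<mu>) * (norm (x0 - x1))\<^sup>2)"

definition frechet_normal_cone :: "'c::real_inner set \<Rightarrow> 'c \<Rightarrow> 'c set" where
  "frechet_normal_cone Q q =
     {v. Limsup (at q within Q) (\<lambda>q'. ereal (v \<bullet> ((q' - q) /\<^sub>R norm (q' - q)))) \<le> 0}"

definition hypo :: "'a::euclidean_space set \<Rightarrow> ('a \<Rightarrow> ereal) \<Rightarrow> ('a \<times> real) set" where
  "hypo S V = {(z, \<beta>). z \<in> closure (- S) \<and> ereal \<beta> \<le> V z}"

text \<open>
  \<open>V\<close> is used at points of the set \<open>R\<close>, on which it is finite, so \<open>real_of_ereal\<close> loses nothing.
\<close>

definition hypo_differentiable_at ::
    "'a::euclidean_space set \<Rightarrow> 'a set \<Rightarrow> ('a \<Rightarrow> ereal) \<Rightarrow> 'a \<Rightarrow> bool" where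
  "hypo_differentiable_at S R V x \<longleftrightarrow>
     (let W = (\<lambda>z. real_of_ereal (V z)) in
      \<exists>v. norm v = 1 \<and>
        frechet_normal_cone (hypo S V) (x, W x) = {s *\<^sub>R v |s. s \<ge> 0} \<and>
        (\<forall>\<epsilon>>0. \<exists>\<delta>>0. \<forall>y \<in> closure (- S) \<inter> R.
           norm (y - x) + \<bar>W y - W x\<bar> < \<delta> \<longrightarrow>
             \<bar>v \<bullet> (y - x, W y - W x)\<bar> \<le> \<epsilon> * (norm (y - x) + \<bar>W y - W x\<bar>)))"

definition convexity_hyp ::
    "'b set \<Rightarrow> ('a::euclidean_space \<Rightarrow> 'b \<Rightarrow> 'a) \<Rightarrow> ('a \<Rightarrow> 'b \<Rightarrow> real) \<Rightarrow> bool" where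
  "convexity_hyp U f r \<longleftrightarrow>
     (\<forall>x. convex {(v, \<mu>::real). \<exists>\<omega>\<in>U. v = f x \<omega> \<and> \<mu> \<ge> r x \<omega>})"

definition dynamics_hyp ::
    "'b::euclidean_space set \<Rightarrow> ('a::euclidean_space \<Rightarrow> 'b \<Rightarrow> 'a) \<Rightarrow> real \<Rightarrow> real \<Rightarrow> bool" where
  "dynamics_hyp U f N L \<longleftrightarrow>
     continuous_on (UNIV \<times> U) (\<lambda>(x, \<omega>). f x \<omega>) \<and>
     (\<forall>x. \<forall>\<omega>\<in>U. norm (f x \<omega>) < N) \<and>
     (\<forall>x y. \<forall>\<omega>\<in>U. norm (f y \<omega> - f x \<omega>) \<le> L * norm (y - x)) \<and>
     (\<exists>Df :: 'a \<Rightarrow> 'b \<Rightarrow> 'a \<Rightarrow>\<^sub>L 'a.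
        (\<forall>x. \<forall>\<omega>\<in>U. ((\<lambda>z. f z \<omega>) has_derivative blinfun_apply (Df x \<omega>)) (at x)) \<and>
        continuous_on (UNIV \<times> U) (\<lambda>(x, \<omega>). Df x \<omega>) \<and>
        (\<forall>x y. \<forall>\<omega>\<in>U. norm (Df y \<omega> - Df x \<omega>) \<le> L * norm (y - x)))"

definition running_cost_hyp ::
    "'b::euclidean_space set \<Rightarrow> ('a::euclidean_space \<Rightarrow> 'b \<Rightarrow> real) \<Rightarrow> real \<Rightarrow> real \<Rightarrow> bool" where
  "running_cost_hyp U r L r\<^sub>0 \<longleftrightarrow>
     continuous_on (UNIV \<times> U) (\<lambda>(x, \<omega>). r x \<omega>) \<and>
     (\<exists>Dr :: 'a \<Rightarrow> 'b \<Rightarrow> 'a.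
        (\<forall>x. \<forall>\<omega>\<in>U. GDERIV (\<lambda>z. r z \<omega>) x :> Dr x \<omega>) \<and>
        continuous_on (UNIV \<times> U) (\<lambda>(x, \<omega>). Dr x \<omega>) \<and>
        (\<forall>x y. \<forall>\<omega>\<in>U. \<bar>r y \<omega> - r x \<omega>\<bar> + norm (Dr y \<omega> - Dr x \<omega>) \<le> L * norm (y - x))) \<and>
     (\<forall>x. \<forall>\<omega>\<in>U. r x \<omega> \<ge> r\<^sub>0)"

definition terminal_cost_hyp ::
    "'a::euclidean_space set \<Rightarrow> ('a \<Rightarrow> real) \<Rightarrow> real \<Rightarrow> real \<Rightarrow> bool" where
  "terminal_cost_hyp S g N r\<^sub>0 \<longleftrightarrow>
     (\<exists>W G. open W \<and> frontier S \<subseteq> W \<and> 0 \<le> G \<and> G < r\<^sub>0 / N \<and>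
        (\<forall>x\<in>W. \<forall>y\<in>W. \<bar>g y - g x\<bar> \<le> G * norm (y - x)))"

definition inner_ball_hyp :: "'a::euclidean_space set \<Rightarrow> real \<Rightarrow> bool" where
  "inner_ball_hyp S \<rho>\<^sub>0 \<longleftrightarrow>
     (\<forall>x\<in>frontier S. \<exists>\<xi>. norm \<xi> = 1 \<and>
        (\<forall>y\<in>closure (- S). \<xi> \<bullet> (y - x) \<le> 1 / (2 * \<rho>\<^sub>0) * (norm (y - x))\<^sup>2))"

end

theory Submission
  imports Defs "HOL-Complex_Analysis.Great_Picard"
begin

text \<open>
  Along an optimal trajectory \<open>y\<close>, perturbing the initial point and estimating the cost of the perturbed
  trajectories shows that the solution \<open>p\<close> of the adjoint equation, started at the exit
  point from a combination of a normal of \<open>S\<close> and a supergradient of \<open>g\<close> that makes the Hamiltonian vanish,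
  satisfies: \<open>(- p t, \<mu>)\<close> is a proximal normal of the hypograph of \<open>V\<close> at \<open>(y t, V (y t))\<close>.
  Proximal normality and dynamic programming give the maximum principle, so \<open>(y, p)\<close> solves the
  Hamiltonian system of \<open>H\<close> if \<open>\<mu> > 0\<close> and of \<open>H\<^sup>0\<close> if \<open>\<mu> = 0\<close>.

  If the normal cone at \<open>(x, V x)\<close> is a ray, any two optimal trajectories have proportional initial costates
  and therefore coincide, the Hamiltonian system being locally Lipschitz. Conversely, if the optimal trajectory
  is unique and \<open>S\<close>, \<open>g\<close> are smooth, its terminal data are unique; by compactness the optimal trajectories and
  costates of points converging to \<open>x\<close> converge to those of \<open>x\<close>. The proximal inequalities at nearby points
  then bound \<open>V\<close> from below near \<open>x\<close>, to first order, by what \<open>(- p 0, \<mu>)\<close> prescribes from above.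
\<close>

section \<open>Lipschitz curves and their almost everywhere derivatives\<close>

text \<open>\<open>V\<close> is only assumed continuous, so normals of its hypograph may be
  horizontal. Normalising dual data by \<open>0 \<le> \<mu> \<le> 1\<close> keeps them in a compact
  set and makes \<mu> = 0 an ordinary limit case. Limits then need uniform estimates: the proximal
  constant depends, beyond the data of the problem, only on a bound for the exit time and on the
  quadratic constant of the supergradient.

  The slope condition \<open>G * N < r\<^sub>0\<close> acts three times: it bounds exit times by
  costs, it shows that a limit of exit times is the first hitting time of the limit curve, and it
  makes the Hamiltonian negative at \<mu> = 1. The inner ball gives the sign at \<mu> = 0, so a
  multiplier with vanishing Hamiltonian exists in between.

  Optimal controls need not converge; only states and costs do. Convexity of the velocity set
  recovers an admissible limit. Differentiability of the Hamiltonians makes velocity and adjoint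
  right-hand side functions of state and costate alone, and this is what lets costates converge.

  Since controls are merely measurable, all equations hold almost everywhere along Lipschitz
  curves.\<close>

text \<open>A gauge argument instead of an integral: tags off \<open>E\<close> get intervals so
  short that the derivative controls the increment, while tags in \<open>E\<close> get intervals
  inside an open set \<open>T\<close> of tiny measure, where absolute continuity makes the total
  increment small.\<close>

lemma abs_continuous_increment_le:
  fixes m :: "real \<Rightarrow> real"
  assumes ab: "a \<le> b" and ac: "abs_continuous_on_interval a b m" and E: "negligible E"
    and der: "\<And>t. t \<in> {a..b} - E \<Longrightarrow> \<exists>w\<le>M. (m has_vector_derivative w) (at t within {a..b})"
  shows "m b - m a \<le> M * (b - a)"
proof (cases "a = b")
  case False
  then have ab': "a < b" using ab by simp
  show ?thesis
  proof (rule field_le_epsilon)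
    fix \<epsilon> :: real assume \<epsilon>: "0 < \<epsilon>"
    define e where "e = (\<epsilon> / 3) / (b - a)"
    have e: "e > 0" "e * (b - a) = \<epsilon>/3" proof -
      have "b - a \<noteq> 0" using ab' by simp
      then show "e * (b - a) = \<epsilon>/3" unfolding e_def by (rule nonzero_eq_divide_eq[THEN iffD1, OF _ refl])
    qed (use \<epsilon> ab' in \<open>simp add: e_def\<close>)
    obtain \<delta> where \<delta>: "\<delta> > 0" and acD: "\<And>D. D division_of \<Union>D \<Longrightarrow> \<Union>D \<subseteq> {a..b} \<Longrightarrow>
        (\<Sum>K\<in>D. Sup K - Inf K) < \<delta> \<Longrightarrow> (\<Sum>K\<in>D. norm (m (Sup K) - m (Inf K))) < \<epsilon>/3"
      using ac[unfolded abs_continuous_on_interval_def, rule_format, of "\<epsilon>/3"] \<epsilon> by auto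
    \<comment> \<open>The second bound pays for the intervals tagged in \<open>E\<close>: their
      length is missing when the slope \<open>M + e\<close> is summed over the other
      intervals.\<close>
    define \<eta> where "\<eta> = min \<delta> (\<epsilon> / (3 * (\<bar>M + e\<bar> + 1)))"
    have \<eta>: "\<eta> > 0" "\<eta> \<le> \<delta>" "\<bar>M + e\<bar> * \<eta> \<le> \<epsilon>/3"
    proof -
      have "\<epsilon> / (3 * (\<bar>M + e\<bar> + 1)) > 0" using \<epsilon> by (intro divide_pos_pos mult_pos_pos add_nonneg_pos) auto
      then show "\<eta> > 0" "\<eta> \<le> \<delta>" using \<delta> by (auto simp: \<eta>_def)
      have "\<bar>M + e\<bar> * \<eta> \<le> \<bar>M + e\<bar> * (\<epsilon> / (3 * (\<bar>M + e\<bar> + 1)))"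
        by (intro mult_left_mono) (auto simp: \<eta>_def)
      also have "\<dots> = \<epsilon>/3 * (\<bar>M + e\<bar> / (\<bar>M + e\<bar> + 1))" by (simp add: mult_ac)
      also have "\<dots> \<le> \<epsilon>/3 * 1" using \<epsilon> by (intro mult_left_mono) (auto simp: divide_le_eq_1)
      finally show "\<bar>M + e\<bar> * \<eta> \<le> \<epsilon>/3" by simp
    qed
    obtain T where T: "open T" "E \<subseteq> T" "(T - E) \<in> lmeasurable" "emeasure lebesgue (T - E) < ennreal \<eta>"
      using sets_lebesgue_outer_open[of E \<eta>] E \<eta>(1) negligible_imp_sets by blast
    have Tm: "T \<in> lmeasurable" "measure lebesgue T < \<eta>"
    proof -
      have eq: "T = (T - E) \<union> E" using T(2) by auto
      have lm: "(T - E) \<union> E \<in> lmeasurable"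
        using T(3) E negligible_imp_measurable by (intro fmeasurable.Un) auto
      then show "T \<in> lmeasurable" using eq by simp
      have "measure lebesgue T \<le> measure lebesgue (T - E) + measure lebesgue E"
        using measure_Un_le[of "T - E" lebesgue E] T(3) E eq negligible_imp_sets by auto
      also have "\<dots> = measure lebesgue (T - E)" using E by (simp add: negligible_imp_measure0)
      also have "\<dots> < \<eta>" using T(3,4) \<eta>(1) by (simp add: emeasure_eq_measure2 ennreal_less_iff)
      finally show "measure lebesgue T < \<eta>" .
    qed
    have "\<exists>d>0. t \<in> {a..b} - E \<longrightarrow> (\<exists>w\<le>M. \<forall>s\<in>{a..b}. \<bar>s - t\<bar> < d \<longrightarrow> \<bar>m s - m t - (s - t) * w\<bar> \<le> e * \<bar>s - t\<bar>)" for t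
    proof (cases "t \<in> {a..b} - E")
      case True
      then obtain w where w: "w \<le> M" "(m has_vector_derivative w) (at t within {a..b})" using der by blast
      then have "\<exists>d>0. \<forall>s\<in>{a..b}. norm (s - t) < d \<longrightarrow> norm (m s - m t - (s - t) *\<^sub>R w) \<le> e * norm (s - t)"
        using e(1) by (auto simp: has_vector_derivative_def has_derivative_within_alt)
      then show ?thesis using w(1) by auto
    qed (auto intro: exI[of _ 1])
    then obtain d where d: "\<And>t. d t > 0" "\<And>t. t \<in> {a..b} - E \<Longrightarrow>
        (\<exists>w\<le>M. \<forall>s\<in>{a..b}. \<bar>s - t\<bar> < d t \<longrightarrow> \<bar>m s - m t - (s - t) * w\<bar> \<le> e * \<bar>s - t\<bar>)"
      by metis
    define \<gamma> where "\<gamma> t = (if t \<in> E then T else ball t (d t))" for t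
    have "gauge \<gamma>" using T(1,2) d(1) by (auto simp: gauge_def \<gamma>_def)
    then obtain p where p: "p tagged_division_of {a..b}" "\<gamma> fine p" by (rule fine_division_exists_real)
    note pD = tagged_division_ofD[OF p(1)]
    have Kint: "Inf K \<le> Sup K" "a \<le> Inf K" "Sup K \<le> b" "Inf K \<le> x" "x \<le> Sup K"
      "Inf K \<in> K" "Sup K \<in> K" "measure lebesgue K = Sup K - Inf K" "K \<noteq> {}"
      if xK: "(x, K) \<in> p" for x K
    proof -
      obtain u v where "K = cbox u v" "x \<in> K" "K \<subseteq> {a..b}" using pD(2)[OF xK] pD(3)[OF xK] pD(4)[OF xK] by blast
      then have "K = {u..v}" "u \<le> v" "a \<le> u" "v \<le> b" "u \<le> x" "x \<le> v" by auto
      then show "Inf K \<le> Sup K" "a \<le> Inf K" "Sup K \<le> b" "Inf K \<le> x" "x \<le> Sup K"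
        "Inf K \<in> K" "Sup K \<in> K" "measure lebesgue K = Sup K - Inf K" "K \<noteq> {}" by auto
    qed
    define P1 where "P1 = {(x, K) \<in> p. x \<in> E}"
    have P1: "P1 \<subseteq> p" "finite P1" using pD(1) by (auto simp: P1_def intro: finite_subset[of _ p])
    have tp1: "P1 tagged_partial_division_of {a..b}"
      by (rule tagged_partial_division_subset[OF _ P1(1)]) (use p(1) in \<open>simp add: tagged_division_of_def\<close>)
    have td1: "P1 tagged_division_of (\<Union>(snd ` P1))"
      using tp1 by (rule tagged_partial_division_of_Union_self)
    define D where "D = snd ` P1"
    have div: "D division_of \<Union>D"
      using td1 division_of_tagged_division unfolding D_def by blast
    have fineD: "K \<subseteq> \<gamma> x" if "(x, K) \<in> p" for x K using p(2) that unfolding fine_def by blast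
    have "K \<subseteq> {a..b} \<and> K \<subseteq> T" if "K \<in> D" for K
    proof -
      from that obtain x where x: "(x, K) \<in> p" "x \<in> E" by (auto simp: D_def P1_def)
      show ?thesis using pD(3)[OF x(1)] fineD[OF x(1)] x(2) by (simp add: \<gamma>_def)
    qed
    then have Dsub: "\<Union>D \<subseteq> {a..b}" "\<Union>D \<subseteq> T" by blast+
    have ne: "K \<noteq> {}" if "(x, K) \<in> p" for x K using Kint(9)[OF that] .
    \<comment> \<open>\<open>P1\<close> consists of tagged pairs, \<open>D\<close> of intervals. Two
      pairs can share an interval only if it is degenerate, which is why \<open>F\<close> has to
      vanish on singletons; the empty set is sent to 0 separately because \<open>Sup\<close> and
      \<open>Inf\<close> carry no information there.\<close>
    have tosum: "sum (\<lambda>(x, K). F K) P1 = sum F D" if F0: "\<And>u. F {u..u} = (0::real)" for F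
    proof -
      define F' where "F' K = (if K = {} then 0 else F K)" for K
      have "sum (\<lambda>(x, K). F K) P1 = sum (\<lambda>(x, K). F' K) P1"
        using ne P1(1) by (intro sum.cong) (auto simp: F'_def)
      also have "\<dots> = sum F' D"
        unfolding D_def
      proof (rule sum.over_tagged_division_lemma[OF td1])
        fix u v :: real assume "box u v = {}"
        then have "v \<le> u" by (simp add: box_real not_less)
        then show "F' (cbox u v) = 0" using F0[of u] by (cases "u = v") (auto simp: F'_def)
      qed
      also have "\<dots> = sum F D" using ne P1(1) by (intro sum.cong) (auto simp: F'_def D_def)
      finally show ?thesis .
    qed
    have len: "sum (\<lambda>(x, K). Sup K - Inf K) P1 < \<eta>"
    proof -
      have "sum (\<lambda>(x, K). Sup K - Inf K) P1 = sum (\<lambda>K. Sup K - Inf K) D" by (rule tosum) simp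
      also have "\<dots> = sum (measure lebesgue) D"
      proof (rule sum.cong)
        fix K assume "K \<in> D"
        then obtain x where "(x, K) \<in> p" using P1(1) by (auto simp: D_def)
        from Kint(8)[OF this] show "Sup K - Inf K = measure lebesgue K" by simp
      qed simp
      also have "\<dots> = measure lebesgue (\<Union>D)" using content_division[OF div] by simp
      also have "\<dots> \<le> measure lebesgue T"
        using Dsub(2) Tm(1) div by (intro measure_mono_fmeasurable) (auto intro: fmeasurableD lmeasurable_division)
      finally show ?thesis using Tm(2) by simp
    qed
    have bad: "sum (\<lambda>(x, K). m (Sup K) - m (Inf K)) P1 \<le> \<epsilon>/3"
    proof -
      have l: "(\<Sum>K\<in>D. Sup K - Inf K) < \<delta>" using len \<eta>(2) tosum[of "\<lambda>K. Sup K - Inf K"] by simp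
      have "sum (\<lambda>(x, K). m (Sup K) - m (Inf K)) P1 = sum (\<lambda>K. m (Sup K) - m (Inf K)) D" by (rule tosum) simp
      also have "\<dots> \<le> sum (\<lambda>K. norm (m (Sup K) - m (Inf K))) D" by (intro sum_mono) simp
      finally show ?thesis using acD[OF div Dsub(1) l] by simp
    qed
    have good: "m (Sup K) - m (Inf K) \<le> (M + e) * (Sup K - Inf K)" if xK: "(x, K) \<in> p - P1" for x K
    proof -
      define u v where "u = Inf K" and "v = Sup K"
      have K: "u \<le> v" "a \<le> u" "v \<le> b" "u \<le> x" "x \<le> v" "u \<in> K" "v \<in> K"
        using Kint[of x K] xK by (simp_all add: u_def v_def)
      have xE: "x \<in> {a..b} - E" using xK K(1-5) by (auto simp: P1_def)
      have Kb: "K \<subseteq> ball x (d x)" using fineD[of x K] xK xE by (simp add: \<gamma>_def)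
      obtain w where w: "w \<le> M" "\<And>s. s \<in> {a..b} \<Longrightarrow> \<bar>s - x\<bar> < d x \<Longrightarrow> \<bar>m s - m x - (s - x) * w\<bar> \<le> e * \<bar>s - x\<bar>"
        using d(2)[OF xE] by blast
      have "u \<in> ball x (d x)" "v \<in> ball x (d x)" using Kb K(6,7) by blast+
      then have "\<bar>m u - m x - (u - x) * w\<bar> \<le> e * (x - u)" "\<bar>m v - m x - (v - x) * w\<bar> \<le> e * (v - x)"
        using w(2)[of u] w(2)[of v] K(1-5) by (auto simp: dist_real_def abs_minus_commute)
      then have "m v - m u \<le> (v - u) * w + e * (v - u)" by (simp add: algebra_simps)
      also have "\<dots> \<le> (v - u) * M + e * (v - u)" using w(1) K(1) by (simp add: mult_left_mono)
      finally show ?thesis unfolding u_def v_def by (simp add: algebra_simps)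
    qed
    have "m b - m a = sum (\<lambda>(x, K). m (Sup K) - m (Inf K)) p"
      using additive_tagged_division_1[OF ab p(1), of m] by simp
    also have "\<dots> = sum (\<lambda>(x, K). m (Sup K) - m (Inf K)) P1 + sum (\<lambda>(x, K). m (Sup K) - m (Inf K)) (p - P1)"
      using sum.subset_diff[OF P1(1) pD(1)] by (simp add: add.commute)
    also have "\<dots> \<le> \<epsilon>/3 + sum (\<lambda>(x, K). (M + e) * (Sup K - Inf K)) (p - P1)"
      using good by (intro add_mono bad sum_mono) auto
    also have "sum (\<lambda>(x, K). (M + e) * (Sup K - Inf K)) (p - P1) =
       (M + e) * (sum (\<lambda>(x, K). Sup K - Inf K) (p - P1))"
      by (simp add: sum_distrib_left case_prod_unfold)
    also have "sum (\<lambda>(x, K). Sup K - Inf K) (p - P1) = (b - a) - sum (\<lambda>(x, K). Sup K - Inf K) P1"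
      using additive_tagged_division_1[OF ab p(1), of "\<lambda>x. x"] P1 pD(1) by (simp add: sum_diff)
    also have "\<epsilon>/3 + (M + e) * ((b - a) - sum (\<lambda>(x, K). Sup K - Inf K) P1)
        \<le> \<epsilon>/3 + ((M * (b - a) + \<epsilon>/3) + \<epsilon>/3)"
    proof -
      have nn: "0 \<le> sum (\<lambda>(x, K). Sup K - Inf K) P1"
        using P1(1) Kint(1) by (intro sum_nonneg) fastforce
      have "- (M + e) * sum (\<lambda>(x, K). Sup K - Inf K) P1 \<le> \<bar>M + e\<bar> * sum (\<lambda>(x, K). Sup K - Inf K) P1"
        using nn by (intro mult_right_mono) auto
      also have "\<dots> \<le> \<bar>M + e\<bar> * \<eta>" using len by (intro mult_left_mono) auto
      also have "\<dots> \<le> \<epsilon>/3" by (rule \<eta>(3))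
      finally show ?thesis using e(2) by (simp add: algebra_simps)
    qed
    finally show "m b - m a \<le> M * (b - a) + \<epsilon>" by simp
  qed
qed simp

lemma lipschitz_imp_abs_continuous:
  assumes "K-lipschitz_on {a..b} y"
  shows "abs_continuous_on_interval a b y"
  unfolding abs_continuous_on_interval_def
proof (intro allI impI)
  fix \<epsilon> :: real assume \<epsilon>: "0 < \<epsilon>"
  have K: "K \<ge> 0" using assms lipschitz_on_nonneg by blast
  show "\<exists>\<delta>>0. \<forall>D. D division_of \<Union> D \<and> \<Union> D \<subseteq> {a..b} \<and> (\<Sum>K\<in>D. Sup K - Inf K) < \<delta> \<longrightarrow>
          (\<Sum>K\<in>D. norm (y (Sup K) - y (Inf K))) < \<epsilon>"
  proof (intro exI[of _ "\<epsilon> / (K + 1)"] conjI allI impI)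
    fix D assume D: "D division_of \<Union> D \<and> \<Union> D \<subseteq> {a..b} \<and> (\<Sum>K\<in>D. Sup K - Inf K) < \<epsilon> / (K + 1)"
    have le: "norm (y (Sup I) - y (Inf I)) \<le> K * (Sup I - Inf I) \<and> Inf I \<le> Sup I" if I: "I \<in> D" for I
    proof -
      obtain u v where "I = cbox u v" "I \<noteq> {}" using D I division_ofD(3,4)[of D "\<Union>D" I] by blast
      then have uv: "I = {u..v}" "u \<le> v" by auto
      then have "{u..v} \<subseteq> {a..b}" using D I by blast
      then have "u \<in> {a..b}" "v \<in> {a..b}" using uv by auto
      then show ?thesis using lipschitz_onD[OF assms, of v u] uv by (auto simp: dist_norm)
    qed
    have "(\<Sum>I\<in>D. norm (y (Sup I) - y (Inf I))) \<le> (\<Sum>I\<in>D. K * (Sup I - Inf I))"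
      using le by (intro sum_mono) auto
    also have "\<dots> = K * (\<Sum>I\<in>D. (Sup I - Inf I))" by (simp add: sum_distrib_left)
    also have "\<dots> \<le> (K + 1) * (\<Sum>I\<in>D. (Sup I - Inf I))"
      using le by (intro mult_right_mono sum_nonneg) auto
    also have "\<dots> < (K + 1) * (\<epsilon> / (K + 1))" using D K by (intro mult_strict_left_mono) auto
    also have "\<dots> = \<epsilon>" using K by simp
    finally show "(\<Sum>K\<in>D. norm (y (Sup K) - y (Inf K))) < \<epsilon>" .
  qed (use K \<epsilon> in auto)
qed

section \<open>Lipschitz curves with a prescribed almost everywhere derivative\<close>

text \<open>The working form of "absolutely continuous with derivative \<open>w\<close>". Lipschitz
  continuity is enough because velocities, running costs and adjoint right-hand sides are bounded on
  compact time intervals, and it is preserved by sums, products and linear maps.\<close>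

definition ae_deriv :: "real \<Rightarrow> real \<Rightarrow> (real \<Rightarrow> 'a::real_normed_vector) \<Rightarrow> (real \<Rightarrow> 'a) \<Rightarrow> bool" where
  "ae_deriv a b y w \<longleftrightarrow> (\<exists>K. K-lipschitz_on {a..b} y) \<and>
     (\<exists>E. negligible E \<and> (\<forall>t\<in>{a<..<b} - E. (y has_vector_derivative w t) (at t)))"

lemma ae_derivE:
  assumes "ae_deriv a b y w"
  obtains K E where "K-lipschitz_on {a..b} y" "negligible E"
    "\<And>t. t \<in> {a<..<b} - E \<Longrightarrow> (y has_vector_derivative w t) (at t)"
  using assms unfolding ae_deriv_def by blast

lemma ae_derivI:
  assumes "K-lipschitz_on {a..b} y" "negligible E"
    "\<And>t. t \<in> {a<..<b} - E \<Longrightarrow> (y has_vector_derivative w t) (at t)"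
  shows "ae_deriv a b y w"
  using assms unfolding ae_deriv_def by blast

lemma ae_deriv_continuous: "ae_deriv a b y w \<Longrightarrow> continuous_on {a..b} y"
  unfolding ae_deriv_def by (auto dest: lipschitz_on_continuous_on)

lemma ae_deriv_subset:
  assumes "ae_deriv a b y w" "a \<le> a'" "b' \<le> b"
  shows "ae_deriv a' b' y w"
proof -
  from assms(1) obtain K E where KE: "K-lipschitz_on {a..b} y" "negligible E"
    "\<And>t. t \<in> {a<..<b} - E \<Longrightarrow> (y has_vector_derivative w t) (at t)" by (rule ae_derivE) blast
  show ?thesis
    by (rule ae_derivI[of K _ _ _ E]) (use KE assms in \<open>auto intro: lipschitz_on_subset\<close>)
qed

lemma ae_deriv_le:
  fixes m :: "real \<Rightarrow> real"
  assumes "a \<le> b" "ae_deriv a b m w" "negligible E" "\<And>t. t \<in> {a<..<b} - E \<Longrightarrow> w t \<le> M"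
  shows "m b - m a \<le> M * (b - a)"
proof -
  obtain K E' where KE: "K-lipschitz_on {a..b} m" "negligible E'"
    "\<And>t. t \<in> {a<..<b} - E' \<Longrightarrow> (m has_vector_derivative w t) (at t)"
    using assms(2) by (rule ae_derivE) blast
  show ?thesis
  proof (rule abs_continuous_increment_le[OF assms(1) lipschitz_imp_abs_continuous[OF KE(1)], of "E \<union> E' \<union> {a, b}"])
    show "negligible (E \<union> E' \<union> {a, b})" using assms(3) KE(2) by auto
    fix t assume "t \<in> {a..b} - (E \<union> E' \<union> {a, b})"
    then have "t \<in> {a<..<b} - E'" "t \<in> {a<..<b} - E" by auto
    then show "\<exists>w\<le>M. (m has_vector_derivative w) (at t within {a..b})"
      using KE(3) assms(4) has_vector_derivative_at_within by blast
  qed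
qed

lemma ae_deriv_linear:
  assumes "bounded_linear l" "ae_deriv a b y w"
  shows "ae_deriv a b (\<lambda>t. l (y t)) (\<lambda>t. l (w t))"
proof -
  from assms(2) obtain K E where KE: "K-lipschitz_on {a..b} y" "negligible E"
    "\<And>t. t \<in> {a<..<b} - E \<Longrightarrow> (y has_vector_derivative w t) (at t)" by (rule ae_derivE) blast
  obtain B where B: "\<And>x. norm (l x) \<le> norm x * B" "B > 0"
    using bounded_linear.pos_bounded[OF assms(1)] by blast
  have lip: "(B * K)-lipschitz_on {a..b} (\<lambda>t. l (y t))"
  proof (rule lipschitz_onI)
    fix s t assume "s \<in> {a..b}" "t \<in> {a..b}"
    then have "norm (y s - y t) \<le> K * dist s t" using KE(1) by (auto simp: lipschitz_on_def dist_norm)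
    then have "norm (y s - y t) * B \<le> (K * dist s t) * B" using B by (intro mult_right_mono) auto
    then show "dist (l (y s)) (l (y t)) \<le> B * K * dist s t"
      using B(1)[of "y s - y t"] by (simp add: dist_norm linear_diff[OF bounded_linear.linear[OF assms(1)]] mult_ac)
  qed (use lipschitz_on_nonneg[OF KE(1)] B in auto)
  show ?thesis
    by (rule ae_derivI[OF lip KE(2)]) (use KE(3) bounded_linear.has_vector_derivative[OF assms(1)] in blast)
qed

lemma ae_deriv_add:
  assumes "ae_deriv a b y w" "ae_deriv a b y' w'"
  shows "ae_deriv a b (\<lambda>t. y t + y' t) (\<lambda>t. w t + w' t)"
proof -
  from assms(1) obtain K E where KE: "K-lipschitz_on {a..b} y" "negligible E"
    "\<And>t. t \<in> {a<..<b} - E \<Longrightarrow> (y has_vector_derivative w t) (at t)" by (rule ae_derivE) blast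
  from assms(2) obtain K' E' where KE': "K'-lipschitz_on {a..b} y'" "negligible E'"
    "\<And>t. t \<in> {a<..<b} - E' \<Longrightarrow> (y' has_vector_derivative w' t) (at t)" by (rule ae_derivE) blast
  show ?thesis
  proof (rule ae_derivI[OF lipschitz_on_add[OF KE(1) KE'(1)], of "E \<union> E'"])
    fix t assume "t \<in> {a<..<b} - (E \<union> E')"
    then show "((\<lambda>t. y t + y' t) has_vector_derivative w t + w' t) (at t)"
      using KE(3) KE'(3) by (intro has_vector_derivative_add) blast+
  qed (use KE(2) KE'(2) in auto)
qed

lemma ae_deriv_cmult:
  fixes w :: "real \<Rightarrow> 'a::real_normed_vector"
  shows "ae_deriv a b y w \<Longrightarrow> ae_deriv a b (\<lambda>t. c *\<^sub>R y t) (\<lambda>t. c *\<^sub>R w t)"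
  by (rule ae_deriv_linear) (rule bounded_linear_scaleR_right)

lemma ae_deriv_minus: "ae_deriv a b y w \<Longrightarrow> ae_deriv a b (\<lambda>t. - y t) (\<lambda>t. - w t)"
  by (rule ae_deriv_linear[OF bounded_linear_minus[OF bounded_linear_ident]])

lemma ae_deriv_diff:
  assumes "ae_deriv a b y w" "ae_deriv a b y' w'"
  shows "ae_deriv a b (\<lambda>t. y t - y' t) (\<lambda>t. w t - w' t)"
  using ae_deriv_add[OF assms(1) ae_deriv_minus[OF assms(2)]] by simp

lemma ae_deriv_const: "ae_deriv a b (\<lambda>t. c) (\<lambda>t. 0)"
  by (rule ae_derivI[of 0 _ _ _ "{}"]) (auto simp: lipschitz_on_def)

lemma ae_deriv_id: "ae_deriv a b (\<lambda>t. t) (\<lambda>t. 1)"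
  by (rule ae_derivI[of 1 _ _ _ "{}"]) (auto simp: lipschitz_on_def)

lemma ae_deriv_inner:
  fixes y z :: "real \<Rightarrow> 'a::euclidean_space"
  assumes "ae_deriv a b y w" "ae_deriv a b z v"
  shows "ae_deriv a b (\<lambda>t. y t \<bullet> z t) (\<lambda>t. y t \<bullet> v t + w t \<bullet> z t)"
proof -
  from assms(1) obtain K E where KE: "K-lipschitz_on {a..b} y" "negligible E"
    "\<And>t. t \<in> {a<..<b} - E \<Longrightarrow> (y has_vector_derivative w t) (at t)" by (rule ae_derivE) blast
  from assms(2) obtain K' E' where KE': "K'-lipschitz_on {a..b} z" "negligible E'"
    "\<And>t. t \<in> {a<..<b} - E' \<Longrightarrow> (z has_vector_derivative v t) (at t)" by (rule ae_derivE) blast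
  have "bounded (y ` {a..b})" "bounded (z ` {a..b})"
    using compact_imp_bounded[OF compact_continuous_image[OF ae_deriv_continuous compact_Icc]] assms by blast+
  then obtain B B' where B: "\<And>t. t \<in> {a..b} \<Longrightarrow> norm (y t) \<le> B" "\<And>t. t \<in> {a..b} \<Longrightarrow> norm (z t) \<le> B'"
    unfolding bounded_iff by blast
  have K0: "K \<ge> 0" "K' \<ge> 0" using KE(1) KE'(1) lipschitz_on_nonneg by blast+
  have lip: "(\<bar>B\<bar> * K' + \<bar>B'\<bar> * K)-lipschitz_on {a..b} (\<lambda>t. y t \<bullet> z t)"
  proof (rule lipschitz_onI)
    fix s t assume st: "s \<in> {a..b}" "t \<in> {a..b}"
    have b: "norm (y s) \<le> \<bar>B\<bar>" "norm (z t) \<le> \<bar>B'\<bar>" using B(1)[OF st(1)] B(2)[OF st(2)] by linarith+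
    have d: "norm (z s - z t) \<le> K' * dist s t" "norm (y s - y t) \<le> K * dist s t"
      using lipschitz_onD[OF KE(1) st] lipschitz_onD[OF KE'(1) st] by (simp_all add: dist_norm)
    have "\<bar>y s \<bullet> z s - y t \<bullet> z t\<bar> = \<bar>y s \<bullet> (z s - z t) + (y s - y t) \<bullet> z t\<bar>"
      by (simp add: inner_diff_left inner_diff_right)
    also have "\<dots> \<le> norm (y s) * norm (z s - z t) + norm (y s - y t) * norm (z t)"
      by (rule order_trans[OF abs_triangle_ineq add_mono[OF Cauchy_Schwarz_ineq2 Cauchy_Schwarz_ineq2]])
    also have "\<dots> \<le> \<bar>B\<bar> * (K' * dist s t) + (K * dist s t) * \<bar>B'\<bar>"
      using b d K0 by (intro add_mono mult_mono) auto
    finally show "dist (y s \<bullet> z s) (y t \<bullet> z t) \<le> (\<bar>B\<bar> * K' + \<bar>B'\<bar> * K) * dist s t"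
      by (simp add: dist_real_def algebra_simps)
  qed (use K0 in auto)
  show ?thesis
  proof (rule ae_derivI[OF lip, of "E \<union> E'"])
    fix t assume "t \<in> {a<..<b} - (E \<union> E')"
    then show "((\<lambda>t. y t \<bullet> z t) has_vector_derivative y t \<bullet> v t + w t \<bullet> z t) (at t)"
      using bounded_bilinear.has_vector_derivative[OF bounded_bilinear_inner KE(3)[of t] KE'(3)[of t]] by auto
  qed (use KE(2) KE'(2) in auto)
qed

text \<open>Pairing with the direction of the total increment reduces the claim to the real
  case.\<close>

lemma ae_deriv_norm_le:
  fixes y :: "real \<Rightarrow> 'a::euclidean_space"
  assumes "a \<le> b" "ae_deriv a b y w" "negligible E" "\<And>t. t \<in> {a<..<b} - E \<Longrightarrow> norm (w t) \<le> M"
  shows "norm (y b - y a) \<le> M * (b - a)"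
proof (cases "a = b")
    case ne: False
    define e where "e = sgn (y b - y a)"
    have ne1: "norm e \<le> 1" by (simp add: e_def norm_sgn)
    \<comment> \<open>For \<open>a = b\<close> no time would be left at which to test
      \<open>M\<close>, which could then be negative; here the open interval is not
      negligible.\<close>
    have M0: "0 \<le> M"
    proof -
      have "\<not> negligible {a<..<b}"
        using ne assms(1) negligible_interval(2)[of a b] by (simp add: not_le)
      then obtain t where "t \<in> {a<..<b} - E" using negligible_subset[OF assms(3), of "{a<..<b}"] by blast
      from assms(4)[OF this] show ?thesis by (meson norm_ge_zero order_trans)
    qed
    have "norm (y b - y a) = y b \<bullet> e - y a \<bullet> e"
    proof -
      define d where "d = y b - y a"
      have "y b \<bullet> e - y a \<bullet> e = d \<bullet> sgn d" by (simp add: e_def d_def inner_diff_left)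
      also have "\<dots> = norm d"
        by (cases "d = 0") (simp_all add: sgn_div_norm dot_square_norm power2_eq_square)
      finally show ?thesis by (simp add: d_def)
    qed
    also have "\<dots> \<le> M * (b - a)"
    proof (rule ae_deriv_le[OF assms(1) ae_deriv_linear[OF bounded_linear_inner_left assms(2)] assms(3)])
      fix t assume "t \<in> {a<..<b} - E"
      have "w t \<bullet> e \<le> norm (w t) * norm e" by (rule norm_cauchy_schwarz)
      also have "\<dots> \<le> M * 1" using assms(4) \<open>t \<in> _\<close> ne1 M0 by (intro mult_mono) auto
      finally show "w t \<bullet> e \<le> M" by simp
    qed
    finally show ?thesis .
qed simp

lemma bounded_measurable_integrable:
  fixes h :: "real \<Rightarrow> 'a::euclidean_space"
  assumes "h \<in> borel_measurable lebesgue" "\<And>t. t \<in> S \<Longrightarrow> norm (h t) \<le> M" "S \<in> lmeasurable"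
  shows "h absolutely_integrable_on S" "h integrable_on S"
proof -
  have S: "S \<in> sets lebesgue" using assms(3) by blast
  show "h absolutely_integrable_on S"
  proof (rule measurable_bounded_by_integrable_imp_absolutely_integrable[OF _ S])
    show "h \<in> borel_measurable (lebesgue_on S)" using assms(1) by (rule measurable_restrict_space1)
    show "(\<lambda>t. M) integrable_on S" using assms(3) by (rule integrable_on_const)
  qed (use assms(2) in auto)
  then show "h integrable_on S" by (simp add: absolutely_integrable_on_def)
qed

lemma has_integral_const_lmeasurable:
  fixes c :: real
  assumes "S \<in> lmeasurable"
  shows "((\<lambda>t. c) has_integral c * measure lebesgue S) S"
proof -
  have "((\<lambda>t. 1::real) has_integral measure lebesgue S) S"
    using assms integrable_on_const[OF assms, of "1::real"] lmeasure_integral[OF assms] by (simp add: has_integral_integral)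
  from has_integral_mult_right[OF this, of c] show ?thesis by simp
qed

section \<open>Lebesgue differentiation of bounded measurable functions\<close>

text \<open>Vitali covering: inside an open set barely larger than the exceptional set, disjoint
  short intervals on which the mean of \<open>h\<close> exceeds \<beta> cover almost all of it. On
  these intervals the integral is at least \<beta> times their length, yet \<open>h\<close> stays
  below \<alpha> on the exceptional set and is bounded on the small rest, so
  \<open>\<beta> - \<alpha>\<close> times the measure is arbitrarily small.\<close>

lemma negligible_upper_derivate_gap:
  fixes h :: "real \<Rightarrow> real"
  assumes h: "h \<in> borel_measurable lebesgue" and M: "\<And>t. \<bar>h t\<bar> \<le> M" and \<alpha>\<beta>: "\<alpha> < \<beta>"
  shows "negligible {t \<in> {a<..<b}. h t < \<alpha> \<and> (\<forall>n::nat. \<exists>u v. u < t \<and> t < v \<and>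
     v - u < 1 / Suc n \<and> \<beta> * (v - u) < integral {u..v} h)}" (is "negligible ?A")
proof -
  define A where "A = ?A"
  \<comment> \<open>Open as a union of open intervals; this is what makes the exceptional set
    measurable.\<close>
  define G where "G n = (\<Union>(u, v) \<in> {(u, v). v - u < 1 / Suc n \<and> \<beta> * (v - u) < integral {u..v} h}. {u<..<v})" for n :: nat
  have "open (G n)" for n unfolding G_def by (intro open_UN) auto
  then have Gm: "G n \<in> sets lebesgue" for n by (simp add: borel_open)
  have "{t. h t < \<alpha>} \<in> sets lebesgue"
    using borel_measurable_less[OF h borel_measurable_const[of \<alpha>]] by (simp add: space_lebesgue_on pred_def)
  then have "{a<..<b} \<inter> {t. h t < \<alpha>} \<inter> (\<Inter>n. G n) \<in> sets lebesgue" using Gm by (intro sets.Int sets.countable_INT) auto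
  also have "{a<..<b} \<inter> {t. h t < \<alpha>} \<inter> (\<Inter>n. G n) = A"
  proof -
    have "t \<in> G n \<longleftrightarrow> (\<exists>u v. u < t \<and> t < v \<and> v - u < 1 / Suc n \<and> \<beta> * (v - u) < integral {u..v} h)" for t n
      unfolding G_def by auto
    then show ?thesis unfolding A_def by auto
  qed
  finally have As: "A \<in> sets lebesgue" .
  have Aab: "A \<subseteq> {a<..<b}" by (auto simp: A_def)
  have Am: "A \<in> lmeasurable" by (rule fmeasurableI2[OF _ Aab As]) (metis box_real(1) lmeasurable_box)
  have M0: "M \<ge> 0" using M[of 0] by linarith
  have hint: "h integrable_on S" if "S \<in> lmeasurable" for S
    using bounded_measurable_integrable(2)[OF h _ that, of M] M by simp
  have key: "measure lebesgue A * (\<beta> - \<alpha>) \<le> \<epsilon> * (2 * (\<beta> - \<alpha>) + (M + \<bar>\<beta>\<bar>))" if \<epsilon>: "\<epsilon> > 0" for \<epsilon>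
  proof -
    obtain T where T: "open T" "A \<subseteq> T" "(T - A) \<in> lmeasurable" "emeasure lebesgue (T - A) < ennreal \<epsilon>"
      using sets_lebesgue_outer_open[OF As \<epsilon>] by blast
    define W where "W = T \<inter> {a<..<b}"
    have W: "open W" "A \<subseteq> W" using T Aab by (auto simp: W_def)
    have "bounded W" by (rule bounded_subset[of "{a<..<b}"]) (auto simp: W_def)
    then have W: "open W" "A \<subseteq> W" "W \<in> lmeasurable" using W lmeasurable_open by auto
    have WA: "measure lebesgue (W - A) \<le> \<epsilon>"
    proof -
      have "measure lebesgue (W - A) \<le> measure lebesgue (T - A)"
        using T(3) W(3) Am by (intro measure_mono_fmeasurable) (auto simp: W_def)
      also have "\<dots> \<le> \<epsilon>" using T(3,4) \<epsilon> by (simp add: emeasure_eq_measure2 ennreal_less_iff)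
      finally show ?thesis .
    qed
    define K where "K = {(c, r). 0 < r \<and> cball c r \<subseteq> W \<and> \<beta> * (2 * r) < integral (cball c r) h}"
    have r0: "0 < snd i" if "i \<in> K" for i using that by (auto simp: K_def)
    have fine: "\<exists>i. i \<in> K \<and> t \<in> cball (fst i) (snd i) \<and> snd i < d" if t: "t \<in> A" and d: "0 < d" for t d
    proof -
      obtain \<eta> where \<eta>: "\<eta> > 0" "ball t \<eta> \<subseteq> W" using W t by (meson open_contains_ball subsetD)
      obtain n :: nat where n: "1 / Suc n < min \<eta> d" using \<eta>(1) d nat_approx_posE[of "min \<eta> d"] by auto
      from t obtain u v where uv: "u < t" "t < v" "v - u < 1 / Suc n" "\<beta> * (v - u) < integral {u..v} h"
        unfolding A_def by blast
      define c r where "c = (u + v) / 2" and "r = (v - u) / 2"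
      have cb: "cball c r = {u..v}" by (auto simp: cball_eq_atLeastAtMost c_def r_def field_simps)
      have "{u..v} \<subseteq> ball t \<eta>"
      proof
        fix s assume "s \<in> {u..v}"
        then show "s \<in> ball t \<eta>" using uv n by (auto simp: dist_real_def)
      qed
      moreover have "0 < r" "2 * r = v - u" using uv by (simp_all add: r_def)
      ultimately have "(c, r) \<in> K" using \<eta>(2) uv(4) unfolding K_def by (simp add: cb)
      moreover have "t \<in> cball c r" unfolding cb using uv by simp
      moreover have "r < d" using uv n by (auto simp: r_def)
      ultimately show ?thesis by (intro exI[of _ "(c, r)"]) simp
    qed
    obtain C where C: "countable C" "C \<subseteq> K"
      "pairwise (\<lambda>i j. disjnt (cball (fst i) (snd i)) (cball (fst j) (snd j))) C"
      "negligible (A - (\<Union>i\<in>C. cball (fst i) (snd i)))"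
      using Vitali_covering_theorem_cballs[of K snd A fst, OF r0 fine] by blast
    define D where "D = (\<lambda>i. cball (fst i) (snd i)) ` C"
    have DK: "\<exists>c r. J = cball c r \<and> 0 < r \<and> cball c r \<subseteq> W \<and> \<beta> * (2 * r) < integral (cball c r) h"
      if J: "J \<in> D" for J
    proof -
      obtain i where i: "i \<in> C" "J = cball (fst i) (snd i)" using J by (auto simp: D_def)
      have "i \<in> K" using i(1) C(2) by blast
      then show ?thesis using i(2)
        by (intro exI[of _ "fst i"] exI[of _ "snd i"]) (simp add: K_def case_prod_unfold)
    qed
    have Dm: "J \<in> lmeasurable" "J \<subseteq> W" if "J \<in> D" for J using DK[OF that] by auto
    have cD: "countable D" using C(1) by (simp add: D_def)
    have UD: "\<Union>D \<subseteq> W" using Dm by blast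
    have finm: "measure lebesgue (\<Union>D') \<le> measure lebesgue W" if "D' \<subseteq> D" "finite D'" for D'
      using that Dm W(3) by (intro measure_mono_fmeasurable) (auto intro!: sets.finite_Union)
    obtain D' where D': "D' \<subseteq> D" "finite D'" "measure lebesgue (\<Union>D) - \<epsilon> < measure lebesgue (\<Union>D')"
      using measure_countable_Union_approachable[OF cD \<epsilon> Dm(1) finm] by blast
    define P where "P = \<Union>D'"
    have PW: "P \<subseteq> W" using D'(1) UD by (auto simp: P_def)
    have Pm: "P \<in> lmeasurable" using D'(1,2) Dm by (auto simp: P_def intro!: fmeasurable.finite_Union)
    have UDm: "\<Union>D \<in> lmeasurable"
      using cD Dm UD W(3) by (intro fmeasurableI2[OF W(3) UD] sets.countable_Union) auto
    have "measure lebesgue A \<le> measure lebesgue (\<Union>D \<union> (A - \<Union>D))"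
      using UDm C(4) Am by (intro measure_mono_fmeasurable fmeasurable.Un) (auto simp: D_def)
    also have "\<dots> \<le> measure lebesgue (\<Union>D) + measure lebesgue (A - \<Union>D)"
      using UDm Am by (intro measure_Un_le) auto
    also have "measure lebesgue (A - \<Union>D) = 0" using C(4) negligible_imp_measure0 by (auto simp: D_def)
    finally have mA: "measure lebesgue A - \<epsilon> < measure lebesgue P" using D'(3) by (simp add: P_def)
    have pw: "pairwise (\<lambda>S S'. negligible (S \<inter> S')) D'"
    proof (rule pairwiseI)
      fix x y assume xy: "x \<in> D'" "y \<in> D'" "x \<noteq> y"
      have "x \<in> D" "y \<in> D" using xy(1,2) D'(1) by blast+
      then obtain i j where ij: "i \<in> C" "x = cball (fst i) (snd i)" "j \<in> C" "y = cball (fst j) (snd j)"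
        unfolding D_def by (elim imageE) (rule that; assumption)
      then have "i \<noteq> j" using xy(3) by metis
      then have "disjnt (cball (fst i) (snd i)) (cball (fst j) (snd j))"
        using C(3) ij(1,3) unfolding pairwise_def by metis
      then have "disjnt x y" unfolding ij .
      then show "negligible (x \<inter> y)" by (simp add: disjnt_def)
    qed
    have DI: "((\<lambda>t. h t - \<beta>) has_integral integral J (\<lambda>t. h t - \<beta>)) J \<and> 0 \<le> integral J (\<lambda>t. h t - \<beta>)" if J: "J \<in> D'" for J
    proof -
      obtain c r where cr: "J = cball c r" "0 < r" "\<beta> * (2 * r) < integral J h"
        using DK[of J] J D'(1) by blast
      have mJ: "measure lebesgue J = 2 * r" unfolding cr(1) cball_eq_atLeastAtMost using cr(2) by simp
      have Jm: "J \<in> lmeasurable" using Dm(1) J D'(1) by blast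
      have "((\<lambda>t. h t - \<beta>) has_integral integral J h - \<beta> * measure lebesgue J) J"
        using hint[OF Jm] by (intro has_integral_diff has_integral_const_lmeasurable Jm) (rule integrable_integral)
      then show ?thesis using cr(3) mJ by (simp add: integral_unique)
    qed
    have "((\<lambda>t. h t - \<beta>) has_integral (\<Sum>J\<in>D'. integral J (\<lambda>t. h t - \<beta>))) P"
      unfolding P_def using DI by (intro has_integral_Union D'(2) pw) auto
    then have nn: "integral P (\<lambda>t. h t - \<beta>) \<ge> 0" using DI by (simp add: integral_unique sum_nonneg)
    have PAm: "P \<inter> A \<in> lmeasurable" "P - A \<in> lmeasurable" using Pm Am by auto
    have i1: "(\<lambda>t. h t - \<beta>) integrable_on (P \<inter> A)" "(\<lambda>t. h t - \<beta>) integrable_on (P - A)"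
      using PAm by (auto intro!: integrable_diff hint integrable_on_const)
    have disj: "P \<inter> A \<inter> (P - A) = {}" by blast
    have "((\<lambda>t. h t - \<beta>) has_integral integral (P \<inter> A) (\<lambda>t. h t - \<beta>) + integral (P - A) (\<lambda>t. h t - \<beta>)) ((P \<inter> A) \<union> (P - A))"
      by (rule has_integral_Un[OF integrable_integral[OF i1(1)] integrable_integral[OF i1(2)]])
        (simp add: disj)
    moreover have "(P \<inter> A) \<union> (P - A) = P" by blast
    ultimately have "integral P (\<lambda>t. h t - \<beta>) = integral (P \<inter> A) (\<lambda>t. h t - \<beta>) + integral (P - A) (\<lambda>t. h t - \<beta>)"
      by (simp add: integral_unique)
    also have "\<dots> \<le> (\<alpha> - \<beta>) * measure lebesgue (P \<inter> A) + (M + \<bar>\<beta>\<bar>) * measure lebesgue (P - A)"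
    proof (rule add_mono)
      show "integral (P \<inter> A) (\<lambda>t. h t - \<beta>) \<le> (\<alpha> - \<beta>) * measure lebesgue (P \<inter> A)"
        by (rule has_integral_le[OF integrable_integral[OF i1(1)] has_integral_const_lmeasurable[OF PAm(1)]])
          (auto simp: A_def)
      show "integral (P - A) (\<lambda>t. h t - \<beta>) \<le> (M + \<bar>\<beta>\<bar>) * measure lebesgue (P - A)"
      proof (rule has_integral_le[OF integrable_integral[OF i1(2)] has_integral_const_lmeasurable[OF PAm(2)]])
        fix t show "h t - \<beta> \<le> M + \<bar>\<beta>\<bar>" using M[of t] by linarith
      qed
    qed
    finally have i2: "0 \<le> (\<alpha> - \<beta>) * measure lebesgue (P \<inter> A) + (M + \<bar>\<beta>\<bar>) * measure lebesgue (P - A)" using nn by linarith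
    have m2: "measure lebesgue (P - A) \<le> \<epsilon>"
      using WA measure_mono_fmeasurable[of "P - A" "W - A" lebesgue] PW PAm(2) W(3) Am by fastforce
    have "measure lebesgue P = measure lebesgue (P \<inter> A) + measure lebesgue (P - A)"
      using measurable_measure_Diff[of P lebesgue "P \<inter> A"] Pm PAm(1) by (simp add: Diff_Int_distrib Diff_Int)
    then have m1: "measure lebesgue A - 2 * \<epsilon> \<le> measure lebesgue (P \<inter> A)" using mA m2 by linarith
    have "(\<beta> - \<alpha>) * (measure lebesgue A - 2 * \<epsilon>) \<le> (\<beta> - \<alpha>) * measure lebesgue (P \<inter> A)"
      using m1 \<alpha>\<beta> by (intro mult_left_mono) auto
    also have "\<dots> \<le> (M + \<bar>\<beta>\<bar>) * measure lebesgue (P - A)" using i2 by (simp add: algebra_simps)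
    also have "\<dots> \<le> (M + \<bar>\<beta>\<bar>) * \<epsilon>" using m2 M0 by (intro mult_left_mono) auto
    finally show ?thesis by (simp add: algebra_simps)
  qed
  have "measure lebesgue A * (\<beta> - \<alpha>) \<le> 0"
  proof (rule field_le_epsilon)
    fix e :: real assume e: "e > 0"
    define B where "B = 2 * (\<beta> - \<alpha>) + (M + \<bar>\<beta>\<bar>)"
    have B: "B > 0" using \<alpha>\<beta> M0 by (simp add: B_def)
    have "measure lebesgue A * (\<beta> - \<alpha>) \<le> e / B * B" using key[of "e / B"] e B unfolding B_def[symmetric] by simp
    then show "measure lebesgue A * (\<beta> - \<alpha>) \<le> 0 + e" using B by simp
  qed
  then have "measure lebesgue A \<le> 0" using \<alpha>\<beta> by (simp add: mult_le_0_iff)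
  then have "measure lebesgue A = 0" by (simp add: antisym)
  then show ?thesis using negligible_iff_measure0[OF Am] by (simp add: A_def)
qed

text \<open>Only countably many rational gaps have to be discarded: some rational pair lies strictly
  between \<open>h t\<close> and \<open>h t + e\<close>, and off its exceptional set the mean of
  \<open>h\<close> is at most \<beta> on all sufficiently short intervals around
  \<open>t\<close>.\<close>

lemma ae_upper_derivate_le:
  fixes h :: "real \<Rightarrow> real"
  assumes h: "h \<in> borel_measurable lebesgue" and M: "\<And>t. \<bar>h t\<bar> \<le> M"
  obtains E where "negligible E" "\<And>t e. t \<in> {a<..<b} - E \<Longrightarrow> 0 < e \<Longrightarrow>
    \<exists>d>0. \<forall>u v. u \<le> t \<and> t \<le> v \<and> v - u < d \<longrightarrow> integral {u..v} h \<le> (h t + e) * (v - u)"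
proof -
  define A where "A \<alpha> \<beta> = {t \<in> {a<..<b}. h t < \<alpha> \<and> (\<forall>n::nat. \<exists>u v. u < t \<and> t < v \<and>
     v - u < 1 / Suc n \<and> \<beta> * (v - u) < integral {u..v} h)}" for \<alpha> \<beta>
  define Q where "Q = {(\<alpha>::real, \<beta>). \<alpha> \<in> \<rat> \<and> \<beta> \<in> \<rat> \<and> \<alpha> < \<beta>}"
  have "countable Q" unfolding Q_def
    by (rule countable_subset[of _ "\<rat> \<times> \<rat>"]) (auto intro!: countable_SIGMA countable_rat)
  then have "countable ((\<lambda>(\<alpha>, \<beta>). A \<alpha> \<beta>) ` Q)" by simp
  then have neg: "negligible (\<Union>((\<lambda>(\<alpha>, \<beta>). A \<alpha> \<beta>) ` Q))"
  proof (rule negligible_countable_Union)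
    fix S assume "S \<in> (\<lambda>(\<alpha>, \<beta>). A \<alpha> \<beta>) ` Q"
    then obtain \<alpha> \<beta> where "\<alpha> < \<beta>" "S = A \<alpha> \<beta>" by (auto simp: Q_def)
    then show "negligible S" using negligible_upper_derivate_gap[OF h M] unfolding A_def by blast
  qed
  have M0: "M \<ge> 0" using M[of 0] by linarith
  have hint: "h integrable_on {u..v}" for u v
    using bounded_measurable_integrable(2)[OF h _, of "{u..v}" M] M by simp
  show thesis
  proof (rule that[OF neg])
    fix t e :: real assume t: "t \<in> {a<..<b} - (\<Union>((\<lambda>(\<alpha>, \<beta>). A \<alpha> \<beta>) ` Q))" and e: "0 < e"
    obtain \<alpha> where \<alpha>: "\<alpha> \<in> \<rat>" "h t < \<alpha>" "\<alpha> < h t + e" using Rats_dense_in_real[of "h t" "h t + e"] e by auto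
    obtain \<beta> where \<beta>: "\<beta> \<in> \<rat>" "\<alpha> < \<beta>" "\<beta> < h t + e" using Rats_dense_in_real[OF \<alpha>(3)] by auto
    have "(\<alpha>, \<beta>) \<in> Q" using \<alpha> \<beta> by (simp add: Q_def)
    then have "t \<notin> A \<alpha> \<beta>" using t by blast
    then obtain n :: nat where n: "\<And>u v. u < t \<Longrightarrow> t < v \<Longrightarrow> v - u < 1 / Suc n \<Longrightarrow> integral {u..v} h \<le> \<beta> * (v - u)"
    proof -
      have "\<not> (\<forall>n::nat. \<exists>u v. u < t \<and> t < v \<and> v - u < 1 / Suc n \<and> \<beta> * (v - u) < integral {u..v} h)"
        using \<open>t \<notin> A \<alpha> \<beta>\<close> t \<alpha>(2) unfolding A_def by blast
      then show ?thesis using that by (meson linorder_not_le)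
    qed
    show "\<exists>d>0. \<forall>u v. u \<le> t \<and> t \<le> v \<and> v - u < d \<longrightarrow> integral {u..v} h \<le> (h t + e) * (v - u)"
    proof (intro exI[of _ "1 / Suc n"] conjI allI impI)
      \<comment> \<open>One-sided difference quotients require intervals with \<open>t\<close> as an
        endpoint, but the discarded sets only see \<open>u < t < v\<close>. The interval is widened
        by \<eta> on both sides and the excess is absorbed by an arbitrary \<epsilon>.\<close>
      fix u v assume uv: "u \<le> t \<and> t \<le> v \<and> v - u < 1 / Suc n"
      have "integral {u..v} h \<le> \<beta> * (v - u)"
      proof (rule field_le_epsilon)
        fix \<epsilon> :: real assume \<epsilon>: "\<epsilon> > 0"
        define B where "B = 2 * (M + \<bar>\<beta>\<bar> + 1)"
        have B: "B > 0" using M0 by (simp add: B_def)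
        define \<delta> where "\<delta> = 1 / Suc n - (v - u)"
        have \<delta>: "\<delta> > 0" using uv by (simp add: \<delta>_def)
        define \<eta> where "\<eta> = min (\<epsilon> / B) (\<delta> / 3)"
        have \<eta>: "\<eta> > 0" "\<eta> * B \<le> \<epsilon>" "2 * \<eta> < 1 / Suc n - (v - u)"
        proof -
          show "\<eta> > 0" using \<epsilon> B \<delta> by (simp add: \<eta>_def)
          have "\<eta> * B \<le> \<epsilon> / B * B" using B by (intro mult_right_mono) (auto simp: \<eta>_def)
          then show "\<eta> * B \<le> \<epsilon>" using B by simp
          have "\<eta> \<le> \<delta> / 3" unfolding \<eta>_def by (rule min.cobounded2)
          then show "2 * \<eta> < 1 / Suc n - (v - u)" using \<delta> unfolding \<delta>_def[symmetric] by linarith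
        qed
        have le: "\<bar>integral {p..q} h\<bar> \<le> M * (q - p)" if "p \<le> q" for p q
          using integral_bound[of p q h M] that hint M has_integral_bound_real[OF M0, of "{}" h "integral {p..q} h" p q]
          by (simp add: integrable_integral)
        have split: "integral {u - \<eta>..v + \<eta>} h = integral {u - \<eta>..u} h + integral {u..v} h + integral {v..v + \<eta>} h"
          using Henstock_Kurzweil_Integration.integral_combine[of "u - \<eta>" u "v + \<eta>" h]
            Henstock_Kurzweil_Integration.integral_combine[of u v "v + \<eta>" h] hint uv \<eta>(1) by simp
        have "integral {u - \<eta>..v + \<eta>} h \<le> \<beta> * ((v + \<eta>) - (u - \<eta>))"
          using uv \<eta> by (intro n) linarith+
        then have "integral {u..v} h \<le> \<beta> * (v - u) + \<eta> * (2 * \<beta> + 2 * M)"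
          using split le[of "u - \<eta>" u] le[of v "v + \<eta>"] \<eta>(1) by (simp add: algebra_simps)
        also have "\<eta> * (2 * \<beta> + 2 * M) \<le> \<eta> * B" using \<eta>(1) by (intro mult_left_mono) (auto simp: B_def)
        finally show "integral {u..v} h \<le> \<beta> * (v - u) + \<epsilon>" using \<eta>(2) by linarith
      qed
      also have "\<dots> \<le> (h t + e) * (v - u)" using \<beta>(3) uv by (intro mult_right_mono) auto
      finally show "integral {u..v} h \<le> (h t + e) * (v - u)" .
    qed simp
  qed
qed

lemma integral_lipschitz_on:
  fixes h :: "real \<Rightarrow> 'a::euclidean_space"
  assumes h: "h \<in> borel_measurable lebesgue" and M: "\<And>t. t \<in> {a..b} \<Longrightarrow> norm (h t) \<le> M" and "0 \<le> M"
  shows "M-lipschitz_on {a..b} (\<lambda>t. integral {a..t} h)"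
proof (rule lipschitz_on_leI)
  fix s t assume st: "s \<in> {a..b}" "t \<in> {a..b}" "s \<le> t"
  have hi: "h integrable_on {u..v}" if "{u..v} \<subseteq> {a..b}" for u v
    using that M by (intro bounded_measurable_integrable(2)[OF h, of _ M]) auto
  have "integral {a..t} h = integral {a..s} h + integral {s..t} h"
    using Henstock_Kurzweil_Integration.integral_combine[of a s t h] hi[of a t] st by simp
  then have "dist (integral {a..s} h) (integral {a..t} h) = norm (integral {s..t} h)" by (simp add: dist_norm)
  also have "\<dots> \<le> M * (t - s)"
    using has_integral_bound[OF assms(3), of h "integral {s..t} h" s t] hi[of s t] M st by (simp add: integrable_integral)
  finally show "dist (integral {a..s} h) (integral {a..t} h) \<le> M * dist s t" using st by (simp add: dist_real_def)
qed (rule assms(3))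

text \<open>The upper bound for the means of \<open>h\<close> and of \<open>- h\<close> squeezes the
  difference quotient of the integral from both sides.\<close>

lemma ae_deriv_integral_real:
  fixes h :: "real \<Rightarrow> real"
  assumes h: "h \<in> borel_measurable lebesgue" and M: "\<And>t. t \<in> {a..b} \<Longrightarrow> \<bar>h t\<bar> \<le> M"
  shows "ae_deriv a b (\<lambda>t. integral {a..t} h) h"
proof (cases "a \<le> b")
  case ab: True
  have M0: "M \<ge> 0" using M[of a] ab by auto
  \<comment> \<open>Truncation produces a globally bounded function that agrees with
    \<open>h\<close> on the interval.\<close>
  define k where "k t = max (- M) (min M (h t))" for t
  have km: "k \<in> borel_measurable lebesgue" unfolding k_def using h by measurable
  have kM: "\<bar>k t\<bar> \<le> M" "\<bar>- k t\<bar> \<le> M" for t using M0 by (auto simp: k_def)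
  have kh: "k t = h t" if "t \<in> {a..b}" for t using M[OF that] by (auto simp: k_def)
  obtain E1 where E1: "negligible E1" "\<And>t e. t \<in> {a<..<b} - E1 \<Longrightarrow> 0 < e \<Longrightarrow>
    \<exists>d>0. \<forall>u v. u \<le> t \<and> t \<le> v \<and> v - u < d \<longrightarrow> integral {u..v} k \<le> (k t + e) * (v - u)"
    using ae_upper_derivate_le[OF km kM(1), of a b] by blast
  have km': "(\<lambda>t. - k t) \<in> borel_measurable lebesgue" using km by measurable
  obtain E2 where E2: "negligible E2" "\<And>t e. t \<in> {a<..<b} - E2 \<Longrightarrow> 0 < e \<Longrightarrow>
    \<exists>d>0. \<forall>u v. u \<le> t \<and> t \<le> v \<and> v - u < d \<longrightarrow> integral {u..v} (\<lambda>t. - k t) \<le> (- k t + e) * (v - u)"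
    using ae_upper_derivate_le[OF km' kM(2), of a b] by blast
  have kint: "k integrable_on {u..v}" for u v
    using bounded_measurable_integrable(2)[OF km _, of "{u..v}" M] kM by simp
  show ?thesis
  proof (rule ae_derivI[OF integral_lipschitz_on[OF h _ M0], of _ _ "E1 \<union> E2"])
    fix t assume t: "t \<in> {a<..<b} - (E1 \<union> E2)"
    show "((\<lambda>t. integral {a..t} h) has_vector_derivative h t) (at t)"
      unfolding has_vector_derivative_def has_derivative_at_alt
    proof (intro conjI allI impI)
      fix e :: real assume e: "0 < e"
      obtain d1 where d1: "d1 > 0" "\<And>u v. u \<le> t \<Longrightarrow> t \<le> v \<Longrightarrow> v - u < d1 \<Longrightarrow> integral {u..v} k \<le> (k t + e) * (v - u)"
        using E1(2)[of t e] t e by blast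
      obtain d2 where d2: "d2 > 0" "\<And>u v. u \<le> t \<Longrightarrow> t \<le> v \<Longrightarrow> v - u < d2 \<Longrightarrow> integral {u..v} (\<lambda>t. - k t) \<le> (- k t + e) * (v - u)"
        using E2(2)[of t e] t e by blast
      define d where "d = min (min d1 d2) (min (t - a) (b - t))"
      have d: "d > 0" "d \<le> d1" "d \<le> d2" "d \<le> t - a" "d \<le> b - t" using d1(1) d2(1) t by (auto simp: d_def)
      have seg: "\<bar>integral {u..v} k - k t * (v - u)\<bar> \<le> e * (v - u)" if "u \<le> t" "t \<le> v" "v - u < d" for u v
        using d1(2)[of u v] d2(2)[of u v] d that by (simp add: abs_le_iff algebra_simps)
      have hk: "integral {u..v} h = integral {u..v} k" if "a \<le> u" "v \<le> b" for u v
        using that kh by (intro integral_cong) auto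
      have ht: "h t = k t" using kh[of t] t by simp
      have comb: "integral {a..v} h = integral {a..u} h + integral {u..v} k" if "a \<le> u" "u \<le> v" "v \<le> b" for u v
        using Henstock_Kurzweil_Integration.integral_combine[of a u v k] kint hk[of a v] hk[of a u] that by simp
      show "\<exists>d>0. \<forall>y. norm (y - t) < d \<longrightarrow>
         norm (integral {a..y} h - integral {a..t} h - (y - t) *\<^sub>R h t) \<le> e * norm (y - t)"
      proof (intro exI[of _ d] conjI allI impI d(1))
        fix y assume y: "norm (y - t) < d"
        show "norm (integral {a..y} h - integral {a..t} h - (y - t) *\<^sub>R h t) \<le> e * norm (y - t)"
        proof (cases "t \<le> y")
          case True
          have "integral {a..y} h = integral {a..t} h + integral {t..y} k" using comb[of t y] True y d t by auto
          then show ?thesis using seg[of t y] True y ht by (simp add: mult.commute)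
        next
          case False
          have "integral {a..t} h = integral {a..y} h + integral {y..t} k" using comb[of y t] False y d t by auto
          then show ?thesis using seg[of y t] False y ht by (simp add: algebra_simps abs_le_iff)
        qed
      qed
    qed (rule bounded_linear_scaleR_left)
  qed (use E1(1) E2(1) M in auto)
qed (auto simp: ae_deriv_def lipschitz_on_def intro: exI[of _ 0])

lemma ae_deriv_componentwise:
  fixes y w :: "real \<Rightarrow> 'a::euclidean_space"
  assumes "\<And>i. i \<in> Basis \<Longrightarrow> ae_deriv a b (\<lambda>t. y t \<bullet> i) (\<lambda>t. w t \<bullet> i)"
  shows "ae_deriv a b y w"
proof -
  have "\<exists>K E. \<forall>i\<in>Basis. (K i)-lipschitz_on {a..b} (\<lambda>t. y t \<bullet> i) \<and> negligible (E i) \<and>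
    (\<forall>t\<in>{a<..<b} - E i. ((\<lambda>t. y t \<bullet> i) has_vector_derivative w t \<bullet> i) (at t))"
    using assms unfolding ae_deriv_def by metis
  then obtain K E where KE: "\<And>i. i \<in> Basis \<Longrightarrow> (K i)-lipschitz_on {a..b} (\<lambda>t. y t \<bullet> i)" "\<And>i. i \<in> Basis \<Longrightarrow> negligible (E i)"
    "\<And>i t. i \<in> Basis \<Longrightarrow> t \<in> {a<..<b} - E i \<Longrightarrow> ((\<lambda>t. y t \<bullet> i) has_vector_derivative w t \<bullet> i) (at t)" by blast
  show ?thesis
  proof (rule ae_derivI[of "\<Sum>i\<in>Basis. K i" _ _ _ "\<Union>i\<in>Basis. E i"])
    show "(\<Sum>i\<in>Basis. K i)-lipschitz_on {a..b} y"
    proof (rule lipschitz_onI)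
      fix s t assume st: "s \<in> {a..b}" "t \<in> {a..b}"
      have "dist (y s) (y t) \<le> (\<Sum>i\<in>Basis. \<bar>(y s - y t) \<bullet> i\<bar>)" unfolding dist_norm by (rule norm_le_l1)
      also have "\<dots> \<le> (\<Sum>i\<in>Basis. K i * dist s t)"
        using lipschitz_onD[OF KE(1) st] by (intro sum_mono) (auto simp: dist_real_def inner_diff_left)
      finally show "dist (y s) (y t) \<le> (\<Sum>i\<in>Basis. K i) * dist s t" by (simp add: sum_distrib_right)
    qed (use KE(1) lipschitz_on_nonneg in \<open>blast intro: sum_nonneg\<close>)
    show "negligible (\<Union>i\<in>Basis. E i)" using KE(2) by (intro negligible_Union) auto
    fix t assume t: "t \<in> {a<..<b} - (\<Union>i\<in>Basis. E i)"
    show "(y has_vector_derivative w t) (at t)"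
      unfolding has_vector_derivative_def has_derivative_componentwise_within[of y]
    proof
      fix i :: 'a assume i: "i \<in> Basis"
      show "((\<lambda>x. y x \<bullet> i) has_derivative (\<lambda>x. (x *\<^sub>R w t) \<bullet> i)) (at t)"
        using KE(3)[OF i, of t] t i by (simp add: has_vector_derivative_def)
    qed
  qed
qed

lemma ae_deriv_integral:
  fixes h :: "real \<Rightarrow> 'a::euclidean_space"
  assumes h: "h \<in> borel_measurable lebesgue" and M: "\<And>t. t \<in> {a..b} \<Longrightarrow> norm (h t) \<le> M"
  shows "ae_deriv a b (\<lambda>t. integral {a..t} h) h"
proof (rule ae_deriv_componentwise)
  fix i :: 'a assume i: "i \<in> Basis"
  have "ae_deriv a b (\<lambda>t. integral {a..t} (\<lambda>t. h t \<bullet> i)) (\<lambda>t. h t \<bullet> i)"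
  proof (rule ae_deriv_integral_real)
    show "(\<lambda>t. h t \<bullet> i) \<in> borel_measurable lebesgue" using h by measurable
    fix t assume "t \<in> {a..b}"
    then show "\<bar>h t \<bullet> i\<bar> \<le> M" using M[of t] Basis_le_norm[OF i, of "h t"] by linarith
  qed
  moreover have "integral {a..t} h \<bullet> i = integral {a..t} (\<lambda>t. h t \<bullet> i)" if "t \<le> b" for t
    using that M by (intro integral_component_eq[symmetric] bounded_measurable_integrable(2)[OF h, of _ M]) auto
  ultimately show "ae_deriv a b (\<lambda>t. integral {a..t} h \<bullet> i) (\<lambda>t. h t \<bullet> i)"
    unfolding ae_deriv_def
  proof (elim conjE exE, intro conjI exI ballI)
    fix K E t
    assume *: "\<And>t. t \<le> b \<Longrightarrow> integral {a..t} h \<bullet> i = integral {a..t} (\<lambda>t. h t \<bullet> i)"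
      and L: "K-lipschitz_on {a..b} (\<lambda>t. integral {a..t} (\<lambda>t. h t \<bullet> i))" and "negligible E"
      and D: "\<forall>t\<in>{a<..<b} - E. ((\<lambda>t. integral {a..t} (\<lambda>t. h t \<bullet> i)) has_vector_derivative h t \<bullet> i) (at t)"
    show "negligible E" by fact
    show "K-lipschitz_on {a..b} (\<lambda>t. integral {a..t} h \<bullet> i)"
      using L * by (auto intro!: lipschitz_on_transform[OF L])
    assume t: "t \<in> {a<..<b} - E"
    show "((\<lambda>t. integral {a..t} h \<bullet> i) has_vector_derivative h t \<bullet> i) (at t)"
      by (rule has_vector_derivative_transform_within_open[of _ _ _ "{a<..<b}", OF D[rule_format, OF t]])
        (use t * in auto)
  qed
qed

section \<open>Lipschitz functions as integrals of bounded densities\<close>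

text \<open>The density comes from the Radon-Nikodym theorem. Adding a steep linear term makes the
  function increasing and bi-Lipschitz; the Lebesgue measure of the image of a set is then a measure
  in that set, absolutely continuous because Lipschitz maps preserve null sets.\<close>

lemma lipschitz_imp_integral_real:
  fixes y :: "real \<Rightarrow> real"
  assumes ab: "a \<le> b" and lip: "K-lipschitz_on {a..b} y"
  obtains h M where "h \<in> borel_measurable lebesgue" "\<And>t. \<bar>h t\<bar> \<le> M"
    "\<And>t. t \<in> {a..b} \<Longrightarrow> y t - y a = integral {a..t} h"
proof -
  have K0: "K \<ge> 0" using lip lipschitz_on_nonneg by blast
  define C where "C = 2 * K + 1"
  have C: "C > 0" using K0 by (simp add: C_def)
  \<comment> \<open>Clamping extends \<open>y\<close> to the line. With the added slope
    \<open>K + 1\<close> increments of \<open>m\<close> are at least those of time, so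
    \<open>m\<close> is a bijection with a 1-Lipschitz inverse.\<close>
  define cl where "cl t = max a (min b t)" for t
  define m where "m t = y (cl t) + (K + 1) * t" for t
  have minc: "t - s \<le> m t - m s" "m t - m s \<le> C * (t - s)" if "s \<le> t" for s t
  proof -
    have "cl s \<in> {a..b}" "cl t \<in> {a..b}" using ab by (auto simp: cl_def)
    then have "dist (y (cl t)) (y (cl s)) \<le> K * dist (cl t) (cl s)" using lip by (auto simp: lipschitz_on_def)
    also have "\<dots> \<le> K * (t - s)" using that K0 by (intro mult_left_mono) (auto simp: cl_def dist_real_def)
    finally have "\<bar>y (cl t) - y (cl s)\<bar> \<le> K * (t - s)" by (simp add: dist_real_def)
    then show "t - s \<le> m t - m s" "m t - m s \<le> C * (t - s)" by (auto simp: m_def C_def algebra_simps abs_le_iff)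
  qed
  have mlip: "C-lipschitz_on X m" for X
  proof (rule lipschitz_onI)
    fix s t show "dist (m s) (m t) \<le> C * dist s t"
      using minc[of s t] minc[of t s] by (cases "s \<le> t") (auto simp: dist_real_def)
  qed (use C in simp)
  have mcont: "continuous_on X m" for X by (rule lipschitz_on_continuous_on[OF mlip])
  have minj: "inj m"
  proof (rule injI)
    fix s t assume eq: "m s = m t"
    show "s = t"
    proof (cases "s \<le> t")
      case True
      then show ?thesis using minc(1)[OF True] eq by linarith
    next
      case False
      then have "t \<le> s" by simp
      from minc(1)[OF this] eq False show ?thesis by linarith
    qed
  qed
  have "\<exists>t. m t = c" for c
  proof -
    have "m (- \<bar>c - m 0\<bar>) \<le> c" "c \<le> m \<bar>c - m 0\<bar>" using minc(1)[of "- \<bar>c - m 0\<bar>" 0] minc(1)[of 0 "\<bar>c - m 0\<bar>"] by auto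
    then show ?thesis using IVT'[of m "- \<bar>c - m 0\<bar>" c "\<bar>c - m 0\<bar>"] mcont by auto
  qed
  then have msurj: "surj m" by (metis surjI)
  define g where "g = inv m"
  have gm: "g (m t) = t" "m (g s) = s" for s t using minj msurj by (auto simp: g_def inv_f_f surj_f_inv_f)
  have mle: "s \<le> t \<longleftrightarrow> m s \<le> m t" for s t using minc(1)[of s t] minc(1)[of t s] by (cases "s \<le> t") auto
  have "1-lipschitz_on UNIV g"
  proof (rule lipschitz_onI)
    fix s t show "dist (g s) (g t) \<le> 1 * dist s t"
      using minc(1)[of "g s" "g t"] minc(1)[of "g t" "g s"] by (cases "g s \<le> g t") (auto simp: dist_real_def gm)
  qed simp
  then have gcont: "continuous_on UNIV g" by (rule lipschitz_on_continuous_on)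
  then have gmeas[measurable]: "g \<in> borel_measurable borel" by (rule borel_measurable_continuous_onI)
  \<comment> \<open>Preimages under \<open>g\<close> are images under \<open>m\<close>, so this
    push-forward measures images under \<open>m\<close>.\<close>
  define \<nu> where "\<nu> = distr lborel borel g"
  have vim: "g -` A = m ` A" for A using gm by (auto simp: image_iff) (metis gm(2))
  have nuA: "emeasure \<nu> A = emeasure lborel (m ` A)" if "A \<in> sets borel" for A
    using that by (simp add: \<nu>_def emeasure_distr vim)
  have nu_Icc: "emeasure \<nu> {u..v} = ennreal (m v - m u)" if "u \<le> v" for u v
  proof -
    have "m ` {u..v} = {m u..m v}"
    proof
      show "m ` {u..v} \<subseteq> {m u..m v}" using mle by auto
      show "{m u..m v} \<subseteq> m ` {u..v}"
      proof
        fix s assume "s \<in> {m u..m v}"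
        then have "m u \<le> m (g s)" "m (g s) \<le> m v" by (auto simp: gm)
        then have "g s \<in> {u..v}" using mle by auto
        then show "s \<in> m ` {u..v}" using gm(2)[of s] by (metis imageI)
      qed
    qed
    then show ?thesis using mle[of u v] that by (simp add: nuA)
  qed
  have ac: "absolutely_continuous lborel \<nu>"
    unfolding absolutely_continuous_def
  proof
    fix A :: "real set" assume A: "A \<in> null_sets lborel"
    then have "negligible A" using negligible_iff_null_sets null_sets_completionI by blast
    then have "negligible (m ` A)"
    proof (rule negligible_locally_Lipschitz_image[rotated])
      fix x assume "x \<in> A"
      have "norm (m y - m x) \<le> C * norm (y - x)" for y using lipschitz_onD[OF mlip, of y UNIV x] by (simp add: dist_real_def)
      then show "\<exists>T B. open T \<and> x \<in> T \<and> (\<forall>y\<in>A \<inter> T. norm (m y - m x) \<le> B * norm (y - x))"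
        by (intro exI[of _ UNIV] exI[of _ C]) auto
    qed simp
    moreover have "m ` A \<in> sets borel" using A gmeas vim[of A] measurable_sets[OF gmeas, of A] by auto
    ultimately have "emeasure lborel (m ` A) = 0"
      using null_setsD1[of "m ` A" lebesgue] by (simp add: negligible_iff_null_sets)
    then show "A \<in> null_sets \<nu>" using A nuA[of A] by (auto simp: null_sets_def \<nu>_def)
  qed
  have "sets \<nu> = sets lborel" by (simp add: \<nu>_def)
  from sigma_finite_measure.Radon_Nikodym[OF sigma_finite_lborel ac this] obtain f where f[measurable]: "f \<in> borel_measurable borel" "density lborel f = \<nu>"
    by auto
  \<comment> \<open>The density is cut off at \<open>C + 1\<close> to be real and bounded. The
    integral of the cut density has derivative \<open>q\<close> almost everywhere and increases at
    most at rate \<open>C\<close>, so \<open>q\<close> is at most \<open>C\<close> there; as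
    \<open>C < C + 1\<close>, the cut was inactive almost everywhere.\<close>
  define q where "q t = enn2real (min (f t) (ennreal (C + 1)))" for t
  have qm[measurable]: "q \<in> borel_measurable borel" unfolding q_def by measurable
  have minfin: "min (f t) (ennreal (C + 1)) < top" for t using ennreal_less_top[of "C+1"] by (auto simp: min_less_iff_disj)
  have q0: "0 \<le> q t" for t by (simp add: q_def)
  have eq: "ennreal (q t) = min (f t) (ennreal (C + 1))" for t using minfin[of t] by (simp add: q_def)
  have qC: "q t \<le> C + 1" for t
  proof -
    have "ennreal (q t) \<le> ennreal (C + 1)" unfolding eq by simp
    then show ?thesis using C ennreal_le_iff[of "C + 1" "q t"] by (simp del: ennreal_plus)
  qed
  have qleb: "q \<in> borel_measurable lebesgue" using qm by (intro measurable_completion) simp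
  have qabs: "\<bar>q t\<bar> \<le> C + 1" for t using q0 qC by simp
  have qint: "q integrable_on {u..v}" for u v
    using bounded_measurable_integrable(2)[OF qleb, of "{u..v}" "C + 1"] qabs by simp
  have nnq: "(\<integral>\<^sup>+x. ennreal (q x) * indicator {u..v} x \<partial>lborel) = ennreal (integral {u..v} q)" for u v
    using nn_integral_has_integral_lebesgue'[of "{u..v}" q "integral {u..v} q"] q0 qint by (simp add: integrable_integral)
  have nnf: "(\<integral>\<^sup>+x. f x * indicator {u..v} x \<partial>lborel) = ennreal (m v - m u)" if "u \<le> v" for u v
    using nu_Icc[OF that] f(2) emeasure_density[of f lborel "{u..v}"] by simp
  have qle: "integral {u..v} q \<le> m v - m u" if "u \<le> v" for u v
  proof -
    have "(\<integral>\<^sup>+x. ennreal (q x) * indicator {u..v} x \<partial>lborel) \<le> (\<integral>\<^sup>+x. f x * indicator {u..v} x \<partial>lborel)"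
      by (intro nn_integral_mono mult_right_mono) (auto simp: eq)
    then show ?thesis using minc(1)[OF that] that unfolding nnq nnf[OF that] by (simp add: ennreal_le_iff)
  qed
  have "ae_deriv a b (\<lambda>t. integral {a..t} q) q" using qabs by (intro ae_deriv_integral_real[OF qleb])
  then obtain E where E: "negligible E" "\<And>t. t \<in> {a<..<b} - E \<Longrightarrow> ((\<lambda>t. integral {a..t} q) has_vector_derivative q t) (at t)"
    by (rule ae_derivE) blast
  have qleC: "q t \<le> C" if t: "t \<in> {a<..<b} - E" for t
  proof -
    have "((\<lambda>t. C * t - integral {a..t} q) has_real_derivative C - q t) (at t)"
      using E(2)[OF t] by (auto intro!: derivative_eq_intros simp: has_real_derivative_iff_has_vector_derivative)
    moreover have "mono_on {a<..<b} (\<lambda>t. C * t - integral {a..t} q)"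
    proof (rule mono_onI)
      fix r s assume rs: "r \<in> {a<..<b}" "s \<in> {a<..<b}" "r \<le> s"
      have "integral {a..s} q = integral {a..r} q + integral {r..s} q"
        using Henstock_Kurzweil_Integration.integral_combine[of a r s q] qint rs by simp
      then show "C * r - integral {a..r} q \<le> C * s - integral {a..s} q"
        using qle[OF rs(3)] minc(2)[OF rs(3)] by (simp add: algebra_simps)
    qed
    ultimately have "0 \<le> C - q t"
      using t by (intro mono_on_imp_deriv_nonneg[of "{a<..<b}" _ _ t]) auto
    then show ?thesis by simp
  qed
  have feq: "f t = ennreal (q t)" if "t \<in> {a<..<b} - E" for t
  proof -
    have "min (f t) (ennreal (C + 1)) \<le> ennreal C" using qleC[OF that] eq[of t] by (metis ennreal_leI)
    moreover have "ennreal C < ennreal (C + 1)" using C by (simp add: ennreal_less_iff)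
    ultimately have "f t \<le> ennreal C" by (auto simp: min_def split: if_splits)
    then have "f t \<le> ennreal (C + 1)" using \<open>ennreal C < ennreal (C + 1)\<close> by simp
    then show ?thesis by (simp add: eq min_absorb1)
  qed
  have qint2: "integral {a..t} q = m t - m a" if t: "t \<in> {a..b}" for t
  proof -
    have "negligible (E \<union> {a, b})" using E(1) by simp
    then have "AE x in lebesgue. x \<notin> E \<union> {a, b}" unfolding negligible_iff_null_sets by (rule AE_not_in)
    then have "AE x in lborel. x \<notin> E \<union> {a, b}" unfolding AE_completion_iff .
    then have "(\<integral>\<^sup>+x. f x * indicator {a..t} x \<partial>lborel) = (\<integral>\<^sup>+x. ennreal (q x) * indicator {a..t} x \<partial>lborel)"
    proof (intro nn_integral_cong_AE, elim eventually_mono)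
      fix x assume "x \<notin> E \<union> {a, b}"
      then have "x \<in> {a..t} \<Longrightarrow> x \<in> {a<..<b} - E" using t by auto
      then show "f x * indicator {a..t} x = ennreal (q x) * indicator {a..t} x"
        using feq[of x] by (cases "x \<in> {a..t}") auto
    qed
    then have "ennreal (integral {a..t} q) = ennreal (m t - m a)" using nnq[of a t] nnf[of a t] t by simp
    moreover have "0 \<le> integral {a..t} q" using q0 qint by (simp add: integral_nonneg)
    ultimately show ?thesis using minc(1)[of a t] t by (simp add: ennreal_inj)
  qed
  show thesis
  proof (rule that[of "\<lambda>t. q t - (K + 1)" "C + 1 + (K + 1)"])
    show "(\<lambda>t. q t - (K + 1)) \<in> borel_measurable lebesgue" using qleb by measurable
    show "\<bar>q t - (K + 1)\<bar> \<le> C + 1 + (K + 1)" for t using qabs[of t] K0 by linarith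
    fix t assume t: "t \<in> {a..b}"
    have "integral {a..t} (\<lambda>t. q t - (K + 1)) = integral {a..t} q - (K + 1) * (t - a)"
      using qint t by (subst Henstock_Kurzweil_Integration.integral_diff) auto
    also have "\<dots> = y t - y a" using t by (simp add: qint2 m_def cl_def algebra_simps)
    finally show "y t - y a = integral {a..t} (\<lambda>t. q t - (K + 1))" by simp
  qed
qed

lemma lipschitz_imp_integral:
  fixes y :: "real \<Rightarrow> 'a::euclidean_space"
  assumes ab: "a \<le> b" and lip: "K-lipschitz_on {a..b} y"
  obtains h M where "h \<in> borel_measurable lebesgue" "\<And>t. norm (h t) \<le> M" "ae_deriv a b y h"
    "\<And>t. t \<in> {a..b} \<Longrightarrow> (h has_integral y t - y a) {a..t}"
proof -
  have "\<exists>h M. h \<in> borel_measurable lebesgue \<and> (\<forall>t. \<bar>h t\<bar> \<le> M) \<and> (\<forall>t\<in>{a..b}. y t \<bullet> i - y a \<bullet> i = integral {a..t} h)"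
    if i: "i \<in> Basis" for i
  proof -
    have "K-lipschitz_on {a..b} (\<lambda>t. y t \<bullet> i)"
    proof (rule lipschitz_onI)
      fix s t assume "s \<in> {a..b}" "t \<in> {a..b}"
      then have "norm (y s - y t) \<le> K * dist s t" using lip by (auto simp: lipschitz_on_def dist_norm)
      then show "dist (y s \<bullet> i) (y t \<bullet> i) \<le> K * dist s t"
        using Basis_le_norm[OF i, of "y s - y t"] by (simp add: dist_real_def inner_diff_left)
    qed (use lip lipschitz_on_nonneg in blast)
    from lipschitz_imp_integral_real[OF ab this] show ?thesis by metis
  qed
  then obtain h M where hM: "\<And>i. i \<in> Basis \<Longrightarrow> h i \<in> borel_measurable lebesgue" "\<And>i t. i \<in> Basis \<Longrightarrow> \<bar>h i t\<bar> \<le> M i"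
    "\<And>i t. i \<in> Basis \<Longrightarrow> t \<in> {a..b} \<Longrightarrow> y t \<bullet> i - y a \<bullet> i = integral {a..t} (h i)" by metis
  define k where "k t = (\<Sum>i\<in>Basis. h i t *\<^sub>R i)" for t
  have ki: "k t \<bullet> i = h i t" if "i \<in> Basis" for i t using that by (simp add: k_def inner_sum_left_Basis)
  have km: "k \<in> borel_measurable lebesgue" unfolding k_def using hM(1) by (intro borel_measurable_sum borel_measurable_scaleR) auto
  have kM: "norm (k t) \<le> (\<Sum>i\<in>Basis. M i)" for t
  proof -
    have "norm (k t) \<le> (\<Sum>i\<in>Basis. \<bar>k t \<bullet> i\<bar>)" by (rule norm_le_l1)
    also have "\<dots> \<le> (\<Sum>i\<in>Basis. M i)" using hM(2) ki by (intro sum_mono) auto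
    finally show ?thesis .
  qed
  have kint: "k integrable_on {a..t}" for t
    using bounded_measurable_integrable(2)[OF km, of "{a..t}"] kM by blast
  have eq: "y t - y a = integral {a..t} k" if "t \<in> {a..b}" for t
  proof (rule euclidean_eqI)
    fix i :: 'a assume i: "i \<in> Basis"
    have "integral {a..t} k \<bullet> i = integral {a..t} (\<lambda>t. k t \<bullet> i)" using kint by (rule integral_component_eq[symmetric])
    then show "(y t - y a) \<bullet> i = integral {a..t} k \<bullet> i" using hM(3)[OF i that] i by (simp add: ki inner_diff_left)
  qed
  have "ae_deriv a b (\<lambda>t. y a + integral {a..t} k) (\<lambda>t. 0 + k t)"
    by (intro ae_deriv_add ae_deriv_const ae_deriv_integral[OF km kM])
  then obtain L E where LE: "negligible E" "\<And>t. t \<in> {a<..<b} - E \<Longrightarrow> ((\<lambda>t. y a + integral {a..t} k) has_vector_derivative k t) (at t)"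
    by (rule ae_derivE) simp
  have "ae_deriv a b y k"
  proof (rule ae_derivI[OF lip LE(1)])
    fix t assume t: "t \<in> {a<..<b} - E"
    show "(y has_vector_derivative k t) (at t)"
    proof (rule has_vector_derivative_transform_within_open[OF LE(2)[OF t], of "{a<..<b}"])
      fix s assume "s \<in> {a<..<b}"
      then show "y a + integral {a..s} k = y s" using eq[of s] by (simp add: algebra_simps)
    qed (use t in auto)
  qed
  moreover have "(k has_integral y t - y a) {a..t}" if "t \<in> {a..b}" for t
    unfolding eq[OF that] using kint by (rule integrable_integral)
  ultimately show thesis using that km kM by blast
qed

text \<open>Uniqueness of derivatives identifies \<open>w\<close> off a null set with the density of
  the integral representation. Hence the fundamental theorem holds although \<open>w\<close> itself
  carries no measurability assumption.\<close>

lemma ae_deriv_has_integral: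
  fixes y :: "real \<Rightarrow> 'a::euclidean_space"
  assumes ab: "a \<le> b" and "ae_deriv a b y w"
  shows "(w has_integral y b - y a) {a..b}"
proof -
  from assms(2) obtain K E where KE: "K-lipschitz_on {a..b} y" "negligible E"
    "\<And>t. t \<in> {a<..<b} - E \<Longrightarrow> (y has_vector_derivative w t) (at t)" by (rule ae_derivE) blast
  obtain h M where h: "ae_deriv a b y h" "\<And>t. t \<in> {a..b} \<Longrightarrow> (h has_integral y t - y a) {a..t}"
    using lipschitz_imp_integral[OF ab KE(1)] by metis
  from h(1) obtain E' where E': "negligible E'"
    "\<And>t. t \<in> {a<..<b} - E' \<Longrightarrow> (y has_vector_derivative h t) (at t)" by (rule ae_derivE) blast
  show ?thesis
  proof (rule has_integral_spike[of "E \<union> E' \<union> {a, b}"])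
    show "(h has_integral y b - y a) {a..b}" using h(2) ab by simp
    show "negligible (E \<union> E' \<union> {a, b})" using KE(2) E'(1) by simp
    fix t assume t: "t \<in> {a..b} - (E \<union> E' \<union> {a, b})"
    then have "t \<in> {a<..<b} - E" "t \<in> {a<..<b} - E'" by auto
    from vector_derivative_unique_at[OF KE(3)[OF this(1)] E'(2)[OF this(2)]] show "w t = h t" .
  qed
qed

section \<open>Gronwall inequalities\<close>

lemma gronwall_integral:
  fixes \<phi> :: "real \<Rightarrow> real"
  assumes cont: "continuous_on {a..b} \<phi>" and L: "0 \<le> L"
    and le: "\<And>t. t \<in> {a..b} \<Longrightarrow> \<phi> t \<le> A + L * integral {a..t} \<phi>" and t: "t \<in> {a..b}"
  shows "\<phi> t \<le> A * exp (L * (t - a))"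
proof -
  define G where "G s = A + L * integral {a..s} \<phi>" for s
  define \<psi> where "\<psi> s = exp (- L * (s - a)) * G s" for s
  have Ic: "continuous_on {a..b} (\<lambda>s. integral {a..s} \<phi>)"
    using cont by (intro indefinite_integral_continuous_1 integrable_continuous_real)
  have "\<psi> t \<le> \<psi> a"
  proof (cases "a = t")
    case False
    then have "a \<le> t" using t by simp
    then show ?thesis
    proof (rule DERIV_nonpos_imp_decreasing_open)
      show "continuous_on {a..t} \<psi>" unfolding \<psi>_def G_def using t
        by (intro continuous_intros continuous_on_subset[OF Ic]) auto
      fix s assume s: "a < s" "s < t"
      have "((\<lambda>s. integral {a..s} \<phi>) has_real_derivative \<phi> s) (at s within {a..b})"
        using s t by (intro integral_has_real_derivative cont) auto
      then have D: "((\<lambda>s. integral {a..s} \<phi>) has_real_derivative \<phi> s) (at s)"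
        using s t at_within_Icc_at[of a s b] by simp
      have "(\<psi> has_real_derivative exp (- L * (s - a)) * (L * \<phi> s) + (exp (- L * (s - a)) * (- L)) * G s) (at s)"
        unfolding \<psi>_def G_def by (auto intro!: derivative_eq_intros D)
      moreover have "exp (- L * (s - a)) * (L * \<phi> s) + (exp (- L * (s - a)) * (- L)) * G s \<le> 0"
      proof -
        have "L * \<phi> s \<le> L * G s" using le[of s] s t L by (intro mult_left_mono) (auto simp: G_def)
        then have "exp (- L * (s - a)) * (L * \<phi> s) \<le> exp (- L * (s - a)) * (L * G s)" by (rule mult_left_mono) simp
        then show ?thesis by simp
      qed
      ultimately show "\<exists>y. (\<psi> has_real_derivative y) (at s) \<and> y \<le> 0" by blast
    qed
  qed simp
  then have "exp (- L * (t - a)) * G t \<le> A" by (simp add: \<psi>_def G_def)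
  then have "exp (- L * (t - a)) * G t * exp (L * (t - a)) \<le> A * exp (L * (t - a))" by (intro mult_right_mono) auto
  moreover have "exp (- L * (t - a)) * G t * exp (L * (t - a)) = G t"
  proof -
    have "exp (- L * (t - a)) * exp (L * (t - a)) = 1" by (simp flip: exp_add)
    then show ?thesis by (simp only: mult.assoc mult.left_commute[of _ "G t"] mult_1_right)
  qed
  ultimately have "G t \<le> A * exp (L * (t - a))" by (simp only:)
  then show ?thesis using le[OF t] by (simp add: G_def)
qed

lemma gronwall_ae_deriv:
  fixes y :: "real \<Rightarrow> 'a::euclidean_space"
  assumes y: "ae_deriv a b y w" and L: "0 \<le> L" and c: "0 \<le> c" and E: "negligible E"
    and le: "\<And>t. t \<in> {a<..<b} - E \<Longrightarrow> norm (w t) \<le> L * norm (y t) + c" and t: "t \<in> {a..b}"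
  shows "norm (y t) \<le> (norm (y a) + c * (b - a)) * exp (L * (t - a))"
proof -
  have cont: "continuous_on {a..b} (\<lambda>s. norm (y s))" by (intro continuous_intros ae_deriv_continuous[OF y])
  show ?thesis
  proof (rule gronwall_integral[OF cont L _ t])
    fix s assume s: "s \<in> {a..b}"
    have wi: "(w has_integral y s - y a) {a..s}"
      using s by (intro ae_deriv_has_integral ae_deriv_subset[OF y]) auto
    have ni: "(\<lambda>s. norm (y s)) integrable_on {a..s}"
      using s by (intro integrable_continuous_real continuous_on_subset[OF cont]) auto
    \<comment> \<open>The norm bound for integrals wants an estimate at every point, so the
      derivative is set to 0 on the exceptional set and at the endpoints.\<close>
    define w' where "w' t = (if t \<in> E \<union> {a, b} then 0 else w t)" for t
    have wi': "(w' has_integral y s - y a) {a..s}"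
      by (rule has_integral_spike[of "E \<union> {a, b}" _ _ w]) (use E wi in \<open>auto simp: w'_def\<close>)
    have gi: "(\<lambda>t. L * norm (y t) + c) integrable_on {a..s}"
      by (intro integrable_add integrable_on_mult_right ni) auto
    have "norm (integral {a..s} w') \<le> integral {a..s} (\<lambda>t. L * norm (y t) + c)"
    proof (rule integral_norm_bound_integral[OF _ gi])
      show "w' integrable_on {a..s}" using wi' by blast
      fix r assume "r \<in> {a..s}"
      then show "norm (w' r) \<le> L * norm (y r) + c" using le[of r] s L c by (auto simp: w'_def)
    qed
    also have "integral {a..s} (\<lambda>t. L * norm (y t) + c) = L * integral {a..s} (\<lambda>t. norm (y t)) + c * (s - a)"
      using ni s by (subst Henstock_Kurzweil_Integration.integral_add) (auto intro!: integrable_on_mult_right)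
    also have "\<dots> \<le> L * integral {a..s} (\<lambda>t. norm (y t)) + c * (b - a)"
      using s c L by (intro add_mono mult_left_mono) auto
    finally have "norm (y s - y a) \<le> L * integral {a..s} (\<lambda>t. norm (y t)) + c * (b - a)"
      using wi' by (simp add: integral_unique)
    then show "norm (y s) \<le> norm (y a) + c * (b - a) + L * integral {a..s} (\<lambda>t. norm (y t))"
      using norm_triangle_sub[of "y s" "y a"] by linarith
  qed
qed

section \<open>Caratheodory equations\<close>

lemma continuous_integral_upper:
  fixes h :: "real \<Rightarrow> 'a::euclidean_space"
  assumes h: "h \<in> borel_measurable lebesgue" and M: "\<And>T. \<exists>M. \<forall>t\<in>{0..T}. norm (h t) \<le> M"
  shows "continuous_on UNIV (\<lambda>t. integral {0..t} h)"
proof -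
  have "continuous (at t) (\<lambda>t. integral {0..t} h)" for t
  proof -
    define T where "T = \<bar>t\<bar> + 1"
    obtain M where M: "\<And>s. s \<in> {0..T} \<Longrightarrow> norm (h s) \<le> M" using assms(2)[of T] by blast
    have "norm (h 0) \<le> M" by (rule M) (simp add: T_def)
    then have M0: "0 \<le> M" using norm_ge_zero order_trans by blast
    have lip: "M-lipschitz_on {0..T} (\<lambda>t. integral {0..t} h)" by (rule integral_lipschitz_on[OF h M M0])
    \<comment> \<open>For negative \<open>s\<close> the interval is empty and the integral is 0, so
      continuity at 0 from the left is included.\<close>
    have eq: "integral {0..s} h = integral {0..max 0 s} h" for s by (cases "0 \<le> s") (auto simp: max_def)
    have "M-lipschitz_on {..T} (\<lambda>t. integral {0..max 0 t} h)"
    proof (rule lipschitz_onI)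
      fix s s' assume "s \<in> {..T}" "s' \<in> {..T}"
      then have "max 0 s \<in> {0..T}" "max 0 s' \<in> {0..T}" by (auto simp: T_def)
      then have "dist (integral {0..max 0 s} h) (integral {0..max 0 s'} h) \<le> M * dist (max 0 s) (max 0 s')"
        using lip by (auto simp: lipschitz_on_def)
      also have "\<dots> \<le> M * dist s s'" using M0 by (intro mult_left_mono) (auto simp: dist_real_def)
      finally show "dist (integral {0..max 0 s} h) (integral {0..max 0 s'} h) \<le> M * dist s s'" .
    qed (rule M0)
    then have "continuous_on {..T} (\<lambda>t. integral {0..t} h)" unfolding eq[symmetric] by (rule lipschitz_on_continuous_on)
    moreover have "t \<in> interior {..T}" by (auto simp: T_def)
    ultimately show ?thesis by (rule continuous_on_interior)
  qed
  then show ?thesis by (simp add: continuous_at_imp_continuous_on)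
qed

text \<open>Picard iteration is contractive on \<open>[0,\<infinity>)\<close> for the norm weighted by \<open>exp (- 2 * L * t)\<close>.\<close>

lemma caratheodory_ode_exists:
  fixes F :: "real \<Rightarrow> 'a::euclidean_space \<Rightarrow> 'a"
  assumes meas: "\<And>y. continuous_on UNIV y \<Longrightarrow> (\<lambda>s. F s (y s)) \<in> borel_measurable lebesgue"
    and L: "0 < L" and lip: "\<And>s x x'. norm (F s x - F s x') \<le> L * norm (x - x')"
    and bnd: "\<And>s. norm (F s x0) \<le> M"
  obtains y where "continuous_on UNIV y" "\<And>t. t \<le> 0 \<Longrightarrow> y t = x0" "\<And>T. ae_deriv 0 T y (\<lambda>t. F t (y t))"
proof -
  define e where "e t = exp (2 * L * max 0 t)" for t :: real
  have e1: "1 \<le> e t" "0 < e t" "e t \<noteq> 0" for t using L by (auto simp: e_def)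
  have ec: "continuous_on X e" for X unfolding e_def by (intro continuous_intros)
  have M0: "0 \<le> M" using bnd norm_ge_zero order_trans by blast
  \<comment> \<open>The unknown is the bounded function \<open>z\<close>; its sup norm is the
    weighted norm of the curve minus its initial value.\<close>
  define Y where "Y z s = x0 + e s *\<^sub>R apply_bcontfun z s" for z :: "real \<Rightarrow>\<^sub>C 'a" and s
  have Yc: "continuous_on UNIV (Y z)" for z unfolding Y_def by (intro continuous_intros ec) auto
  define G where "G z s = F s (Y z s)" for z s
  have Gm: "G z \<in> borel_measurable lebesgue" for z unfolding G_def by (rule meas[OF Yc])
  have Gb: "norm (G z s) \<le> M + L * norm z * e s" for z s
  proof -
    have "norm (G z s) \<le> norm (F s x0) + norm (F s (Y z s) - F s x0)"
      unfolding G_def using norm_triangle_sub[of "F s (Y z s)" "F s x0"] by simp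
    also have "\<dots> \<le> M + L * norm (Y z s - x0)" by (intro add_mono bnd lip)
    also have "norm (Y z s - x0) \<le> e s * norm z" using e1(2)[of s] norm_bounded[of z s] by (simp add: Y_def)
    then have "M + L * norm (Y z s - x0) \<le> M + L * norm z * e s" using L by (simp add: mult_ac)
    finally show ?thesis .
  qed
  have Gloc: "\<exists>B. \<forall>t\<in>{0..T}. norm (G z t) \<le> B" for z T
  proof (intro exI ballI)
    fix t assume "t \<in> {0..T}"
    then have "e t \<le> e T" using L by (auto simp: e_def)
    then have "M + L * norm z * e t \<le> M + L * norm z * e T" using L by (intro add_left_mono mult_left_mono) auto
    then show "norm (G z t) \<le> M + L * norm z * e T" using Gb[of z t] by linarith
  qed
  have Gi: "G z integrable_on {0..t}" for z t
  proof -
    obtain B where "\<And>s. s \<in> {0..t} \<Longrightarrow> norm (G z s) \<le> B" using Gloc[of t z] by blast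
    then show ?thesis by (rule bounded_measurable_integrable(2)[OF Gm]) auto
  qed
  \<comment> \<open>The origin of the contraction factor 1/2: \<open>L\<close> times the integral of
    the weight is at most half of the weight.\<close>
  have ei: "(e has_integral (e t - 1) / (2 * L)) {0..t}" if "0 \<le> t" for t
  proof -
    have "((\<lambda>s. exp (2 * L * s)) has_integral exp (2 * L * t) / (2 * L) - exp (2 * L * 0) / (2 * L)) {0..t}"
      using L that by (intro fundamental_theorem_of_calculus)
        (auto intro!: derivative_eq_intros simp: has_real_derivative_iff_has_vector_derivative[symmetric])
    then have "((\<lambda>s. exp (2 * L * s)) has_integral (e t - 1) / (2 * L)) {0..t}"
      using that by (simp add: e_def diff_divide_distrib)
    then show ?thesis by (rule has_integral_eq[rotated]) (auto simp: e_def)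
  qed
  define J where "J z t = (1 / e t) *\<^sub>R integral {0..t} (G z)" for z t
  have Jc: "continuous_on UNIV (J z)" for z
    unfolding J_def by (intro continuous_intros ec continuous_integral_upper[OF Gm Gloc]) (use e1(3) in auto)
  have J0: "J z t = 0" if "t \<le> 0" for z t using that by (cases "t = 0") (auto simp: J_def)
  have Jb: "norm (J z t) \<le> (M + L * norm z) / (2 * L)" for z t
  proof (cases "0 \<le> t")
    case True
    have "norm (integral {0..t} (G z)) \<le> integral {0..t} (\<lambda>s. (M + L * norm z) * e s)"
    proof (rule integral_norm_bound_integral[OF Gi])
      show "(\<lambda>s. (M + L * norm z) * e s) integrable_on {0..t}" using ei[OF True] by (intro integrable_on_mult_right) blast
      fix s assume "s \<in> {0..t}"
      have "M * 1 \<le> M * e s" using e1(1)[of s] M0 by (intro mult_left_mono) auto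
      then show "norm (G z s) \<le> (M + L * norm z) * e s" using Gb[of z s] by (simp add: algebra_simps)
    qed
    also have "\<dots> = (M + L * norm z) * ((e t - 1) / (2 * L))" using ei[OF True] by (simp add: integral_unique)
    also have "\<dots> \<le> (M + L * norm z) * (e t / (2 * L))" using M0 L by (intro mult_left_mono divide_right_mono) auto
    finally show ?thesis using e1(2)[of t] by (simp add: J_def field_simps)
  qed (use J0[of t z] M0 L in auto)
  define \<Phi> where "\<Phi> z = Bcontfun (J z)" for z
  have \<Phi>: "apply_bcontfun (\<Phi> z) = J z" for z
    unfolding \<Phi>_def by (rule Bcontfun_inverse) (rule bcontfun_normI[OF Jc Jb])
  have contr: "dist (\<Phi> z) (\<Phi> z') \<le> (1/2) * dist z z'" for z z'
  proof (rule dist_bound)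
    fix t
    show "dist (apply_bcontfun (\<Phi> z) t) (apply_bcontfun (\<Phi> z') t) \<le> (1/2) * dist z z'"
    proof (cases "0 \<le> t")
      case True
      have "norm (integral {0..t} (\<lambda>s. G z s - G z' s)) \<le> integral {0..t} (\<lambda>s. (L * dist z z') * e s)"
      proof (rule integral_norm_bound_integral)
        show "(\<lambda>s. G z s - G z' s) integrable_on {0..t}" by (intro integrable_diff Gi)
        show "(\<lambda>s. (L * dist z z') * e s) integrable_on {0..t}" using ei[OF True] by (intro integrable_on_mult_right) blast
        fix s assume "s \<in> {0..t}"
        have "norm (G z s - G z' s) \<le> L * norm (Y z s - Y z' s)" unfolding G_def by (rule lip)
        also have "Y z s - Y z' s = e s *\<^sub>R (apply_bcontfun z s - apply_bcontfun z' s)" by (simp add: Y_def algebra_simps)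
        also have "L * norm (e s *\<^sub>R (apply_bcontfun z s - apply_bcontfun z' s)) \<le> L * (e s * dist z z')"
          using L e1(2)[of s] dist_bounded[of z s z'] by (auto simp: dist_norm)
        finally show "norm (G z s - G z' s) \<le> (L * dist z z') * e s" by (simp add: mult_ac)
      qed
      also have "\<dots> = (L * dist z z') * ((e t - 1) / (2 * L))" using ei[OF True] by (simp add: integral_unique)
      also have "\<dots> \<le> (L * dist z z') * (e t / (2 * L))" using L by (intro mult_left_mono divide_right_mono) auto
      also have "\<dots> = e t * ((1/2) * dist z z')" using L by simp
      finally have "(1 / e t) * norm (integral {0..t} (\<lambda>s. G z s - G z' s)) \<le> (1/2) * dist z z'"
        using e1(2)[of t] by (simp add: field_simps)
      moreover have "J z t - J z' t = (1 / e t) *\<^sub>R integral {0..t} (\<lambda>s. G z s - G z' s)"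
        unfolding J_def by (subst Henstock_Kurzweil_Integration.integral_diff[OF Gi Gi]) (rule scaleR_diff_right[symmetric])
      ultimately show ?thesis using e1(2)[of t] by (simp add: \<Phi> dist_norm)
    qed (simp add: \<Phi> J0)
  qed
  have "\<exists>!z. \<Phi> z = z" by (rule banach_fix_type[of "1/2"]) (use contr in auto)
  then obtain z where z: "\<Phi> z = z" by blast
  have zJ: "apply_bcontfun z = J z" using \<Phi>[of z] z by simp
  have Yeq: "Y z t = x0 + integral {0..t} (G z)" for t
    using e1(3)[of t] by (simp add: Y_def zJ J_def)
  show thesis
  proof (rule that[OF Yc[of z]])
    show "Y z t = x0" if "t \<le> 0" for t using J0[OF that, of z] by (simp add: Y_def zJ)
    fix T
    obtain B where B: "\<And>t. t \<in> {0..T} \<Longrightarrow> norm (G z t) \<le> B" using Gloc[of T z] by blast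
    have "ae_deriv 0 T (\<lambda>t. x0 + integral {0..t} (G z)) (\<lambda>t. 0 + G z t)"
      by (intro ae_deriv_add ae_deriv_const ae_deriv_integral[OF Gm B])
    moreover have "Y z = (\<lambda>t. x0 + integral {0..t} (G z))" using Yeq by auto
    ultimately show "ae_deriv 0 T (Y z) (\<lambda>t. F t (Y z t))" by (simp add: G_def)
  qed
qed

lemma ae_deriv_unique:
  fixes y y' :: "real \<Rightarrow> 'a::euclidean_space"
  assumes y: "ae_deriv a b y (\<lambda>t. F t (y t))" and y': "ae_deriv a b y' (\<lambda>t. F t (y' t))"
    and L: "0 \<le> L" and lip: "\<And>s. s \<in> {a..b} \<Longrightarrow> norm (F s (y s) - F s (y' s)) \<le> L * norm (y s - y' s)"
    and eq: "y a = y' a" and t: "t \<in> {a..b}"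
  shows "y t = y' t"
proof -
  have "norm (y t - y' t) \<le> (norm (y a - y' a) + 0 * (b - a)) * exp (L * (t - a))"
    by (rule gronwall_ae_deriv[OF ae_deriv_diff[OF y y'] L, of 0 "{}"]) (use lip t in auto)
  then show ?thesis using eq by simp
qed

text \<open>Continuity is only known over \<open>U\<close>; as \<open>U\<close> is closed, the
  extension by 0 is a Borel function.\<close>

lemma measurable_continuous_composition:
  fixes \<Phi> :: "'a::euclidean_space \<Rightarrow> 'b::euclidean_space \<Rightarrow> 'c::{second_countable_topology, real_normed_vector}"
  assumes U: "closed U" and cont: "continuous_on (UNIV \<times> U) (\<lambda>(x, \<omega>). \<Phi> x \<omega>)"
    and y: "y \<in> borel_measurable lebesgue" and u: "u \<in> borel_measurable lebesgue" "\<And>t. u t \<in> U"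
  shows "(\<lambda>s. \<Phi> (y s) (u s)) \<in> borel_measurable lebesgue"
proof -
  define \<Psi> where "\<Psi> q = (if q \<in> UNIV \<times> U then (\<lambda>(x, \<omega>). \<Phi> x \<omega>) q else 0)" for q
  have "\<Psi> \<in> borel_measurable borel"
    unfolding \<Psi>_def using U by (intro borel_measurable_continuous_on_if cont continuous_on_const) (auto intro!: borel_closed closed_Times)
  moreover have "(\<lambda>s. (y s, u s)) \<in> borel_measurable lebesgue" using y u(1) by measurable
  ultimately have "(\<lambda>s. \<Psi> (y s, u s)) \<in> borel_measurable lebesgue" by (rule measurable_compose_rev)
  then show ?thesis using u(2) by (simp add: \<Psi>_def)
qed

section \<open>Controlled trajectories and dynamic programming\<close>

lemma negligible_iff_AE_lebesgue:
  "(AE s in lebesgue_on {0::real..}. P s) \<longleftrightarrow> (\<exists>E. negligible E \<and> (\<forall>s. 0 \<le> s \<longrightarrow> s \<notin> E \<longrightarrow> P s))"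
proof -
  have "(AE s in lebesgue_on {0::real..}. P s) \<longleftrightarrow> (AE s in lebesgue. s \<in> {0..} \<longrightarrow> P s)"
    by (rule AE_restrict_space_iff) simp
  also have "\<dots> \<longleftrightarrow> (\<exists>E\<in>null_sets lebesgue. {s \<in> space lebesgue. \<not> (s \<in> {0..} \<longrightarrow> P s)} \<subseteq> E)"
    by (rule eventually_ae_filter)
  also have "\<dots> \<longleftrightarrow> (\<exists>E. negligible E \<and> (\<forall>s. 0 \<le> s \<longrightarrow> s \<notin> E \<longrightarrow> P s))"
    unfolding negligible_iff_null_sets by auto
  finally show ?thesis .
qed

text \<open>This is what turns an absolutely continuous solution of the differential equation into a
  Lipschitz curve, after which the calculus of \<open>ae_deriv\<close> applies to it.\<close>

lemma abs_continuous_norm_increment_le: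
  fixes y :: "real \<Rightarrow> 'a::euclidean_space"
  assumes ab: "a \<le> b" and ac: "abs_continuous_on_interval a b y" and E: "negligible E"
    and der: "\<And>t. t \<in> {a..b} - E \<Longrightarrow> \<exists>w. norm w \<le> M \<and> (y has_vector_derivative w) (at t within {a..b})"
    and M: "0 \<le> M"
  shows "norm (y b - y a) \<le> M * (b - a)"
proof -
  define e where "e = sgn (y b - y a)"
  have e: "norm e \<le> 1" by (simp add: e_def norm_sgn)
  have ac': "abs_continuous_on_interval a b (\<lambda>t. y t \<bullet> e)"
    unfolding abs_continuous_on_interval_def
  proof (intro allI impI)
    fix \<epsilon> :: real assume "0 < \<epsilon>"
    then obtain \<delta> where \<delta>: "\<delta> > 0" "\<And>D. D division_of \<Union>D \<and> \<Union>D \<subseteq> {a..b} \<and> (\<Sum>K\<in>D. Sup K - Inf K) < \<delta> \<Longrightarrow>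
        (\<Sum>K\<in>D. norm (y (Sup K) - y (Inf K))) < \<epsilon>"
      using ac unfolding abs_continuous_on_interval_def by blast
    have le: "(\<Sum>K\<in>D. norm (y (Sup K) \<bullet> e - y (Inf K) \<bullet> e)) \<le> (\<Sum>K\<in>D. norm (y (Sup K) - y (Inf K)))" for D
    proof (rule sum_mono)
      fix K
      have "norm (y (Sup K) \<bullet> e - y (Inf K) \<bullet> e) \<le> norm (y (Sup K) - y (Inf K)) * norm e"
        unfolding inner_diff_left[symmetric] real_norm_def by (rule Cauchy_Schwarz_ineq2)
      also have "\<dots> \<le> norm (y (Sup K) - y (Inf K)) * 1" using e by (intro mult_left_mono) auto
      finally show "norm (y (Sup K) \<bullet> e - y (Inf K) \<bullet> e) \<le> norm (y (Sup K) - y (Inf K))" by simp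
    qed
    show "\<exists>\<delta>>0. \<forall>D. D division_of \<Union>D \<and> \<Union>D \<subseteq> {a..b} \<and> (\<Sum>K\<in>D. Sup K - Inf K) < \<delta> \<longrightarrow>
        (\<Sum>K\<in>D. norm (y (Sup K) \<bullet> e - y (Inf K) \<bullet> e)) < \<epsilon>"
      using \<delta> le_less_trans[OF le] by blast
  qed
  have "norm (y b - y a) = y b \<bullet> e - y a \<bullet> e"
  proof -
    define d where "d = y b - y a"
    have "y b \<bullet> e - y a \<bullet> e = d \<bullet> sgn d" by (simp add: e_def d_def inner_diff_left)
    also have "\<dots> = norm d"
      by (cases "d = 0") (simp_all add: sgn_div_norm dot_square_norm power2_eq_square)
    finally show ?thesis by (simp add: d_def)
  qed
  also have "\<dots> \<le> M * (b - a)"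
  proof (rule abs_continuous_increment_le[OF ab ac' E])
    fix t assume "t \<in> {a..b} - E"
    then obtain w where w: "norm w \<le> M" "(y has_vector_derivative w) (at t within {a..b})" using der by blast
    have "w \<bullet> e \<le> norm w * norm e" by (rule norm_cauchy_schwarz)
    also have "\<dots> \<le> M * 1" using w(1) e M by (intro mult_mono) auto
    finally show "\<exists>w\<le>M. ((\<lambda>t. y t \<bullet> e) has_vector_derivative w) (at t within {a..b})"
      using bounded_linear.has_vector_derivative[OF bounded_linear_inner_left w(2)] by (intro exI[of _ "w \<bullet> e"]) auto
  qed
  finally show ?thesis .
qed

lemma abs_continuous_subinterval:
  "abs_continuous_on_interval a b y \<Longrightarrow> a \<le> c \<Longrightarrow> d \<le> b \<Longrightarrow> abs_continuous_on_interval c d y"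
  unfolding abs_continuous_on_interval_def
  by (meson atLeastatMost_subset_iff order_trans)

section \<open>The control problem, with controls and curves extended to the whole line\<close>

text \<open>The derivatives, the neighborhood \<open>W\<close> and the slope \<open>G\<close>,
  existentially quantified in the hypotheses, are fixed so that later constants can refer to them.
  The slope condition is kept in multiplied form because \<open>r\<^sub>0 - G * N\<close> recurs as
  the net price per unit of time of a later exit.\<close>

locale exit_time_problem =
  fixes U :: "'b::euclidean_space set" and S :: "'a::euclidean_space set"
    and f :: "'a \<Rightarrow> 'b \<Rightarrow> 'a" and r :: "'a \<Rightarrow> 'b \<Rightarrow> real" and g :: "'a \<Rightarrow> real"
    and N L r\<^sub>0 \<rho>\<^sub>0 G :: real
    and Df :: "'a \<Rightarrow> 'b \<Rightarrow> 'a \<Rightarrow>\<^sub>L 'a" and Dr :: "'a \<Rightarrow> 'b \<Rightarrow> 'a" and W :: "'a set"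
  assumes U: "U \<noteq> {}" "compact U" and S: "closed S"
    and pos: "N > 0" "L > 0" "r\<^sub>0 > 0" "\<rho>\<^sub>0 > 0"
    and velocity_convex: "\<And>x. convex {(v, \<mu>::real). \<exists>\<omega>\<in>U. v = f x \<omega> \<and> \<mu> \<ge> r x \<omega>}"
    and f_cont: "continuous_on (UNIV \<times> U) (\<lambda>(x, \<omega>). f x \<omega>)"
    and f_bound: "\<And>x \<omega>. \<omega> \<in> U \<Longrightarrow> norm (f x \<omega>) < N"
    and f_lip: "\<And>x y \<omega>. \<omega> \<in> U \<Longrightarrow> norm (f y \<omega> - f x \<omega>) \<le> L * norm (y - x)"
    and f_der: "\<And>x \<omega>. \<omega> \<in> U \<Longrightarrow> ((\<lambda>z. f z \<omega>) has_derivative blinfun_apply (Df x \<omega>)) (at x)"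
    and Df_cont: "continuous_on (UNIV \<times> U) (\<lambda>(x, \<omega>). Df x \<omega>)"
    and Df_lip: "\<And>x y \<omega>. \<omega> \<in> U \<Longrightarrow> norm (Df y \<omega> - Df x \<omega>) \<le> L * norm (y - x)"
    and r_cont: "continuous_on (UNIV \<times> U) (\<lambda>(x, \<omega>). r x \<omega>)"
    and r_der: "\<And>x \<omega>. \<omega> \<in> U \<Longrightarrow> GDERIV (\<lambda>z. r z \<omega>) x :> Dr x \<omega>"
    and Dr_cont: "continuous_on (UNIV \<times> U) (\<lambda>(x, \<omega>). Dr x \<omega>)"
    and r_Dr_lip: "\<And>x y \<omega>. \<omega> \<in> U \<Longrightarrow> \<bar>r y \<omega> - r x \<omega>\<bar> + norm (Dr y \<omega> - Dr x \<omega>) \<le> L * norm (y - x)"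
    and r_lower: "\<And>x \<omega>. \<omega> \<in> U \<Longrightarrow> r x \<omega> \<ge> r\<^sub>0"
    and W: "open W" "frontier S \<subseteq> W" and G: "0 \<le> G" "G * N < r\<^sub>0"
    and g_lip: "\<And>x y. x \<in> W \<Longrightarrow> y \<in> W \<Longrightarrow> \<bar>g y - g x\<bar> \<le> G * norm (y - x)"
    and inner_ball: "inner_ball_hyp S \<rho>\<^sub>0"
    and semiconcave: "locally_semiconcave g"
begin

lemma r_lip: "\<omega> \<in> U \<Longrightarrow> \<bar>r y \<omega> - r x \<omega>\<bar> \<le> L * norm (y - x)"
  and Dr_lip: "\<omega> \<in> U \<Longrightarrow> norm (Dr y \<omega> - Dr x \<omega>) \<le> L * norm (y - x)"
  using r_Dr_lip[of \<omega> y x] norm_ge_zero[of "Dr y \<omega> - Dr x \<omega>"] by linarith+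

lemma U_closed: "closed U" using U(2) by (rule compact_imp_closed)

text \<open>Measurability and values in \<open>U\<close> are required at negative times too, so that
  shifted and concatenated controls are controls again without a case distinction at 0.\<close>

definition ctrl :: "(real \<Rightarrow> 'b) \<Rightarrow> bool" where
  "ctrl u \<longleftrightarrow> u \<in> borel_measurable lebesgue \<and> (\<forall>t. u t \<in> U)"

text \<open>Solutions are extended to negative times by their initial value, so that they are unique as functions on \<open>\<real>\<close>.\<close>

definition sol :: "'a \<Rightarrow> (real \<Rightarrow> 'b) \<Rightarrow> (real \<Rightarrow> 'a) \<Rightarrow> bool" where
  "sol x u y \<longleftrightarrow> continuous_on UNIV y \<and> (\<forall>t\<le>0. y t = x) \<and> (\<forall>T. ae_deriv 0 T y (\<lambda>t. f (y t) (u t)))"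

definition hit :: "(real \<Rightarrow> 'a) \<Rightarrow> real \<Rightarrow> bool" where
  "hit y \<tau> \<longleftrightarrow> 0 \<le> \<tau> \<and> y \<tau> \<in> S \<and> (\<forall>t. 0 \<le> t \<and> t < \<tau> \<longrightarrow> y t \<notin> S)"

definition R :: "(real \<Rightarrow> 'b) \<Rightarrow> (real \<Rightarrow> 'a) \<Rightarrow> real \<Rightarrow> real" where
  "R u y t = integral {0..t} (\<lambda>s. r (y s) (u s))"

abbreviation "V \<equiv> value_function U S f r g"
abbreviation "reach \<equiv> reachable_set U S f"

lemma ctrlD: "ctrl u \<Longrightarrow> u t \<in> U" "ctrl u \<Longrightarrow> u \<in> borel_measurable lebesgue"
  by (auto simp: ctrl_def)

lemma solD:
  assumes "sol x u y"
  shows "continuous_on A y" "y 0 = x" "t \<le> 0 \<Longrightarrow> y t = x" "ae_deriv 0 T y (\<lambda>t. f (y t) (u t))"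
    "y \<in> borel_measurable lebesgue"
proof -
  have c: "continuous_on UNIV y" using assms by (simp add: sol_def)
  then show "continuous_on A y" by (rule continuous_on_subset) simp
  show "y \<in> borel_measurable lebesgue"
    using borel_measurable_continuous_onI[OF c] by (intro measurable_completion) simp
  show "y 0 = x" "t \<le> 0 \<Longrightarrow> y t = x" "ae_deriv 0 T y (\<lambda>t. f (y t) (u t))" using assms unfolding sol_def by blast+
qed

lemma path_measurable:
  fixes \<Phi> :: "'a \<Rightarrow> 'b \<Rightarrow> 'c::{second_countable_topology, real_normed_vector}"
  assumes "continuous_on (UNIV \<times> U) (\<lambda>(x, \<omega>). \<Phi> x \<omega>)" "continuous_on UNIV y" "ctrl u"
  shows "(\<lambda>s. \<Phi> (y s) (u s)) \<in> borel_measurable lebesgue"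
proof (rule measurable_continuous_composition[OF U_closed assms(1)])
  show "y \<in> borel_measurable lebesgue"
    using borel_measurable_continuous_onI[OF assms(2)] by (intro measurable_completion) simp
qed (use assms(3) in \<open>simp_all add: ctrl_def\<close>)

lemma path_bounded:
  fixes \<Phi> :: "'a \<Rightarrow> 'b \<Rightarrow> 'c::real_normed_vector"
  assumes "continuous_on (UNIV \<times> U) (\<lambda>(x, \<omega>). \<Phi> x \<omega>)" "compact K"
  obtains B where "\<And>x \<omega>. x \<in> K \<Longrightarrow> \<omega> \<in> U \<Longrightarrow> norm (\<Phi> x \<omega>) \<le> B"
proof -
  have "compact ((\<lambda>(x, \<omega>). \<Phi> x \<omega>) ` (K \<times> U))"
    using assms U(2) by (intro compact_continuous_image compact_Times continuous_on_subset[OF assms(1)]) auto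
  then have "bounded ((\<lambda>(x, \<omega>). \<Phi> x \<omega>) ` (K \<times> U))" by (rule compact_imp_bounded)
  then obtain B where B: "\<forall>z\<in>(\<lambda>(x, \<omega>). \<Phi> x \<omega>) ` (K \<times> U). norm z \<le> B" unfolding bounded_iff by blast
  show thesis
  proof (rule that)
    fix x \<omega> assume "x \<in> K" "\<omega> \<in> U"
    then have "(\<lambda>(x, \<omega>). \<Phi> x \<omega>) (x, \<omega>) \<in> (\<lambda>(x, \<omega>). \<Phi> x \<omega>) ` (K \<times> U)" by (intro imageI) simp
    with B show "norm (\<Phi> x \<omega>) \<le> B" by auto
  qed
qed

lemma sol_exists:
  assumes u: "ctrl u"
  obtains y where "sol x u y"
proof -
  have "\<exists>y. continuous_on UNIV y \<and> (\<forall>t\<le>0. y t = x) \<and> (\<forall>T. ae_deriv 0 T y (\<lambda>t. f (y t) (u t)))"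
  proof (rule caratheodory_ode_exists[of "\<lambda>t x. f x (u t)" L x N])
    show "(\<lambda>s. f (y s) (u s)) \<in> borel_measurable lebesgue" if "continuous_on UNIV y" for y
      using path_measurable[OF f_cont that u] .
    show "norm (f z (u s) - f z' (u s)) \<le> L * norm (z - z')" for s z z'
      using f_lip ctrlD[OF u] by blast
    show "norm (f x (u s)) \<le> N" for s using f_bound ctrlD[OF u] less_imp_le by blast
  qed (use pos in blast)+
  then show thesis using that by (auto simp: sol_def)
qed

lemma sol_unique_on:
  assumes "ctrl u" "sol x u y" "ae_deriv 0 T y' (\<lambda>t. f (y' t) (u t))" "y' 0 = x" "t \<in> {0..T}"
  shows "y t = y' t"
proof (rule ae_deriv_unique[OF solD(4)[OF assms(2)] assms(3), of L t])
  show "norm (f (y s) (u s) - f (y' s) (u s)) \<le> L * norm (y s - y' s)" for s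
    using f_lip ctrlD[OF assms(1)] by blast
qed (use pos solD(2)[OF assms(2)] assms in auto)

lemma sol_lip:
  assumes "ctrl u" "sol x u y"
  shows "norm (y t - y s) \<le> N * \<bar>t - s\<bar>"
proof -
  have *: "norm (y t - y s) \<le> N * (t - s)" if "0 \<le> s" "s \<le> t" for s t
    by (rule ae_deriv_norm_le[OF that(2) ae_deriv_subset[OF solD(4)[OF assms(2), of t]], of "{}"])
      (use that f_bound[OF ctrlD(1)[OF assms(1)]] in \<open>auto intro: less_imp_le\<close>)
  have eq: "y s = y (max 0 s)" for s using solD(3)[OF assms(2), of s] solD(2)[OF assms(2)] by (cases "s \<le> 0") auto
  have "norm (y (max 0 t) - y (max 0 s)) \<le> N * \<bar>max 0 t - max 0 s\<bar>"
  proof (cases "max 0 s \<le> max 0 t")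
    case True
    then show ?thesis using *[of "max 0 s" "max 0 t"] by simp
  next
    case False
    then have "max 0 t \<le> max 0 s" by linarith
    with *[of "max 0 t" "max 0 s"] False show ?thesis
      unfolding norm_minus_commute[of "y (max 0 t)" "y (max 0 s)"] by (simp only: abs_if) auto
  qed
  also have "\<dots> \<le> N * \<bar>t - s\<bar>" using pos by (intro mult_left_mono) auto
  finally show ?thesis using eq by metis
qed

lemma r_path:
  assumes "ctrl u" "sol x u y"
  shows "ae_deriv 0 T (R u y) (\<lambda>t. r (y t) (u t))" "(\<lambda>s. r (y s) (u s)) absolutely_integrable_on {0..T}"
    "(\<lambda>s. r (y s) (u s)) integrable_on {0..T}"
proof -
  obtain B where B: "\<And>z \<omega>. z \<in> y ` {0..T} \<Longrightarrow> \<omega> \<in> U \<Longrightarrow> norm (r z \<omega>) \<le> B"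
    by (rule path_bounded[OF r_cont compact_continuous_image[OF solD(1)[OF assms(2)] compact_Icc]]) (rule that)
  have B': "norm (r (y t) (u t)) \<le> B" if "t \<in> {0..T}" for t using B ctrlD[OF assms(1)] that by blast
  note m = path_measurable[OF r_cont solD(1)[OF assms(2)] assms(1)]
  show "ae_deriv 0 T (R u y) (\<lambda>t. r (y t) (u t))"
    unfolding R_def by (rule ae_deriv_integral[OF m B'])
  show "(\<lambda>s. r (y s) (u s)) absolutely_integrable_on {0..T}" "(\<lambda>s. r (y s) (u s)) integrable_on {0..T}"
    by (rule bounded_measurable_integrable[OF m B']; simp)+
qed

lemma R_0: "R u y 0 = 0" by (simp add: R_def)

lemma R_mono:
  assumes "ctrl u" "sol x u y" "0 \<le> s" "s \<le> t"
  shows "r\<^sub>0 * (t - s) \<le> R u y t - R u y s"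
proof -
  have "(- R u y t) - (- R u y s) \<le> (- r\<^sub>0) * (t - s)"
    by (rule ae_deriv_le[OF assms(4) ae_deriv_minus[OF ae_deriv_subset[OF r_path(1)[OF assms(1,2), of t]]], of "{}"])
      (use assms r_lower[OF ctrlD(1)[OF assms(1)]] in auto)
  then show ?thesis by simp
qed

text \<open>Links the definite description in the statement with \<open>sol\<close>. The two
  controls only have to agree at nonnegative times, where a given control is extended from.\<close>

lemma trajectory_eq:
  assumes u: "ctrl u" and y: "sol x u y" and eq: "\<And>t. 0 \<le> t \<Longrightarrow> u' t = u t"
  shows "trajectory f x u' = restrict y {0..}"
  unfolding trajectory_def
proof (rule the_equality)
  \<comment> \<open>The exceptional set of \<open>sol\<close> depends on the time horizon; integer
    horizons suffice, and their countable union is still negligible.\<close>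
  have "\<exists>E. negligible E \<and> (\<forall>t\<in>{0<..<real n} - E. (y has_vector_derivative f (y t) (u t)) (at t))" for n :: nat
    using solD(4)[OF y, of "real n"] unfolding ae_deriv_def by blast
  then obtain E where E: "\<And>n. negligible (E n)"
    "\<And>n t. t \<in> {0<..<real n} - E n \<Longrightarrow> (y has_vector_derivative f (y t) (u t)) (at t)" by metis
  have neg: "negligible ((\<Union>n. E n) \<union> {0})" using E(1) by (intro negligible_Un negligible_Union_nat) auto
  show "restrict y {0..} \<in> extensional {0..} \<and> caratheodory_solution f x u' (restrict y {0..})"
    unfolding caratheodory_solution_def negligible_iff_AE_lebesgue
  proof (intro conjI allI impI exI[of _ "(\<Union>n. E n) \<union> {0}"] neg)
    show "restrict y {0..} \<in> extensional {0..}" "restrict y {0..} 0 = x" using solD(2)[OF y] by auto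
    fix T :: real assume "0 \<le> T"
    have "N-lipschitz_on {0..T} (restrict y {0..})"
      by (rule lipschitz_onI) (use sol_lip[OF u y] pos in \<open>auto simp: dist_norm\<close>)
    then show "abs_continuous_on_interval 0 T (restrict y {0..})" by (rule lipschitz_imp_abs_continuous)
  next
    fix s :: real assume s: "0 \<le> s" "s \<notin> (\<Union>n. E n) \<union> {0}"
    obtain n :: nat where "s < real n" using reals_Archimedean2 by blast
    then have "(y has_vector_derivative f (y s) (u s)) (at s)" using E(2)[of s n] s by auto
    then have "(y has_vector_derivative f (y s) (u s)) (at s within {0..})" by (rule has_vector_derivative_at_within)
    then have "(restrict y {0..} has_vector_derivative f (y s) (u s)) (at s within {0..})"
      by (rule has_vector_derivative_transform[rotated 2]) (use s in auto)
    then show "(restrict y {0..} has_vector_derivative f (restrict y {0..} s) (u' s)) (at s within {0..})"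
      using s eq by simp
  qed
  fix z assume z: "z \<in> extensional {0..} \<and> caratheodory_solution f x u' z"
  then obtain E' where E': "negligible E'"
    "\<And>s. 0 \<le> s \<Longrightarrow> s \<notin> E' \<Longrightarrow> (z has_vector_derivative f (z s) (u' s)) (at s within {0..})"
    unfolding caratheodory_solution_def negligible_iff_AE_lebesgue by blast
  have z0: "z 0 = x" and zac: "0 \<le> T \<Longrightarrow> abs_continuous_on_interval 0 T z" for T
    using z by (auto simp: caratheodory_solution_def)
  \<comment> \<open>A competing solution is only known to be absolutely continuous. Its bounded
    velocity makes it Lipschitz, and then Gronwall's inequality identifies it with
    \<open>y\<close>.\<close>
  have zb: "norm (z t - z s) \<le> N * (t - s)" if st: "0 \<le> s" "s \<le> t" for s t
  proof (rule abs_continuous_norm_increment_le[OF st(2) abs_continuous_subinterval[OF zac[of t]] E'(1)])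
    fix \<sigma> assume \<sigma>: "\<sigma> \<in> {s..t} - E'"
    then have "(z has_vector_derivative f (z \<sigma>) (u' \<sigma>)) (at \<sigma> within {s..t})"
      using st by (intro has_vector_derivative_within_subset[OF E'(2)]) auto
    moreover have "norm (f (z \<sigma>) (u' \<sigma>)) \<le> N"
      using \<sigma> st eq[of \<sigma>] f_bound[OF ctrlD(1)[OF u], of "z \<sigma>" \<sigma>] by simp
    ultimately show "\<exists>w. norm w \<le> N \<and> (z has_vector_derivative w) (at \<sigma> within {s..t})" by blast
  qed (use st pos in auto)
  have zd: "ae_deriv 0 T z (\<lambda>t. f (z t) (u t))" for T
  proof (rule ae_derivI[of N _ _ _ E'])
    show "N-lipschitz_on {0..T} z"
    proof (rule lipschitz_onI)
      fix s t assume "s \<in> {0..T}" "t \<in> {0..T}"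
      then show "dist (z s) (z t) \<le> N * dist s t"
        using zb[of s t] zb[of t s] by (cases "s \<le> t") (auto simp: dist_norm norm_minus_commute)
    qed (use pos in simp)
    fix t assume t: "t \<in> {0<..<T} - E'"
    then have "(z has_vector_derivative f (z t) (u' t)) (at t within {0..})" using E'(2) by simp
    moreover have "at t within {0..} = at t" using t by (intro at_within_interior) auto
    ultimately show "(z has_vector_derivative f (z t) (u t)) (at t)" using eq[of t] t by simp
  qed (rule E'(1))
  show "z = restrict y {0..}"
  proof
    fix t show "z t = restrict y {0..} t"
    proof (cases "0 \<le> t")
      case True
      then show ?thesis using sol_unique_on[OF u y zd[of t] z0, of t] by simp
    next
      case False
      then show ?thesis using z by (simp add: extensional_def)
    qed
  qed
qed

lemma hitting_time_eq:
  assumes "hit y \<tau>"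
  shows "hitting_time S (restrict y {0..}) = ereal \<tau>"
  unfolding hitting_time_def
proof (rule antisym)
  show "(INF t\<in>{t. 0 \<le> t \<and> restrict y {0..} t \<in> S}. ereal t) \<le> ereal \<tau>"
    using assms by (intro INF_lower) (auto simp: hit_def)
  show "ereal \<tau> \<le> (INF t\<in>{t. 0 \<le> t \<and> restrict y {0..} t \<in> S}. ereal t)"
    using assms by (intro INF_greatest) (auto simp: hit_def not_less[symmetric])
qed

lemma hit_exists:
  assumes y: "continuous_on UNIV y" and t: "0 \<le> t" "y t \<in> S"
  obtains \<tau> where "hit y \<tau>" "\<tau> \<le> t"
proof -
  define A where "A = {0..} \<inter> y -` S"
  have "closed A" unfolding A_def using continuous_closed_vimage[OF S] y
    by (intro closed_Int) (auto simp: continuous_on_eq_continuous_within)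
  moreover have "A \<noteq> {}" "bdd_below A" using t by (auto simp: A_def bdd_below_def)
  ultimately have "Inf A \<in> A" by (intro closed_contains_Inf)
  moreover have "t' \<notin> S \<or> True" for t' by simp
  moreover have "Inf A \<le> s" if "s \<in> A" for s using that \<open>bdd_below A\<close> by (rule cInf_lower)
  ultimately have "hit y (Inf A)" "Inf A \<le> t" using t by (force simp: hit_def A_def)+
  then show thesis using that by blast
qed

definition J :: "'a \<Rightarrow> real \<Rightarrow> bool" where
  "J x c \<longleftrightarrow> (\<exists>u y \<tau>. ctrl u \<and> sol x u y \<and> hit y \<tau> \<and> c = R u y \<tau> + g (y \<tau>))"

lemma cost_eq:
  assumes u: "ctrl u" and y: "sol x u y" and eq: "\<And>t. 0 \<le> t \<Longrightarrow> u' t = u t" and h: "hit y \<tau>"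
  shows "cost S f r g x u' = R u y \<tau> + g (y \<tau>)"
proof -
  have \<tau>: "0 \<le> \<tau>" using h by (simp add: hit_def)
  have "(LINT s:{0..\<tau>}|lebesgue. r (restrict y {0..} s) (u' s)) = (LINT s:{0..\<tau>}|lebesgue. r (y s) (u s))"
    using eq by (intro set_lebesgue_integral_cong) auto
  also have "\<dots> = R u y \<tau>"
    unfolding R_def by (rule set_lebesgue_integral_eq_integral(2)[OF r_path(2)[OF u y]])
  finally show ?thesis
    using \<tau> by (simp add: cost_def Let_def trajectory_eq[OF u y eq] hitting_time_eq[OF h])
qed

lemma measurable_control_ctrl:
  assumes "u' \<in> measurable_controls U"
  obtains u where "ctrl u" "\<And>t. 0 \<le> t \<Longrightarrow> u' t = u t"
proof -
  define u where "u = (\<lambda>t. if t \<in> {0..} then (if t \<in> {0..} then u' t else 0) else u' 0)"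
  have m: "u' \<in> borel_measurable (lebesgue_on {0..})" and ui: "u' t \<in> U" if "0 \<le> t" for t
    using assms that unfolding measurable_controls_def by blast+
  have "(\<lambda>t. if t \<in> {0..} then u' t else 0) \<in> borel_measurable lebesgue"
    by (rule borel_measurable_if_I[OF m[OF order_refl]]) simp
  then have "u \<in> borel_measurable lebesgue"
    unfolding u_def by (rule measurable_If_set) simp_all
  moreover have "u t \<in> U" for t using ui[of t] ui[of 0] by (simp add: u_def)
  ultimately have "ctrl u" unfolding ctrl_def by blast
  then show thesis by (rule that) (simp add: u_def)
qed

lemma ctrl_measurable_control: "ctrl u \<Longrightarrow> u \<in> measurable_controls U"
  by (auto simp: ctrl_def measurable_controls_def measurable_restrict_space1)

lemma reaching_control:
  assumes "u' \<in> reaching_controls U S f x"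
  obtains u y \<tau> where "ctrl u" "\<And>t. 0 \<le> t \<Longrightarrow> u' t = u t" "sol x u y" "hit y \<tau>"
proof -
  have m: "u' \<in> measurable_controls U" and h: "hitting_time S (trajectory f x u') < \<infinity>"
    using assms by (auto simp: reaching_controls_def)
  obtain u where u: "ctrl u" "\<And>t. 0 \<le> t \<Longrightarrow> u' t = u t" using measurable_control_ctrl[OF m] by blast
  obtain y where y: "sol x u y" using sol_exists[OF u(1)] by blast
  have "\<exists>t\<ge>0. y t \<in> S"
  proof (rule ccontr)
    assume "\<not> ?thesis"
    then have "{t. 0 \<le> t \<and> restrict y {0..} t \<in> S} = {}" by auto
    then have "hitting_time S (restrict y {0..}) = \<infinity>"
      unfolding hitting_time_def by (simp only: image_empty Inf_empty top_ereal_def)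
    then show False using h trajectory_eq[OF u(1) y u(2)] by simp
  qed
  then obtain t where "0 \<le> t" "y t \<in> S" by blast
  then obtain \<tau> where "hit y \<tau>" by (rule hit_exists[OF solD(1)[OF y]])
  from that[OF u y this] show thesis .
qed

lemma reaching_ctrl:
  assumes "ctrl u" "sol x u y" "hit y \<tau>"
  shows "u \<in> reaching_controls U S f x"
proof -
  have "trajectory f x u = restrict y {0..}" by (rule trajectory_eq[OF assms(1,2)]) simp
  then show ?thesis
    using ctrl_measurable_control[OF assms(1)] hitting_time_eq[OF assms(3)] by (simp add: reaching_controls_def)
qed

lemma reach_iff: "x \<in> reach \<longleftrightarrow> (\<exists>c. J x c)"
proof
  assume "x \<in> reach"
  then obtain u' where "u' \<in> reaching_controls U S f x" by (auto simp: reachable_set_def)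
  then show "\<exists>c. J x c" unfolding J_def by (rule reaching_control) blast
next
  assume "\<exists>c. J x c"
  then show "x \<in> reach" using reaching_ctrl[of _ x] unfolding J_def reachable_set_def mem_Collect_eq by blast
qed

lemma V_eq: "V x = Inf (ereal ` {c. J x c})"
proof -
  have "(\<lambda>u. ereal (cost S f r g x u)) ` reaching_controls U S f x = ereal ` {c. J x c}"
  proof (intro equalityI subsetI)
    fix c assume "c \<in> (\<lambda>u. ereal (cost S f r g x u)) ` reaching_controls U S f x"
    then obtain u' where u': "u' \<in> reaching_controls U S f x" and c: "c = ereal (cost S f r g x u')" by blast
    from u' obtain u y \<tau> where *: "ctrl u" "\<And>t. 0 \<le> t \<Longrightarrow> u' t = u t" "sol x u y" "hit y \<tau>"
      by (rule reaching_control) (rule that; blast)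
    have "cost S f r g x u' = R u y \<tau> + g (y \<tau>)" by (rule cost_eq[OF *(1,3) _ *(4)]) (rule *(2))
    then have "J x (cost S f r g x u')" unfolding J_def
      by (intro exI[of _ u] exI[of _ y] exI[of _ \<tau>] conjI *(1,3,4))
    then show "c \<in> ereal ` {c. J x c}" unfolding c by (intro imageI CollectI)
  next
    fix c assume "c \<in> ereal ` {c. J x c}"
    then obtain u y \<tau> where *: "ctrl u" "sol x u y" "hit y \<tau>" and c: "c = ereal (R u y \<tau> + g (y \<tau>))"
      unfolding J_def by (elim imageE CollectE exE conjE) (rule that; simp)
    have eq: "cost S f r g x u = R u y \<tau> + g (y \<tau>)" by (rule cost_eq[OF *(1,2) _ *(3)]) simp
    show "c \<in> (\<lambda>u. ereal (cost S f r g x u)) ` reaching_controls U S f x"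
      unfolding c eq[symmetric] by (rule imageI) (rule reaching_ctrl[OF *])
  qed
  then show ?thesis unfolding value_function_def by simp
qed

definition opt :: "'a \<Rightarrow> (real \<Rightarrow> 'b) \<Rightarrow> (real \<Rightarrow> 'a) \<Rightarrow> real \<Rightarrow> bool" where
  "opt x u y \<tau> \<longleftrightarrow> ctrl u \<and> sol x u y \<and> hit y \<tau> \<and> V x = ereal (R u y \<tau> + g (y \<tau>))"

lemma optimal_trajectories_iff:
  "(\<tau>, z) \<in> optimal_trajectories U S f r g x \<longleftrightarrow> (\<exists>u y. opt x u y \<tau> \<and> z = restrict y {0..\<tau>})"
proof
  assume "(\<tau>, z) \<in> optimal_trajectories U S f r g x"
  then obtain u' where u': "u' \<in> reaching_controls U S f x" "ereal (cost S f r g x u') = V x"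
    "ereal \<tau> = hitting_time S (trajectory f x u')" "z = restrict (trajectory f x u') {0..\<tau>}"
    unfolding optimal_trajectories_def optimal_control_def by (elim CollectE case_prodE) auto
  from u'(1) obtain u y \<tau>' where *: "ctrl u" "\<And>t. 0 \<le> t \<Longrightarrow> u' t = u t" "sol x u y" "hit y \<tau>'"
    by (rule reaching_control) (rule that; blast)
  have tr: "trajectory f x u' = restrict y {0..}" by (rule trajectory_eq[OF *(1,3,2)])
  have \<tau>: "\<tau>' = \<tau>" using u'(3) hitting_time_eq[OF *(4)] unfolding tr by simp
  have "z = restrict y {0..\<tau>}" unfolding u'(4) tr by (auto simp: restrict_def)
  moreover have "opt x u y \<tau>"
  proof -
    have "cost S f r g x u' = R u y \<tau>' + g (y \<tau>')" by (rule cost_eq[OF *(1,3) _ *(4)]) (rule *(2))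
    then show ?thesis using *(1,3,4) u'(2) unfolding \<tau> opt_def by simp
  qed
  ultimately show "\<exists>u y. opt x u y \<tau> \<and> z = restrict y {0..\<tau>}" by blast
next
  assume "\<exists>u y. opt x u y \<tau> \<and> z = restrict y {0..\<tau>}"
  then obtain u y where *: "ctrl u" "sol x u y" "hit y \<tau>" "V x = ereal (R u y \<tau> + g (y \<tau>))" "z = restrict y {0..\<tau>}"
    unfolding opt_def by (elim exE conjE) (rule that; assumption)
  have tr: "trajectory f x u = restrict y {0..}" by (rule trajectory_eq[OF *(1,2)]) simp
  have "z = restrict (trajectory f x u) {0..\<tau>}" unfolding *(5) tr by (auto simp: restrict_def)
  moreover have "ereal \<tau> = hitting_time S (trajectory f x u)" unfolding tr hitting_time_eq[OF *(3)] ..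
  moreover have "cost S f r g x u = R u y \<tau> + g (y \<tau>)" by (rule cost_eq[OF *(1,2) _ *(3)]) simp
  then have "optimal_control U S f r g x u"
    unfolding optimal_control_def *(4) using reaching_ctrl[OF *(1-3)] by simp
  ultimately show "(\<tau>, z) \<in> optimal_trajectories U S f r g x"
    unfolding optimal_trajectories_def by (intro CollectI case_prodI2) (auto intro!: exI[of _ u])
qed

end

section \<open>Shifting and concatenating controls; dynamic programming\<close>

lemma ae_deriv_cong:
  assumes "ae_deriv a b y w" "\<And>t. t \<in> {a..b} \<Longrightarrow> y' t = y t" "\<And>t. t \<in> {a<..<b} \<Longrightarrow> w' t = w t"
  shows "ae_deriv a b y' w'"
proof -
  from assms(1) obtain K E where KE: "K-lipschitz_on {a..b} y" "negligible E"
    "\<And>t. t \<in> {a<..<b} - E \<Longrightarrow> (y has_vector_derivative w t) (at t)" by (rule ae_derivE) blast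
  show ?thesis
  proof (rule ae_derivI[OF _ KE(2)])
    show "K-lipschitz_on {a..b} y'" using KE(1) assms(2) by (auto intro: lipschitz_on_transform)
    fix t assume t: "t \<in> {a<..<b} - E"
    have "(y has_vector_derivative w' t) (at t)" using KE(3)[OF t] assms(3)[of t] t by simp
    then show "(y' has_vector_derivative w' t) (at t)"
      by (rule has_vector_derivative_transform_within_open[of _ _ _ "{a<..<b}"]) (use t assms(2) in auto)
  qed
qed

lemma ae_deriv_shift:
  assumes "ae_deriv a b y w"
  shows "ae_deriv (a - c) (b - c) (\<lambda>t. y (t + c)) (\<lambda>t. w (t + c))"
proof -
  from assms(1) obtain K E where KE: "K-lipschitz_on {a..b} y" "negligible E"
    "\<And>t. t \<in> {a<..<b} - E \<Longrightarrow> (y has_vector_derivative w t) (at t)" by (rule ae_derivE) blast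
  show ?thesis
  proof (rule ae_derivI)
    show "K-lipschitz_on {a - c..b - c} (\<lambda>t. y (t + c))"
    proof (rule lipschitz_onI)
      fix s t assume "s \<in> {a - c..b - c}" "t \<in> {a - c..b - c}"
      then have "dist (y (s + c)) (y (t + c)) \<le> K * dist (s + c) (t + c)"
        by (intro lipschitz_onD[OF KE(1)]) auto
      then show "dist (y (s + c)) (y (t + c)) \<le> K * dist s t" by simp
    qed (rule lipschitz_on_nonneg[OF KE(1)])
    show "negligible ((+) (- c) ` E)" using KE(2) by (rule negligible_translation)
    fix t assume t: "t \<in> {a - c<..<b - c} - (+) (- c) ` E"
    have "t + c \<notin> E"
    proof
      assume "t + c \<in> E"
      then have "- c + (t + c) \<in> (+) (- c) ` E" by (rule imageI)
      then show False using t by simp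
    qed
    then have "(y has_vector_derivative w (t + c)) (at (t + c))" using t by (intro KE(3)) auto
    moreover have "((\<lambda>t. t + c) has_real_derivative 1) (at t)" by (auto intro!: derivative_eq_intros)
    ultimately show "((\<lambda>t. y (t + c)) has_vector_derivative w (t + c)) (at t)"
      using vector_diff_chain_at[of "\<lambda>t. t + c" 1 t y "w (t + c)"]
      by (simp add: has_real_derivative_iff_has_vector_derivative o_def)
  qed
qed

lemma ae_deriv_zero_const:
  fixes y :: "real \<Rightarrow> 'a::euclidean_space"
  assumes "ae_deriv a b y w" "\<And>t. t \<in> {a<..<b} \<Longrightarrow> w t = 0" "a \<le> b"
  shows "y b = y a"
  using ae_deriv_norm_le[OF assms(3,1), of "{}" 0] assms(2) by auto

lemma translation_borel_measurable:
  fixes u :: "real \<Rightarrow> 'b::euclidean_space"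
  assumes "u \<in> borel_measurable lebesgue"
  shows "(\<lambda>t. u (t + c)) \<in> borel_measurable lebesgue"
proof -
  have "(\<lambda>t. c + 1 *\<^sub>R t) \<in> lebesgue \<rightarrow>\<^sub>M lebesgue"
    using lebesgue_affine_measurable[of "\<lambda>_. 1" c] by simp
  from measurable_compose[OF this assms] show ?thesis by (simp add: add.commute)
qed

context exit_time_problem
begin

lemma ctrl_shift: "ctrl u \<Longrightarrow> ctrl (\<lambda>t. u (t + c))"
  unfolding ctrl_def using translation_borel_measurable[of u c] by blast

lemma ctrl_concat:
  assumes "ctrl u" "ctrl v"
  shows "ctrl (\<lambda>t. if t < c then u t else v (t - c))"
proof -
  have "(\<lambda>t. if t \<in> {..<c} then u t else v (t + - c)) \<in> borel_measurable lebesgue"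
    using ctrlD(2)[OF assms(1)] ctrlD(2)[OF ctrl_shift[OF assms(2), of "- c"]] by (rule measurable_If_set) simp
  moreover have "(\<lambda>t. if t \<in> {..<c} then u t else v (t + - c)) = (\<lambda>t. if t < c then u t else v (t - c))" by auto
  ultimately show ?thesis using assms unfolding ctrl_def by simp
qed

lemma ctrl_const: "\<omega> \<in> U \<Longrightarrow> ctrl (\<lambda>t. \<omega>)"
  by (simp add: ctrl_def)

lemma sol_agree:
  assumes u: "ctrl u" "sol x u y" and u': "ctrl u'" "sol x u' y'"
    and eq: "\<And>t. 0 < t \<Longrightarrow> t < T \<Longrightarrow> u' t = u t" and t: "t \<in> {0..T}"
  shows "y' t = y t" "R u' y' t = R u y t"
proof -
  have "ae_deriv 0 T y' (\<lambda>t. f (y' t) (u t))"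
    by (rule ae_deriv_cong[OF solD(4)[OF u'(2)]]) (use eq in auto)
  from sol_unique_on[OF u(1,2) this solD(2)[OF u'(2)]]
  have yeq: "y' t = y t" if "t \<in> {0..T}" for t
    using that by simp
  then show "y' t = y t" using t by simp
  show "R u' y' t = R u y t" unfolding R_def
  proof (rule integral_spike[of "{0, T}"])
    fix s assume "s \<in> {0..t} - {0, T}"
    then show "r (y s) (u s) = r (y' s) (u' s)" using yeq[of s] eq[of s] t by simp
  qed simp
qed

lemma sol_restart:
  assumes u: "ctrl u" "sol x u y" and c: "0 \<le> c" and v: "ctrl v" "sol (y c) v z"
    and eq: "\<And>t. 0 < t \<Longrightarrow> v t = u (t + c)" and s: "0 \<le> s"
  shows "z s = y (s + c)" "R v z s = R u y (s + c) - R u y c"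
proof -
  have sh: "ae_deriv 0 s (\<lambda>t. y (t + c)) (\<lambda>t. f (y (t + c)) (v t))"
  proof -
    have "ae_deriv (c - c) (s + c - c) (\<lambda>t. y (t + c)) (\<lambda>t. f (y (t + c)) (u (t + c)))"
      by (rule ae_deriv_shift[OF ae_deriv_subset[OF solD(4)[OF u(2), of "s + c"]]]) (use c in auto)
    then have "ae_deriv 0 s (\<lambda>t. y (t + c)) (\<lambda>t. f (y (t + c)) (u (t + c)))" by simp
    then show ?thesis by (rule ae_deriv_cong) (use eq in auto)
  qed
  have zy: "z t = y (t + c)" if "t \<in> {0..s}" for t
    by (rule sol_unique_on[OF v sh _ that]) simp
  then show "z s = y (s + c)" using s by simp
  have rz: "ae_deriv 0 s (R v z) (\<lambda>t. r (z t) (v t))" by (rule r_path(1)[OF v])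
  have "ae_deriv (c - c) (s + c - c) (\<lambda>t. R u y (t + c)) (\<lambda>t. r (y (t + c)) (u (t + c)))"
    by (rule ae_deriv_shift[OF ae_deriv_subset[OF r_path(1)[OF u, of "s + c"]]]) (use c in auto)
  then have ry: "ae_deriv 0 s (\<lambda>t. R u y (t + c)) (\<lambda>t. r (y (t + c)) (u (t + c)))" by simp
  have "R v z s - R u y (s + c) = R v z 0 - R u y (0 + c)"
    by (rule ae_deriv_zero_const[OF ae_deriv_diff[OF rz ry] _ s]) (use zy eq in auto)
  then show "R v z s = R u y (s + c) - R u y c" by (simp add: R_0)
qed

lemma sol_concat:
  assumes u: "ctrl u" "sol x u y" and c: "0 \<le> c" and v: "ctrl v" "sol (y c) v z"
  obtains w Y where "ctrl w" "sol x w Y" "w = (\<lambda>t. if t < c then u t else v (t - c))"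
    "\<And>t. t \<in> {0..c} \<Longrightarrow> Y t = y t" "\<And>t. t \<in> {0..c} \<Longrightarrow> R w Y t = R u y t"
    "\<And>s. 0 \<le> s \<Longrightarrow> Y (s + c) = z s" "\<And>s. 0 \<le> s \<Longrightarrow> R w Y (s + c) = R u y c + R v z s"
proof -
  define w where "w = (\<lambda>t. if t < c then u t else v (t - c))"
  have w: "ctrl w" unfolding w_def by (rule ctrl_concat[OF u(1) v(1)])
  obtain Y where Y: "sol x w Y" using sol_exists[OF w] by blast
  have weq: "w t = u t" if "0 < t" "t < c" for t using that by (simp add: w_def)
  have *: "Y t = y t" "R w Y t = R u y t" if "t \<in> {0..c}" for t
    using sol_agree[OF u w Y weq that] by auto
  have v': "sol (Y c) v z" using *(1)[of c] c v(2) by simp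
  have weq': "v t = w (t + c)" if "0 < t" for t using that by (simp add: w_def)
  have **: "Y (s + c) = z s" "R w Y (s + c) = R u y c + R v z s" if "0 \<le> s" for s
    using sol_restart[OF w Y c v(1) v' weq' that] *(2)[of c] c by auto
  show thesis by (rule that[OF w Y w_def * **])
qed

lemma V_le: "ctrl u \<Longrightarrow> sol x u y \<Longrightarrow> hit y \<tau> \<Longrightarrow> V x \<le> ereal (R u y \<tau> + g (y \<tau>))"
  unfolding V_eq by (intro Inf_lower imageI CollectI) (auto simp: J_def)

lemma V_greatest: "(\<And>u y \<tau>. ctrl u \<Longrightarrow> sol x u y \<Longrightarrow> hit y \<tau> \<Longrightarrow> m \<le> ereal (R u y \<tau> + g (y \<tau>))) \<Longrightarrow> m \<le> V x"
  unfolding V_eq by (intro Inf_greatest) (auto simp: J_def)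

lemma hit_frontier:
  assumes "sol x u y" "hit y \<tau>" "x \<in> closure (- S)"
  shows "y \<tau> \<in> frontier S"
proof -
  have "y \<tau> \<in> closure (- S)"
  proof (cases "\<tau> = 0")
    case True
    then show ?thesis using assms(3) solD(2)[OF assms(1)] by simp
  next
    case False
    then have \<tau>: "0 < \<tau>" using assms(2) by (simp add: hit_def)
    have "\<tau> \<in> closure {0..<\<tau>}" using \<tau> by simp
    moreover have "y ` closure {0..<\<tau>} \<subseteq> closure (y ` {0..<\<tau>})"
      by (rule image_closure_subset[OF solD(1)[OF assms(1)]]) (auto simp: closure_subset)
    moreover have "closure (y ` {0..<\<tau>}) \<subseteq> closure (- S)"
      using assms(2) by (intro closure_mono) (auto simp: hit_def)
    ultimately show ?thesis by blast
  qed
  moreover have "y \<tau> \<in> S" using assms(2) by (simp add: hit_def)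
  ultimately show ?thesis by (simp add: frontier_closures closure_closed[OF S])
qed

lemma g_frontier_lip: "e \<in> frontier S \<Longrightarrow> z \<in> frontier S \<Longrightarrow> \<bar>g e - g z\<bar> \<le> G * norm (e - z)"
  using g_lip[of z e] W(2) by blast

text \<open>Running cost accrues at rate at least \<open>r\<^sub>0\<close>, while between boundary
  points the terminal cost can drop at rate at most \<open>G * N\<close>. Ignoring a first hit is
  therefore strictly expensive, which will exclude limits of exit times that come too late.\<close>

lemma later_cost:
  assumes "ctrl u" "sol x u y" "hit y \<tau>" "x \<in> closure (- S)" "\<tau> \<le> T" "y T \<in> frontier S"
  shows "R u y \<tau> + g (y \<tau>) + (r\<^sub>0 - G * N) * (T - \<tau>) \<le> R u y T + g (y T)"
proof -
  have "0 \<le> \<tau>" using assms(3) by (simp add: hit_def)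
  then have "r\<^sub>0 * (T - \<tau>) \<le> R u y T - R u y \<tau>" using R_mono[OF assms(1,2) _ assms(5)] by simp
  moreover have "g (y \<tau>) - g (y T) \<le> G * norm (y \<tau> - y T)"
    using g_frontier_lip[OF hit_frontier[OF assms(2-4)] assms(6)] by linarith
  moreover have "G * norm (y \<tau> - y T) \<le> G * (N * (T - \<tau>))"
    using sol_lip[OF assms(1,2), of \<tau> T] assms(5) G(1) by (intro mult_left_mono) auto
  ultimately show ?thesis by (simp add: algebra_simps)
qed

text \<open>Serves two purposes: \<open>V\<close> is bounded below at each point, and along bounded
  initial points a bound on the cost is a bound on the exit time.\<close>

lemma cost_lower_bound:
  assumes "ctrl u" "sol x u y" "hit y \<tau>" "x \<in> closure (- S)" "z \<in> frontier S"
  shows "(r\<^sub>0 - G * N) * \<tau> + g z - G * norm (x - z) \<le> R u y \<tau> + g (y \<tau>)"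
proof -
  have \<tau>: "0 \<le> \<tau>" using assms(3) by (simp add: hit_def)
  then have "r\<^sub>0 * \<tau> \<le> R u y \<tau>" using R_mono[OF assms(1,2) order_refl \<tau>] by (simp add: R_0)
  moreover have "g z - g (y \<tau>) \<le> G * norm (y \<tau> - z)"
    using g_frontier_lip[OF hit_frontier[OF assms(2-4)] assms(5)] by linarith
  moreover have "norm (y \<tau> - z) \<le> N * \<tau> + norm (x - z)"
    using sol_lip[OF assms(1,2), of \<tau> 0] solD(2)[OF assms(2)] \<tau> norm_triangle_ineq[of "y \<tau> - x" "x - z"] by simp
  then have "G * norm (y \<tau> - z) \<le> G * (N * \<tau> + norm (x - z))" using G(1) by (rule mult_left_mono)
  ultimately show ?thesis by (simp add: algebra_simps)
qed

lemma reach_iff_ctrl: "x \<in> reach \<longleftrightarrow> (\<exists>u y \<tau>. ctrl u \<and> sol x u y \<and> hit y \<tau>)"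
  unfolding reach_iff J_def by blast

lemma V_finite:
  assumes "x \<in> reach" "x \<in> closure (- S)"
  shows "V x = ereal (real_of_ereal (V x))"
proof -
  obtain u y \<tau> where u: "ctrl u" "sol x u y" "hit y \<tau>" using assms(1) reach_iff_ctrl by blast
  have z: "y \<tau> \<in> frontier S" by (rule hit_frontier[OF u(2,3) assms(2)])
  have "V x \<le> ereal (R u y \<tau> + g (y \<tau>))" by (rule V_le[OF u])
  moreover have "ereal (g (y \<tau>) - G * norm (x - y \<tau>)) \<le> V x"
  proof (rule V_greatest)
    fix u' y' \<tau>' assume u': "ctrl u'" "sol x u' y'" "hit y' \<tau>'"
    have "0 \<le> (r\<^sub>0 - G * N) * \<tau>'" using u'(3) G(2) by (intro mult_nonneg_nonneg) (auto simp: hit_def)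
    then show "ereal (g (y \<tau>) - G * norm (x - y \<tau>)) \<le> ereal (R u' y' \<tau>' + g (y' \<tau>'))"
      using cost_lower_bound[OF u' assms(2) z] by simp
  qed
  ultimately have "\<bar>V x\<bar> \<noteq> \<infinity>" by (cases "V x") auto
  then show ?thesis by (simp add: ereal_real)
qed

lemma V_infinite: "x \<notin> reach \<Longrightarrow> V x = \<infinity>"
proof -
  assume "x \<notin> reach"
  then have "{c. J x c} = {}" using reach_iff[of x] by auto
  then show ?thesis by (simp only: V_eq image_empty Inf_empty top_ereal_def)
qed

lemma dpp_le:
  assumes u: "ctrl u" "sol x u y" and t: "0 \<le> t" and out: "\<And>s. 0 \<le> s \<Longrightarrow> s < t \<Longrightarrow> y s \<notin> S"
    and v: "ctrl v" "sol (y t) v z" "hit z \<sigma>"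
  shows "V x \<le> ereal (R u y t + (R v z \<sigma> + g (z \<sigma>)))"
proof -
  obtain w Y where w: "ctrl w" "sol x w Y"
    "\<And>s. s \<in> {0..t} \<Longrightarrow> Y s = y s"
    "\<And>s. 0 \<le> s \<Longrightarrow> Y (s + t) = z s" "\<And>s. 0 \<le> s \<Longrightarrow> R w Y (s + t) = R u y t + R v z s"
    by (rule sol_concat[OF u t v(1,2)]) (rule that)
  have \<sigma>: "0 \<le> \<sigma>" "z \<sigma> \<in> S" "\<And>s. 0 \<le> s \<Longrightarrow> s < \<sigma> \<Longrightarrow> z s \<notin> S" using v(3) by (auto simp: hit_def)
  have "hit Y (\<sigma> + t)"
    unfolding hit_def
  proof (intro conjI allI impI)
    show "0 \<le> \<sigma> + t" using \<sigma>(1) t by simp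
    show "Y (\<sigma> + t) \<in> S" using w(4)[OF \<sigma>(1)] \<sigma>(2) by simp
    fix s assume s: "0 \<le> s \<and> s < \<sigma> + t"
    show "Y s \<notin> S"
    proof (cases "s < t")
      case True
      then show ?thesis using w(3)[of s] out[of s] s by simp
    next
      case False
      then show ?thesis using w(4)[of "s - t"] \<sigma>(3)[of "s - t"] s by simp
    qed
  qed
  from V_le[OF w(1,2) this] show ?thesis using w(4,5)[OF \<sigma>(1)] by (simp add: add.assoc)
qed

lemma dpp_V_le:
  assumes u: "ctrl u" "sol x u y" and t: "0 \<le> t" and out: "\<And>s. 0 \<le> s \<Longrightarrow> s < t \<Longrightarrow> y s \<notin> S"
  shows "V x - ereal (R u y t) \<le> V (y t)"
proof (rule V_greatest)
  fix v z \<sigma> assume v: "ctrl v" "sol (y t) v z" "hit z \<sigma>"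
  have "V x \<le> ereal (R v z \<sigma> + g (z \<sigma>)) + ereal (R u y t)"
    using dpp_le[OF u t out v] by (simp add: add.commute)
  then show "V x - ereal (R u y t) \<le> ereal (R v z \<sigma> + g (z \<sigma>))"
    by (subst ereal_minus_le) auto
qed

lemma optD:
  assumes "opt x u y \<tau>"
  shows "ctrl u" "sol x u y" "hit y \<tau>" "V x = ereal (R u y \<tau> + g (y \<tau>))" "0 \<le> \<tau>" "y \<tau> \<in> S" "x \<in> reach"
    "\<And>t. 0 \<le> t \<Longrightarrow> t < \<tau> \<Longrightarrow> y t \<notin> S"
  using assms reach_iff_ctrl unfolding opt_def hit_def by blast+

text \<open>Bellman's principle: a cheaper continuation from \<open>y t\<close>, prefixed by the
  initial piece, would beat the optimal cost at \<open>x\<close>.\<close>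

lemma opt_shift:
  assumes o: "opt x u y \<tau>" and t: "0 \<le> t" "t \<le> \<tau>"
  obtains y' where "opt (y t) (\<lambda>s. u (s + t)) y' (\<tau> - t)" "\<And>s. 0 \<le> s \<Longrightarrow> y' s = y (s + t)"
    "\<And>s. 0 \<le> s \<Longrightarrow> R (\<lambda>s. u (s + t)) y' s = R u y (s + t) - R u y t"
proof -
  note od = optD[OF o]
  define v where "v = (\<lambda>s. u (s + t))"
  have v: "ctrl v" unfolding v_def by (rule ctrl_shift[OF od(1)])
  obtain z where z: "sol (y t) v z" using sol_exists[OF v] by blast
  have eq: "z s = y (s + t)" "R v z s = R u y (s + t) - R u y t" if "0 \<le> s" for s
    using sol_restart[OF od(1,2) t(1) v z _ that] by (auto simp: v_def)
  have h: "hit z (\<tau> - t)"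
    using t od(6,8) eq(1) by (auto simp: hit_def)
  have "V x - ereal (R u y t) \<le> V (y t)"
    using t od(8) by (intro dpp_V_le[OF od(1,2) t(1)]) auto
  moreover have "V (y t) \<le> ereal (R v z (\<tau> - t) + g (z (\<tau> - t)))" by (rule V_le[OF v z h])
  moreover have "R v z (\<tau> - t) + g (z (\<tau> - t)) = R u y \<tau> + g (y \<tau>) - R u y t" using eq[of "\<tau> - t"] t by simp
  ultimately have "V (y t) = ereal (R v z (\<tau> - t) + g (z (\<tau> - t)))" using od(4) by (simp add: antisym)
  then have "opt (y t) v z (\<tau> - t)" using v z h by (simp add: opt_def)
  then show thesis using eq unfolding v_def by (rule that)
qed

lemma opt_V:
  assumes o: "opt x u y \<tau>" and t: "0 \<le> t" "t \<le> \<tau>"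
  shows "V (y t) = ereal (R u y \<tau> + g (y \<tau>) - R u y t)" "y t \<in> reach"
proof -
  obtain y' where y': "opt (y t) (\<lambda>s. u (s + t)) y' (\<tau> - t)" "\<And>s. 0 \<le> s \<Longrightarrow> y' s = y (s + t)"
    "\<And>s. 0 \<le> s \<Longrightarrow> R (\<lambda>s. u (s + t)) y' s = R u y (s + t) - R u y t"
    by (rule opt_shift[OF o t]) (rule that)
  show "y t \<in> reach" by (rule optD(7)[OF y'(1)])
  show "V (y t) = ereal (R u y \<tau> + g (y \<tau>) - R u y t)"
    using optD(4)[OF y'(1)] y'(2,3)[of "\<tau> - t"] t by simp
qed

end

section \<open>Costates and proximal normals of the hypograph\<close>

text \<open>The transpose of \<open>A\<close> for the inner product, written out in the standard
  basis.\<close>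

definition blinfun_tr :: "('a::euclidean_space \<Rightarrow>\<^sub>L 'a) \<Rightarrow> 'a \<Rightarrow> 'a" where
  "blinfun_tr A p = (\<Sum>b\<in>Basis. (p \<bullet> blinfun_apply A b) *\<^sub>R b)"

lemma blinfun_tr_inner: "blinfun_tr A p \<bullet> h = p \<bullet> blinfun_apply A h"
proof -
  have "p \<bullet> blinfun_apply A h = p \<bullet> blinfun_apply A (\<Sum>b\<in>Basis. (h \<bullet> b) *\<^sub>R b)" by (simp add: euclidean_representation)
  also have "\<dots> = (\<Sum>b\<in>Basis. (h \<bullet> b) * (p \<bullet> blinfun_apply A b))"
    by (simp add: blinfun.sum_right blinfun.scaleR_right inner_sum_right)
  also have "\<dots> = blinfun_tr A p \<bullet> h"
    by (simp add: blinfun_tr_def inner_sum_left mult.commute inner_commute[of h])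
  finally show ?thesis by simp
qed

lemma blinfun_tr_unique: "(\<And>h. c \<bullet> h = p \<bullet> blinfun_apply A h) \<Longrightarrow> blinfun_tr A p = c"
  by (metis blinfun_tr_inner vector_eq_rdot)

lemma blinfun_tr_diff: "blinfun_tr A (p - q) = blinfun_tr A p - blinfun_tr A q"
  by (rule blinfun_tr_unique) (simp add: inner_diff_left blinfun_tr_inner)

lemma blinfun_tr_scaleR: "blinfun_tr A (c *\<^sub>R p) = c *\<^sub>R blinfun_tr A p"
  by (rule blinfun_tr_unique) (simp add: blinfun_tr_inner)

lemma norm_blinfun_tr: "norm (blinfun_tr A p) \<le> norm A * norm p"
proof (cases "blinfun_tr A p = 0")
  case False
  have "norm (blinfun_tr A p) * norm (blinfun_tr A p) = p \<bullet> blinfun_apply A (blinfun_tr A p)"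
    by (simp add: blinfun_tr_inner[symmetric] power2_eq_square[symmetric] power2_norm_eq_inner)
  also have "\<dots> \<le> norm p * norm (blinfun_apply A (blinfun_tr A p))" by (rule norm_cauchy_schwarz)
  also have "\<dots> \<le> norm p * (norm A * norm (blinfun_tr A p))" by (intro mult_left_mono norm_blinfun) simp
  finally show ?thesis using False by (simp add: mult_ac)
qed simp

text \<open>Costates are prescribed at the exit time. Reflecting time turns such terminal value
  problems into initial value problems, both for existence and for Gronwall estimates.\<close>

lemma ae_deriv_reflect:
  assumes "ae_deriv 0 T y w"
  shows "ae_deriv 0 T (\<lambda>t. y (T - t)) (\<lambda>t. - w (T - t))"
proof -
  from assms(1) obtain K E where KE: "K-lipschitz_on {0..T} y" "negligible E"
    "\<And>t. t \<in> {0<..<T} - E \<Longrightarrow> (y has_vector_derivative w t) (at t)" by (rule ae_derivE) blast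
  show ?thesis
  proof (rule ae_derivI)
    show "K-lipschitz_on {0..T} (\<lambda>t. y (T - t))"
    proof (rule lipschitz_onI)
      fix s t assume "s \<in> {0..T}" "t \<in> {0..T}"
      then have "dist (y (T - s)) (y (T - t)) \<le> K * dist (T - s) (T - t)"
        by (intro lipschitz_onD[OF KE(1)]) auto
      then show "dist (y (T - s)) (y (T - t)) \<le> K * dist s t" by (simp add: dist_real_def abs_minus_commute)
    qed (rule lipschitz_on_nonneg[OF KE(1)])
    show "negligible ((\<lambda>t. T - t) ` E)"
    proof (rule negligible_locally_Lipschitz_image[OF order_refl KE(2)])
      fix x assume "x \<in> E"
      show "\<exists>T' B. open T' \<and> x \<in> T' \<and> (\<forall>y\<in>E \<inter> T'. norm (T - y - (T - x)) \<le> B * norm (y - x))"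
        by (intro exI[of _ UNIV] exI[of _ 1]) (auto simp: abs_minus_commute)
    qed
    fix t assume t: "t \<in> {0<..<T} - (\<lambda>t. T - t) ` E"
    have "T - t \<notin> E"
    proof
      assume "T - t \<in> E"
      then have "T - (T - t) \<in> (\<lambda>t. T - t) ` E" by (rule imageI)
      then show False using t by simp
    qed
    then have "(y has_vector_derivative w (T - t)) (at (T - t))" using t by (intro KE(3)) auto
    moreover have "((\<lambda>t. T - t) has_vector_derivative (- 1)) (at t)" by (auto intro!: derivative_eq_intros)
    ultimately show "((\<lambda>t. y (T - t)) has_vector_derivative - w (T - t)) (at t)"
      using vector_diff_chain_at[of "\<lambda>t. T - t" "-1" t y "w (T - t)"] by (simp add: o_def)
  qed
qed

lemma gronwall_ae_deriv_backward:
  fixes y :: "real \<Rightarrow> 'a::euclidean_space"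
  assumes y: "ae_deriv 0 T y w" and L: "0 \<le> L" and c: "0 \<le> c"
    and le: "\<And>t. t \<in> {0<..<T} \<Longrightarrow> norm (w t) \<le> L * norm (y t) + c" and t: "t \<in> {0..T}"
  shows "norm (y t) \<le> (norm (y T) + c * T) * exp (L * T)"
proof -
  have "norm (y (T - (T - t))) \<le> (norm (y (T - 0)) + c * (T - 0)) * exp (L * ((T - t) - 0))"
    by (rule gronwall_ae_deriv[OF ae_deriv_reflect[OF y] L c, of "{}"]) (use le t in auto)
  then have "norm (y t) \<le> (norm (y T) + c * T) * exp (L * (T - t))" by simp
  also have "\<dots> \<le> (norm (y T) + c * T) * exp (L * T)" using t L c by (intro mult_left_mono) (auto simp: mult_left_mono)
  finally show ?thesis .
qed

context exit_time_problem
begin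

abbreviation "Vr x \<equiv> real_of_ereal (V x)"

lemma f_taylor:
  assumes \<omega>: "\<omega> \<in> U"
  shows "norm (f y \<omega> - f x \<omega> - blinfun_apply (Df x \<omega>) (y - x)) \<le> L * (norm (y - x))\<^sup>2"
proof -
  have "norm (f y \<omega> - f x \<omega> - blinfun_apply (Df x \<omega>) (y - x)) \<le> norm (y - x) * (L * norm (y - x))"
  proof (rule differentiable_bound_linearization[where S = "cball x (norm (y - x))" and f' = "\<lambda>z. blinfun_apply (Df z \<omega>)"])
    fix t :: real assume "t \<in> {0..1}"
    then show "x + t *\<^sub>R (y - x) \<in> cball x (norm (y - x))" by (simp add: dist_norm mult_left_le_one_le)
  next
    fix z assume "z \<in> cball x (norm (y - x))"
    show "((\<lambda>z. f z \<omega>) has_derivative blinfun_apply (Df z \<omega>)) (at z within cball x (norm (y - x)))"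
      by (rule has_derivative_at_withinI[OF f_der[OF \<omega>]])
  next
    fix z assume z: "z \<in> cball x (norm (y - x))"
    have "blinfun_apply (Df z \<omega>) - blinfun_apply (Df x \<omega>) = blinfun_apply (Df z \<omega> - Df x \<omega>)"
      by (simp add: fun_eq_iff blinfun.diff_left)
    then have "onorm (blinfun_apply (Df z \<omega>) - blinfun_apply (Df x \<omega>)) = norm (Df z \<omega> - Df x \<omega>)"
      by (simp add: norm_blinfun.rep_eq)
    also have "\<dots> \<le> L * norm (z - x)" by (rule Df_lip[OF \<omega>])
    also have "\<dots> \<le> L * norm (y - x)" using z pos by (intro mult_left_mono) (auto simp: dist_norm norm_minus_commute)
    finally show "onorm (blinfun_apply (Df z \<omega>) - blinfun_apply (Df x \<omega>)) \<le> L * norm (y - x)" .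
  qed simp
  then show ?thesis by (simp add: power2_eq_square mult_ac)
qed

lemma r_taylor:
  assumes \<omega>: "\<omega> \<in> U"
  shows "\<bar>r y \<omega> - r x \<omega> - Dr x \<omega> \<bullet> (y - x)\<bar> \<le> L * (norm (y - x))\<^sup>2"
proof -
  have "norm (r y \<omega> - r x \<omega> - (y - x) \<bullet> Dr x \<omega>) \<le> norm (y - x) * (L * norm (y - x))"
  proof (rule differentiable_bound_linearization[where S = "cball x (norm (y - x))" and f' = "\<lambda>z h. h \<bullet> Dr z \<omega>"])
    fix t :: real assume "t \<in> {0..1}"
    then show "x + t *\<^sub>R (y - x) \<in> cball x (norm (y - x))" by (simp add: dist_norm mult_left_le_one_le)
  next
    fix z assume "z \<in> cball x (norm (y - x))"
    show "((\<lambda>z. r z \<omega>) has_derivative (\<lambda>h. h \<bullet> Dr z \<omega>)) (at z within cball x (norm (y - x)))"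
      using r_der[OF \<omega>, of z] unfolding gderiv_def by (rule has_derivative_at_withinI)
  next
    fix z assume z: "z \<in> cball x (norm (y - x))"
    have "onorm ((\<lambda>i. i \<bullet> Dr z \<omega>) - (\<lambda>i. i \<bullet> Dr x \<omega>)) \<le> norm (Dr z \<omega> - Dr x \<omega>)"
    proof (rule onorm_bound)
      fix i show "norm (((\<lambda>i. i \<bullet> Dr z \<omega>) - (\<lambda>i. i \<bullet> Dr x \<omega>)) i) \<le> norm (Dr z \<omega> - Dr x \<omega>) * norm i"
        using Cauchy_Schwarz_ineq2[of i "Dr z \<omega> - Dr x \<omega>"] by (simp add: inner_diff_right mult.commute)
    qed simp
    also have "\<dots> \<le> L * norm (z - x)" by (rule Dr_lip[OF \<omega>])
    also have "\<dots> \<le> L * norm (y - x)" using z pos by (intro mult_left_mono) (auto simp: dist_norm norm_minus_commute)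
    finally show "onorm ((\<lambda>i. i \<bullet> Dr z \<omega>) - (\<lambda>i. i \<bullet> Dr x \<omega>)) \<le> L * norm (y - x)" .
  qed simp
  then show ?thesis by (simp add: power2_eq_square mult_ac inner_commute)
qed

text \<open>Along a short vector \<open>t *\<^sub>R h\<close> the Lipschitz bound for
  \<open>f\<close> and the quadratic Taylor remainder combine; \<open>t\<close> is chosen so small
  that the remainder, divided by \<open>t\<close>, is at most \<open>e\<close>.\<close>

lemma Df_bound:
  assumes \<omega>: "\<omega> \<in> U"
  shows "norm (Df x \<omega>) \<le> L"
proof (rule norm_blinfun_bound)
  fix h
  show "norm (blinfun_apply (Df x \<omega>) h) \<le> L * norm h"
  proof (rule field_le_epsilon)
    fix e :: real assume e: "0 < e"
    define t where "t = e / (L * (norm h)\<^sup>2 + 1)"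
    have d: "0 < L * (norm h)\<^sup>2 + 1" using pos by (intro add_nonneg_pos) auto
    have t: "0 < t" using e d by (simp add: t_def)
    have "t * (L * (norm h)\<^sup>2 + 1) = e" using d by (simp add: t_def)
    then have te: "t * (L * (norm h)\<^sup>2) \<le> e" using t by (simp add: distrib_left)
    have "norm (blinfun_apply (Df x \<omega>) (t *\<^sub>R h)) \<le> norm (f (x + t *\<^sub>R h) \<omega> - f x \<omega>) + L * (norm (t *\<^sub>R h))\<^sup>2"
      using f_taylor[OF \<omega>, of "x + t *\<^sub>R h" x]
        norm_triangle_sub[of "blinfun_apply (Df x \<omega>) (t *\<^sub>R h)" "f (x + t *\<^sub>R h) \<omega> - f x \<omega>"]
      by (simp add: norm_minus_commute)
    also have "\<dots> \<le> L * norm (t *\<^sub>R h) + L * (norm (t *\<^sub>R h))\<^sup>2"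
      using f_lip[OF \<omega>, of "x + t *\<^sub>R h" x] by simp
    finally have "t * norm (blinfun_apply (Df x \<omega>) h) \<le> t * (L * norm h + t * (L * (norm h)\<^sup>2))"
      using t by (simp add: blinfun.scaleR_right power_mult_distrib algebra_simps power2_eq_square)
    then show "norm (blinfun_apply (Df x \<omega>) h) \<le> L * norm h + e" using t te by simp
  qed
qed (use pos in simp)

lemma Dr_bound:
  assumes \<omega>: "\<omega> \<in> U"
  shows "norm (Dr x \<omega>) \<le> L"
proof (rule field_le_epsilon)
  fix e :: real assume e: "0 < e"
  \<comment> \<open>The gradient itself is the test direction, which recovers its norm.\<close>
  define D where "D = Dr x \<omega>"
  define t where "t = e / (L * norm D + 1)"
  have d: "0 < L * norm D + 1" using pos by (intro add_nonneg_pos) auto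
  have t: "0 < t" using e d by (simp add: t_def)
  have "t * (L * norm D + 1) = e" using d by (simp add: t_def)
  then have te: "t * (L * norm D) \<le> e" using t by (simp add: distrib_left)
  have "D \<bullet> (t *\<^sub>R D) \<le> \<bar>r (x + t *\<^sub>R D) \<omega> - r x \<omega>\<bar> + L * (norm (t *\<^sub>R D))\<^sup>2"
    using r_taylor[OF \<omega>, of "x + t *\<^sub>R D" x] by (simp add: D_def)
  also have "\<dots> \<le> L * norm (t *\<^sub>R D) + L * (norm (t *\<^sub>R D))\<^sup>2"
    using r_lip[OF \<omega>, of "x + t *\<^sub>R D" x] by simp
  finally have "t * (norm D * norm D) \<le> t * (norm D * (L + t * (L * norm D)))"
    using t by (simp add: dot_square_norm power_mult_distrib algebra_simps power2_eq_square)
  then have "norm D * norm D \<le> norm D * (L + t * (L * norm D))" using t by simp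
  then have "norm D \<le> L + t * (L * norm D) \<or> norm D = 0" by auto
  then show "norm (Dr x \<omega>) \<le> L + e" using te pos e unfolding D_def[symmetric] by auto
qed

section \<open>Adjoint arcs and their terminal data\<close>

text \<open>The adjoint equation of Pontryagin's principle with cost multiplier \<mu>, along a fixed
  control; it is affine in \<open>p\<close>, and linear when \<mu> = 0.\<close>

definition adj :: "(real \<Rightarrow> 'b) \<Rightarrow> (real \<Rightarrow> 'a) \<Rightarrow> real \<Rightarrow> (real \<Rightarrow> 'a) \<Rightarrow> real \<Rightarrow> bool" where
  "adj u y \<mu> p T \<longleftrightarrow> ae_deriv 0 T p (\<lambda>t. - (blinfun_tr (Df (y t) (u t)) (p t) + \<mu> *\<^sub>R Dr (y t) (u t)))"

lemma adj_rhs_bound: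
  assumes "\<omega> \<in> U" "0 \<le> \<mu>" "\<mu> \<le> 1"
  shows "norm (blinfun_tr (Df x \<omega>) p + \<mu> *\<^sub>R Dr x \<omega>) \<le> L * norm p + L * \<mu>"
proof -
  have "norm (blinfun_tr (Df x \<omega>) p) \<le> L * norm p"
    using norm_blinfun_tr[of "Df x \<omega>" p] mult_right_mono[OF Df_bound[OF assms(1)] norm_ge_zero[of p]] by (rule order_trans)
  moreover have "norm (\<mu> *\<^sub>R Dr x \<omega>) \<le> L * \<mu>"
    using mult_right_mono[OF Dr_bound[OF assms(1)] assms(2)] assms(2) by (simp add: mult.commute)
  ultimately show ?thesis by (rule norm_triangle_mono)
qed

lemma adj_rhs_measurable:
  assumes y: "continuous_on UNIV y" and u: "ctrl u" and q: "q \<in> borel_measurable lebesgue"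
  shows "(\<lambda>s. blinfun_tr (Df (y s) (u s)) (q s) + \<mu> *\<^sub>R Dr (y s) (u s)) \<in> borel_measurable lebesgue"
proof -
  have Dfb: "(\<lambda>s. blinfun_apply (Df (y s) (u s)) b) \<in> borel_measurable lebesgue" for b
  proof (rule path_measurable[OF _ y u, of "\<lambda>x \<omega>. blinfun_apply (Df x \<omega>) b"])
    have "continuous_on (UNIV \<times> U) (\<lambda>q. blinfun_apply ((\<lambda>(x, \<omega>). Df x \<omega>) q) b)"
      by (intro continuous_intros Df_cont)
    then show "continuous_on (UNIV \<times> U) (\<lambda>(x, \<omega>). blinfun_apply (Df x \<omega>) b)" by (simp add: case_prod_unfold)
  qed
  have Drm: "(\<lambda>s. Dr (y s) (u s)) \<in> borel_measurable lebesgue" by (rule path_measurable[OF Dr_cont y u])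
  show ?thesis unfolding blinfun_tr_def
    by (intro borel_measurable_add borel_measurable_sum borel_measurable_scaleR borel_measurable_inner q Dfb Drm borel_measurable_const)
qed

lemma adj_exists:
  assumes u: "ctrl u" "sol x u y" and T: "0 \<le> T"
  obtains p where "adj u y \<mu> p T" "p T = P"
proof -
  define v where "v t = u (T - t)" for t
  define z where "z t = y (T - t)" for t
  define F where "F t q = blinfun_tr (Df (z t) (v t)) q + \<mu> *\<^sub>R Dr (z t) (v t)" for t q
  have "(\<lambda>t. T + (- 1) *\<^sub>R t) \<in> lebesgue \<rightarrow>\<^sub>M lebesgue"
    using lebesgue_affine_measurable[of "\<lambda>_. - 1" T] by simp
  from measurable_compose[OF this ctrlD(2)[OF u(1)]] have "v \<in> borel_measurable lebesgue" by (simp add: v_def[abs_def])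
  then have v: "ctrl v" using ctrlD(1)[OF u(1)] by (simp add: ctrl_def v_def)
  have z: "continuous_on UNIV z" unfolding z_def
    by (rule continuous_on_compose2[OF solD(1)[OF u(2), of UNIV]]) (auto intro!: continuous_intros)
  have vU: "v t \<in> U" for t using ctrlD(1)[OF v] .
  have "\<exists>q. continuous_on UNIV q \<and> (\<forall>t\<le>0. q t = P) \<and> (\<forall>T. ae_deriv 0 T q (\<lambda>t. F t (q t)))"
  proof (rule caratheodory_ode_exists[of F L P "L * norm P + L * \<bar>\<mu>\<bar>"])
    fix q :: "real \<Rightarrow> 'a" assume "continuous_on UNIV q"
    then have qm: "q \<in> borel_measurable lebesgue"
      using borel_measurable_continuous_onI[of q] by (intro measurable_completion) simp
    show "(\<lambda>s. F s (q s)) \<in> borel_measurable lebesgue"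
      unfolding F_def by (rule adj_rhs_measurable[OF z v qm])
  next
    fix s q q'
    have "norm (F s q - F s q') = norm (blinfun_tr (Df (z s) (v s)) (q - q'))" by (simp add: F_def blinfun_tr_diff)
    also have "\<dots> \<le> L * norm (q - q')"
      using norm_blinfun_tr[of "Df (z s) (v s)" "q - q'"] mult_right_mono[OF Df_bound[OF vU] norm_ge_zero[of "q - q'"]]
      by (rule order_trans)
    finally show "norm (F s q - F s q') \<le> L * norm (q - q')" .
  next
    fix s
    have "norm (blinfun_tr (Df (z s) (v s)) P) \<le> L * norm P"
      using norm_blinfun_tr[of "Df (z s) (v s)" P] mult_right_mono[OF Df_bound[OF vU] norm_ge_zero[of P]] by (rule order_trans)
    moreover have "norm (\<mu> *\<^sub>R Dr (z s) (v s)) \<le> L * \<bar>\<mu>\<bar>"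
      using mult_right_mono[OF Dr_bound[OF vU] abs_ge_zero[of \<mu>]] by (simp add: mult.commute)
    ultimately show "norm (F s P) \<le> L * norm P + L * \<bar>\<mu>\<bar>" unfolding F_def by (rule norm_triangle_mono)
  qed (use pos in blast)+
  then obtain q where q: "q 0 = P" "ae_deriv 0 T q (\<lambda>t. F t (q t))" by auto
  show thesis
  proof (rule that[of "\<lambda>t. q (T - t)"])
    show "adj u y \<mu> (\<lambda>t. q (T - t)) T"
      unfolding adj_def by (rule ae_deriv_cong[OF ae_deriv_reflect[OF q(2)]]) (auto simp: F_def z_def v_def)
  qed (use q(1) in simp)
qed

text \<open>The terminal data of a dual arc: an inner normal \<open>\<xi>\<close> of the target, a supergradient \<open>q\<close> of the
  terminal cost, and the multiplier \<open>\<mu>\<close> for which the Hamiltonian vanishes at \<open>\<mu> q - (1 - \<mu>) \<xi>\<close>;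
  the abnormal case is \<open>\<mu> = 0\<close>. Scaling by \<open>1 - \<mu>\<close> instead of normalising \<open>\<mu> = 1\<close> keeps all constants uniform.\<close>

definition inner_normal :: "'a \<Rightarrow> 'a \<Rightarrow> bool" where
  "inner_normal z \<xi> \<longleftrightarrow> norm \<xi> = 1 \<and> (\<forall>e\<in>closure (- S). \<xi> \<bullet> (e - z) \<le> 1 / (2 * \<rho>\<^sub>0) * (norm (e - z))\<^sup>2)"

definition supergrad :: "real \<Rightarrow> 'a \<Rightarrow> 'a \<Rightarrow> bool" where
  "supergrad c z q \<longleftrightarrow> norm q \<le> G \<and> (\<forall>e\<in>frontier S. g e \<le> g z + q \<bullet> (e - z) + c * (norm (e - z))\<^sup>2)"

definition covec :: "real \<Rightarrow> 'a \<Rightarrow> 'a \<Rightarrow> 'a" where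
  "covec \<mu> q \<xi> = \<mu> *\<^sub>R q - (1 - \<mu>) *\<^sub>R \<xi>"

definition ham_le :: "'a \<Rightarrow> 'a \<Rightarrow> real \<Rightarrow> bool" where
  "ham_le x p \<mu> \<longleftrightarrow> (\<forall>\<omega>\<in>U. - (p \<bullet> f x \<omega>) - \<mu> * r x \<omega> \<le> 0)"

definition transversal :: "real \<Rightarrow> 'a \<Rightarrow> 'a \<Rightarrow> 'a \<Rightarrow> real \<Rightarrow> bool" where
  "transversal c z \<xi> q \<mu> \<longleftrightarrow> inner_normal z \<xi> \<and> supergrad c z q \<and> 0 \<le> \<mu> \<and> \<mu> \<le> 1 \<and>
     ham_le z (covec \<mu> q \<xi>) \<mu> \<and> (\<exists>\<omega>\<in>U. - (covec \<mu> q \<xi> \<bullet> f z \<omega>) - \<mu> * r z \<omega> = 0)"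

text \<open>Comparing with points below the graph instead of with \<open>V x'\<close> covers
  \<open>V x' = \<infinity>\<close> as well. The inequality is global in \<open>x'\<close> and
  \<beta>, so with a common constant it passes to limits with no neighborhood that could
  shrink.\<close>

definition prox_normal :: "real \<Rightarrow> 'a \<Rightarrow> 'a \<Rightarrow> real \<Rightarrow> bool" where
  "prox_normal C x p \<mu> \<longleftrightarrow> (\<forall>x' \<beta>. x' \<in> closure (- S) \<longrightarrow> ereal \<beta> \<le> V x' \<longrightarrow>
     - (p \<bullet> (x' - x)) + \<mu> * (\<beta> - Vr x) \<le> C * (norm (x' - x) + \<bar>\<beta> - Vr x\<bar>)\<^sup>2)"

lemma norm_covec:
  assumes "transversal c z \<xi> q \<mu>"
  shows "norm (covec \<mu> q \<xi>) \<le> G + 1"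
proof -
  have *: "norm q \<le> G" "norm \<xi> = 1" "0 \<le> \<mu>" "\<mu> \<le> 1"
    using assms by (auto simp: transversal_def supergrad_def inner_normal_def)
  have "norm (covec \<mu> q \<xi>) \<le> \<mu> * norm q + (1 - \<mu>) * norm \<xi>"
    unfolding covec_def using * norm_triangle_ineq4[of "\<mu> *\<^sub>R q" "(1 - \<mu>) *\<^sub>R \<xi>"] by simp
  also have "\<dots> \<le> 1 * G + 1 * 1" using * G by (intro add_mono mult_mono) auto
  finally show ?thesis by simp
qed

lemma adj_bound:
  assumes "adj u y \<mu> p T" "ctrl u" "0 \<le> \<mu>" "\<mu> \<le> 1" "t \<in> {0..T}"
  shows "norm (p t) \<le> (norm (p T) + L * \<mu> * T) * exp (L * T)"
proof (rule gronwall_ae_deriv_backward[OF assms(1)[unfolded adj_def] _ _ _ assms(5)])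
  show "norm (- (blinfun_tr (Df (y t) (u t)) (p t) + \<mu> *\<^sub>R Dr (y t) (u t))) \<le> L * norm (p t) + L * \<mu>" for t
    unfolding norm_minus_cancel by (rule adj_rhs_bound[OF ctrlD(1)[OF assms(2)] assms(3,4)])
qed (use pos assms(3) in simp_all)

text \<open>The constant is the bound \<open>G + 1\<close> for the covector plus 1 for the
  multiplier.\<close>

lemma ham_lip:
  assumes "\<omega> \<in> U" "0 \<le> \<mu>" "\<mu> \<le> 1" "norm P \<le> G + 1"
  shows "\<bar>(P \<bullet> f e \<omega> + \<mu> * r e \<omega>) - (P \<bullet> f z \<omega> + \<mu> * r z \<omega>)\<bar> \<le> (G + 2) * L * norm (e - z)"
proof -
  have "\<bar>P \<bullet> (f e \<omega> - f z \<omega>)\<bar> \<le> norm P * norm (f e \<omega> - f z \<omega>)" by (rule Cauchy_Schwarz_ineq2)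
  also have "\<dots> \<le> (G + 1) * (L * norm (e - z))" using assms(4) f_lip[OF assms(1)] G by (intro mult_mono) auto
  finally have 1: "\<bar>P \<bullet> (f e \<omega> - f z \<omega>)\<bar> \<le> (G + 1) * (L * norm (e - z))" .
  have "\<bar>\<mu> * (r e \<omega> - r z \<omega>)\<bar> \<le> 1 * (L * norm (e - z))"
    unfolding abs_mult using assms(2,3) r_lip[OF assms(1)] by (intro mult_mono) auto
  then show ?thesis using 1 by (simp add: inner_diff_right algebra_simps)
qed

text \<open>The perturbed trajectory follows the optimal control up to the optimal exit time and then a
  control maximising the Hamiltonian at the exit point, for a time of the order of the perturbation.\<close>

lemma prox_normal_optimal:
  assumes T0: "0 \<le> T" and c0: "0 \<le> c"
  obtains C where "0 \<le> C"
    "\<And>x u y \<tau> \<xi> q \<mu> p. opt x u y \<tau> \<Longrightarrow> \<tau> \<le> T \<Longrightarrow> x \<in> closure (- S) \<Longrightarrow>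
       transversal c (y \<tau>) \<xi> q \<mu> \<Longrightarrow> adj u y \<mu> p \<tau> \<Longrightarrow> p \<tau> = covec \<mu> q \<xi> \<Longrightarrow> prox_normal C x (p 0) \<mu>"
proof -
  define a0 where "a0 = r\<^sub>0 - G * N"
  have a0: "0 < a0" using G by (simp add: a0_def)
  define M1 where "M1 = exp (L * T)"
  have M1: "1 \<le> M1" using pos T0 by (simp add: M1_def)
  define B where "B = (G + 1 + L * T) * exp (L * T)"
  have B: "0 \<le> B" using pos T0 G by (simp add: B_def)
  \<comment> \<open>Chosen so that \<open>a0 * \<kappa>0 * E\<close> dominates the change of height
    plus the changes of running and terminal cost caused by the shift of the initial point. It
    bounds how much earlier a perturbed path can exit, and how long it has to be followed after
    \<tau>.\<close>
  define \<kappa>0 where "\<kappa>0 = (1 + L * T * M1 + G * M1) / a0"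
  have \<kappa>0: "0 \<le> \<kappa>0" "a0 * \<kappa>0 = 1 + L * T * M1 + G * M1" using a0 pos T0 G M1 by (auto simp: \<kappa>0_def)
  \<comment> \<open>All points used near the exit lie within \<open>D * E\<close> of
    \<open>z\<close>: \<open>M1\<close> accounts for the divergence of the two paths,
    \<open>N * \<kappa>0\<close> for the time difference.\<close>
  define D where "D = M1 + N * \<kappa>0"
  have D: "0 \<le> D" "M1 \<le> D" using M1 \<kappa>0 pos by (auto simp: D_def)
  define K1 where "K1 = (B + 1) * L * M1\<^sup>2 * T"
  define K3 where "K3 = (L * B + L) * \<kappa>0"
  define K4 where "K4 = (G + 2) * L * D * \<kappa>0"
  define K5 where "K5 = D\<^sup>2 / (2 * \<rho>\<^sub>0) + c * D\<^sup>2"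
  define K6 where "K6 = (G + 2) * L * N * \<kappa>0\<^sup>2"
  have Kn: "0 \<le> K1" "0 \<le> K3" "0 \<le> K4" "0 \<le> K5" "0 \<le> K6"
    using pos T0 G B D \<kappa>0 c0 by (auto simp: K1_def K3_def K4_def K5_def K6_def)
  define C where "C = K1 + K3 * M1 + K4 + K5 + K6"
  have C: "0 \<le> C" using Kn M1 by (simp add: C_def)
  have "- (p 0 \<bullet> (x' - x)) + \<mu> * (\<beta> - Vr x) \<le> C * (norm (x' - x) + \<bar>\<beta> - Vr x\<bar>)\<^sup>2"
    if o: "opt x u y \<tau>" and \<tau>T: "\<tau> \<le> T" and xS: "x \<in> closure (- S)" and tv: "transversal c (y \<tau>) \<xi> q \<mu>"
      and ad: "adj u y \<mu> p \<tau>" and pT: "p \<tau> = covec \<mu> q \<xi>"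
      and x'S: "x' \<in> closure (- S)" and \<beta>: "ereal \<beta> \<le> V x'"
    for x u y \<tau> \<xi> q \<mu> p x' \<beta>
  proof -
    note od = optD[OF o]
    define z where "z = y \<tau>"
    define P where "P = covec \<mu> q \<xi>"
    define h where "h = x' - x"
    define v0 where "v0 = R u y \<tau> + g z"
    have v0: "Vr x = v0" using od(4) by (simp add: v0_def z_def)
    define \<delta> where "\<delta> = \<beta> - v0"
    define E where "E = norm h + \<bar>\<delta>\<bar>"
    have E: "0 \<le> E" "norm h \<le> E" "\<bar>\<delta>\<bar> \<le> E" by (auto simp: E_def)
    have \<tau>: "0 \<le> \<tau>" by (rule od(5))
    have zf: "z \<in> frontier S" unfolding z_def by (rule hit_frontier[OF od(2,3) xS])
    have tr: "norm \<xi> = 1" "\<And>e. e \<in> closure (- S) \<Longrightarrow> \<xi> \<bullet> (e - z) \<le> 1 / (2 * \<rho>\<^sub>0) * (norm (e - z))\<^sup>2"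
      "norm q \<le> G" "\<And>e. e \<in> frontier S \<Longrightarrow> g e \<le> g z + q \<bullet> (e - z) + c * (norm (e - z))\<^sup>2"
      "0 \<le> \<mu>" "\<mu> \<le> 1" "\<And>\<omega>. \<omega> \<in> U \<Longrightarrow> - (P \<bullet> f z \<omega>) - \<mu> * r z \<omega> \<le> 0"
      using tv unfolding transversal_def inner_normal_def supergrad_def ham_le_def P_def z_def by blast+
    obtain \<omega>1 where \<omega>1: "\<omega>1 \<in> U" "- (P \<bullet> f z \<omega>1) - \<mu> * r z \<omega>1 = 0"
      using tv unfolding transversal_def P_def z_def by blast
    have nP: "norm P \<le> G + 1" unfolding P_def by (rule norm_covec[OF tv])
    have pb: "norm (p t) \<le> B" if "t \<in> {0..\<tau>}" for t
    proof -
      have "norm (p t) \<le> (norm (p \<tau>) + L * \<mu> * \<tau>) * exp (L * \<tau>)"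
        by (rule adj_bound[OF ad od(1) tr(5,6) that])
      also have "\<dots> \<le> (G + 1 + L * 1 * T) * exp (L * T)"
        using nP \<tau>T \<tau> tr(5,6) pos G T0 unfolding pT P_def[symmetric] by (intro mult_mono add_mono) auto
      finally show ?thesis by (simp add: B_def)
    qed
    define u' where "u' = (\<lambda>t. if t < \<tau> then u t else (\<lambda>t. \<omega>1) (t - \<tau>))"
    have u': "ctrl u'" unfolding u'_def by (rule ctrl_concat[OF od(1) ctrl_const[OF \<omega>1(1)]])
    obtain y' where y': "sol x' u' y'" using sol_exists[OF u'] by blast
    have y'd: "ae_deriv 0 \<tau> y' (\<lambda>t. f (y' t) (u t))"
      by (rule ae_deriv_cong[OF solD(4)[OF y']]) (auto simp: u'_def)
    have R'd: "ae_deriv 0 \<tau> (R u' y') (\<lambda>t. r (y' t) (u t))"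
      by (rule ae_deriv_cong[OF r_path(1)[OF u' y']]) (auto simp: u'_def)
    define d where "d t = y' t - y t" for t
    have dd: "ae_deriv 0 \<tau> d (\<lambda>t. f (y' t) (u t) - f (y t) (u t))"
      unfolding d_def by (rule ae_deriv_diff[OF y'd solD(4)[OF od(2)]])
    have d0: "d 0 = h" using solD(2)[OF y'] solD(2)[OF od(2)] by (simp add: d_def h_def)
    have db: "norm (d t) \<le> M1 * norm h" if "t \<in> {0..\<tau>}" for t
    proof -
      have "norm (d t) \<le> (norm (d 0) + 0 * (\<tau> - 0)) * exp (L * (t - 0))"
        by (rule gronwall_ae_deriv[OF dd, of L 0 "{}"])
          (use pos that f_lip[OF ctrlD(1)[OF od(1)]] in \<open>auto simp: d_def\<close>)
      also have "\<dots> \<le> norm h * exp (L * T)" using that \<tau>T pos d0 by (auto intro!: mult_left_mono)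
      finally show ?thesis by (simp add: M1_def mult.commute)
    qed
    have dbE: "norm (d t) \<le> M1 * E" if "t \<in> {0..\<tau>}" for t
      using db[OF that] mult_left_mono[OF E(2), of M1] M1 by linarith
    have Rd: "\<bar>R u' y' t - R u y t\<bar> \<le> L * T * M1 * norm h" if "t \<in> {0..\<tau>}" for t
    proof -
      have "norm ((R u' y' t - R u y t) - (R u' y' 0 - R u y 0)) \<le> (L * (M1 * norm h)) * (t - 0)"
      proof (rule ae_deriv_norm_le[of 0 t "\<lambda>t. R u' y' t - R u y t" "\<lambda>t. r (y' t) (u t) - r (y t) (u t)" "{}"])
        show "ae_deriv 0 t (\<lambda>t. R u' y' t - R u y t) (\<lambda>t. r (y' t) (u t) - r (y t) (u t))"
          using that by (intro ae_deriv_diff ae_deriv_subset[OF R'd] r_path(1)[OF od(1,2)]) auto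
        fix s assume "s \<in> {0<..<t} - {}"
        then have "norm (d s) \<le> M1 * norm h" using that by (intro db) auto
        then have "L * norm (y' s - y s) \<le> L * (M1 * norm h)" using pos unfolding d_def by (intro mult_left_mono) auto
        then show "norm (r (y' s) (u s) - r (y s) (u s)) \<le> L * (M1 * norm h)"
          using r_lip[OF ctrlD(1)[OF od(1), of s], of "y' s" "y s"] by (simp only: real_norm_def)
      qed (use that in auto)
      also have "\<dots> \<le> (L * (M1 * norm h)) * T" using that \<tau>T pos M1 by (intro mult_left_mono) auto
      finally show ?thesis by (simp add: R_0 mult_ac)
    qed
    \<comment> \<open>The adjoint equation is made for this: in the derivative of
      \<open>p \<bullet> d + \<mu> * (difference of running costs)\<close> the first order terms
      cancel, leaving Taylor remainders that are quadratic in \<open>d\<close>.\<close>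
    have A1: "- (p 0 \<bullet> h) \<le> - (p t \<bullet> d t) - \<mu> * (R u' y' t - R u y t) + K1 * E\<^sup>2" if t: "t \<in> {0..\<tau>}" for t
    proof -
      define m where "m t = p t \<bullet> d t + \<mu> *\<^sub>R (R u' y' t - R u y t)" for t
      define m' where "m' t = (p t \<bullet> (f (y' t) (u t) - f (y t) (u t)) +
          (- (blinfun_tr (Df (y t) (u t)) (p t) + \<mu> *\<^sub>R Dr (y t) (u t))) \<bullet> d t) +
          \<mu> *\<^sub>R (r (y' t) (u t) - r (y t) (u t))" for t
      have md: "ae_deriv 0 t m m'" unfolding m_def m'_def
        using t ad dd by (intro ae_deriv_add ae_deriv_inner ae_deriv_cmult ae_deriv_diff r_path(1)[OF od(1,2)])
          (auto simp: adj_def intro: ae_deriv_subset R'd)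
      have "norm (m t - m 0) \<le> ((B + 1) * L * M1\<^sup>2 * E\<^sup>2) * (t - 0)"
      proof (rule ae_deriv_norm_le[OF _ md, of "{}"])
        fix s assume s: "s \<in> {0<..<t} - {}"
        then have s': "s \<in> {0..\<tau>}" using t by auto
        have us: "u s \<in> U" by (rule ctrlD(1)[OF od(1)])
        define F where "F = f (y' s) (u s) - f (y s) (u s) - blinfun_apply (Df (y s) (u s)) (d s)"
        define \<rho> where "\<rho> = r (y' s) (u s) - r (y s) (u s) - Dr (y s) (u s) \<bullet> d s"
        have "m' s = p s \<bullet> F + \<mu> * \<rho>"
          by (simp add: m'_def F_def \<rho>_def inner_diff_right inner_diff_left inner_add_left blinfun_tr_inner algebra_simps)
        also have "\<bar>p s \<bullet> F + \<mu> * \<rho>\<bar> \<le> norm (p s) * norm F + \<bar>\<mu>\<bar> * \<bar>\<rho>\<bar>"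
          using Cauchy_Schwarz_ineq2[of "p s" F] abs_triangle_ineq[of "p s \<bullet> F" "\<mu> * \<rho>"] by (simp add: abs_mult)
        also have "\<dots> \<le> B * (L * (norm (d s))\<^sup>2) + 1 * (L * (norm (d s))\<^sup>2)"
          using pb[OF s'] f_taylor[OF us, of "y' s" "y s"] r_taylor[OF us, of "y' s" "y s"] tr(5,6) B
          unfolding d_def[symmetric] F_def[symmetric] \<rho>_def[symmetric]
          by (intro add_mono mult_mono) auto
        also have "\<dots> = (B + 1) * L * (norm (d s))\<^sup>2" by (simp add: algebra_simps)
        also have "\<dots> \<le> (B + 1) * L * (M1 * E)\<^sup>2"
          using dbE[OF s'] B pos by (intro mult_left_mono power_mono) auto
        finally show "norm (m' s) \<le> (B + 1) * L * M1\<^sup>2 * E\<^sup>2" by (simp add: power_mult_distrib mult_ac)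
      qed (use t in auto)
      also have "\<dots> \<le> ((B + 1) * L * M1\<^sup>2 * E\<^sup>2) * T"
        using t \<tau>T B pos by (intro mult_left_mono) auto
      also have "\<dots> = K1 * E\<^sup>2" by (simp add: K1_def mult_ac)
      finally have "m t - m 0 \<le> K1 * E\<^sup>2" by simp
      moreover have "\<bar>m t - m 0\<bar> \<le> K1 * E\<^sup>2"
        using \<open>norm (m t - m 0) \<le> _ * (t - 0)\<close> \<open>((B + 1) * L * M1\<^sup>2 * E\<^sup>2) * (t - 0) \<le> _\<close>
          \<open>((B + 1) * L * M1\<^sup>2 * E\<^sup>2) * T = K1 * E\<^sup>2\<close> by simp
      moreover have "m 0 = p 0 \<bullet> h" by (simp add: m_def R_0 d0)
      ultimately show ?thesis by (simp add: m_def)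
    qed
    have ball: "(1 - \<mu>) * (\<xi> \<bullet> (e - z)) \<le> D\<^sup>2 / (2 * \<rho>\<^sub>0) * E\<^sup>2" if "e \<in> closure (- S)" "norm (e - z) \<le> D * E" for e
    proof -
      have "\<xi> \<bullet> (e - z) \<le> 1 / (2 * \<rho>\<^sub>0) * (norm (e - z))\<^sup>2" by (rule tr(2)[OF that(1)])
      also have "\<dots> \<le> 1 / (2 * \<rho>\<^sub>0) * (D * E)\<^sup>2" using that(2) pos by (intro mult_left_mono power_mono) auto
      finally have *: "\<xi> \<bullet> (e - z) \<le> D\<^sup>2 / (2 * \<rho>\<^sub>0) * E\<^sup>2" by (simp add: power_mult_distrib)
      have "(1 - \<mu>) * (\<xi> \<bullet> (e - z)) \<le> (1 - \<mu>) * (D\<^sup>2 / (2 * \<rho>\<^sub>0) * E\<^sup>2)" using * tr(6) by (intro mult_left_mono) auto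
      also have "\<dots> \<le> 1 * (D\<^sup>2 / (2 * \<rho>\<^sub>0) * E\<^sup>2)" using tr(5) pos by (intro mult_right_mono) auto
      finally show ?thesis by simp
    qed
    have gub: "\<mu> * (g e - g z - q \<bullet> (e - z)) \<le> c * D\<^sup>2 * E\<^sup>2" if "e \<in> frontier S" "norm (e - z) \<le> D * E" for e
    proof -
      have "g e - g z - q \<bullet> (e - z) \<le> c * (norm (e - z))\<^sup>2" using tr(4)[OF that(1)] by simp
      also have "\<dots> \<le> c * (D * E)\<^sup>2" using that(2) c0 by (intro mult_left_mono power_mono) auto
      finally have *: "g e - g z - q \<bullet> (e - z) \<le> c * D\<^sup>2 * E\<^sup>2" by (simp add: power_mult_distrib mult_ac)
      have "\<mu> * (g e - g z - q \<bullet> (e - z)) \<le> \<mu> * (c * D\<^sup>2 * E\<^sup>2)" using * tr(5) by (intro mult_left_mono) auto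
      also have "\<dots> \<le> 1 * (c * D\<^sup>2 * E\<^sup>2)" using tr(6) c0 by (intro mult_right_mono) auto
      finally show ?thesis by simp
    qed
    \<comment> \<open>The supergradient part will be matched with the terminal cost, the normal part
      with the inner ball condition.\<close>
    have Pdec: "- (P \<bullet> w) = - \<mu> * (q \<bullet> w) + (1 - \<mu>) * (\<xi> \<bullet> w)" for w
      by (simp add: P_def covec_def inner_diff_left algebra_simps)
    have hitcost: "\<delta> \<le> R u' y' t1 + g (y' t1) - v0" if "hit y' t1" for t1
      using order_trans[OF \<beta> V_le[OF u' y' that]] by (simp add: \<delta>_def)
    have CE: "C * E\<^sup>2 = K1 * E\<^sup>2 + K3 * M1 * E\<^sup>2 + K4 * E\<^sup>2 + D\<^sup>2 / (2 * \<rho>\<^sub>0) * E\<^sup>2 + c * D\<^sup>2 * E\<^sup>2 + K6 * E\<^sup>2"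
      by (simp add: C_def K5_def algebra_simps)
    have Enn: "0 \<le> K3 * M1 * E\<^sup>2" "0 \<le> K4 * E\<^sup>2" "0 \<le> K6 * E\<^sup>2" "0 \<le> c * D\<^sup>2 * E\<^sup>2"
      using Kn M1 c0 by auto
    have \<tau>m: "\<tau> \<in> {0..\<tau>}" using \<tau> by simp
    have "- (p 0 \<bullet> h) + \<mu> * \<delta> \<le> C * E\<^sup>2"
    proof (cases "\<exists>t1\<le>\<tau>. hit y' t1")
      case True
      then obtain t1 where t1: "t1 \<le> \<tau>" "hit y' t1" by blast
      have t1m: "t1 \<in> {0..\<tau>}" using t1 by (auto simp: hit_def)
      define e where "e = y' t1"
      have ef: "e \<in> frontier S" unfolding e_def by (rule hit_frontier[OF y' t1(2) x'S])
      then have ec: "e \<in> closure (- S)" by (simp add: frontier_closures)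
      define \<eta> where "\<eta> = \<tau> - t1"
      have \<eta>0: "0 \<le> \<eta>" using t1 by (simp add: \<eta>_def)
      have split: "e - z = d t1 + (y t1 - y \<tau>)" by (simp add: e_def d_def z_def)
      have yb: "norm (y t1 - y \<tau>) \<le> N * \<eta>" using sol_lip[OF od(1,2), of t1 \<tau>] t1 by (simp add: \<eta>_def)
      have ezb: "norm (e - z) \<le> M1 * norm h + N * \<eta>"
        unfolding split using norm_triangle_ineq[of "d t1" "y t1 - y \<tau>"] db[OF t1m] yb by linarith
      have RR: "r\<^sub>0 * \<eta> \<le> R u y \<tau> - R u y t1"
        using R_mono[OF od(1,2), of t1 \<tau>] t1m by (simp add: \<eta>_def)
      have "g e - g z \<le> G * norm (e - z)" using g_frontier_lip[OF ef zf] by linarith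
      also have "\<dots> \<le> G * (M1 * norm h + N * \<eta>)" using ezb G by (intro mult_left_mono) auto
      \<comment> \<open>An exit long before \<tau> would save more than the perturbation can account
        for and so cost less than \<beta>, a lower bound for the cost of every admissible path from
        \<open>x'\<close>.\<close>
      finally have "a0 * \<eta> \<le> \<bar>\<delta>\<bar> + L * T * M1 * norm h + G * M1 * norm h"
        using hitcost[OF t1(2)] Rd[OF t1m] RR unfolding e_def[symmetric] v0_def a0_def by (simp add: algebra_simps)
      also have "\<dots> \<le> E + L * T * M1 * E + G * M1 * E"
        using E pos T0 M1 G by (intro add_mono mult_left_mono) auto
      also have "\<dots> = a0 * (\<kappa>0 * E)" unfolding mult.assoc[symmetric] \<kappa>0(2) by (simp add: algebra_simps)
      finally have \<eta>: "\<eta> \<le> \<kappa>0 * E" using a0 by simp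
      have ezD: "norm (e - z) \<le> D * E"
      proof -
        have "M1 * norm h + N * \<eta> \<le> M1 * E + N * (\<kappa>0 * E)" using E \<eta> M1 pos by (intro add_mono mult_left_mono) auto
        then show ?thesis using ezb by (simp add: D_def algebra_simps)
      qed
      have pP: "norm (p t1 - P) \<le> K3 * E"
      proof -
        have "norm (p \<tau> - p t1) \<le> (L * B + L) * (\<tau> - t1)"
        proof (rule ae_deriv_norm_le[OF t1(1) ae_deriv_subset[OF ad[unfolded adj_def]], of "{}"])
          fix s assume s: "s \<in> {t1<..<\<tau>} - {}"
          then have "s \<in> {0..\<tau>}" using t1m by auto
          have "norm (blinfun_tr (Df (y s) (u s)) (p s) + \<mu> *\<^sub>R Dr (y s) (u s)) \<le> L * norm (p s) + L * \<mu>"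
            by (rule adj_rhs_bound[OF ctrlD(1)[OF od(1)] tr(5,6)])
          also have "\<dots> \<le> L * B + L * 1" using pb[OF \<open>s \<in> {0..\<tau>}\<close>] pos tr(6) by (intro add_mono mult_left_mono) auto
          finally show "norm (- (blinfun_tr (Df (y s) (u s)) (p s) + \<mu> *\<^sub>R Dr (y s) (u s))) \<le> L * B + L"
            unfolding norm_minus_cancel by simp
        qed (use t1m in auto)
        also have "\<dots> \<le> (L * B + L) * (\<kappa>0 * E)" using \<eta> pos B unfolding \<eta>_def by (intro mult_left_mono) auto
        finally show ?thesis unfolding pT P_def[symmetric] by (simp add: K3_def norm_minus_commute mult_ac)
      qed
      have 1: "- (p t1 \<bullet> d t1) \<le> - (P \<bullet> d t1) + K3 * M1 * E\<^sup>2"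
      proof -
        have "\<bar>(p t1 - P) \<bullet> d t1\<bar> \<le> norm (p t1 - P) * norm (d t1)" by (rule Cauchy_Schwarz_ineq2)
        also have "\<dots> \<le> (K3 * E) * (M1 * E)" using pP dbE[OF t1m] Kn E by (intro mult_mono) auto
        finally show ?thesis by (simp add: inner_diff_left power2_eq_square algebra_simps)
      qed
      \<comment> \<open>This is the part of the optimal path that the perturbed one no longer
        follows. At \<open>z\<close> the Hamiltonian of every control is at most 0, so along a piece
        of length \<eta> it exceeds 0 by at most a multiple of \<eta>, and the integral is of second
        order.\<close>
      have 2: "- (P \<bullet> (y \<tau> - y t1)) - \<mu> * (R u y \<tau> - R u y t1) \<le> K6 * E\<^sup>2"
      proof -
        have "(- (P \<bullet> y \<tau>) - \<mu> *\<^sub>R R u y \<tau>) - (- (P \<bullet> y t1) - \<mu> *\<^sub>R R u y t1) \<le> ((G + 2) * L * (N * \<eta>)) * (\<tau> - t1)"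
        proof (rule ae_deriv_le[OF t1(1), of "\<lambda>t. - (P \<bullet> y t) - \<mu> *\<^sub>R R u y t" "\<lambda>t. - (P \<bullet> f (y t) (u t)) - \<mu> *\<^sub>R r (y t) (u t)" "{}"])
          have "ae_deriv 0 \<tau> (\<lambda>t. - (P \<bullet> y t) - \<mu> *\<^sub>R R u y t) (\<lambda>t. - (P \<bullet> f (y t) (u t)) - \<mu> *\<^sub>R r (y t) (u t))"
            by (intro ae_deriv_diff ae_deriv_minus ae_deriv_linear[OF bounded_linear_inner_right] ae_deriv_cmult
                solD(4)[OF od(2)] r_path(1)[OF od(1,2)])
          then show "ae_deriv t1 \<tau> (\<lambda>t. - (P \<bullet> y t) - \<mu> *\<^sub>R R u y t) (\<lambda>t. - (P \<bullet> f (y t) (u t)) - \<mu> *\<^sub>R r (y t) (u t))"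
            by (rule ae_deriv_subset) (use t1m in auto)
          fix s assume s: "s \<in> {t1<..<\<tau>} - {}"
          have us: "u s \<in> U" by (rule ctrlD(1)[OF od(1)])
          have "N * (\<tau> - s) \<le> N * \<eta>" using s pos by (intro mult_left_mono) (auto simp: \<eta>_def)
          then have "norm (y s - z) \<le> N * \<eta>" using sol_lip[OF od(1,2), of s \<tau>] s by (simp add: z_def)
          then have "(G + 2) * L * norm (y s - z) \<le> (G + 2) * L * (N * \<eta>)" using G pos by (intro mult_left_mono) auto
          then show "- (P \<bullet> f (y s) (u s)) - \<mu> *\<^sub>R r (y s) (u s) \<le> (G + 2) * L * (N * \<eta>)"
            using ham_lip[OF us tr(5,6) nP, of "y s" z] tr(7)[OF us] by simp
        qed simp
        also have "\<dots> = (G + 2) * L * N * \<eta>\<^sup>2" by (simp add: \<eta>_def power2_eq_square mult_ac)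
        also have "\<dots> \<le> (G + 2) * L * N * (\<kappa>0 * E)\<^sup>2"
          using \<eta> \<eta>0 G pos by (intro mult_left_mono power_mono) auto
        also have "\<dots> = K6 * E\<^sup>2" by (simp add: K6_def power_mult_distrib mult_ac)
        finally show ?thesis by (simp add: inner_diff_right algebra_simps)
      qed
      have "\<mu> * \<delta> \<le> \<mu> * (R u' y' t1 + g e - v0)" using hitcost[OF t1(2)] tr(5) unfolding e_def by (rule mult_left_mono)
      moreover have "d t1 = (e - z) + (y \<tau> - y t1)" by (simp add: split)
      then have "- (P \<bullet> d t1) = - \<mu> * (q \<bullet> (e - z)) + (1 - \<mu>) * (\<xi> \<bullet> (e - z)) - P \<bullet> (y \<tau> - y t1)"
        using Pdec[of "e - z"] by (simp add: inner_add_right)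
      ultimately have "- (p 0 \<bullet> h) + \<mu> * \<delta> \<le> K1 * E\<^sup>2 + K3 * M1 * E\<^sup>2 + K6 * E\<^sup>2
          + (1 - \<mu>) * (\<xi> \<bullet> (e - z)) + \<mu> * (g e - g z - q \<bullet> (e - z))"
        using A1[OF t1m] 1 2 by (simp add: v0_def algebra_simps)
      then show ?thesis using ball[OF ec ezD] gub[OF ef ezD] Enn unfolding CE by linarith
    next
      case False
      define \<kappa> where "\<kappa> = \<kappa>0 * E"
      have \<kappa>: "0 \<le> \<kappa>" using \<kappa>0 E by (simp add: \<kappa>_def)
      \<comment> \<open>Valid at every point reached within time \<kappa> after \<tau> that lies in
        \<open>closure (- S)\<close>, exit point or not. The control \<open>\<omega>1\<close> makes
        the Hamiltonian at \<open>z\<close> vanish, so this extra stretch contributes only second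
        order terms.\<close>
      have main: "- (p 0 \<bullet> h) + \<mu> * \<delta> \<le> \<mu> * (\<delta> - (R u' y' (\<tau> + \<sigma>) - R u y \<tau>) - q \<bullet> (y' (\<tau> + \<sigma>) - z))
           + K1 * E\<^sup>2 + K4 * E\<^sup>2 + D\<^sup>2 / (2 * \<rho>\<^sub>0) * E\<^sup>2 \<and> norm (y' (\<tau> + \<sigma>) - z) \<le> M1 * norm h + N * \<sigma>
           \<and> norm (y' (\<tau> + \<sigma>) - z) \<le> D * E"
        if \<sigma>: "0 \<le> \<sigma>" "\<sigma> \<le> \<kappa>" and ec: "y' (\<tau> + \<sigma>) \<in> closure (- S)" for \<sigma>
      proof -
        define e where "e = y' (\<tau> + \<sigma>)"
        have dist1: "norm (y' t - z) \<le> M1 * norm h + N * (t - \<tau>)" if "\<tau> \<le> t" for t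
        proof -
          have "y' t - z = (y' t - y' \<tau>) + d \<tau>" by (simp add: d_def z_def)
          then have "norm (y' t - z) \<le> norm (y' t - y' \<tau>) + norm (d \<tau>)" by (metis norm_triangle_ineq)
          then show ?thesis using sol_lip[OF u' y', of t \<tau>] db[OF \<tau>m] that by simp
        qed
        have distD: "norm (y' t - z) \<le> D * E" if "\<tau> \<le> t" "t \<le> \<tau> + \<sigma>" for t
        proof -
          have "M1 * norm h + N * (t - \<tau>) \<le> M1 * E + N * (\<kappa>0 * E)"
            using E that \<sigma> M1 pos unfolding \<kappa>_def by (intro add_mono mult_left_mono) auto
          then show ?thesis using dist1[OF that(1)] by (simp add: D_def algebra_simps)
        qed
        have ezD: "norm (e - z) \<le> D * E" unfolding e_def by (rule distD) (use \<sigma> in auto)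
        have 3: "P \<bullet> (e - y' \<tau>) + \<mu> * (R u' y' (\<tau> + \<sigma>) - R u' y' \<tau>) \<le> K4 * E\<^sup>2"
        proof -
          have "(P \<bullet> y' (\<tau> + \<sigma>) + \<mu> *\<^sub>R R u' y' (\<tau> + \<sigma>)) - (P \<bullet> y' \<tau> + \<mu> *\<^sub>R R u' y' \<tau>)
              \<le> ((G + 2) * L * (D * E)) * ((\<tau> + \<sigma>) - \<tau>)"
          proof (rule ae_deriv_le[of \<tau> "\<tau> + \<sigma>" "\<lambda>t. P \<bullet> y' t + \<mu> *\<^sub>R R u' y' t" "\<lambda>t. P \<bullet> f (y' t) (u' t) + \<mu> *\<^sub>R r (y' t) (u' t)" "{}"])
            have "ae_deriv 0 (\<tau> + \<sigma>) (\<lambda>t. P \<bullet> y' t + \<mu> *\<^sub>R R u' y' t) (\<lambda>t. P \<bullet> f (y' t) (u' t) + \<mu> *\<^sub>R r (y' t) (u' t))"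
              by (intro ae_deriv_add ae_deriv_linear[OF bounded_linear_inner_right] ae_deriv_cmult
                  solD(4)[OF y'] r_path(1)[OF u' y'])
            then show "ae_deriv \<tau> (\<tau> + \<sigma>) (\<lambda>t. P \<bullet> y' t + \<mu> *\<^sub>R R u' y' t) (\<lambda>t. P \<bullet> f (y' t) (u' t) + \<mu> *\<^sub>R r (y' t) (u' t))"
              by (rule ae_deriv_subset) (use \<tau> in auto)
            fix s assume s: "s \<in> {\<tau><..<\<tau> + \<sigma>} - {}"
            then have us: "u' s = \<omega>1" by (simp add: u'_def)
            have "(G + 2) * L * norm (y' s - z) \<le> (G + 2) * L * (D * E)"
              using distD[of s] s G pos by (intro mult_left_mono) auto
            then show "P \<bullet> f (y' s) (u' s) + \<mu> *\<^sub>R r (y' s) (u' s) \<le> (G + 2) * L * (D * E)"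
              using ham_lip[OF \<omega>1(1) tr(5,6) nP, of "y' s" z] \<omega>1(2) unfolding us by simp
          qed (use \<sigma> in auto)
          also have "\<dots> \<le> ((G + 2) * L * (D * E)) * (\<kappa>0 * E)"
            using \<sigma> G pos D E unfolding \<kappa>_def by (intro mult_left_mono) auto
          also have "\<dots> = K4 * E\<^sup>2" by (simp add: K4_def power2_eq_square mult_ac)
          finally show ?thesis unfolding e_def by (simp add: inner_diff_right algebra_simps)
        qed
        have "d \<tau> = (e - z) - (e - y' \<tau>)" by (simp add: d_def z_def)
        then have "- (P \<bullet> d \<tau>) = - \<mu> * (q \<bullet> (e - z)) + (1 - \<mu>) * (\<xi> \<bullet> (e - z)) + P \<bullet> (e - y' \<tau>)"
          using Pdec[of "e - z"] by (simp add: inner_diff_right)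
        then have "- (p 0 \<bullet> h) + \<mu> * \<delta> \<le> \<mu> * (\<delta> - (R u' y' (\<tau> + \<sigma>) - R u y \<tau>) - q \<bullet> (e - z))
           + K1 * E\<^sup>2 + K4 * E\<^sup>2 + (1 - \<mu>) * (\<xi> \<bullet> (e - z))"
          using A1[OF \<tau>m] 3 unfolding pT P_def[symmetric] by (simp add: algebra_simps)
        then show ?thesis
          using ball[OF ec[folded e_def] ezD] ezD dist1[of "\<tau> + \<sigma>"] \<sigma> unfolding e_def by simp
      qed
      show ?thesis
      proof (cases "\<exists>t1\<le>\<tau> + \<kappa>. hit y' t1")
        case True
        then obtain t1 where t1: "t1 \<le> \<tau> + \<kappa>" "hit y' t1" by blast
        then have "\<tau> < t1" using False by (meson not_le)
        define \<sigma> where "\<sigma> = t1 - \<tau>"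
        have \<sigma>: "0 \<le> \<sigma>" "\<sigma> \<le> \<kappa>" "t1 = \<tau> + \<sigma>" using t1 \<open>\<tau> < t1\<close> by (auto simp: \<sigma>_def)
        have ef: "y' (\<tau> + \<sigma>) \<in> frontier S" using hit_frontier[OF y' t1(2) x'S] \<sigma>(3) by simp
        then have ec: "y' (\<tau> + \<sigma>) \<in> closure (- S)" by (simp add: frontier_closures)
        note mn = main[OF \<sigma>(1,2) ec]
        have "\<delta> - (R u' y' (\<tau> + \<sigma>) - R u y \<tau>) - q \<bullet> (y' (\<tau> + \<sigma>) - z) \<le> g (y' (\<tau> + \<sigma>)) - g z - q \<bullet> (y' (\<tau> + \<sigma>) - z)"
          using hitcost[OF t1(2)] unfolding \<sigma>(3) v0_def by simp
        from mult_left_mono[OF this tr(5)]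
        show ?thesis using mn gub[OF ef] Enn unfolding CE by linarith
      next
        \<comment> \<open>If the target is missed during the whole extra time, there is no exit cost
          to compare with. None is required: by the choice of \<open>\<kappa>0\<close> the running
          cost accumulated meanwhile outweighs the other first order terms multiplied by \<mu>, and
          the inner ball inequality still applies at the current point.\<close>
        case F2: False
        have ec: "y' (\<tau> + \<kappa>) \<in> closure (- S)"
        proof -
          have "y' (\<tau> + \<kappa>) \<notin> S"
          proof
            assume "y' (\<tau> + \<kappa>) \<in> S"
            then obtain t1 where "hit y' t1" "t1 \<le> \<tau> + \<kappa>"
              by (rule hit_exists[OF solD(1)[OF y'] add_nonneg_nonneg[OF \<tau> \<kappa>]])
            then show False using F2 by blast
          qed
          then show ?thesis by (intro subsetD[OF closure_subset]) simp
        qed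
        note mn = main[OF \<kappa> order_refl ec]
        have "- (q \<bullet> (y' (\<tau> + \<kappa>) - z)) \<le> norm q * norm (y' (\<tau> + \<kappa>) - z)"
          using Cauchy_Schwarz_ineq2[of q "y' (\<tau> + \<kappa>) - z"] by linarith
        also have "\<dots> \<le> G * (M1 * norm h + N * \<kappa>)" using mn tr(3) G by (intro mult_mono) auto
        finally have "\<delta> - (R u' y' (\<tau> + \<kappa>) - R u y \<tau>) - q \<bullet> (y' (\<tau> + \<kappa>) - z) \<le>
           \<bar>\<delta>\<bar> + L * T * M1 * norm h + G * M1 * norm h - a0 * \<kappa>"
          using Rd[OF \<tau>m] R_mono[OF u' y' \<tau>, of "\<tau> + \<kappa>"] \<kappa> by (simp add: a0_def algebra_simps)
        also have "\<dots> \<le> E + L * T * M1 * E + G * M1 * E - a0 * \<kappa>"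
          using E pos T0 M1 G by (intro diff_right_mono add_mono mult_left_mono) auto
        also have "\<dots> = 0" unfolding \<kappa>_def mult.assoc[symmetric] \<kappa>0(2) by (simp add: algebra_simps)
        finally have "\<mu> * (\<delta> - (R u' y' (\<tau> + \<kappa>) - R u y \<tau>) - q \<bullet> (y' (\<tau> + \<kappa>) - z)) \<le> 0"
          using tr(5) by (simp add: mult_nonneg_nonpos)
        then show ?thesis using mn Enn unfolding CE by linarith
      qed
    qed
    then show ?thesis unfolding h_def[symmetric] v0 \<delta>_def[symmetric] E_def .
  qed
  then have "prox_normal C x (p 0) \<mu>"
    if "opt x u y \<tau>" "\<tau> \<le> T" "x \<in> closure (- S)" "transversal c (y \<tau>) \<xi> q \<mu>" "adj u y \<mu> p \<tau>" "p \<tau> = covec \<mu> q \<xi>"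
    for x u y \<tau> \<xi> q \<mu> p using that unfolding prox_normal_def by blast
  with C show thesis by (rule that)
qed

end

section \<open>The maximum principle\<close>

text \<open>Separate the point \<open>(z, k z)\<close> from the strict epigraph. The hyperplane is
  not vertical because \<open>z\<close> is interior to \<open>B\<close>.\<close>

lemma convex_on_subgradient:
  fixes k :: "'a::euclidean_space \<Rightarrow> real"
  assumes cv: "convex_on B k" and B: "open B" "z \<in> B"
  obtains a where "\<And>x. x \<in> B \<Longrightarrow> k z + a \<bullet> (x - z) \<le> k x"
proof -
  define E where "E = {(x, t). x \<in> B \<and> k x < t}"
  have "convex E"
  proof (rule convexI)
    fix p q :: "'a \<times> real" and s t :: real
    assume pq: "p \<in> E" "q \<in> E" and st: "0 \<le> s" "0 \<le> t" "s + t = 1"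
    have kle: "k (s *\<^sub>R fst p + t *\<^sub>R fst q) \<le> s * k (fst p) + t * k (fst q)"
    proof -
      have s: "s = 1 - t" using st by simp
      show ?thesis unfolding s by (rule convex_onD[OF cv]) (use pq st in \<open>auto simp: E_def\<close>)
    qed
    have "s * k (fst p) + t * k (fst q) < s * snd p + t * snd q"
    proof (cases "s = 0")
      case True
      then show ?thesis using pq st by (auto simp: E_def)
    next
      case False
      have "s * k (fst p) < s * snd p" using False pq st by (auto simp: E_def)
      moreover have "t * k (fst q) \<le> t * snd q" using pq st by (auto simp: E_def intro!: mult_left_mono)
      ultimately show ?thesis by linarith
    qed
    moreover have "s *\<^sub>R fst p + t *\<^sub>R fst q \<in> B"
      using convexD[OF convex_on_imp_convex[OF cv]] pq st by (auto simp: E_def)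
    ultimately show "s *\<^sub>R p + t *\<^sub>R q \<in> E" using kle by (auto simp: E_def case_prod_unfold)
  qed
  moreover have "(z, k z + 1) \<in> E" using B by (simp add: E_def)
  then have "E \<noteq> {}" by blast
  moreover have "E \<inter> {(z, k z)} = {}" by (auto simp: E_def)
  ultimately have "\<exists>w b. w \<noteq> 0 \<and> (\<forall>p\<in>E. w \<bullet> p \<le> b) \<and> (\<forall>p\<in>{(z, k z)}. b \<le> w \<bullet> p)"
    using convex_singleton by (intro separating_hyperplane_sets) simp_all
  then obtain w b where w: "w \<noteq> 0" "\<And>p. p \<in> E \<Longrightarrow> w \<bullet> p \<le> b" "w \<bullet> (z, k z) \<ge> b"
    by blast
  define v \<alpha> where "v = fst w" and "\<alpha> = snd w"
  have le: "v \<bullet> x + \<alpha> * t \<le> v \<bullet> z + \<alpha> * k z" if "x \<in> B" "k x < t" for x t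
    using w(2)[of "(x, t)"] w(3) that by (cases w) (auto simp: E_def v_def \<alpha>_def)
  have "\<alpha> \<le> 0" using le[OF B(2), of "k z + 1"] by (simp add: algebra_simps)
  have "\<alpha> \<noteq> 0"
  proof
    assume "\<alpha> = 0"
    obtain \<eta> where \<eta>: "\<eta> > 0" "cball z \<eta> \<subseteq> B" using B open_contains_cball by blast
    have v0: "v \<noteq> 0" using w(1) \<open>\<alpha> = 0\<close> by (cases w) (auto simp: v_def \<alpha>_def zero_prod_def)
    have "z + (\<eta> / norm v) *\<^sub>R v \<in> B" using \<eta> v0 by (intro subsetD[OF \<eta>(2)]) (simp add: dist_norm)
    from le[OF this, of "k (z + (\<eta> / norm v) *\<^sub>R v) + 1"] have "(\<eta> / norm v) * (v \<bullet> v) \<le> 0"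
      using \<open>\<alpha> = 0\<close> by (simp add: inner_add_right)
    moreover have "0 < (\<eta> / norm v) * (v \<bullet> v)" using \<eta> v0 by simp
    ultimately show False by linarith
  qed
  then have \<alpha>: "\<alpha> < 0" using \<open>\<alpha> \<le> 0\<close> by simp
  show thesis
  proof (rule that[of "(1 / (- \<alpha>)) *\<^sub>R v"])
    fix x assume x: "x \<in> B"
    have "v \<bullet> (x - z) / (- \<alpha>) \<le> k x - k z"
    proof (rule field_le_epsilon)
      fix e :: real assume "0 < e"
      then have "v \<bullet> x + \<alpha> * (k x + e) \<le> v \<bullet> z + \<alpha> * k z" by (intro le x) simp
      then have "v \<bullet> (x - z) \<le> (k x - k z + e) * (- \<alpha>)" by (simp add: inner_diff_right algebra_simps)
      then show "v \<bullet> (x - z) / (- \<alpha>) \<le> k x - k z + e" using \<alpha> by (subst pos_divide_le_eq) auto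
    qed
    then show "k z + (1 / (- \<alpha>)) *\<^sub>R v \<bullet> (x - z) \<le> k x" by simp
  qed
qed

context exit_time_problem
begin

lemma not_in_S_closure: "x \<notin> S \<Longrightarrow> x \<in> closure (- S)"
  by (rule subsetD[OF closure_subset]) simp

text \<open>Following a constant control for a short time \<open>s\<close> and lowering the value by
  the running cost stays in the hypograph, by dynamic programming. The proximal inequality at that
  point, divided by \<open>s\<close>, gives the Hamiltonian inequality as \<open>s\<close> tends to
  0.\<close>

lemma prox_normal_ham_le:
  assumes x: "x \<notin> S" "x \<in> reach" and pn: "prox_normal C x p \<mu>" and C: "0 \<le> C"
  shows "ham_le x p \<mu>"
  unfolding ham_le_def
proof
  fix \<omega> assume \<omega>: "\<omega> \<in> U"
  obtain y where y: "sol x (\<lambda>t. \<omega>) y" using sol_exists[OF ctrl_const[OF \<omega>]] by blast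
  note cu = ctrl_const[OF \<omega>]
  have "open (- S)" using S by (simp add: open_Compl)
  then obtain \<eta> where \<eta>: "\<eta> > 0" "ball x \<eta> \<subseteq> - S" using x(1) open_contains_ball by blast
  have yx: "norm (y s - x) \<le> N * s" if "0 \<le> s" for s
    using sol_lip[OF cu y, of s 0] solD(2)[OF y] that by simp
  define v w where "v = f x \<omega>" and "w = r x \<omega>"
  define s0 where "s0 = min 1 (\<eta> / (2 * N))"
  have s0: "s0 > 0" "s0 \<le> 1" "N * s0 < \<eta>"
  proof -
    show "s0 > 0" "s0 \<le> 1" using \<eta> pos by (auto simp: s0_def)
    have "N * s0 \<le> N * (\<eta> / (2 * N))" using pos by (intro mult_left_mono) (auto simp: s0_def)
    then show "N * s0 < \<eta>" using \<eta> pos by simp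
  qed
  define R1 where "R1 = \<bar>w\<bar> + L * N"
  \<comment> \<open>Collects the errors of second order in time: the proximal remainder and the
    drift of velocity and running cost.\<close>
  define K where "K = C * (N + R1)\<^sup>2 + norm p * (L * N) + \<bar>\<mu>\<bar> * (L * N)"
  have key: "- (p \<bullet> v) - \<mu> * w \<le> K * s" if s: "0 < s" "s < s0" for s
  proof -
    have in_ball: "y t \<notin> S" if "0 \<le> t" "t \<le> s" for t
    proof -
      have "N * t \<le> N * s0" using that s pos by (intro mult_left_mono) auto
      then have "y t \<in> ball x \<eta>" using yx[OF that(1)] s0 by (simp add: dist_norm norm_minus_commute)
      then show ?thesis using \<eta> by blast
    qed
    have e1: "norm (y s - x - s *\<^sub>R v) \<le> (L * N) * s * s"
    proof -
      have "norm ((y s - s *\<^sub>R v) - (y 0 - 0 *\<^sub>R v)) \<le> (L * (N * s)) * (s - 0)"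
      proof (rule ae_deriv_norm_le[of 0 s "\<lambda>t. y t - t *\<^sub>R v" "\<lambda>t. f (y t) \<omega> - 1 *\<^sub>R v" "{}"])
        show "ae_deriv 0 s (\<lambda>t. y t - t *\<^sub>R v) (\<lambda>t. f (y t) \<omega> - 1 *\<^sub>R v)"
          by (intro ae_deriv_diff solD(4)[OF y] ae_deriv_linear[OF bounded_linear_scaleR_left] ae_deriv_id)
        fix t assume t: "t \<in> {0<..<s} - {}"
        have "N * t \<le> N * s" using t pos by (intro mult_left_mono) auto
        then have "norm (y t - x) \<le> N * s" using yx[of t] t by simp
        then have "L * norm (y t - x) \<le> L * (N * s)" using pos by (intro mult_left_mono) auto
        then show "norm (f (y t) \<omega> - 1 *\<^sub>R v) \<le> L * (N * s)" using f_lip[OF \<omega>, of "y t" x] by (simp add: v_def)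
      qed (use s in auto)
      then show ?thesis using solD(2)[OF y] by (simp add: algebra_simps)
    qed
    have e2: "\<bar>R (\<lambda>t. \<omega>) y s - s * w\<bar> \<le> (L * N) * s * s"
    proof -
      have "norm ((R (\<lambda>t. \<omega>) y s - s *\<^sub>R w) - (R (\<lambda>t. \<omega>) y 0 - 0 *\<^sub>R w)) \<le> (L * (N * s)) * (s - 0)"
      proof (rule ae_deriv_norm_le[of 0 s "\<lambda>t. R (\<lambda>t. \<omega>) y t - t *\<^sub>R w" "\<lambda>t. r (y t) \<omega> - 1 *\<^sub>R w" "{}"])
        show "ae_deriv 0 s (\<lambda>t. R (\<lambda>t. \<omega>) y t - t *\<^sub>R w) (\<lambda>t. r (y t) \<omega> - 1 *\<^sub>R w)"
          by (intro ae_deriv_diff r_path(1)[OF cu y] ae_deriv_linear[OF bounded_linear_scaleR_left] ae_deriv_id)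
        fix t assume t: "t \<in> {0<..<s} - {}"
        have "N * t \<le> N * s" using t pos by (intro mult_left_mono) auto
        then have "norm (y t - x) \<le> N * s" using yx[of t] t by simp
        then have "L * norm (y t - x) \<le> L * (N * s)" using pos by (intro mult_left_mono) auto
        then show "norm (r (y t) \<omega> - 1 *\<^sub>R w) \<le> L * (N * s)" using r_lip[OF \<omega>, of "y t" x] by (simp add: w_def)
      qed (use s in auto)
      then show ?thesis by (simp add: R_0 mult_ac)
    qed
    have Vx: "V x = ereal (Vr x)" by (rule V_finite[OF x(2) not_in_S_closure[OF x(1)]])
    have "V x - ereal (R (\<lambda>t. \<omega>) y s) \<le> V (y s)"
      by (rule dpp_V_le[OF cu y]) (use s in_ball in auto)
    then have Vle: "ereal (Vr x - R (\<lambda>t. \<omega>) y s) \<le> V (y s)" by (metis Vx ereal_minus(1))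
    have ineq: "- (p \<bullet> (y s - x)) + \<mu> * ((Vr x - R (\<lambda>t. \<omega>) y s) - Vr x) \<le>
      C * (norm (y s - x) + \<bar>(Vr x - R (\<lambda>t. \<omega>) y s) - Vr x\<bar>)\<^sup>2"
      by (rule pn[unfolded prox_normal_def, rule_format, OF not_in_S_closure[OF in_ball[of s]] Vle]) (use s in auto)
    have Rb: "\<bar>R (\<lambda>t. \<omega>) y s\<bar> \<le> R1 * s"
    proof -
      have "(L * N) * s * s \<le> (L * N) * s * 1" using s s0 pos by (intro mult_left_mono) auto
      moreover have "s * w \<le> s * \<bar>w\<bar>" "s * (- w) \<le> s * \<bar>w\<bar>" using s by (intro mult_left_mono; simp)+
      ultimately show ?thesis using e2 by (simp add: R1_def abs_le_iff algebra_simps)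
    qed
    have "C * (norm (y s - x) + \<bar>(Vr x - R (\<lambda>t. \<omega>) y s) - Vr x\<bar>)\<^sup>2 \<le> C * (N * s + R1 * s)\<^sup>2"
      using C Rb yx[of s] s by (intro mult_left_mono power_mono add_mono) auto
    also have "\<dots> = C * (N + R1)\<^sup>2 * s * s" by (simp add: power2_eq_square algebra_simps)
    finally have 1: "- (p \<bullet> (y s - x)) - \<mu> * R (\<lambda>t. \<omega>) y s \<le> C * (N + R1)\<^sup>2 * s * s" using ineq by simp
    have "\<bar>p \<bullet> (y s - x - s *\<^sub>R v)\<bar> \<le> norm p * norm (y s - x - s *\<^sub>R v)" by (rule Cauchy_Schwarz_ineq2)
    also have "\<dots> \<le> norm p * ((L * N) * s * s)" by (intro mult_left_mono e1) simp
    finally have 2: "\<bar>p \<bullet> (y s - x) - s * (p \<bullet> v)\<bar> \<le> norm p * (L * N) * s * s" by (simp add: inner_diff_right mult_ac)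
    have "\<bar>\<mu> * (R (\<lambda>t. \<omega>) y s - s * w)\<bar> \<le> \<bar>\<mu>\<bar> * ((L * N) * s * s)" unfolding abs_mult by (intro mult_left_mono e2) simp
    then have 3: "\<bar>\<mu> * R (\<lambda>t. \<omega>) y s - s * (\<mu> * w)\<bar> \<le> \<bar>\<mu>\<bar> * (L * N) * s * s" by (simp add: algebra_simps)
    have "s * (- (p \<bullet> v) - \<mu> * w) \<le> s * (K * s)" using 1 2 3 by (simp add: K_def algebra_simps abs_le_iff)
    then show ?thesis using s by simp
  qed
  have "- (p \<bullet> v) - \<mu> * w \<le> 0"
  proof (rule field_le_epsilon)
    fix \<epsilon> :: real assume \<epsilon>: "0 < \<epsilon>"
    define s where "s = min (s0 / 2) (\<epsilon> / (\<bar>K\<bar> + 1))"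
    have s: "0 < s" "s < s0" using s0 \<epsilon> by (auto simp: s_def min_def divide_simps)
    have "K * s \<le> \<bar>K\<bar> * s" using s by (intro mult_right_mono) auto
    also have "\<dots> \<le> \<bar>K\<bar> * (\<epsilon> / (\<bar>K\<bar> + 1))" by (intro mult_left_mono) (auto simp: s_def)
    also have "\<dots> = \<epsilon> * (\<bar>K\<bar> / (\<bar>K\<bar> + 1))" by simp
    also have "\<dots> \<le> \<epsilon> * 1" using \<epsilon> by (intro mult_left_mono) (auto simp: divide_le_eq_1)
    finally show "- (p \<bullet> v) - \<mu> * w \<le> 0 + \<epsilon>" using key[OF s] by simp
  qed
  then show "- (p \<bullet> f x \<omega>) - \<mu> * r x \<omega> \<le> 0" by (simp add: v_def w_def)
qed

text \<open>Along an optimal path the dynamic programming relation is an equality, so earlier points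
  of the path are also available as test points. Approaching \<open>t\<close> from the left reverses
  the Hamiltonian inequality for the control actually applied.\<close>

lemma prox_normal_backward:
  assumes o: "opt x u y \<tau>" and t: "0 < t" "t < \<tau>" and pn: "prox_normal C (y t) p \<mu>" and C: "0 \<le> C"
    and dy: "(y has_vector_derivative f (y t) (u t)) (at t)"
    and dR: "(R u y has_vector_derivative r (y t) (u t)) (at t)"
  shows "p \<bullet> f (y t) (u t) + \<mu> * r (y t) (u t) \<le> 0"
proof (rule ccontr)
  define a where "a = p \<bullet> f (y t) (u t) + \<mu> * r (y t) (u t)"
  assume "\<not> ?thesis"
  then have a: "a > 0" by (simp add: a_def)
  note od = optD[OF o]
  obtain K where K: "K-lipschitz_on {0..\<tau>} (R u y)" using r_path(1)[OF od(1,2), of \<tau>] unfolding ae_deriv_def by blast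
  have K0: "0 \<le> K" by (rule lipschitz_on_nonneg[OF K])
  \<comment> \<open>Half of the supposed slope is subtracted: the remaining positive derivative
    still forces growth at least \<open>a / 2 * h\<close>, against a proximal bound quadratic in
    \<open>h\<close>.\<close>
  define \<phi> where "\<phi> s = p \<bullet> y s + \<mu> * R u y s - (a / 2) * s" for s
  have "(\<phi> has_real_derivative a - a / 2) (at t)"
    unfolding \<phi>_def a_def has_real_derivative_iff_has_vector_derivative
    by (intro has_vector_derivative_diff has_vector_derivative_add bounded_linear.has_vector_derivative[OF bounded_linear_inner_right dy]
        bounded_linear.has_vector_derivative[OF bounded_linear_mult_right dR])
      (auto intro!: derivative_eq_intros simp: has_real_derivative_iff_has_vector_derivative[symmetric])
  then obtain d where d: "d > 0" "\<And>h. 0 < h \<Longrightarrow> h < d \<Longrightarrow> \<phi> (t - h) < \<phi> t"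
    using DERIV_pos_inc_left[of \<phi> "a - a/2" t] a by auto
  define K2 where "K2 = C * (N + K)\<^sup>2"
  have K2: "0 \<le> K2" using C by (simp add: K2_def)
  have key: "a / 2 * h < K2 * h * h" if h: "0 < h" "h < d" "h < t" for h
  proof -
    define s where "s = t - h"
    have s: "0 \<le> s" "s \<le> \<tau>" "s < \<tau>" using h t by (auto simp: s_def)
    have Vs: "V (y s) = ereal (R u y \<tau> + g (y \<tau>) - R u y s)" by (rule opt_V(1)[OF o s(1,2)])
    have Vt: "Vr (y t) = R u y \<tau> + g (y \<tau>) - R u y t" using opt_V(1)[OF o, of t] t by simp
    have "y s \<in> closure (- S)" by (rule not_in_S_closure[OF od(8)[OF s(1,3)]])
    then have "- (p \<bullet> (y s - y t)) + \<mu> * ((R u y \<tau> + g (y \<tau>) - R u y s) - Vr (y t))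
        \<le> C * (norm (y s - y t) + \<bar>(R u y \<tau> + g (y \<tau>) - R u y s) - Vr (y t)\<bar>)\<^sup>2"
      using pn Vs unfolding prox_normal_def by simp
    then have "- (p \<bullet> (y s - y t)) + \<mu> * (R u y t - R u y s) \<le> C * (norm (y s - y t) + \<bar>R u y t - R u y s\<bar>)\<^sup>2"
      unfolding Vt by simp
    also have "\<dots> \<le> C * (N * h + K * h)\<^sup>2"
    proof (intro mult_left_mono power_mono add_mono C)
      show "norm (y s - y t) \<le> N * h" using sol_lip[OF od(1,2), of s t] h by (simp add: s_def)
      show "\<bar>R u y t - R u y s\<bar> \<le> K * h"
        using lipschitz_onD[OF K, of t s] s t h by (simp add: dist_real_def s_def)
    qed auto
    also have "\<dots> = K2 * h * h" by (simp add: K2_def power2_eq_square algebra_simps)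
    finally have "- (p \<bullet> (y s - y t)) + \<mu> * (R u y t - R u y s) \<le> K2 * h * h" .
    moreover have "\<phi> s < \<phi> t" unfolding s_def by (rule d(2)[OF h(1,2)])
    moreover have "(a / 2) * t - (a / 2) * s = a / 2 * h" by (simp add: s_def right_diff_distrib)
    ultimately show ?thesis unfolding \<phi>_def inner_diff_right right_diff_distrib by linarith
  qed
  define h where "h = min (min (d / 2) (t / 2)) (a / (2 * (K2 + 1)))"
  have h: "0 < h" "h < d" "h < t" using d t a K2 by (auto simp: h_def)
  have "a / 2 < K2 * h" using key[OF h] h(1) by (simp add: mult.assoc[symmetric])
  also have "\<dots> \<le> K2 * (a / (2 * (K2 + 1)))" using K2 by (intro mult_left_mono) (auto simp: h_def)
  also have "\<dots> = a / 2 * (K2 / (K2 + 1))" by simp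
  also have "\<dots> \<le> a / 2 * 1" using a K2 by (intro mult_left_mono) (auto simp: divide_le_eq_1)
  finally show False by simp
qed

lemma opt_ae_derivatives:
  assumes "opt x u y \<tau>"
  obtains E where "negligible E"
    "\<And>t. t \<in> {0<..<\<tau>} - E \<Longrightarrow> (y has_vector_derivative f (y t) (u t)) (at t)"
    "\<And>t. t \<in> {0<..<\<tau>} - E \<Longrightarrow> (R u y has_vector_derivative r (y t) (u t)) (at t)"
proof -
  note od = optD[OF assms]
  obtain E1 where E1: "negligible E1" "\<And>t. t \<in> {0<..<\<tau>} - E1 \<Longrightarrow> (y has_vector_derivative f (y t) (u t)) (at t)"
    using solD(4)[OF od(2), of \<tau>] unfolding ae_deriv_def by blast
  obtain E2 where E2: "negligible E2" "\<And>t. t \<in> {0<..<\<tau>} - E2 \<Longrightarrow> (R u y has_vector_derivative r (y t) (u t)) (at t)"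
    using r_path(1)[OF od(1,2), of \<tau>] unfolding ae_deriv_def by blast
  show thesis by (rule that[of "E1 \<union> E2"]) (use E1 E2 in auto)
qed

text \<open>The forward inequality holds for all controls and the backward one for the control in
  use. The costate is an arbitrary function with proximal normals, not a solution of the adjoint
  equation: a limit of costates will be inserted before its equation is known.\<close>

lemma maximum_principle:
  assumes o: "opt x u y \<tau>" and pn: "\<And>t. 0 \<le> t \<Longrightarrow> t < \<tau> \<Longrightarrow> prox_normal C (y t) (p t) \<mu>" and C: "0 \<le> C"
  obtains E where "negligible E" "\<And>t. 0 \<le> t \<Longrightarrow> t < \<tau> \<Longrightarrow> ham_le (y t) (p t) \<mu>"
    "\<And>t. t \<in> {0<..<\<tau>} - E \<Longrightarrow> p t \<bullet> f (y t) (u t) + \<mu> * r (y t) (u t) = 0"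
proof -
  note od = optD[OF o]
  have hl: "ham_le (y t) (p t) \<mu>" if "0 \<le> t" "t < \<tau>" for t
    using that opt_V(2)[OF o] by (intro prox_normal_ham_le[OF od(8)[OF that] _ pn[OF that] C]) auto
  obtain E where E: "negligible E"
    "\<And>t. t \<in> {0<..<\<tau>} - E \<Longrightarrow> (y has_vector_derivative f (y t) (u t)) (at t)"
    "\<And>t. t \<in> {0<..<\<tau>} - E \<Longrightarrow> (R u y has_vector_derivative r (y t) (u t)) (at t)"
    by (rule opt_ae_derivatives[OF o]) (rule that)
  show thesis
  proof (rule that[OF E(1) hl])
    fix t assume t: "t \<in> {0<..<\<tau>} - E"
    then have t': "0 < t" "t < \<tau>" by auto
    have "p t \<bullet> f (y t) (u t) + \<mu> * r (y t) (u t) \<le> 0"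
      using t' by (intro prox_normal_backward[OF o t' pn C E(2,3)[OF t]]) auto
    moreover have "- (p t \<bullet> f (y t) (u t)) - \<mu> * r (y t) (u t) \<le> 0"
      using hl[of t] t' ctrlD(1)[OF od(1)] unfolding ham_le_def by auto
    ultimately show "p t \<bullet> f (y t) (u t) + \<mu> * r (y t) (u t) = 0" by linarith
  qed
qed

lemma opt_in_closure:
  assumes "opt x u y \<tau>" "x \<in> closure (- S)" "0 \<le> t" "t \<le> \<tau>"
  shows "y t \<in> closure (- S)"
proof (cases "t < \<tau>")
  case True
  then show ?thesis by (intro not_in_S_closure optD(8)[OF assms(1,3)])
next
  case False
  then show ?thesis using hit_frontier[OF optD(2,3)[OF assms(1)] assms(2)] assms(4) by (simp add: frontier_closures)
qed

text \<open>The rest of an optimal path is optimal with the same exit data, so the estimate at the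
  initial point applies at every time. It enters as an assumption to keep one constant
  \<open>C\<close> for all times and all paths with exit time at most \<open>T\<close>.\<close>

lemma prox_normal_along:
  assumes o: "opt x u y \<tau>" and \<tau>T: "\<tau> \<le> T" and xS: "x \<in> closure (- S)"
    and tv: "transversal c (y \<tau>) \<xi> q \<mu>" and ad: "adj u y \<mu> p \<tau>" and pT: "p \<tau> = covec \<mu> q \<xi>"
    and t: "0 \<le> t" "t \<le> \<tau>"
    and thA: "\<And>x u y \<tau> \<xi> q \<mu> p. opt x u y \<tau> \<Longrightarrow> \<tau> \<le> T \<Longrightarrow> x \<in> closure (- S) \<Longrightarrow>
       transversal c (y \<tau>) \<xi> q \<mu> \<Longrightarrow> adj u y \<mu> p \<tau> \<Longrightarrow> p \<tau> = covec \<mu> q \<xi> \<Longrightarrow> prox_normal C x (p 0) \<mu>"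
  shows "prox_normal C (y t) (p t) \<mu>"
proof -
  obtain y' where y': "opt (y t) (\<lambda>s. u (s + t)) y' (\<tau> - t)" "\<And>s. 0 \<le> s \<Longrightarrow> y' s = y (s + t)"
    by (rule opt_shift[OF o t]) (rule that)
  have y'\<tau>: "y' (\<tau> - t) = y \<tau>" using y'(2)[of "\<tau> - t"] t by simp
  have "adj (\<lambda>s. u (s + t)) y' \<mu> (\<lambda>s. p (s + t)) (\<tau> - t)"
    unfolding adj_def
  proof (rule ae_deriv_cong)
    have "ae_deriv (t - t) (\<tau> - t) (\<lambda>s. p (s + t))
       (\<lambda>s. - (blinfun_tr (Df (y (s + t)) (u (s + t))) (p (s + t)) + \<mu> *\<^sub>R Dr (y (s + t)) (u (s + t))))"
      by (rule ae_deriv_shift[OF ae_deriv_subset[OF ad[unfolded adj_def]]]) (use t in auto)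
    then show "ae_deriv 0 (\<tau> - t) (\<lambda>s. p (s + t))
       (\<lambda>s. - (blinfun_tr (Df (y (s + t)) (u (s + t))) (p (s + t)) + \<mu> *\<^sub>R Dr (y (s + t)) (u (s + t))))" by simp
  qed (use y'(2) in auto)
  from thA[OF y'(1) _ opt_in_closure[OF o xS t] tv[folded y'\<tau>] this] show ?thesis using \<tau>T t pT by simp
qed

section \<open>Existence and uniqueness of terminal data\<close>

text \<open>\<open>k \<mu> \<omega>\<close> is affine in \<mu>. Some control makes it nonnegative at
  \<mu> = 0, since the path does reach the target, and all make it negative at \<mu> = 1, by the
  slope condition. The largest \<mu> at which it is nonnegative for some control is the
  multiplier.\<close>

lemma transversal_exists:
  assumes o: "opt x u y \<tau>" and x: "x \<notin> S" and \<xi>: "inner_normal (y \<tau>) \<xi>" and q: "supergrad c (y \<tau>) q"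
  obtains \<mu> where "transversal c (y \<tau>) \<xi> q \<mu>"
proof -
  note od = optD[OF o]
  define z where "z = y \<tau>"
  have \<tau>: "0 < \<tau>" using od(5,6) x solD(2)[OF od(2)] by (cases "\<tau> = 0") auto
  have \<xi>': "norm \<xi> = 1" "\<And>e. e \<in> closure (- S) \<Longrightarrow> \<xi> \<bullet> (e - z) \<le> 1 / (2 * \<rho>\<^sub>0) * (norm (e - z))\<^sup>2"
    using \<xi> unfolding inner_normal_def z_def by auto
  have q': "norm q \<le> G" using q by (simp add: supergrad_def)
  define k where "k \<mu> \<omega> = - (covec \<mu> q \<xi> \<bullet> f z \<omega>) - \<mu> * r z \<omega>" for \<mu> \<omega>
  have fz: "continuous_on U (f z)" "continuous_on U (r z)"
  proof -
    have c: "continuous_on U (\<lambda>\<omega>. (z, \<omega>))" by (rule continuous_on_Pair[OF continuous_on_const continuous_on_id])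
    show "continuous_on U (f z)" "continuous_on U (r z)"
      using continuous_on_compose2[OF f_cont c] continuous_on_compose2[OF r_cont c] by auto
  qed
  have fz': "continuous_on ({0..1} \<times> U) (\<lambda>s. f z (snd s))" "continuous_on ({0..1} \<times> U) (\<lambda>s. r z (snd s))"
    by (rule continuous_on_compose2[OF fz(1)] continuous_on_compose2[OF fz(2)]; auto intro!: continuous_intros)+
  have kc: "continuous_on ({0..1::real} \<times> U) (\<lambda>s. k (fst s) (snd s))"
    unfolding k_def covec_def by (intro continuous_intros fz')
  \<comment> \<open>If every velocity at \<open>z\<close> pointed strictly against \<xi>, the last
    piece of the path would approach \<open>z\<close> from the \<xi> side, at a distance along \<xi>
    linear in the remaining time. The inner ball allows only a quadratic one outside
    \<open>S\<close>.\<close>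
  have k0: "\<exists>\<omega>\<in>U. 0 \<le> k 0 \<omega>"
  proof (rule ccontr)
    assume neg: "\<not> ?thesis"
    have "continuous_on U (\<lambda>\<omega>. \<xi> \<bullet> f z \<omega>)" by (intro continuous_intros fz)
    from continuous_attains_sup[OF U(2,1) this] obtain \<omega>m where \<omega>m: "\<omega>m \<in> U" "\<And>\<omega>. \<omega> \<in> U \<Longrightarrow> \<xi> \<bullet> f z \<omega> \<le> \<xi> \<bullet> f z \<omega>m" by blast
    define m where "m = - (\<xi> \<bullet> f z \<omega>m)"
    have m: "m > 0" using neg \<omega>m(1) by (auto simp: k_def covec_def m_def not_le)
    define A where "A = L * N + N\<^sup>2 / (2 * \<rho>\<^sub>0)"
    have A: "0 < A" using pos by (simp add: A_def add_pos_nonneg)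
    have key: "m * s \<le> A * s * s" if s: "0 < s" "s \<le> \<tau>" for s
    proof -
      define t where "t = \<tau> - s"
      have t: "0 \<le> t" "t < \<tau>" using s by (auto simp: t_def)
      have yz: "norm (y t - z) \<le> N * s" using sol_lip[OF od(1,2), of t \<tau>] s by (simp add: z_def t_def)
      have "\<xi> \<bullet> (y t - z) \<le> 1 / (2 * \<rho>\<^sub>0) * (norm (y t - z))\<^sup>2" by (rule \<xi>'(2)[OF not_in_S_closure[OF od(8)[OF t]]])
      also have "\<dots> \<le> 1 / (2 * \<rho>\<^sub>0) * (N * s)\<^sup>2" using yz pos by (intro mult_left_mono power_mono) auto
      finally have 1: "\<xi> \<bullet> (y t - z) \<le> N\<^sup>2 / (2 * \<rho>\<^sub>0) * s * s" by (simp add: power2_eq_square mult_ac)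
      have "\<xi> \<bullet> y \<tau> - \<xi> \<bullet> y t \<le> (- m + L * (N * s)) * (\<tau> - t)"
      proof (rule ae_deriv_le[of t \<tau> "\<lambda>t. \<xi> \<bullet> y t" "\<lambda>t. \<xi> \<bullet> f (y t) (u t)" "{}"])
        show "ae_deriv t \<tau> (\<lambda>t. \<xi> \<bullet> y t) (\<lambda>t. \<xi> \<bullet> f (y t) (u t))"
          by (rule ae_deriv_linear[OF bounded_linear_inner_right ae_deriv_subset[OF solD(4)[OF od(2), of \<tau>]]]) (use t in auto)
        fix \<sigma> assume \<sigma>: "\<sigma> \<in> {t<..<\<tau>} - {}"
        have us: "u \<sigma> \<in> U" by (rule ctrlD(1)[OF od(1)])
        have "\<xi> \<bullet> (f (y \<sigma>) (u \<sigma>) - f z (u \<sigma>)) \<le> norm \<xi> * norm (f (y \<sigma>) (u \<sigma>) - f z (u \<sigma>))" by (rule norm_cauchy_schwarz)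
        also have "\<dots> \<le> L * norm (y \<sigma> - z)" using \<xi>'(1) f_lip[OF us] by simp
        also have "\<dots> \<le> L * (N * s)"
        proof -
          have "N * (\<tau> - \<sigma>) \<le> N * s" using \<sigma> pos by (intro mult_left_mono) (auto simp: t_def)
          then have "norm (y \<sigma> - z) \<le> N * s" using sol_lip[OF od(1,2), of \<sigma> \<tau>] \<sigma> by (simp add: z_def)
          then show ?thesis using pos by (intro mult_left_mono) auto
        qed
        finally show "\<xi> \<bullet> f (y \<sigma>) (u \<sigma>) \<le> - m + L * (N * s)"
          using \<omega>m(2)[OF us] by (simp add: m_def inner_diff_right)
      qed (use t in auto)
      then have "\<xi> \<bullet> z - \<xi> \<bullet> y t \<le> - m * s + L * N * s * s" by (simp add: z_def t_def algebra_simps)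
      then show ?thesis using 1 by (simp add: A_def inner_diff_right algebra_simps)
    qed
    define s where "s = min \<tau> (m / (2 * A))"
    have s: "0 < s" "s \<le> \<tau>" using \<tau> m A by (auto simp: s_def)
    have "m \<le> A * s" using key[OF s] s(1) by simp
    also have "\<dots> \<le> A * (m / (2 * A))" using A by (intro mult_left_mono) (auto simp: s_def)
    also have "\<dots> = m / 2" using A by simp
    finally show False using m by simp
  qed
  \<comment> \<open>At \<mu> = 1 the covector is \<open>q\<close> alone, and
    \<open>norm q \<le> G\<close> bounds its product with a velocity below the running cost.\<close>
  have k1: "k 1 \<omega> < 0" if \<omega>: "\<omega> \<in> U" for \<omega>
  proof -
    have "- (q \<bullet> f z \<omega>) \<le> norm q * norm (f z \<omega>)" using Cauchy_Schwarz_ineq2[of q "f z \<omega>"] by linarith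
    also have "\<dots> \<le> G * N" using q' f_bound[OF \<omega>, of z] G by (intro mult_mono) auto
    finally show ?thesis using G(2) r_lower[OF \<omega>, of z] by (simp add: k_def covec_def)
  qed
  define \<Lambda> where "\<Lambda> = {s \<in> {0..1::real} \<times> U. 0 \<le> k (fst s) (snd s)}"
  have cU: "compact ({0..1::real} \<times> U)" using U(2) by (intro compact_Times) auto
  have "\<Lambda> = ({0..1::real} \<times> U) \<inter> (\<lambda>s. k (fst s) (snd s)) -` {0..}" by (auto simp: \<Lambda>_def)
  moreover have "closed (({0..1::real} \<times> U) \<inter> (\<lambda>s. k (fst s) (snd s)) -` {0..})"
    by (rule continuous_closed_preimage[OF kc compact_imp_closed[OF cU]]) simp
  ultimately have "closed \<Lambda>" by simp
  then have "compact (({0..1::real} \<times> U) \<inter> \<Lambda>)" by (rule compact_Int_closed[OF cU])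
  moreover have "({0..1::real} \<times> U) \<inter> \<Lambda> = \<Lambda>" by (auto simp: \<Lambda>_def)
  ultimately have "compact \<Lambda>" by simp
  then have "compact (fst ` \<Lambda>)" by (intro compact_continuous_image continuous_on_fst continuous_on_id)
  moreover have "fst ` \<Lambda> \<noteq> {}" using k0 by (auto simp: \<Lambda>_def)
  ultimately obtain \<mu> where \<mu>: "\<mu> \<in> fst ` \<Lambda>" "\<And>\<mu>'. \<mu>' \<in> fst ` \<Lambda> \<Longrightarrow> \<mu>' \<le> \<mu>"
    using compact_attains_sup[of "fst ` \<Lambda>"] by blast
  then obtain \<omega>1 where \<omega>1: "\<omega>1 \<in> U" "0 \<le> k \<mu> \<omega>1" and \<mu>01: "0 \<le> \<mu>" "\<mu> \<le> 1" by (auto simp: \<Lambda>_def)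
  have \<mu>1: "\<mu> < 1" using k1[OF \<omega>1(1)] \<omega>1(2) \<mu>01 by (cases "\<mu> = 1") auto
  have aff: "k ((1 - s) * \<mu> + s) \<omega> = (1 - s) * k \<mu> \<omega> + s * k 1 \<omega>" for s \<omega>
    by (simp add: k_def covec_def inner_diff_left inner_add_left algebra_simps)
  have hl: "k \<mu> \<omega> \<le> 0" if \<omega>: "\<omega> \<in> U" for \<omega>
  proof (rule ccontr)
    assume "\<not> ?thesis"
    then have kp: "k \<mu> \<omega> > 0" by simp
    \<comment> \<open>The zero of the affine function between \<mu> and 1. A positive value at \<mu>
      would place it at a larger multiplier, against maximality.\<close>
    define s where "s = k \<mu> \<omega> / (k \<mu> \<omega> - k 1 \<omega>)"
    have den: "k \<mu> \<omega> - k 1 \<omega> > 0" using kp k1[OF \<omega>] by simp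
    have s: "0 < s" "s < 1" using kp den k1[OF \<omega>] by (auto simp: s_def)
    have "s * (k \<mu> \<omega> - k 1 \<omega>) = k \<mu> \<omega>" using den by (simp add: s_def)
    then have "k ((1 - s) * \<mu> + s) \<omega> = 0" unfolding aff by (simp add: algebra_simps)
    moreover have "(1 - s) * \<mu> + s \<in> {0..1}"
    proof -
      have "(1 - s) * \<mu> \<le> (1 - s) * 1" using s \<mu>01 by (intro mult_left_mono) auto
      then have "(1 - s) * \<mu> + s \<le> (1 - s) * 1 + s" by (rule add_right_mono)
      moreover have "0 \<le> (1 - s) * \<mu> + s" using s \<mu>01 by (intro add_nonneg_nonneg mult_nonneg_nonneg) auto
      ultimately show ?thesis by simp
    qed
    ultimately have "((1 - s) * \<mu> + s, \<omega>) \<in> \<Lambda>" using \<omega> by (simp add: \<Lambda>_def)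
    then have "(1 - s) * \<mu> + s \<le> \<mu>" using \<mu>(2) by force
    then have "s * (1 - \<mu>) \<le> 0" by (simp add: algebra_simps)
    then show False using s \<mu>1 by (simp add: mult_le_0_iff)
  qed
  have "transversal c (y \<tau>) \<xi> q \<mu>"
    unfolding transversal_def ham_le_def
  proof (intro conjI ballI \<xi> q \<mu>01)
    show "- (covec \<mu> q \<xi> \<bullet> f (y \<tau>) \<omega>) - \<mu> * r (y \<tau>) \<omega> \<le> 0" if "\<omega> \<in> U" for \<omega>
      using hl[OF that] by (simp add: k_def z_def)
    show "\<exists>\<omega>\<in>U. - (covec \<mu> q \<xi> \<bullet> f (y \<tau>) \<omega>) - \<mu> * r (y \<tau>) \<omega> = 0"
      using \<omega>1 hl[OF \<omega>1(1)] by (intro bexI[of _ \<omega>1]) (auto simp: k_def z_def)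
  qed
  then show thesis by (rule that)
qed

text \<open>For a control with value 0 at the larger multiplier, affinity writes this value as a
  combination of a nonpositive value at the smaller one and the negative value at 1, the latter with
  positive weight.\<close>

lemma transversal_unique:
  assumes "transversal c z \<xi> q \<mu>" "transversal c' z \<xi> q \<mu>'"
  shows "\<mu> = \<mu>'"
proof -
  have *: False if tv: "transversal c z \<xi> q \<mu>" "transversal c' z \<xi> q \<mu>'" and lt: "\<mu> < \<mu>'" for \<mu> \<mu>' c c'
  proof -
    define k where "k \<mu> \<omega> = - (covec \<mu> q \<xi> \<bullet> f z \<omega>) - \<mu> * r z \<omega>" for \<mu> \<omega>
    obtain \<omega> where \<omega>: "\<omega> \<in> U" "k \<mu>' \<omega> = 0" using tv(2) unfolding transversal_def k_def by blast
    have le: "k \<mu> \<omega> \<le> 0" using tv(1) \<omega>(1) unfolding transversal_def ham_le_def k_def by blast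
    have m: "0 \<le> \<mu>" "\<mu>' \<le> 1" "norm q \<le> G" using tv by (auto simp: transversal_def supergrad_def)
    have "- (q \<bullet> f z \<omega>) \<le> norm q * norm (f z \<omega>)" using Cauchy_Schwarz_ineq2[of q "f z \<omega>"] by linarith
    also have "\<dots> \<le> G * N" using m f_bound[OF \<omega>(1), of z] G by (intro mult_mono) auto
    finally have k1: "k 1 \<omega> < 0" using G(2) r_lower[OF \<omega>(1), of z] by (simp add: k_def covec_def)
    have "(1 - \<mu>) * k \<mu>' \<omega> = (1 - \<mu>') * k \<mu> \<omega> + (\<mu>' - \<mu>) * k 1 \<omega>"
      by (simp add: k_def covec_def inner_diff_left algebra_simps)
    moreover have "(1 - \<mu>') * k \<mu> \<omega> \<le> 0" using m le by (simp add: mult_nonneg_nonpos)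
    moreover have "(\<mu>' - \<mu>) * k 1 \<omega> < 0" using lt k1 by (simp add: mult_pos_neg)
    ultimately show False using \<omega>(2) by simp
  qed
  show ?thesis using *[OF assms] *[OF assms(2,1)] by (meson linorder_neqE_linordered_idom)
qed

lemma inner_normal_exists: "z \<in> frontier S \<Longrightarrow> \<exists>\<xi>. inner_normal z \<xi>"
  using inner_ball unfolding inner_ball_hyp_def inner_normal_def by blast

text \<open>Semiconcavity means that a multiple of the squared norm minus \<open>g\<close> is convex
  near \<open>z0\<close>; its subgradients yield supergradients of \<open>g\<close> with one
  constant for all nearby \<open>z\<close>. The inequality on the larger ball, off the boundary too,
  is kept so that differentiability of \<open>g\<close> can later identify \<open>q\<close>.\<close>

lemma supergrad_exists:
  obtains e c where "0 < e" "0 \<le> c"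
    "\<And>z. z \<in> frontier S \<Longrightarrow> z \<in> ball z0 e \<Longrightarrow> \<exists>q. supergrad c z q \<and> (\<forall>x\<in>ball z0 (2 * e). g x \<le> g z + q \<bullet> (x - z) + c * (norm (x - z))\<^sup>2)"
proof -
  obtain e0 c0 where e0: "e0 > 0" "c0 > 0" and sc: "\<And>x0 x1 \<mu>. x0 \<in> ball z0 e0 \<Longrightarrow> x1 \<in> ball z0 e0 \<Longrightarrow> \<mu> \<in> {0..1} \<Longrightarrow>
        (1 - \<mu>) * g x0 + \<mu> * g x1 - g ((1 - \<mu>) *\<^sub>R x0 + \<mu> *\<^sub>R x1) \<le> c0 * \<mu> * (1 - \<mu>) * (norm (x0 - x1))\<^sup>2"
    using semiconcave unfolding locally_semiconcave_def by meson
  define k where "k x = c0 * (x \<bullet> x) - g x" for x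
  have cv: "convex_on (ball z0 e0) k"
  proof (rule convex_onI)
    fix t x y assume t: "0 < t" "t < (1::real)" and xy: "x \<in> ball z0 e0" "y \<in> ball z0 e0"
    have id: "(1 - t) * (x \<bullet> x) + t * (y \<bullet> y) - ((1 - t) *\<^sub>R x + t *\<^sub>R y) \<bullet> ((1 - t) *\<^sub>R x + t *\<^sub>R y)
        = t * (1 - t) * (norm (x - y))\<^sup>2"
      by (simp add: power2_norm_eq_inner inner_diff_left inner_diff_right inner_add_left inner_add_right inner_commute algebra_simps)
    have "(1 - t) * g x + t * g y - g ((1 - t) *\<^sub>R x + t *\<^sub>R y) \<le> c0 * t * (1 - t) * (norm (x - y))\<^sup>2"
      using sc[OF xy, of t] t by simp
    also have "\<dots> = c0 * ((1 - t) * (x \<bullet> x) + t * (y \<bullet> y) - ((1 - t) *\<^sub>R x + t *\<^sub>R y) \<bullet> ((1 - t) *\<^sub>R x + t *\<^sub>R y))"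
      unfolding id by simp
    finally show "k ((1 - t) *\<^sub>R x + t *\<^sub>R y) \<le> (1 - t) * k x + t * k y"
      unfolding k_def by (simp only: right_diff_distrib distrib_left mult.left_commute[of _ c0])
  qed simp
  \<comment> \<open>The extra \<open>4 * G / e0\<close> makes the quadratic term take over far away:
    boundary points outside the ball are at least \<open>e0 / 2\<close> from \<open>z\<close>, where
    it dominates the growth \<open>2 * G\<close> of \<open>g\<close> and of the linear term.\<close>
  define e c where "e = e0 / 2" and "c = c0 + 4 * G / e0"
  have e: "0 < e" "2 * e = e0" using e0 by (auto simp: e_def)
  have c: "0 \<le> c" "c0 \<le> c" using e0 G by (auto simp: c_def)
  show thesis
  proof (rule that[OF e(1) c(1)])
    fix z assume zf: "z \<in> frontier S" and zb: "z \<in> ball z0 e"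
    have zb': "z \<in> ball z0 e0" using zb e0 by (auto simp: e_def)
    obtain a where a: "\<And>x. x \<in> ball z0 e0 \<Longrightarrow> k z + a \<bullet> (x - z) \<le> k x"
      by (rule convex_on_subgradient[OF cv open_ball zb']) blast
    define q where "q = (2 * c0) *\<^sub>R z - a"
    have gq: "g x \<le> g z + q \<bullet> (x - z) + c0 * (norm (x - z))\<^sup>2" if "x \<in> ball z0 e0" for x
      using a[OF that] by (simp add: k_def q_def power2_norm_eq_inner inner_diff_left inner_diff_right inner_commute algebra_simps)
    have zW: "z \<in> W" using zf W by blast
    \<comment> \<open>A small step in direction \<open>- q\<close> lowers the upper bound for
      \<open>g\<close> at rate \<open>norm q\<close>, while \<open>g\<close> falls at rate at most
      \<open>G\<close>. The step stays in \<open>W\<close> and makes the quadratic error at most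
      \<epsilon>.\<close>
    have qG: "norm q \<le> G"
    proof (cases "q = 0")
      case False
      have "open (W \<inter> ball z0 e0)" "z \<in> W \<inter> ball z0 e0" using W zW zb' by auto
      then obtain \<eta> where \<eta>: "\<eta> > 0" "ball z \<eta> \<subseteq> W \<inter> ball z0 e0" using open_contains_ball by blast
      show ?thesis
      proof (rule field_le_epsilon)
        fix \<epsilon> :: real assume \<epsilon>: "0 < \<epsilon>"
        define s where "s = min (\<eta> / (2 * norm q)) (\<epsilon> / (c0 * norm q))"
        have s: "0 < s" using \<eta> \<epsilon> e0 False by (simp add: s_def)
        have "s * norm q \<le> \<eta> / (2 * norm q) * norm q" by (intro mult_right_mono) (auto simp: s_def)
        then have "s * norm q < \<eta>" using \<eta> False by simp
        then have xb: "z - s *\<^sub>R q \<in> ball z \<eta>" using s by (simp add: dist_norm)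
        have "g (z - s *\<^sub>R q) \<le> g z + q \<bullet> ((z - s *\<^sub>R q) - z) + c0 * (norm ((z - s *\<^sub>R q) - z))\<^sup>2"
          using xb \<eta> by (intro gq) blast
        moreover have "\<bar>g (z - s *\<^sub>R q) - g z\<bar> \<le> G * norm ((z - s *\<^sub>R q) - z)"
          using xb \<eta> zW by (intro g_lip) auto
        ultimately have "s * (norm q)\<^sup>2 \<le> G * (s * norm q) + c0 * (s * norm q)\<^sup>2"
          using s by (simp add: power2_norm_eq_inner abs_le_iff power_mult_distrib)
        then have "s * norm q * norm q \<le> s * norm q * (G + c0 * s * norm q)"
          by (simp add: power2_eq_square algebra_simps)
        then have "norm q \<le> G + c0 * s * norm q" using s False by simp
        also have "c0 * s * norm q \<le> \<epsilon>"
        proof -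
          have "s * (c0 * norm q) \<le> \<epsilon> / (c0 * norm q) * (c0 * norm q)" using e0 by (intro mult_right_mono) (auto simp: s_def)
          then show ?thesis using e0 False by (simp add: mult_ac)
        qed
        finally show "norm q \<le> G + \<epsilon>" by simp
      qed
    qed (use G in simp)
    have inb: "g x \<le> g z + q \<bullet> (x - z) + c * (norm (x - z))\<^sup>2" if "x \<in> ball z0 e0" for x
      using gq[OF that] mult_right_mono[OF c(2), of "(norm (x - z))\<^sup>2"] by simp
    have "g x \<le> g z + q \<bullet> (x - z) + c * (norm (x - z))\<^sup>2" if xf: "x \<in> frontier S" for x
    proof (cases "x \<in> ball z0 e0")
      case False
      have "dist z0 x \<le> dist z0 z + dist z x" by (rule dist_triangle)
      then have far: "e0 / 2 \<le> norm (x - z)" using False zb by (simp add: e_def dist_norm norm_minus_commute)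
      have "g x - g z \<le> G * norm (x - z)" using g_frontier_lip[OF xf zf] by linarith
      moreover have "- (q \<bullet> (x - z)) \<le> G * norm (x - z)"
        using Cauchy_Schwarz_ineq2[of q "x - z"] mult_right_mono[OF qG norm_ge_zero[of "x - z"]] by linarith
      moreover have "2 * G * norm (x - z) \<le> 4 * G / e0 * (norm (x - z))\<^sup>2"
      proof -
        have "e0 / 2 * norm (x - z) \<le> norm (x - z) * norm (x - z)" using far by (intro mult_right_mono) auto
        then have "4 * G / e0 * (e0 / 2 * norm (x - z)) \<le> 4 * G / e0 * (norm (x - z))\<^sup>2"
          using e0 G unfolding power2_eq_square by (intro mult_left_mono) auto
        then show ?thesis using e0 by simp
      qed
      moreover have "4 * G / e0 * (norm (x - z))\<^sup>2 \<le> c * (norm (x - z))\<^sup>2" using e0 by (intro mult_right_mono) (auto simp: c_def)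
      ultimately show ?thesis by linarith
    qed (rule inb)
    then show "\<exists>q. supergrad c z q \<and> (\<forall>x\<in>ball z0 (2 * e). g x \<le> g z + q \<bullet> (x - z) + c * (norm (x - z))\<^sup>2)"
      using qG inb unfolding supergrad_def e(2) by blast
  qed
qed

end

section \<open>Compactness of the set of trajectories\<close>

text \<open>On a compact set a zero exists exactly when the values come arbitrarily close to 0, and
  by continuity a countable dense subset detects this.\<close>

lemma zero_set_measurable:
  fixes \<Psi> :: "real \<Rightarrow> 'b::euclidean_space \<Rightarrow> real"
  assumes K: "compact K" and meas: "\<And>\<omega>. \<omega> \<in> K \<Longrightarrow> (\<lambda>s. \<Psi> s \<omega>) \<in> borel_measurable lebesgue"
    and cont: "\<And>s. continuous_on K (\<Psi> s)" and nonneg: "\<And>s \<omega>. 0 \<le> \<Psi> s \<omega>"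
  shows "{s. \<exists>\<omega>\<in>K. \<Psi> s \<omega> = 0} \<in> sets lebesgue"
proof -
  obtain Q where Q: "countable Q" "Q \<subseteq> K" "K \<subseteq> closure Q" by (rule separable)
  have eq: "(\<exists>\<omega>\<in>K. \<Psi> s \<omega> = 0) \<longleftrightarrow> (\<forall>n::nat. \<exists>\<omega>\<in>Q. \<Psi> s \<omega> < 1 / Suc n)" for s
  proof
    assume "\<exists>\<omega>\<in>K. \<Psi> s \<omega> = 0"
    then obtain \<omega> where \<omega>: "\<omega> \<in> K" "\<Psi> s \<omega> = 0" by blast
    show "\<forall>n::nat. \<exists>\<omega>\<in>Q. \<Psi> s \<omega> < 1 / Suc n"
    proof
      fix n :: nat
      have e: "0 < 1 / real (Suc n)" by simp
      obtain d where d: "d > 0" "\<And>\<omega>'. \<omega>' \<in> K \<Longrightarrow> dist \<omega>' \<omega> < d \<Longrightarrow> dist (\<Psi> s \<omega>') (\<Psi> s \<omega>) < 1 / Suc n"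
        using cont[of s] \<omega>(1) e unfolding continuous_on_iff by metis
      obtain \<omega>' where "\<omega>' \<in> Q" "dist \<omega>' \<omega> < d"
        using \<omega>(1) Q(3) d(1) closure_approachable by blast
      then show "\<exists>\<omega>\<in>Q. \<Psi> s \<omega> < 1 / Suc n" using d(2)[of \<omega>'] Q(2) \<omega>(2) by (intro bexI[of _ \<omega>']) (auto simp: dist_real_def)
    qed
  next
    assume *: "\<forall>n::nat. \<exists>\<omega>\<in>Q. \<Psi> s \<omega> < 1 / Suc n"
    then have "K \<noteq> {}" using Q(2) by blast
    then obtain \<omega> where \<omega>: "\<omega> \<in> K" "\<And>\<omega>'. \<omega>' \<in> K \<Longrightarrow> \<Psi> s \<omega> \<le> \<Psi> s \<omega>'"
      using continuous_attains_inf[OF K _ cont[of s]] by blast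
    have "\<Psi> s \<omega> = 0"
    proof (rule ccontr)
      assume "\<Psi> s \<omega> \<noteq> 0"
      then have "0 < \<Psi> s \<omega>" using nonneg[of s \<omega>] by simp
      then obtain n :: nat where "1 / Suc n < \<Psi> s \<omega>" using nat_approx_posE by blast
      moreover obtain \<omega>' where "\<omega>' \<in> Q" "\<Psi> s \<omega>' < 1 / Suc n" using * by blast
      ultimately show False using \<omega>(2)[of \<omega>'] Q(2) by auto
    qed
    then show "\<exists>\<omega>\<in>K. \<Psi> s \<omega> = 0" using \<omega>(1) by blast
  qed
  have "{s. \<Psi> s \<omega> < c} \<in> sets lebesgue" if "\<omega> \<in> Q" for \<omega> c
    using borel_measurable_less[OF meas[of \<omega>] borel_measurable_const[of c]] that Q(2) by (auto simp: pred_def)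
  then have "(\<Inter>n::nat. \<Union>\<omega>\<in>Q. {s. \<Psi> s \<omega> < 1 / Suc n}) \<in> sets lebesgue"
    using Q(1) by (intro sets.countable_INT sets.countable_UN') auto
  also have "(\<Inter>n::nat. \<Union>\<omega>\<in>Q. {s. \<Psi> s \<omega> < 1 / Suc n}) = {s. \<exists>\<omega>\<in>K. \<Psi> s \<omega> = 0}" unfolding eq by blast
  finally show ?thesis .
qed

text \<open>The selected zero is fixed coordinate by coordinate, each coordinate being the least possible one.\<close>

lemma measurable_zero_selection:
  fixes \<Phi> :: "real \<Rightarrow> 'b::euclidean_space \<Rightarrow> real"
  assumes K: "compact K" and meas: "\<And>\<omega>. \<omega> \<in> K \<Longrightarrow> (\<lambda>s. \<Phi> s \<omega>) \<in> borel_measurable lebesgue"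
    and cont: "\<And>s. continuous_on K (\<Phi> s)" and nonneg: "\<And>s \<omega>. 0 \<le> \<Phi> s \<omega>"
    and zero: "\<And>s. \<exists>\<omega>\<in>K. \<Phi> s \<omega> = 0"
  obtains u where "u \<in> borel_measurable lebesgue" "\<And>s. u s \<in> K" "\<And>s. \<Phi> s (u s) = 0"
proof -
  have "\<exists>v. (\<forall>b\<in>B. v b \<in> borel_measurable lebesgue) \<and> (\<forall>s. \<exists>\<omega>\<in>K. \<Phi> s \<omega> = 0 \<and> (\<forall>b\<in>B. \<omega> \<bullet> b = v b s))"
    if "finite B" for B :: "'b set"
    using that
  proof (induction B)
    case empty
    then show ?case using zero by auto
  next
    case (insert b B)
    then obtain v where v: "\<And>b. b \<in> B \<Longrightarrow> v b \<in> borel_measurable lebesgue"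
      "\<And>s. \<exists>\<omega>\<in>K. \<Phi> s \<omega> = 0 \<and> (\<forall>b\<in>B. \<omega> \<bullet> b = v b s)" by metis
    \<comment> \<open>Zeros of the penalised function are the zeros whose coordinates in
      \<open>B\<close> have the values already selected, so the induction repeats the same
      situation.\<close>
    define \<Psi> where "\<Psi> s \<omega> = \<Phi> s \<omega> + (\<Sum>b'\<in>B. \<bar>\<omega> \<bullet> b' - v b' s\<bar>)" for s \<omega>
    have \<Psi>0: "\<Psi> s \<omega> = 0 \<longleftrightarrow> \<Phi> s \<omega> = 0 \<and> (\<forall>b\<in>B. \<omega> \<bullet> b = v b s)" for s \<omega>
      using insert(1) nonneg[of s \<omega>] by (simp add: \<Psi>_def add_nonneg_eq_0_iff sum_nonneg sum_nonneg_eq_0_iff)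
    have \<Psi>m: "(\<lambda>s. \<Psi> s \<omega>) \<in> borel_measurable lebesgue" if "\<omega> \<in> K" for \<omega>
      unfolding \<Psi>_def using v(1)
      by (intro borel_measurable_add meas that borel_measurable_sum borel_measurable_abs borel_measurable_diff borel_measurable_const) auto
    have \<Psi>c: "continuous_on K (\<Psi> s)" for s unfolding \<Psi>_def by (intro continuous_intros cont)
    have \<Psi>n: "0 \<le> \<Psi> s \<omega>" for s \<omega> unfolding \<Psi>_def by (intro add_nonneg_nonneg nonneg sum_nonneg) auto
    define Z where "Z s = {\<omega> \<in> K. \<Psi> s \<omega> = 0}" for s
    have "\<exists>\<omega>\<in>Z s. \<forall>\<omega>'\<in>Z s. \<omega> \<bullet> b \<le> \<omega>' \<bullet> b" for s
    proof -
      have "closed (K \<inter> \<Psi> s -` {0})" by (rule continuous_closed_preimage[OF \<Psi>c compact_imp_closed[OF K]]) simp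
      then have "compact (K \<inter> (K \<inter> \<Psi> s -` {0}))" by (rule compact_Int_closed[OF K])
      moreover have "K \<inter> (K \<inter> \<Psi> s -` {0}) = Z s" by (auto simp: Z_def)
      ultimately have "compact (Z s)" by simp
      moreover have "Z s \<noteq> {}" using v(2)[of s] by (auto simp: Z_def \<Psi>0)
      moreover have "continuous_on (Z s) (\<lambda>\<omega>. \<omega> \<bullet> b)" by (intro continuous_intros)
      ultimately show ?thesis by (intro continuous_attains_inf)
    qed
    then obtain m where m: "\<And>s. m s \<in> Z s" "\<And>s \<omega>'. \<omega>' \<in> Z s \<Longrightarrow> m s \<bullet> b \<le> \<omega>' \<bullet> b" by metis
    \<comment> \<open>The least coordinate is at most \<open>c\<close> exactly when a zero exists in
      the part of \<open>K\<close> below \<open>c\<close>, which is again compact.\<close>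
    have "(\<lambda>s. m s \<bullet> b) \<in> borel_measurable lebesgue"
    proof (rule borel_measurableI_le)
      fix c
      have "compact (K \<inter> {\<omega>. \<omega> \<bullet> b \<le> c})"
        by (intro compact_Int_closed[OF K] closed_Collect_le continuous_intros)
      then have "{s. \<exists>\<omega>\<in>K \<inter> {\<omega>. \<omega> \<bullet> b \<le> c}. \<Psi> s \<omega> = 0} \<in> sets lebesgue"
        by (rule zero_set_measurable) (auto intro: \<Psi>m \<Psi>n continuous_on_subset[OF \<Psi>c])
      also have "{s. \<exists>\<omega>\<in>K \<inter> {\<omega>. \<omega> \<bullet> b \<le> c}. \<Psi> s \<omega> = 0} = {s \<in> space lebesgue. m s \<bullet> b \<le> c}"
      proof (intro set_eqI iffI; clarsimp)
        fix s \<omega> assume "\<omega> \<in> K" "\<omega> \<bullet> b \<le> c" "\<Psi> s \<omega> = 0"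
        then show "m s \<bullet> b \<le> c" using m(2)[of \<omega> s] by (simp add: Z_def)
      next
        fix s assume "m s \<bullet> b \<le> c"
        then show "\<exists>\<omega>\<in>K \<inter> {\<omega>. \<omega> \<bullet> b \<le> c}. \<Psi> s \<omega> = 0" using m(1)[of s] by (intro bexI[of _ "m s"]) (auto simp: Z_def)
      qed
      finally show "{s \<in> space lebesgue. m s \<bullet> b \<le> c} \<in> sets lebesgue" .
    qed
    then show ?case
    proof (intro exI[of _ "v(b := \<lambda>s. m s \<bullet> b)"] conjI ballI allI)
      fix b' assume "b' \<in> insert b B"
      then show "(v(b := \<lambda>s. m s \<bullet> b)) b' \<in> borel_measurable lebesgue"
        using v(1) \<open>(\<lambda>s. m s \<bullet> b) \<in> borel_measurable lebesgue\<close> by (cases "b' = b") auto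
    next
      fix s
      have "m s \<in> K" "\<Phi> s (m s) = 0" "\<forall>b\<in>B. m s \<bullet> b = v b s" using m(1)[of s] by (auto simp: Z_def \<Psi>0)
      then show "\<exists>\<omega>\<in>K. \<Phi> s \<omega> = 0 \<and> (\<forall>b'\<in>insert b B. \<omega> \<bullet> b' = (v(b := \<lambda>s. m s \<bullet> b)) b' s)"
        using insert(2) by (intro bexI[of _ "m s"]) auto
    qed
  qed
  from this[OF finite_Basis] obtain v where v: "\<And>b. b \<in> Basis \<Longrightarrow> v b \<in> borel_measurable lebesgue"
    "\<And>s. \<exists>\<omega>\<in>K. \<Phi> s \<omega> = 0 \<and> (\<forall>b\<in>Basis. \<omega> \<bullet> b = v b s)" by blast
  define u where "u s = (\<Sum>b\<in>Basis. v b s *\<^sub>R b)" for s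
  have um: "u \<in> borel_measurable lebesgue" unfolding u_def using v(1) by (intro borel_measurable_sum borel_measurable_scaleR) auto
  have uz: "u s \<in> K \<and> \<Phi> s (u s) = 0" for s
  proof -
    obtain \<omega> where \<omega>: "\<omega> \<in> K" "\<Phi> s \<omega> = 0" "\<And>b. b \<in> Basis \<Longrightarrow> \<omega> \<bullet> b = v b s" using v(2)[of s] by blast
    have "u s = (\<Sum>b\<in>Basis. (\<omega> \<bullet> b) *\<^sub>R b)" unfolding u_def using \<omega>(3) by (intro sum.cong) auto
    then have "u s = \<omega>" by (simp add: euclidean_representation)
    then show ?thesis using \<omega> by simp
  qed
  show thesis by (rule that[OF um]) (use uz in auto)
qed

section \<open>Closure of the set of trajectories and existence of minimizers\<close>

context exit_time_problem
begin

text \<open>Velocity and cost rate are paired and the cost rate may be wasted. This is the set that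
  is assumed convex, and it is also why a limit of running costs only dominates the running cost of
  the limit.\<close>

definition velocity_set :: "'a \<Rightarrow> ('a \<times> real) set" where
  "velocity_set x = {(v, \<mu>). \<exists>\<omega>\<in>U. v = f x \<omega> \<and> \<mu> \<ge> r x \<omega>}"

lemma continuous_on_control:
  fixes \<Phi> :: "'a \<Rightarrow> 'b \<Rightarrow> 'c::topological_space"
  assumes "continuous_on (UNIV \<times> U) (\<lambda>(x, \<omega>). \<Phi> x \<omega>)"
  shows "continuous_on U (\<Phi> z)"
proof -
  have c: "continuous_on U (\<lambda>\<omega>. (z, \<omega>))" by (rule continuous_on_Pair[OF continuous_on_const continuous_on_id])
  show ?thesis using continuous_on_compose2[OF assms c] by auto
qed

lemma velocity_set_closed: "closed (velocity_set x)"
proof -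
  define A where "A = (\<lambda>\<omega>. (f x \<omega>, r x \<omega>)) ` U"
  have "compact A" unfolding A_def
    by (rule compact_continuous_image[OF _ U(2)]) (intro continuous_on_Pair continuous_on_control f_cont r_cont)
  moreover have "closed ({0::'a} \<times> {0::real..})" by (intro closed_Times) auto
  ultimately have "closed (\<Union>p\<in>A. \<Union>q\<in>{0::'a} \<times> {0::real..}. {p + q})" by (rule compact_closed_sums)
  also have "(\<Union>p\<in>A. \<Union>q\<in>{0::'a} \<times> {0::real..}. {p + q}) = velocity_set x"
  proof (intro set_eqI iffI)
    fix s assume "s \<in> (\<Union>p\<in>A. \<Union>q\<in>{0::'a} \<times> {0::real..}. {p + q})"
    then show "s \<in> velocity_set x" by (auto simp: A_def velocity_set_def)
  next
    fix s assume "s \<in> velocity_set x"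
    then obtain \<omega> \<mu> where s: "s = (f x \<omega>, \<mu>)" "\<omega> \<in> U" "r x \<omega> \<le> \<mu>" by (auto simp: velocity_set_def)
    then have "s = (f x \<omega>, r x \<omega>) + (0, \<mu> - r x \<omega>)" by simp
    moreover have "(f x \<omega>, r x \<omega>) \<in> A" using s(2) by (simp add: A_def)
    moreover have "(0, \<mu> - r x \<omega>) \<in> {0::'a} \<times> {0::real..}" using s(3) by simp
    ultimately show "s \<in> (\<Union>p\<in>A. \<Union>q\<in>{0::'a} \<times> {0::real..}. {p + q})" by blast
  qed
  finally show ?thesis .
qed

text \<open>Filippov's argument. Pairs of state and accumulated cost have a uniform limit by
  Arzela-Ascoli; its derivative lies in the convex velocity set, and a measurable selection recovers
  a control. The cost component of the limit is \<open>z\<close>, of which \<open>R u y\<close> may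
  use only a part.\<close>

lemma closure_trajectories:
  fixes X :: "nat \<Rightarrow> 'a"
  assumes X: "X \<longlonglongrightarrow> x" and us: "\<And>n. ctrl (us n)" and ys: "\<And>n. sol (X n) (us n) (ys n)" and T: "0 \<le> T"
  obtains u y z k where "ctrl u" "sol x u y" "strict_mono (k :: nat \<Rightarrow> nat)" "continuous_on {0..T} z"
    "\<And>e. 0 < e \<Longrightarrow> \<exists>M. \<forall>n\<ge>M. \<forall>t\<in>{0..T}. norm (ys (k n) t - y t) < e \<and> \<bar>R (us (k n)) (ys (k n)) t - z t\<bar> < e"
    "\<And>t. t \<in> {0..T} \<Longrightarrow> R u y t \<le> z t"
proof -
  obtain M0 where M0: "\<And>n. norm (X n) \<le> M0" using convergent_imp_Bseq[OF convergentI[OF X]] unfolding Bseq_def by blast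
  define Kb where "Kb = cball (0::'a) (M0 + N * T)"
  have yK: "ys n t \<in> Kb" if "t \<in> {0..T}" for n t
  proof -
    have "norm (ys n t) \<le> norm (X n) + N * t"
      using sol_lip[OF us ys, of n t 0] solD(2)[OF ys, of n] that norm_triangle_sub[of "ys n t" "X n"] by simp
    moreover have "N * t \<le> N * T" using that pos by (intro mult_left_mono) auto
    ultimately show ?thesis using M0[of n] by (simp add: Kb_def)
  qed
  have "compact Kb" by (simp add: Kb_def)
  then obtain Br where Br: "\<And>x \<omega>. x \<in> Kb \<Longrightarrow> \<omega> \<in> U \<Longrightarrow> norm (r x \<omega>) \<le> Br"
    by (rule path_bounded[OF r_cont]) (rule that)
  have "norm (r (ys 0 0) (us 0 0)) \<le> Br" by (rule Br[OF yK ctrlD(1)[OF us]]) (use T in simp)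
  then have Br0: "0 \<le> Br" by (rule order_trans[OF norm_ge_zero])
  define K where "K = N + Br"
  have K: "0 \<le> K" using pos Br0 by (simp add: K_def)
  define F where "F n t = (ys n t, R (us n) (ys n) t)" for n t
  have Rl: "\<bar>R (us n) (ys n) t - R (us n) (ys n) s\<bar> \<le> Br * (t - s)" if "0 \<le> s" "s \<le> t" "t \<le> T" for n s t
  proof -
    have "norm (R (us n) (ys n) t - R (us n) (ys n) s) \<le> Br * (t - s)"
    proof (rule ae_deriv_norm_le[OF that(2) ae_deriv_subset[OF r_path(1)[OF us ys, of T]], of "{}"])
      fix \<sigma> assume "\<sigma> \<in> {s<..<t} - {}"
      then show "norm (r (ys n \<sigma>) (us n \<sigma>)) \<le> Br" using that by (intro Br yK ctrlD(1)[OF us]) auto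
    qed (use that in auto)
    then show ?thesis by simp
  qed
  have Fl0: "norm (F n t - F n s) \<le> K * (t - s)" if "0 \<le> s" "s \<le> t" "t \<le> T" for n s t
  proof -
    have "norm (F n t - F n s) \<le> norm (ys n t - ys n s) + norm (R (us n) (ys n) t - R (us n) (ys n) s)"
      unfolding F_def diff_Pair norm_Pair by (rule sqrt_sum_squares_le_sum) auto
    also have "\<dots> \<le> N * (t - s) + Br * (t - s)"
      using sol_lip[OF us ys, of n t s] Rl[OF that, of n] that by (intro add_mono) auto
    finally show ?thesis by (simp add: K_def algebra_simps)
  qed
  have Fl: "norm (F n t - F n s) \<le> K * \<bar>t - s\<bar>" if "s \<in> {0..T}" "t \<in> {0..T}" for n s t
  proof (cases "s \<le> t")
    case True
    then show ?thesis using Fl0[of s t n] that by simp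
  next
    case False
    then have "t \<le> s" by simp
    then show ?thesis using Fl0[of t s n] that by (simp add: norm_minus_commute abs_minus_commute)
  qed
  have Fb: "norm (F n t) \<le> M0 + K * T" if "t \<in> {0..T}" for n t
  proof -
    have "norm (F n 0) = norm (X n)" using solD(2)[OF ys, of n] by (simp add: F_def R_0 norm_Pair)
    moreover have "norm (F n t) \<le> norm (F n 0) + norm (F n t - F n 0)" by (rule norm_triangle_sub)
    moreover have "K * t \<le> K * T" using that K by (intro mult_left_mono) auto
    ultimately show ?thesis using Fl[of 0 t n] that T M0[of n] by simp
  qed
  obtain h k where h: "continuous_on {0..T} h" "strict_mono (k :: nat \<Rightarrow> nat)"
    "\<And>e. 0 < e \<Longrightarrow> \<exists>M. \<forall>n t. n \<ge> M \<and> t \<in> {0..T} \<longrightarrow> norm (F (k n) t - h t) < e"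
  proof (rule Arzela_Ascoli[of "{0..T}" F "M0 + K * T"])
    fix t and e :: real assume t: "t \<in> {0..T}" and e: "0 < e"
    show "\<exists>d>0. \<forall>n y. y \<in> {0..T} \<and> norm (t - y) < d \<longrightarrow> norm (F n t - F n y) < e"
    proof (intro exI[of _ "e / (K + 1)"] conjI allI impI)
      show "0 < e / (K + 1)" using e K by simp
      fix n s assume s: "s \<in> {0..T} \<and> norm (t - s) < e / (K + 1)"
      have "norm (F n t - F n s) \<le> K * \<bar>t - s\<bar>" using Fl s t by blast
      also have "\<dots> \<le> (K + 1) * \<bar>t - s\<bar>" by (intro mult_right_mono) auto
      also have "\<dots> < (K + 1) * (e / (K + 1))" using s K by (intro mult_strict_left_mono) auto
      also have "\<dots> = e" using K by simp
      finally show "norm (F n t - F n s) < e" .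
    qed
  qed (use Fb in auto)
  have hlip: "norm (h t - h s) \<le> K * \<bar>t - s\<bar>" if st: "s \<in> {0..T}" "t \<in> {0..T}" for s t
  proof (rule field_le_epsilon)
    fix e :: real assume e: "0 < e"
    obtain n where n: "\<And>t. t \<in> {0..T} \<Longrightarrow> norm (F (k n) t - h t) < e / 2" using h(3)[of "e/2"] e by auto
    have "norm (h t - h s) = norm ((F (k n) t - F (k n) s) - (F (k n) t - h t) + (F (k n) s - h s))" by (simp add: algebra_simps)
    also have "\<dots> \<le> norm (F (k n) t - F (k n) s) + norm (F (k n) t - h t) + norm (F (k n) s - h s)"
      by (meson add_mono norm_triangle_ineq norm_triangle_ineq4 order_refl order_trans)
    finally show "norm (h t - h s) \<le> K * \<bar>t - s\<bar> + e" using n[OF st(1)] n[OF st(2)] Fl[OF st, of "k n"] by linarith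
  qed
  have hL: "K-lipschitz_on {0..T} h"
    by (rule lipschitz_onI) (use hlip K in \<open>auto simp: dist_norm abs_minus_commute norm_minus_commute\<close>)
  define y0 z where "y0 = fst \<circ> h" and "z = snd \<circ> h"
  have hyz: "h t = (y0 t, z t)" for t by (simp add: y0_def z_def)
  have y0c: "continuous_on {0..T} y0" and zc: "continuous_on {0..T} z"
    unfolding y0_def z_def o_def by (intro continuous_intros h(1))+
  have conv: "\<exists>M. \<forall>n\<ge>M. \<forall>t\<in>{0..T}. norm (ys (k n) t - y0 t) < e \<and> \<bar>R (us (k n)) (ys (k n)) t - z t\<bar> < e" if e: "0 < e" for e
  proof -
    obtain M where M: "\<forall>n t. n \<ge> M \<and> t \<in> {0..T} \<longrightarrow> norm (F (k n) t - h t) < e" using h(3)[OF e] by blast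
    show ?thesis
    proof (intro exI[of _ M] allI impI ballI)
      fix n t assume "M \<le> n" "t \<in> {0..T}"
      then have *: "norm (F (k n) t - h t) < e" using M by blast
      have "F (k n) t - h t = (ys (k n) t - y0 t, R (us (k n)) (ys (k n)) t - z t)" by (simp add: F_def hyz)
      then have "norm (ys (k n) t - y0 t) \<le> norm (F (k n) t - h t)" "norm (R (us (k n)) (ys (k n)) t - z t) \<le> norm (F (k n) t - h t)"
        using norm_fst_le[of "ys (k n) t - y0 t"] norm_snd_le[of "R (us (k n)) (ys (k n)) t - z t"] by simp_all
      then show "norm (ys (k n) t - y0 t) < e \<and> \<bar>R (us (k n)) (ys (k n)) t - z t\<bar> < e" using * by simp
    qed
  qed
  obtain w Mw where w: "w \<in> borel_measurable lebesgue" "\<And>t. norm (w t) \<le> Mw" "ae_deriv 0 T h w"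
    using lipschitz_imp_integral[OF T hL] by metis
  obtain E where E: "negligible E" "\<And>t. t \<in> {0<..<T} - E \<Longrightarrow> (h has_vector_derivative w t) (at t)"
    using w(3) unfolding ae_deriv_def by blast
  \<comment> \<open>Otherwise a hyperplane separates \<open>w t\<close> from the velocity set at
    \<open>y0 t\<close>. All nearby approximating paths then advance in its normal direction faster
    than \<open>h\<close> does at \<open>t\<close>.\<close>
  have inF: "w t \<in> velocity_set (y0 t)" if t: "t \<in> {0<..<T} - E" for t
  proof (rule ccontr)
    assume notin: "w t \<notin> velocity_set (y0 t)"
    have "convex (velocity_set (y0 t))" using velocity_convex[of "y0 t"] by (simp add: velocity_set_def)
    then obtain a b where ab: "a \<bullet> w t < b" "\<And>s. s \<in> velocity_set (y0 t) \<Longrightarrow> b < a \<bullet> s"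
      using separating_hyperplane_closed_point[OF _ velocity_set_closed notin] by blast
    define a1 a2 where "a1 = fst a" and "a2 = snd a"
    have aeq: "a \<bullet> (v, \<nu>) = a1 \<bullet> v + a2 * \<nu>" for v \<nu> by (cases a) (simp add: a1_def a2_def)
    have below: "b < a1 \<bullet> f (y0 t) \<omega> + a2 * \<nu>" if "\<omega> \<in> U" "r (y0 t) \<omega> \<le> \<nu>" for \<omega> \<nu>
      using ab(2)[of "(f (y0 t) \<omega>, \<nu>)"] that by (auto simp: velocity_set_def aeq)
    obtain \<omega>0 where \<omega>0: "\<omega>0 \<in> U" using U(1) by blast
    \<comment> \<open>Cost rates in the velocity set are unbounded above, so the normal cannot point
      downward in that coordinate.\<close>
    have a2: "0 \<le> a2"
    proof (rule ccontr)
      assume "\<not> 0 \<le> a2"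
      then have neg: "a2 < 0" by simp
      define \<nu> where "\<nu> = max (r (y0 t) \<omega>0) ((b - a1 \<bullet> f (y0 t) \<omega>0) / a2)"
      have "a2 * \<nu> \<le> a2 * ((b - a1 \<bullet> f (y0 t) \<omega>0) / a2)" using neg by (intro mult_left_mono_neg) (auto simp: \<nu>_def)
      then show False using below[OF \<omega>0, of \<nu>] neg by (simp add: \<nu>_def)
    qed
    define A where "A = (norm a1 + a2) * L"
    have A: "0 \<le> A" using a2 pos by (simp add: A_def)
    define \<psi> where "\<psi> s = a \<bullet> h s" for s
    \<comment> \<open>The loss \<open>A * K * \<eta>\<close> comes from the motion of the limit
      state during time \<eta>. The further error \<open>e'\<close>, from replacing \<open>h\<close>
      by an approximating path, is made to disappear through \<open>e\<close>.\<close>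
    have key: "(b - A * K * \<eta>) * \<eta> \<le> \<psi> (t + \<eta>) - \<psi> t" if \<eta>: "0 < \<eta>" "t + \<eta> < T" for \<eta>
    proof (rule field_le_epsilon)
      fix e :: real assume e: "0 < e"
      define e' where "e' = e / (A * \<eta> + 2 * norm a + 1)"
      have den: "0 < A * \<eta> + 2 * norm a + 1" using A \<eta> by (intro add_nonneg_pos add_nonneg_nonneg mult_nonneg_nonneg) auto
      have e': "0 < e'" "e' * (A * \<eta> + 2 * norm a + 1) = e" using e den by (auto simp: e'_def)
      obtain M where M: "\<forall>n t. n \<ge> M \<and> t \<in> {0..T} \<longrightarrow> norm (F (k n) t - h t) < e'" using h(3)[OF e'(1)] by blast
      define Y where "Y = ys (k M)"
      define u0 where "u0 = us (k M)"
      have FM: "norm (F (k M) s - h s) < e'" if "s \<in> {0..T}" for s using M that by blast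
      have Yh: "norm (Y s - y0 s) < e'" if "s \<in> {0..T}" for s
      proof -
        have "norm (Y s - y0 s) \<le> norm (F (k M) s - h s)"
          using norm_fst_le[of "Y s - y0 s"] by (simp add: F_def hyz Y_def)
        then show ?thesis using FM[OF that] by linarith
      qed
      have u0U: "u0 s \<in> U" for s unfolding u0_def by (rule ctrlD(1)[OF us])
      have "(b - A * (e' + K * \<eta>)) * ((t + \<eta>) - t) \<le> a \<bullet> F (k M) (t + \<eta>) - a \<bullet> F (k M) t"
      proof -
        have "(- (a1 \<bullet> Y (t + \<eta>) + a2 *\<^sub>R R u0 Y (t + \<eta>))) - (- (a1 \<bullet> Y t + a2 *\<^sub>R R u0 Y t)) \<le> (- (b - A * (e' + K * \<eta>))) * ((t + \<eta>) - t)"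
        proof (rule ae_deriv_le[of t "t + \<eta>" "\<lambda>s. - (a1 \<bullet> Y s + a2 *\<^sub>R R u0 Y s)" "\<lambda>s. - (a1 \<bullet> f (Y s) (u0 s) + a2 *\<^sub>R r (Y s) (u0 s))" "{}"])
          have "ae_deriv 0 T (\<lambda>s. - (a1 \<bullet> Y s + a2 *\<^sub>R R u0 Y s)) (\<lambda>s. - (a1 \<bullet> f (Y s) (u0 s) + a2 *\<^sub>R r (Y s) (u0 s)))"
            unfolding Y_def u0_def
            by (intro ae_deriv_minus ae_deriv_add ae_deriv_linear[OF bounded_linear_inner_right] ae_deriv_cmult
                solD(4)[OF ys] r_path(1)[OF us ys])
          then show "ae_deriv t (t + \<eta>) (\<lambda>s. - (a1 \<bullet> Y s + a2 *\<^sub>R R u0 Y s)) (\<lambda>s. - (a1 \<bullet> f (Y s) (u0 s) + a2 *\<^sub>R r (Y s) (u0 s)))"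
            by (rule ae_deriv_subset) (use t \<eta> in auto)
          fix s assume s: "s \<in> {t<..<t + \<eta>} - {}"
          then have sT: "s \<in> {0..T}" "t \<in> {0..T}" using t \<eta> by auto
          have "norm (y0 s - y0 t) \<le> norm (h s - h t)" using norm_fst_le[of "y0 s - y0 t"] by (simp add: hyz)
          also have "\<dots> \<le> K * \<eta>" using hlip[OF sT(2,1)] s K mult_left_mono[of "\<bar>s - t\<bar>" \<eta> K] by auto
          finally have "norm (y0 s - y0 t) \<le> K * \<eta>" .
          then have dY: "norm (Y s - y0 t) \<le> e' + K * \<eta>"
            using Yh[OF sT(1)] norm_triangle_ineq[of "Y s - y0 s" "y0 s - y0 t"] by simp
          have "\<bar>a1 \<bullet> (f (Y s) (u0 s) - f (y0 t) (u0 s))\<bar> \<le> norm a1 * norm (f (Y s) (u0 s) - f (y0 t) (u0 s))"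
            by (rule Cauchy_Schwarz_ineq2)
          also have "\<dots> \<le> norm a1 * (L * norm (Y s - y0 t))" using f_lip[OF u0U] by (intro mult_left_mono) auto
          finally have 1: "\<bar>a1 \<bullet> (f (Y s) (u0 s) - f (y0 t) (u0 s))\<bar> \<le> norm a1 * (L * norm (Y s - y0 t))" .
          have 2: "\<bar>a2 * (r (Y s) (u0 s) - r (y0 t) (u0 s))\<bar> \<le> a2 * (L * norm (Y s - y0 t))"
            unfolding abs_mult using r_lip[OF u0U[of s], of "Y s" "y0 t"] a2 by (simp add: mult_left_mono)
          have 3: "A * norm (Y s - y0 t) \<le> A * (e' + K * \<eta>)" using dY A by (rule mult_left_mono)
          have "b < a1 \<bullet> f (y0 t) (u0 s) + a2 * r (y0 t) (u0 s)" by (rule below[OF u0U order_refl])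
          then show "- (a1 \<bullet> f (Y s) (u0 s) + a2 *\<^sub>R r (Y s) (u0 s)) \<le> - (b - A * (e' + K * \<eta>))"
            using 1 2 3 by (simp add: A_def inner_diff_right algebra_simps abs_le_iff)
        qed (use \<eta> in auto)
        then show ?thesis unfolding F_def aeq Y_def[symmetric] u0_def[symmetric]
          by (simp add: left_diff_distrib)
      qed
      moreover have "\<bar>a \<bullet> (F (k M) s - h s)\<bar> \<le> norm a * e'" if "s \<in> {0..T}" for s
        using Cauchy_Schwarz_ineq2[of a "F (k M) s - h s"] mult_left_mono[OF less_imp_le[OF FM[OF that]] norm_ge_zero[of a]] by linarith
      from this[of t] this[of "t + \<eta>"] have "\<bar>a \<bullet> F (k M) t - \<psi> t\<bar> \<le> norm a * e'" "\<bar>a \<bullet> F (k M) (t + \<eta>) - \<psi> (t + \<eta>)\<bar> \<le> norm a * e'"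
        using t \<eta> by (simp_all add: \<psi>_def inner_diff_right)
      ultimately have "(b - A * (e' + K * \<eta>)) * \<eta> \<le> \<psi> (t + \<eta>) - \<psi> t + 2 * (norm a * e')" by (simp add: abs_le_iff)
      then have "(b - A * K * \<eta>) * \<eta> \<le> \<psi> (t + \<eta>) - \<psi> t + e' * (A * \<eta> + 2 * norm a)" by (simp add: algebra_simps)
      moreover have "e' * (A * \<eta> + 2 * norm a) \<le> e" using e' by (simp add: algebra_simps)
      ultimately show "(b - A * K * \<eta>) * \<eta> \<le> \<psi> (t + \<eta>) - \<psi> t + e" by linarith
    qed
    define d where "d = a \<bullet> w t"
    have db: "d < b" using ab(1) by (simp add: d_def)
    have "((\<lambda>s. ((d + b) / 2) * s - \<psi> s) has_real_derivative (d + b) / 2 - d) (at t)"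
      unfolding \<psi>_def d_def has_real_derivative_iff_has_vector_derivative
      by (intro has_vector_derivative_diff bounded_linear.has_vector_derivative[OF bounded_linear_inner_right E(2)[OF t]])
        (auto intro!: derivative_eq_intros simp: has_real_derivative_iff_has_vector_derivative[symmetric])
    then obtain \<delta> where \<delta>: "\<delta> > 0" "\<And>\<eta>. 0 < \<eta> \<Longrightarrow> \<eta> < \<delta> \<Longrightarrow> ((d + b) / 2) * t - \<psi> t < ((d + b) / 2) * (t + \<eta>) - \<psi> (t + \<eta>)"
      using DERIV_pos_inc_right[of "\<lambda>s. ((d + b) / 2) * s - \<psi> s" "(d + b) / 2 - d" t] db by auto
    \<comment> \<open>The last bound keeps the loss \<open>A * K * \<eta>\<close> below half of the
      gap between \<open>d\<close> and \<open>b\<close>.\<close>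
    define \<eta> where "\<eta> = min (min (\<delta> / 2) ((T - t) / 2)) ((b - d) / (2 * (A * K + 1)))"
    have AK: "0 \<le> A * K" using A K by simp
    have \<eta>: "0 < \<eta>" "\<eta> < \<delta>" "t + \<eta> < T"
    proof -
      have "0 < (b - d) / (2 * (A * K + 1))" using db AK by (intro divide_pos_pos) auto
      then show "0 < \<eta>" using \<delta>(1) t by (simp add: \<eta>_def)
      have "\<eta> \<le> \<delta> / 2" "\<eta> \<le> (T - t) / 2" unfolding \<eta>_def by (meson min.cobounded1 min.cobounded2 order_trans)+
      then show "\<eta> < \<delta>" "t + \<eta> < T" using \<delta>(1) t by (auto simp: field_simps)
    qed
    have "(b - A * K * \<eta>) * \<eta> < (d + b) / 2 * \<eta>" using key[OF \<eta>(1,3)] \<delta>(2)[OF \<eta>(1,2)] by (simp add: distrib_left)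
    then have "b - A * K * \<eta> < (d + b) / 2" using \<eta>(1) by simp
    moreover have "A * K * \<eta> \<le> (b - d) / 2"
    proof -
      have "A * K * \<eta> \<le> A * K * ((b - d) / (2 * (A * K + 1)))" using AK by (intro mult_left_mono) (auto simp: \<eta>_def)
      also have "\<dots> = (b - d) / 2 * (A * K / (A * K + 1))" by simp
      also have "\<dots> \<le> (b - d) / 2 * 1" using db AK by (intro mult_left_mono) (auto simp: divide_le_eq_1)
      finally show ?thesis by simp
    qed
    ultimately have "b - (b - d) / 2 < (d + b) / 2" by linarith
    then show False by (simp add: field_simps)
  qed
  define D where "D = {0<..<T} - E"
  have Dm: "D \<in> sets lebesgue" unfolding D_def using negligible_imp_sets[OF E(1)] by auto
  define yh where "yh s = y0 (max 0 (min T s))" for s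
  have yhc: "continuous_on UNIV yh" unfolding yh_def
    by (rule continuous_on_compose2[OF y0c]) (use T in \<open>auto intro!: continuous_intros\<close>)
  have yhD: "yh s = y0 s" if "s \<in> D" for s using that by (simp add: yh_def D_def)
  \<comment> \<open>A zero is a control that realises the velocity at no more than the given cost
    rate. Off \<open>D\<close> the function is set to 0 so that zeros exist at all times.\<close>
  define \<Phi> where "\<Phi> s \<omega> = (if s \<in> D then norm (f (yh s) \<omega> - fst (w s)) + max 0 (r (yh s) \<omega> - snd (w s)) else 0)" for s \<omega>
  have "\<exists>u. u \<in> borel_measurable lebesgue \<and> (\<forall>s. u s \<in> U) \<and> (\<forall>s. \<Phi> s (u s) = 0)"
  proof -
    have 1: "(\<lambda>s. \<Phi> s \<omega>) \<in> borel_measurable lebesgue" if \<omega>: "\<omega> \<in> U" for \<omega>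
    proof -
      have fm: "(\<lambda>s. f (yh s) \<omega>) \<in> borel_measurable lebesgue" "(\<lambda>s. r (yh s) \<omega>) \<in> borel_measurable lebesgue"
        using path_measurable[OF f_cont yhc ctrl_const[OF \<omega>]] path_measurable[OF r_cont yhc ctrl_const[OF \<omega>]] by auto
      have wm: "(\<lambda>s. fst (w s)) \<in> borel_measurable lebesgue" "(\<lambda>s. snd (w s)) \<in> borel_measurable lebesgue"
        by (rule measurable_compose[OF w(1)] borel_measurable_continuous_onI continuous_on_fst continuous_on_snd continuous_on_id)+
      have "(\<lambda>s. norm (f (yh s) \<omega> - fst (w s)) + max 0 (r (yh s) \<omega> - snd (w s))) \<in> borel_measurable lebesgue"
        using fm wm by measurable
      then show ?thesis unfolding \<Phi>_def by (rule measurable_If_set) (use Dm in simp_all)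
    qed
    have 2: "continuous_on U (\<Phi> s)" for s
    proof (cases "s \<in> D")
      case True
      then show ?thesis unfolding \<Phi>_def by (auto intro!: continuous_intros continuous_on_control[OF f_cont] continuous_on_control[OF r_cont])
    qed (simp add: \<Phi>_def)
    have 3: "0 \<le> \<Phi> s \<omega>" for s \<omega> by (simp add: \<Phi>_def)
    have 4: "\<exists>\<omega>\<in>U. \<Phi> s \<omega> = 0" for s
    proof (cases "s \<in> D")
      case True
      then have "w s \<in> velocity_set (yh s)" using inF[of s] yhD[OF True] by (simp add: D_def)
      then obtain \<omega> where "\<omega> \<in> U" "fst (w s) = f (yh s) \<omega>" "r (yh s) \<omega> \<le> snd (w s)"
        by (cases "w s") (auto simp: velocity_set_def)
      then show ?thesis by (intro bexI[of _ \<omega>]) (auto simp: \<Phi>_def)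
    qed (use U(1) in \<open>auto simp: \<Phi>_def\<close>)
    show ?thesis by (rule measurable_zero_selection[OF U(2) 1 2 3 4]) auto
  qed
  then obtain u where u: "u \<in> borel_measurable lebesgue" "\<And>s. u s \<in> U" "\<And>s. \<Phi> s (u s) = 0" by blast
  have uc: "ctrl u" using u by (simp add: ctrl_def)
  have uD: "fst (w s) = f (y0 s) (u s)" "r (y0 s) (u s) \<le> snd (w s)" if "s \<in> D" for s
  proof -
    have "norm (f (yh s) (u s) - fst (w s)) + max 0 (r (yh s) (u s) - snd (w s)) = 0" using u(3)[of s] that by (simp add: \<Phi>_def)
    moreover have "0 \<le> norm (f (yh s) (u s) - fst (w s))" "0 \<le> max 0 (r (yh s) (u s) - snd (w s))" by auto
    ultimately have "norm (f (yh s) (u s) - fst (w s)) = 0" "max 0 (r (yh s) (u s) - snd (w s)) = 0" by linarith+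
    then show "fst (w s) = f (y0 s) (u s)" "r (y0 s) (u s) \<le> snd (w s)" using yhD[OF that] by (auto simp: max_def split: if_splits)
  qed
  have h0: "h 0 = (x, 0)"
  proof -
    have "(\<lambda>n. F (k n) 0) \<longlonglongrightarrow> h 0"
    proof (rule LIMSEQ_I)
      fix e :: real assume "0 < e"
      then show "\<exists>no. \<forall>n\<ge>no. norm (F (k n) 0 - h 0) < e" using h(3)[of e] T by auto
    qed
    moreover have "(\<lambda>n. F (k n) 0) = (\<lambda>n. ((X \<circ> k) n, 0))" using solD(2)[OF ys] by (simp add: F_def R_0)
    moreover have "(\<lambda>n. ((X \<circ> k) n, 0::real)) \<longlonglongrightarrow> (x, 0)"
      by (intro tendsto_Pair LIMSEQ_subseq_LIMSEQ[OF X h(2)] tendsto_const)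
    ultimately show ?thesis using LIMSEQ_unique by metis
  qed
  obtain y where y: "sol x u y" using sol_exists[OF uc] by blast
  have y0d: "ae_deriv 0 T y0 (\<lambda>t. f (y0 t) (u t))"
  proof (rule ae_derivI[OF _ E(1)])
    show "K-lipschitz_on {0..T} y0"
    proof (rule lipschitz_onI)
      fix s t assume "s \<in> {0..T}" "t \<in> {0..T}"
      then show "dist (y0 s) (y0 t) \<le> K * dist s t"
        using hlip[of t s] norm_fst_le[of "y0 s - y0 t" "z s - z t"] by (simp add: hyz dist_norm)
    qed (rule K)
    fix t assume t: "t \<in> {0<..<T} - E"
    have "(y0 has_vector_derivative fst (w t)) (at t)"
      unfolding y0_def o_def by (rule bounded_linear.has_vector_derivative[OF bounded_linear_fst E(2)[OF t]])
    then show "(y0 has_vector_derivative f (y0 t) (u t)) (at t)" using uD(1)[of t] t by (simp add: D_def)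
  qed
  have yy: "y t = y0 t" if "t \<in> {0..T}" for t
    by (rule sol_unique_on[OF uc y y0d _ that]) (use h0 in \<open>simp add: y0_def\<close>)
  have Rz: "R u y t \<le> z t" if t: "t \<in> {0..T}" for t
  proof -
    have zd: "ae_deriv 0 T z (\<lambda>t. snd (w t))"
      unfolding z_def o_def by (rule ae_deriv_linear[OF bounded_linear_snd w(3)])
    have "(R u y t - z t) - (R u y 0 - z 0) \<le> 0 * (t - 0)"
    proof (rule ae_deriv_le[of 0 t "\<lambda>t. R u y t - z t" "\<lambda>t. r (y t) (u t) - snd (w t)" E])
      show "ae_deriv 0 t (\<lambda>t. R u y t - z t) (\<lambda>t. r (y t) (u t) - snd (w t))"
        by (intro ae_deriv_diff r_path(1)[OF uc y] ae_deriv_subset[OF zd]) (use t in auto)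
      fix s assume s: "s \<in> {0<..<t} - E"
      then have "s \<in> D" "s \<in> {0..T}" using t by (auto simp: D_def)
      then show "r (y s) (u s) - snd (w s) \<le> 0" using uD(2)[of s] yy[of s] by simp
    qed (use t E(1) in auto)
    then show ?thesis using h0 by (simp add: R_0 z_def)
  qed
  show thesis by (rule that[OF uc y h(2) zc _ Rz]) (use conv yy in simp)
qed

text \<open>One statement for two uses: minimizing sequences from a fixed point give existence, and
  optimal paths from converging points give stability. The assumption
  \<open>ereal l \<le> V x\<close> turns semicontinuity of the cost into equality.\<close>

lemma opt_limit:
  fixes X :: "nat \<Rightarrow> 'a"
  assumes X: "X \<longlonglongrightarrow> x" and x: "x \<in> closure (- S)" and XS: "\<And>n. X n \<in> closure (- S)"
    and us: "\<And>n. ctrl (us n)" and ys: "\<And>n. sol (X n) (us n) (ys n)" and hs: "\<And>n. hit (ys n) (\<tau>s n)"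
    and cost: "(\<lambda>n. R (us n) (ys n) (\<tau>s n) + g (ys n (\<tau>s n))) \<longlonglongrightarrow> l" and l: "ereal l \<le> V x"
  obtains u y \<tau> k T where "opt x u y \<tau>" "strict_mono (k :: nat \<Rightarrow> nat)" "(\<lambda>n. \<tau>s (k n)) \<longlonglongrightarrow> \<tau>"
    "(\<lambda>n. ys (k n) (\<tau>s (k n))) \<longlonglongrightarrow> y \<tau>" "\<And>n. \<tau>s n \<le> T" "\<tau> \<le> T" "0 \<le> T"
    "\<And>e. 0 < e \<Longrightarrow> \<exists>M. \<forall>n\<ge>M. \<forall>t\<in>{0..T}. norm (ys (k n) t - y t) < e"
proof -
  define z0 where "z0 = ys 0 (\<tau>s 0)"
  have z0: "z0 \<in> frontier S" unfolding z0_def by (rule hit_frontier[OF ys hs XS])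
  define a0 where "a0 = r\<^sub>0 - G * N"
  have a0: "0 < a0" using G by (simp add: a0_def)
  obtain B1 where B1: "\<And>n. norm (X n) \<le> B1" using convergent_imp_Bseq[OF convergentI[OF X]] unfolding Bseq_def by blast
  obtain B2 where B2: "\<And>n. norm (R (us n) (ys n) (\<tau>s n) + g (ys n (\<tau>s n))) \<le> B2"
    using convergent_imp_Bseq[OF convergentI[OF cost]] unfolding Bseq_def by blast
  \<comment> \<open>Solving the lower bound on the cost for the exit time, with the costs and
    initial points bounded by convergence.\<close>
  define T where "T = (B2 + \<bar>g z0\<bar> + G * (B1 + norm z0)) / a0"
  have \<tau>0: "0 \<le> \<tau>s n" for n using hs[of n] by (simp add: hit_def)
  have \<tau>T: "\<tau>s n \<le> T" for n
  proof -
    have "norm (X n - z0) \<le> B1 + norm z0" using norm_triangle_ineq4[of "X n" z0] B1[of n] by linarith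
    then have "G * norm (X n - z0) \<le> G * (B1 + norm z0)" using G(1) by (rule mult_left_mono)
    then have "a0 * \<tau>s n \<le> B2 + \<bar>g z0\<bar> + G * (B1 + norm z0)"
      using cost_lower_bound[OF us ys hs XS z0, of n] B2[of n] unfolding a0_def real_norm_def by linarith
    then show ?thesis using a0 by (simp add: T_def pos_le_divide_eq mult.commute)
  qed
  have T0: "0 \<le> T" using \<tau>0[of 0] \<tau>T[of 0] by linarith
  obtain u y z k where *: "ctrl u" "sol x u y" "strict_mono (k :: nat \<Rightarrow> nat)" "continuous_on {0..T} z"
    "\<And>e. 0 < e \<Longrightarrow> \<exists>M. \<forall>n\<ge>M. \<forall>t\<in>{0..T}. norm (ys (k n) t - y t) < e \<and> \<bar>R (us (k n)) (ys (k n)) t - z t\<bar> < e"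
    "\<And>t. t \<in> {0..T} \<Longrightarrow> R u y t \<le> z t"
    by (rule closure_trajectories[OF X us ys T0]) blast
  have "compact {0..T}" by simp
  moreover have "\<forall>n. (\<tau>s \<circ> k) n \<in> {0..T}" using \<tau>0 \<tau>T by simp
  ultimately obtain \<tau> k' where \<tau>: "\<tau> \<in> {0..T}" "strict_mono (k' :: nat \<Rightarrow> nat)" "((\<tau>s \<circ> k) \<circ> k') \<longlonglongrightarrow> \<tau>"
    unfolding compact_def by metis
  define j where "j = k \<circ> k'"
  have j: "strict_mono j" unfolding j_def by (rule strict_mono_o[OF *(3) \<tau>(2)])
  have \<tau>j: "(\<lambda>n. \<tau>s (j n)) \<longlonglongrightarrow> \<tau>" using \<tau>(3) by (simp add: j_def o_def)
  have unif: "\<exists>M. \<forall>n\<ge>M. \<forall>t\<in>{0..T}. norm (ys (j n) t - y t) < e \<and> \<bar>R (us (j n)) (ys (j n)) t - z t\<bar> < e" if e: "0 < e" for e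
  proof -
    obtain M where M: "\<forall>n\<ge>M. \<forall>t\<in>{0..T}. norm (ys (k n) t - y t) < e \<and> \<bar>R (us (k n)) (ys (k n)) t - z t\<bar> < e"
      using *(5)[OF e] by blast
    have "M \<le> k' n" if "M \<le> n" for n using seq_suble[OF \<tau>(2), of n] that by linarith
    then show ?thesis using M by (intro exI[of _ M]) (auto simp: j_def)
  qed
  have tT: "\<tau>s (j n) \<in> {0..T}" for n using \<tau>0 \<tau>T by simp
  have ylim: "(\<lambda>n. ys (j n) (\<tau>s (j n))) \<longlonglongrightarrow> y \<tau>"
  proof -
    have "(\<lambda>n. ys (j n) (\<tau>s (j n)) - y (\<tau>s (j n))) \<longlonglongrightarrow> 0"
    proof (rule LIMSEQ_I)
      fix e :: real assume "0 < e"
      then show "\<exists>no. \<forall>n\<ge>no. norm (ys (j n) (\<tau>s (j n)) - y (\<tau>s (j n)) - 0) < e" using unif[of e] tT by fastforce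
    qed
    moreover have "(\<lambda>n. y (\<tau>s (j n))) \<longlonglongrightarrow> y \<tau>"
      by (rule continuous_on_tendsto_compose[OF solD(1)[OF *(2), of UNIV] \<tau>j]) auto
    ultimately have "(\<lambda>n. (ys (j n) (\<tau>s (j n)) - y (\<tau>s (j n))) + y (\<tau>s (j n))) \<longlonglongrightarrow> 0 + y \<tau>" by (rule tendsto_add)
    then show ?thesis by simp
  qed
  have Rlim: "(\<lambda>n. R (us (j n)) (ys (j n)) (\<tau>s (j n))) \<longlonglongrightarrow> z \<tau>"
  proof -
    have "(\<lambda>n. R (us (j n)) (ys (j n)) (\<tau>s (j n)) - z (\<tau>s (j n))) \<longlonglongrightarrow> 0"
    proof (rule LIMSEQ_I)
      fix e :: real assume "0 < e"
      then show "\<exists>no. \<forall>n\<ge>no. norm (R (us (j n)) (ys (j n)) (\<tau>s (j n)) - z (\<tau>s (j n)) - 0) < e" using unif[of e] tT by fastforce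
    qed
    moreover have "(\<lambda>n. z (\<tau>s (j n))) \<longlonglongrightarrow> z \<tau>"
      by (rule continuous_on_tendsto_compose[OF *(4) \<tau>j \<tau>(1)]) (use tT in auto)
    ultimately have "(\<lambda>n. (R (us (j n)) (ys (j n)) (\<tau>s (j n)) - z (\<tau>s (j n))) + z (\<tau>s (j n))) \<longlonglongrightarrow> 0 + z \<tau>" by (rule tendsto_add)
    then show ?thesis by simp
  qed
  have fr: "ys (j n) (\<tau>s (j n)) \<in> frontier S" for n by (rule hit_frontier[OF ys hs XS])
  have yf: "y \<tau> \<in> frontier S" by (rule closed_sequentially[OF frontier_closed fr ylim])
  have glim: "(\<lambda>n. g (ys (j n) (\<tau>s (j n)))) \<longlonglongrightarrow> g (y \<tau>)"
  proof (rule Lim_null_comparison[THEN LIM_zero_cancel])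
    show "\<forall>\<^sub>F n in sequentially. norm (g (ys (j n) (\<tau>s (j n))) - g (y \<tau>)) \<le> G * norm (ys (j n) (\<tau>s (j n)) - y \<tau>)"
      by (intro always_eventually allI) (unfold real_norm_def, rule g_frontier_lip[OF fr yf])
    show "(\<lambda>n. G * norm (ys (j n) (\<tau>s (j n)) - y \<tau>)) \<longlonglongrightarrow> 0"
      by (rule tendsto_mult_right_zero[OF tendsto_norm_zero[OF LIM_zero[OF ylim]]])
  qed
  have "(\<lambda>n. R (us (j n)) (ys (j n)) (\<tau>s (j n)) + g (ys (j n) (\<tau>s (j n)))) \<longlonglongrightarrow> l"
    using LIMSEQ_subseq_LIMSEQ[OF cost j] by (simp add: o_def)
  then have leq: "l = z \<tau> + g (y \<tau>)" using tendsto_add[OF Rlim glim] LIMSEQ_unique by blast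
  have yS: "y \<tau> \<in> S" using yf S frontier_subset_closed by blast
  have "0 \<le> \<tau>" using \<tau>(1) by simp
  then obtain \<tau>' where h: "hit y \<tau>'" "\<tau>' \<le> \<tau>" using yS by (rule hit_exists[OF solD(1)[OF *(2)]])
  \<comment> \<open>If the limit curve hit the target before \<tau>, stopping there would cost
    strictly less than \<open>l\<close>, hence less than \<open>V x\<close>.\<close>
  have "R u y \<tau>' + g (y \<tau>') + a0 * (\<tau> - \<tau>') \<le> R u y \<tau> + g (y \<tau>)"
    unfolding a0_def by (rule later_cost[OF *(1,2) h(1) x h(2) yf])
  moreover have "R u y \<tau> + g (y \<tau>) \<le> l" using *(6)[OF \<tau>(1)] leq by simp
  moreover have "l \<le> R u y \<tau>' + g (y \<tau>')" using order_trans[OF l V_le[OF *(1,2) h(1)]] by simp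
  moreover have "0 \<le> a0 * (\<tau> - \<tau>')" using a0 h(2) by simp
  ultimately have eq: "a0 * (\<tau> - \<tau>') = 0" "l = R u y \<tau>' + g (y \<tau>')" by linarith+
  then have \<tau>\<tau>: "\<tau>' = \<tau>" using a0 by simp
  have "V x = ereal (R u y \<tau>' + g (y \<tau>'))" using V_le[OF *(1,2) h(1)] l eq(2) by (simp add: antisym)
  then have "opt x u y \<tau>" using *(1,2) h(1) unfolding \<tau>\<tau> opt_def by blast
  moreover have "\<exists>M. \<forall>n\<ge>M. \<forall>t\<in>{0..T}. norm (ys (j n) t - y t) < e" if e: "0 < e" for e
    using unif[OF e] by blast
  moreover have "\<tau> \<le> T" using \<tau>(1) by simp
  ultimately show thesis using \<tau>T T0 by (intro that[of u y \<tau> j T, OF _ j \<tau>j ylim]) auto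
qed

lemma opt_exists:
  assumes x: "x \<in> reach" "x \<in> closure (- S)"
  obtains u y \<tau> where "opt x u y \<tau>"
proof -
  have Vx: "V x = ereal (Vr x)" by (rule V_finite[OF x])
  have "\<exists>u y \<tau>. ctrl u \<and> sol x u y \<and> hit y \<tau> \<and> R u y \<tau> + g (y \<tau>) < Vr x + 1 / Suc n" for n :: nat
  proof -
    have "V x < ereal (Vr x + 1 / Suc n)" by (subst Vx) simp
    then have "Inf (ereal ` {c. J x c}) < ereal (Vr x + 1 / Suc n)" unfolding V_eq .
    then obtain c where "J x c" "c < Vr x + 1 / Suc n" unfolding Inf_less_iff by auto
    then show ?thesis unfolding J_def by blast
  qed
  then obtain us ys \<tau>s where "\<forall>n. ctrl (us n) \<and> sol x (us n) (ys n) \<and> hit (ys n) (\<tau>s n) \<and>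
      R (us n) (ys n) (\<tau>s n) + g (ys n (\<tau>s n)) < Vr x + 1 / Suc n" by metis
  then have *: "\<And>n. ctrl (us n)" "\<And>n. sol x (us n) (ys n)" "\<And>n. hit (ys n) (\<tau>s n)"
    "\<And>n. R (us n) (ys n) (\<tau>s n) + g (ys n (\<tau>s n)) < Vr x + 1 / Suc n" by auto
  have ge: "Vr x \<le> R (us n) (ys n) (\<tau>s n) + g (ys n (\<tau>s n))" for n
    using V_le[OF *(1,2,3), of n] unfolding Vx[symmetric] by (subst (asm) Vx) simp
  have "(\<lambda>n. R (us n) (ys n) (\<tau>s n) + g (ys n (\<tau>s n))) \<longlonglongrightarrow> Vr x"
  proof (rule tendsto_sandwich[OF _ _ tendsto_const])
    show "\<forall>\<^sub>F n in sequentially. Vr x \<le> R (us n) (ys n) (\<tau>s n) + g (ys n (\<tau>s n))" using ge by simp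
    show "\<forall>\<^sub>F n in sequentially. R (us n) (ys n) (\<tau>s n) + g (ys n (\<tau>s n)) \<le> Vr x + 1 / Suc n"
      using *(4) by (intro always_eventually allI less_imp_le)
    show "(\<lambda>n. Vr x + 1 / Suc n) \<longlonglongrightarrow> Vr x"
      using tendsto_add[OF tendsto_const LIMSEQ_inverse_real_of_nat, of "Vr x"] by (simp add: inverse_eq_divide)
  qed
  then have lim: "(\<lambda>n. R (us n) (ys n) (\<tau>s n) + g (ys n (\<tau>s n))) \<longlonglongrightarrow> Vr x" .
  have l: "ereal (Vr x) \<le> V x" using Vx by (rule eq_refl[OF sym])
  have *: "\<exists>u y \<tau>. opt x u y \<tau>"
    by (rule opt_limit[where X = "\<lambda>_. x", OF tendsto_const x(2) x(2) *(1,2,3) lim l]) (intro exI)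
  then show thesis using that by auto
qed

end

section \<open>Hamiltonian systems and uniqueness of optimal trajectories\<close>

lemma ae_deriv_cong_ae:
  assumes "ae_deriv a b y w" "negligible E" "\<And>t. t \<in> {a<..<b} - E \<Longrightarrow> w' t = w t"
  shows "ae_deriv a b y w'"
proof -
  obtain K E' where *: "K-lipschitz_on {a..b} y" "negligible E'"
    "\<And>t. t \<in> {a<..<b} - E' \<Longrightarrow> (y has_vector_derivative w t) (at t)"
    by (rule ae_derivE[OF assms(1)]) (rule that)
  show ?thesis
  proof (rule ae_derivI[OF *(1) negligible_Un[OF *(2) assms(2)]])
    fix t assume "t \<in> {a<..<b} - (E' \<union> E)"
    then have "t \<in> {a<..<b} - E'" "t \<in> {a<..<b} - E" by auto
    then show "(y has_vector_derivative w' t) (at t)" using *(3) assms(3) by metis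
  qed
qed

lemma continuous_le_off_negligible:
  fixes \<phi> :: "real \<Rightarrow> real"
  assumes \<phi>: "continuous_on {a..b} \<phi>" and ab: "a < b" and E: "negligible E"
    and le: "\<And>t. t \<in> {a<..<b} - E \<Longrightarrow> \<phi> t \<le> c" and t: "t \<in> {a..b}"
  shows "\<phi> t \<le> c"
proof (rule ccontr)
  assume "\<not> \<phi> t \<le> c"
  then have "0 < \<phi> t - c" by simp
  then obtain d where d: "0 < d" "\<And>s. s \<in> {a..b} \<Longrightarrow> dist s t < d \<Longrightarrow> dist (\<phi> s) (\<phi> t) < \<phi> t - c"
    using \<phi> t unfolding continuous_on_iff by blast
  define I where "I = {max a (t - d)<..<min b (t + d)}"
  have "I \<subseteq> E"
  proof
    fix s assume s: "s \<in> I"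
    then have "dist (\<phi> s) (\<phi> t) < \<phi> t - c" by (intro d(2)) (auto simp: I_def dist_real_def)
    then have "c < \<phi> s" unfolding dist_real_def by linarith
    then show "s \<in> E" using le[of s] s by (force simp: I_def)
  qed
  then have "negligible I" by (rule negligible_subset[OF E])
  moreover have "I \<noteq> {}" using ab t d(1) by (simp add: I_def min_def max_def not_le)
  moreover have "open I" by (simp add: I_def)
  ultimately show False using open_not_negligible by blast
qed

lemma C11_with_gradient_lipschitz_on_compact:
  fixes h :: "'c::euclidean_space \<Rightarrow> real"
  assumes h: "C11_with_gradient X h Dh" and K: "compact K" "K \<subseteq> X"
  obtains C where "C-lipschitz_on K Dh"
proof -
  have loc: "\<exists>u>0. \<exists>C. C-lipschitz_on (cball x u \<inter> K) Dh" if x: "x \<in> K" for x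
  proof -
    obtain e C where e: "0 < e" "C-lipschitz_on (ball x e \<inter> X) Dh"
      using h K(2) x unfolding C11_with_gradient_def by blast
    have "cball x (e/2) \<inter> K \<subseteq> ball x e \<inter> X" using K(2) e(1) by auto
    then have "C-lipschitz_on (cball x (e/2) \<inter> K) Dh" by (rule lipschitz_on_subset[OF e(2)])
    then show ?thesis using e(1) half_gt_zero by blast
  qed
  \<comment> \<open>The time parameter is a dummy with the single value 0.\<close>
  have "local_lipschitz {0::real} K (\<lambda>_. Dh)"
    unfolding local_lipschitz_def
  proof (intro ballI)
    fix x and t :: real assume "x \<in> K"
    then obtain u C where "u > 0" "C-lipschitz_on (cball x u \<inter> K) Dh" using loc by blast
    then show "\<exists>u>0. \<exists>C. \<forall>t\<in>cball t u \<inter> {0}. C-lipschitz_on (cball x u \<inter> K) Dh" by blast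
  qed
  then obtain C where "\<And>t. t \<in> {0::real} \<Longrightarrow> C-lipschitz_on K Dh"
    by (rule local_lipschitz_compact_implies_lipschitz[OF _ K(1), of "{0}"]) auto
  then show thesis using that by blast
qed

text \<open>Clearing the denominator removes both the upper limit and the exclusion of
  \<open>q' = q\<close>.\<close>

lemma frechet_normal_cone_iff:
  "v \<in> frechet_normal_cone Q q \<longleftrightarrow>
    (\<forall>\<epsilon>>0. \<exists>\<delta>>0. \<forall>q'\<in>Q. norm (q' - q) < \<delta> \<longrightarrow> v \<bullet> (q' - q) \<le> \<epsilon> * norm (q' - q))"
proof -
  have le: "v \<bullet> ((q' - q) /\<^sub>R norm (q' - q)) \<le> \<epsilon> \<longleftrightarrow> v \<bullet> (q' - q) \<le> \<epsilon> * norm (q' - q)" if "q' \<noteq> q" for q' \<epsilon>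
    using that by (simp add: inverse_eq_divide pos_divide_le_eq)
  show ?thesis
  proof
    assume "v \<in> frechet_normal_cone Q q"
    then have L: "Limsup (at q within Q) (\<lambda>q'. ereal (v \<bullet> ((q' - q) /\<^sub>R norm (q' - q)))) \<le> 0"
      by (simp add: frechet_normal_cone_def)
    show "\<forall>\<epsilon>>0. \<exists>\<delta>>0. \<forall>q'\<in>Q. norm (q' - q) < \<delta> \<longrightarrow> v \<bullet> (q' - q) \<le> \<epsilon> * norm (q' - q)"
    proof (intro allI impI)
      fix \<epsilon> :: real assume "0 < \<epsilon>"
      then have "Limsup (at q within Q) (\<lambda>q'. ereal (v \<bullet> ((q' - q) /\<^sub>R norm (q' - q)))) < ereal \<epsilon>"
        using L by (simp add: order_le_less_trans)
      then have "\<forall>\<^sub>F q' in at q within Q. ereal (v \<bullet> ((q' - q) /\<^sub>R norm (q' - q))) < ereal \<epsilon>"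
        by (rule Limsup_lessD)
      then obtain d where d: "d > 0" "\<And>q'. q' \<in> Q \<Longrightarrow> q' \<noteq> q \<Longrightarrow> dist q' q < d \<Longrightarrow> v \<bullet> ((q' - q) /\<^sub>R norm (q' - q)) < \<epsilon>"
        unfolding eventually_at by auto
      have "v \<bullet> (q' - q) \<le> \<epsilon> * norm (q' - q)" if "q' \<in> Q" "norm (q' - q) < d" for q'
      proof (cases "q' = q")
        case False
        then show ?thesis using d(2)[OF that(1)] that(2) le[of q' \<epsilon>] by (simp add: dist_norm)
      qed simp
      then show "\<exists>\<delta>>0. \<forall>q'\<in>Q. norm (q' - q) < \<delta> \<longrightarrow> v \<bullet> (q' - q) \<le> \<epsilon> * norm (q' - q)" using d(1) by blast
    qed
  next
    assume *: "\<forall>\<epsilon>>0. \<exists>\<delta>>0. \<forall>q'\<in>Q. norm (q' - q) < \<delta> \<longrightarrow> v \<bullet> (q' - q) \<le> \<epsilon> * norm (q' - q)"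
    have "Limsup (at q within Q) (\<lambda>q'. ereal (v \<bullet> ((q' - q) /\<^sub>R norm (q' - q)))) \<le> 0"
    proof (rule ereal_le_epsilon2)
      fix \<epsilon> :: real assume "0 < \<epsilon>"
      then obtain \<delta> where \<delta>: "\<delta> > 0" "\<And>q'. q' \<in> Q \<Longrightarrow> norm (q' - q) < \<delta> \<Longrightarrow> v \<bullet> (q' - q) \<le> \<epsilon> * norm (q' - q)"
        using * by blast
      have "Limsup (at q within Q) (\<lambda>q'. ereal (v \<bullet> ((q' - q) /\<^sub>R norm (q' - q)))) \<le> ereal \<epsilon>"
      proof (rule Limsup_bounded)
        show "\<forall>\<^sub>F q' in at q within Q. ereal (v \<bullet> ((q' - q) /\<^sub>R norm (q' - q))) \<le> ereal \<epsilon>"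
          unfolding eventually_at ereal_less_eq
        proof (intro exI[of _ \<delta>] conjI ballI impI)
          fix q' assume "q' \<in> Q" and "q' \<noteq> q \<and> dist q' q < \<delta>"
          then show "v \<bullet> ((q' - q) /\<^sub>R norm (q' - q)) \<le> \<epsilon>" using \<delta>(2)[of q'] le[of q' \<epsilon>] by (simp add: dist_norm)
        qed (rule \<delta>(1))
      qed
      then show "Limsup (at q within Q) (\<lambda>q'. ereal (v \<bullet> ((q' - q) /\<^sub>R norm (q' - q)))) \<le> 0 + ereal \<epsilon>" by simp
    qed
    then show "v \<in> frechet_normal_cone Q q" by (simp add: frechet_normal_cone_def)
  qed
qed

section \<open>Hamiltonians and extremals\<close>

context exit_time_problem
begin

text \<open>One family for both Hamiltonians: \<kappa> = 1 is H and \<kappa> = 0 is H0. State and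
  covector form a pair because the gradient is taken in both.\<close>

definition ham :: "real \<Rightarrow> 'a \<times> 'a \<Rightarrow> real" where
  "ham \<kappa> z = (SUP \<omega>\<in>U. - (snd z \<bullet> f (fst z) \<omega>) - \<kappa> * r (fst z) \<omega>)"

text \<open>Maximality and vanishing of the Hamiltonian are bundled. The notion is then homogeneous
  in \<open>(p, \<mu>)\<close> and closed under limits, which neither a normalised multiplier nor an
  argmax would give directly.\<close>

definition maximizer :: "'a \<Rightarrow> 'a \<Rightarrow> real \<Rightarrow> 'b \<Rightarrow> bool" where
  "maximizer x p \<mu> \<omega> \<longleftrightarrow> \<omega> \<in> U \<and> ham_le x p \<mu> \<and> p \<bullet> f x \<omega> + \<mu> * r x \<omega> = 0"

lemma maximizer_scale:
  assumes "maximizer x p \<mu> \<omega>" "0 < s"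
  shows "maximizer x (s *\<^sub>R p) (s * \<mu>) \<omega>"
proof -
  have "- (s *\<^sub>R p \<bullet> f x \<omega>) - s * \<mu> * r x \<omega> = s * (- (p \<bullet> f x \<omega>) - \<mu> * r x \<omega>)" for \<omega> by (simp add: algebra_simps)
  moreover have "s *\<^sub>R p \<bullet> f x \<omega> + s * \<mu> * r x \<omega> = s * (p \<bullet> f x \<omega> + \<mu> * r x \<omega>)" by (simp add: algebra_simps)
  ultimately show ?thesis using assms unfolding maximizer_def ham_le_def by (simp add: mult_le_0_iff)
qed

lemma ham_ge:
  assumes "\<omega> \<in> U"
  shows "- (p \<bullet> f x \<omega>) - \<kappa> * r x \<omega> \<le> ham \<kappa> (x, p)"
proof -
  have "compact ((\<lambda>\<omega>. - (p \<bullet> f x \<omega>) - \<kappa> * r x \<omega>) ` U)"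
    by (intro compact_continuous_image U(2) continuous_intros continuous_on_control f_cont r_cont)
  then have "bdd_above ((\<lambda>\<omega>. - (p \<bullet> f x \<omega>) - \<kappa> * r x \<omega>) ` U)" by (intro bounded_imp_bdd_above compact_imp_bounded)
  then show ?thesis unfolding ham_def fst_conv snd_conv by (intro cSUP_upper assms)
qed

text \<open>
  At a maximizer \<open>\<omega>\<close> with vanishing Hamiltonian, the function
  \<open>ham \<kappa> (x', p') + p' \<bullet> f x' \<omega> + \<kappa> * r x' \<omega>\<close> attains its minimum \<open>0\<close>.
\<close>

lemma ham_gradient:
  assumes m: "maximizer x p \<kappa> \<omega>" and D: "GDERIV (ham \<kappa>) (x, p) :> D"
  shows "D = (- (blinfun_tr (Df x \<omega>) p + \<kappa> *\<^sub>R Dr x \<omega>), - f x \<omega>)"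
proof -
  have \<omega>: "\<omega> \<in> U" and le: "ham_le x p \<kappa>" and eq: "p \<bullet> f x \<omega> + \<kappa> * r x \<omega> = 0"
    using m by (auto simp: maximizer_def)
  define k where "k = (\<lambda>z. ham \<kappa> z + (snd z \<bullet> f (fst z) \<omega> + \<kappa> * r (fst z) \<omega>))"
  have k0: "0 \<le> k z" for z using ham_ge[OF \<omega>, of "snd z" "fst z" \<kappa>] by (simp add: k_def)
  have "ham \<kappa> (x, p) \<le> 0" unfolding ham_def using le by (intro cSUP_least U(1)) (simp add: ham_le_def)
  then have kx: "k (x, p) \<le> 0" using eq by (simp add: k_def)
  have ff: "((\<lambda>z. f (fst z) \<omega>) has_derivative (\<lambda>h. blinfun_apply (Df x \<omega>) (fst h))) (at (x, p))"
    using has_derivative_compose[OF has_derivative_fst[OF has_derivative_ident], of "\<lambda>y. f y \<omega>" _ "(x, p)"] f_der[OF \<omega>, of x] by simp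
  have rr: "((\<lambda>z. r (fst z) \<omega>) has_derivative (\<lambda>h. Dr x \<omega> \<bullet> fst h)) (at (x, p))"
    using has_derivative_compose[OF has_derivative_fst[OF has_derivative_ident], of "\<lambda>y. r y \<omega>" _ "(x, p)"] r_der[OF \<omega>, of x]
    unfolding gderiv_def by (simp add: inner_commute)
  have "(k has_derivative (\<lambda>h. h \<bullet> D + ((snd (x, p) \<bullet> blinfun_apply (Df x \<omega>) (fst h) + snd h \<bullet> f (fst (x, p)) \<omega>) + \<kappa> * (Dr x \<omega> \<bullet> fst h)))) (at (x, p))"
    unfolding k_def
    by (intro has_derivative_add has_derivative_inner has_derivative_mult_right ff rr has_derivative_snd has_derivative_ident)
      (use D in \<open>simp add: gderiv_def\<close>)
  moreover have "\<forall>\<^sub>F z in at (x, p). k (x, p) \<le> k z" using order_trans[OF kx k0] by simp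
  ultimately have z: "(\<lambda>h. h \<bullet> D + ((snd (x, p) \<bullet> blinfun_apply (Df x \<omega>) (fst h) + snd h \<bullet> f (fst (x, p)) \<omega>) + \<kappa> * (Dr x \<omega> \<bullet> fst h))) = (\<lambda>h. 0)"
    by (rule has_derivative_local_min)
  have "fst D \<bullet> h = - (blinfun_tr (Df x \<omega>) p + \<kappa> *\<^sub>R Dr x \<omega>) \<bullet> h" for h
    using fun_cong[OF z, of "(h, 0)"] by (simp add: inner_prod_def blinfun_tr_inner inner_left_distrib inner_diff_left inner_commute[of h])
  then have 1: "fst D = - (blinfun_tr (Df x \<omega>) p + \<kappa> *\<^sub>R Dr x \<omega>)" by (rule vector_eq_rdot[THEN iffD1, OF allI])
  have "snd D \<bullet> h = - f x \<omega> \<bullet> h" for h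
    using fun_cong[OF z, of "(0, h)"] by (simp add: inner_prod_def inner_commute[of h] blinfun.zero_right)
  then have 2: "snd D = - f x \<omega>" by (rule vector_eq_rdot[THEN iffD1, OF allI])
  show ?thesis using 1 2 by (simp add: prod_eq_iff)
qed

lemma prox_normal_frechet:
  assumes pn: "prox_normal C x p \<mu>" and C: "0 \<le> C"
  shows "(- p, \<mu>) \<in> frechet_normal_cone (hypo S V) (x, Vr x)"
  unfolding frechet_normal_cone_iff
proof (intro allI impI)
  fix \<epsilon> :: real assume \<epsilon>: "0 < \<epsilon>"
  define \<delta> where "\<delta> = \<epsilon> / (4 * C + 1)"
  have \<delta>: "0 < \<delta>" using \<epsilon> C by (simp add: \<delta>_def)
  have "(- p, \<mu>) \<bullet> (q - (x, Vr x)) \<le> \<epsilon> * norm (q - (x, Vr x))" if q: "q \<in> hypo S V" "norm (q - (x, Vr x)) < \<delta>" for q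
  proof -
    obtain x' \<beta> where qq: "q = (x', \<beta>)" by (cases q)
    define \<theta> where "\<theta> = norm (q - (x, Vr x))"
    have n1: "norm (x' - x) \<le> \<theta>" using norm_fst_le[of "x' - x" "\<beta> - Vr x"] by (simp add: qq \<theta>_def)
    have n2: "\<bar>\<beta> - Vr x\<bar> \<le> \<theta>" using norm_snd_le[of "\<beta> - Vr x" "x' - x"] by (simp add: qq \<theta>_def)
    have th: "0 \<le> \<theta>" "\<theta> < \<delta>" using q(2) by (simp_all add: \<theta>_def)
    have "(- p, \<mu>) \<bullet> (q - (x, Vr x)) = - (p \<bullet> (x' - x)) + \<mu> * (\<beta> - Vr x)" by (simp add: qq inner_prod_def)
    also have "\<dots> \<le> C * (norm (x' - x) + \<bar>\<beta> - Vr x\<bar>)\<^sup>2"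
      using pn q(1) unfolding prox_normal_def qq hypo_def by auto
    also have "\<dots> \<le> C * (2 * \<theta>)\<^sup>2" using n1 n2 C by (intro mult_left_mono power_mono) auto
    also have "\<dots> = (4 * C * \<theta>) * \<theta>" by (simp add: power2_eq_square)
    also have "\<dots> \<le> \<epsilon> * \<theta>"
    proof (rule mult_right_mono[OF _ th(1)])
      have "4 * C * \<theta> \<le> 4 * C * \<delta>" using th(2) C by (intro mult_left_mono) auto
      also have "\<dots> \<le> (4 * C + 1) * \<delta>" using \<delta> by (simp add: algebra_simps)
      also have "\<dots> = \<epsilon>" using C by (simp add: \<delta>_def)
      finally show "4 * C * \<theta> \<le> \<epsilon>" .
    qed
    finally show ?thesis by (simp add: \<theta>_def)
  qed
  then show "\<exists>\<delta>>0. \<forall>q\<in>hypo S V. norm (q - (x, Vr x)) < \<delta> \<longrightarrow> (- p, \<mu>) \<bullet> (q - (x, Vr x)) \<le> \<epsilon> * norm (q - (x, Vr x))"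
    using \<delta> by blast
qed

text \<open>The condition that \<open>p\<close> never vanishes keeps the arc in the region where the
  Hamiltonians are assumed to be regular.\<close>

definition extremal :: "(real \<Rightarrow> 'b) \<Rightarrow> (real \<Rightarrow> 'a) \<Rightarrow> (real \<Rightarrow> 'a) \<Rightarrow> real \<Rightarrow> real \<Rightarrow> bool" where
  "extremal u y p \<mu> \<tau> \<longleftrightarrow> adj u y \<mu> p \<tau> \<and> (\<forall>t\<in>{0..\<tau>}. p t \<noteq> 0) \<and>
     (\<exists>E. negligible E \<and> (\<forall>t\<in>{0<..<\<tau>} - E. maximizer (y t) (p t) \<mu> (u t)))"

lemma extremal_scale:
  assumes "extremal u y p \<mu> \<tau>" "0 < s"
  shows "extremal u y (\<lambda>t. s *\<^sub>R p t) (s * \<mu>) \<tau>"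
proof -
  have "ae_deriv 0 \<tau> (\<lambda>t. s *\<^sub>R p t) (\<lambda>t. s *\<^sub>R - (blinfun_tr (Df (y t) (u t)) (p t) + \<mu> *\<^sub>R Dr (y t) (u t)))"
    using assms(1) unfolding extremal_def adj_def by (intro ae_deriv_cmult) blast
  then have "adj u y (s * \<mu>) (\<lambda>t. s *\<^sub>R p t) \<tau>"
    unfolding adj_def by (rule ae_deriv_cong) (simp_all add: blinfun_tr_scaleR scaleR_diff_right algebra_simps)
  then show ?thesis using assms maximizer_scale unfolding extremal_def by (metis less_irrefl scaleR_eq_0_iff)
qed

lemma opt_time_pos:
  assumes "opt x u y \<tau>" "x \<notin> S"
  shows "0 < \<tau>"
proof (rule ccontr)
  assume "\<not> 0 < \<tau>"
  then have "\<tau> = 0" using optD(5)[OF assms(1)] by simp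
  then show False using optD(6)[OF assms(1)] solD(2)[OF optD(2)[OF assms(1)]] assms(2) by simp
qed

text \<open>Only the nonvanishing of \<open>p\<close> needs an argument. If \<mu> = 0, the adjoint
  equation is linear and a zero would propagate to the exit, where the covector is a unit vector. If
  \<mu> > 0, a vanishing Hamiltonian bounds \<open>norm p\<close> below by
  \<open>\<mu> * r\<^sub>0 / N\<close> almost everywhere, hence everywhere by continuity.\<close>

lemma extremal_exists:
  assumes o: "opt x u y \<tau>" and \<tau>T: "\<tau> \<le> T" and xS: "x \<notin> S"
    and tv: "transversal c (y \<tau>) \<xi> q \<mu>" and ad: "adj u y \<mu> p \<tau>" and pT: "p \<tau> = covec \<mu> q \<xi>" and C: "0 \<le> C"
    and pn: "\<And>t. t \<in> {0..\<tau>} \<Longrightarrow> prox_normal C (y t) (p t) \<mu>"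
  shows "extremal u y p \<mu> \<tau>"
proof -
  have \<mu>: "0 \<le> \<mu>" "\<mu> \<le> 1" using tv by (auto simp: transversal_def)
  obtain E where E: "negligible E" "\<And>t. 0 \<le> t \<Longrightarrow> t < \<tau> \<Longrightarrow> ham_le (y t) (p t) \<mu>"
    "\<And>t. t \<in> {0<..<\<tau>} - E \<Longrightarrow> p t \<bullet> f (y t) (u t) + \<mu> * r (y t) (u t) = 0"
    by (rule maximum_principle[OF o _ C, of p \<mu>]) (use pn in auto)
  have uU: "u t \<in> U" for t using ctrlD(1)[OF optD(1)[OF o]] .
  have max: "maximizer (y t) (p t) \<mu> (u t)" if "t \<in> {0<..<\<tau>} - E" for t
    using E(2,3)[of t] uU that by (auto simp: maximizer_def)
  have \<tau>0: "0 < \<tau>" by (rule opt_time_pos[OF o xS])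
  have pc: "continuous_on {0..\<tau>} p" using ad unfolding adj_def by (rule ae_deriv_continuous)
  have ne: "p t \<noteq> 0" if t: "t \<in> {0..\<tau>}" for t
  proof (cases "\<mu> = 0")
    case True
    show ?thesis
    proof
      assume p0: "p t = 0"
      have "ae_deriv t \<tau> p (\<lambda>t. - (blinfun_tr (Df (y t) (u t)) (p t) + \<mu> *\<^sub>R Dr (y t) (u t)))"
        by (rule ae_deriv_subset[OF ad[unfolded adj_def]]) (use t in simp_all)
      moreover have "norm (- (blinfun_tr (Df (y s) (u s)) (p s) + \<mu> *\<^sub>R Dr (y s) (u s))) \<le> L * norm (p s) + 0" for s
        using adj_rhs_bound[OF uU[of s], of \<mu> "y s" "p s"] True by simp
      ultimately have "norm (p \<tau>) \<le> (norm (p t) + 0 * (\<tau> - t)) * exp (L * (\<tau> - t))"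
        using t pos by (intro gronwall_ae_deriv[where E = "{}"]) auto
      then have "p \<tau> = 0" using p0 by simp
      then show False using pT True tv by (auto simp: covec_def transversal_def inner_normal_def)
    qed
  next
    case False
    then have "0 < \<mu>" using \<mu> by simp
    have "- (N * norm (p t)) \<le> - (\<mu> * r\<^sub>0)"
    proof (rule continuous_le_off_negligible[OF _ \<tau>0 E(1) _ t])
      show "continuous_on {0..\<tau>} (\<lambda>t. - (N * norm (p t)))" by (intro continuous_intros pc)
      fix s assume s: "s \<in> {0<..<\<tau>} - E"
      have "\<mu> * r\<^sub>0 \<le> \<mu> * r (y s) (u s)" using r_lower[OF uU] \<mu> by (intro mult_left_mono)
      also have "\<dots> = - (p s \<bullet> f (y s) (u s))" using E(3)[OF s] by linarith
      also have "\<dots> \<le> norm (p s) * norm (f (y s) (u s))" using Cauchy_Schwarz_ineq2[of "p s" "f (y s) (u s)"] by linarith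
      also have "\<dots> \<le> norm (p s) * N" using f_bound[OF uU, of "y s" s] by (intro mult_left_mono) auto
      finally show "- (N * norm (p s)) \<le> - (\<mu> * r\<^sub>0)" by (simp add: mult.commute)
    qed
    moreover have "0 < \<mu> * r\<^sub>0" using \<open>0 < \<mu>\<close> pos by simp
    ultimately show ?thesis by auto
  qed
  show ?thesis unfolding extremal_def using ad ne E(1) max by blast
qed

end

section \<open>Uniqueness of optimal trajectories from a ray of normals\<close>

locale regular_exit_time_problem = exit_time_problem U S f r g N L r\<^sub>0 \<rho>\<^sub>0 G Df Dr W
  for U :: "'b::euclidean_space set" and S :: "'a::euclidean_space set" and f r g N L r\<^sub>0 \<rho>\<^sub>0 G Df Dr W +
  assumes V_cont: "continuous_on reach V"
    and ham1: "C11_on (UNIV \<times> (UNIV - {0})) (ham 1)"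
    and ham0: "C11_on (UNIV \<times> (UNIV - {0})) (ham 0)"
begin

text \<open>Both quantities are components of the gradient of the Hamiltonian at
  \<open>(x, p)\<close>, so they do not depend on which maximizing control is chosen.\<close>

lemma maximizer_feedback:
  assumes p: "p \<noteq> 0" and m: "maximizer x p \<mu> \<omega>" "maximizer x p \<mu> \<omega>'" and \<mu>: "0 \<le> \<mu>"
  shows "f x \<omega> = f x \<omega>' \<and> blinfun_tr (Df x \<omega>) p + \<mu> *\<^sub>R Dr x \<omega> = blinfun_tr (Df x \<omega>') p + \<mu> *\<^sub>R Dr x \<omega>'"
proof -
  \<comment> \<open>Homogeneity moves the multiplier to 0 or 1, the two values with a differentiable
    Hamiltonian.\<close>
  define s where "s = (if \<mu> = 0 then 1 else 1 / \<mu>)"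
  have s: "0 < s" "s * \<mu> = 1 \<or> s * \<mu> = 0" using \<mu> by (auto simp: s_def)
  obtain Dh where Dh: "C11_with_gradient (UNIV \<times> (UNIV - {0})) (ham (s * \<mu>)) Dh"
    using s(2) ham0 ham1 unfolding C11_on_def by metis
  have "GDERIV (ham (s * \<mu>)) (x, s *\<^sub>R p) :> Dh (x, s *\<^sub>R p)"
    using Dh p s(1) unfolding C11_with_gradient_def by simp
  then have D: "Dh (x, s *\<^sub>R p) = (- (blinfun_tr (Df x \<omega>) (s *\<^sub>R p) + (s * \<mu>) *\<^sub>R Dr x \<omega>), - f x \<omega>)"
    if "maximizer x p \<mu> \<omega>" for \<omega> using ham_gradient[OF maximizer_scale[OF that s(1)]] by blast
  have "s *\<^sub>R (blinfun_tr (Df x \<omega>) p + \<mu> *\<^sub>R Dr x \<omega>) = s *\<^sub>R (blinfun_tr (Df x \<omega>') p + \<mu> *\<^sub>R Dr x \<omega>')"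
    using D[OF m(1)] D[OF m(2)]
    by (simp only: prod.inject neg_equal_iff_equal blinfun_tr_scaleR scaleR_add_right scaleR_scaleR)
  then show ?thesis using D[OF m(1)] D[OF m(2)] s(1) by simp
qed

text \<open>State and costate together solve an autonomous equation with locally Lipschitz
  right-hand side, from which the controls have disappeared; Gronwall's inequality does the
  rest.\<close>

lemma extremal_unique:
  assumes \<kappa>: "\<kappa> = 0 \<or> \<kappa> = 1" and T: "0 \<le> T"
    and y: "ae_deriv 0 T y1 (\<lambda>t. f (y1 t) (u1 t))" "ae_deriv 0 T y2 (\<lambda>t. f (y2 t) (u2 t))"
    and e: "extremal u1 y1 p1 \<kappa> T" "extremal u2 y2 p2 \<kappa> T" and 0: "y1 0 = y2 0" "p1 0 = p2 0" and t: "t \<in> {0..T}"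
  shows "y1 t = y2 t" "p1 t = p2 t"
proof -
  obtain Dh where Dh: "C11_with_gradient (UNIV \<times> (UNIV - {0})) (ham \<kappa>) Dh"
    using \<kappa> ham0 ham1 unfolding C11_on_def by metis
  \<comment> \<open>The Hamiltonian vector field; the signs are reversed because the Hamiltonian is
    built with \<open>- p\<close>.\<close>
  define \<Phi> where "\<Phi> = (\<lambda>z. (- snd (Dh z), fst (Dh z)))"
  have Z: "ae_deriv 0 T (\<lambda>t. (y t, p t)) (\<lambda>t. \<Phi> (y t, p t))"
    if y: "ae_deriv 0 T y (\<lambda>t. f (y t) (u t))" and e: "extremal u y p \<kappa> T" for y p u
  proof -
    obtain E where E: "negligible E" "\<And>t. t \<in> {0<..<T} - E \<Longrightarrow> maximizer (y t) (p t) \<kappa> (u t)"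
      using e unfolding extremal_def by blast
    have "ae_deriv 0 T (\<lambda>t. (y t, 0) + (0, p t)) (\<lambda>t. (f (y t) (u t), 0) + (0, - (blinfun_tr (Df (y t) (u t)) (p t) + \<kappa> *\<^sub>R Dr (y t) (u t))))"
      using e unfolding extremal_def adj_def
      by (intro ae_deriv_add ae_deriv_linear[OF _ y, of "\<lambda>x. (x, 0)"] ae_deriv_linear[of "\<lambda>x. (0, x)"]
          bounded_linear_Pair bounded_linear_ident bounded_linear_zero) blast
    then have "ae_deriv 0 T (\<lambda>t. (y t, p t)) (\<lambda>t. (f (y t) (u t), - (blinfun_tr (Df (y t) (u t)) (p t) + \<kappa> *\<^sub>R Dr (y t) (u t))))"
      by simp
    then show ?thesis
    proof (rule ae_deriv_cong_ae[OF _ E(1)])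
      fix t assume t: "t \<in> {0<..<T} - E"
      then have "p t \<noteq> 0" using e unfolding extremal_def by auto
      then have "GDERIV (ham \<kappa>) (y t, p t) :> Dh (y t, p t)" using Dh unfolding C11_with_gradient_def by simp
      from ham_gradient[OF E(2)[OF t] this]
      show "\<Phi> (y t, p t) = (f (y t) (u t), - (blinfun_tr (Df (y t) (u t)) (p t) + \<kappa> *\<^sub>R Dr (y t) (u t)))"
        by (simp add: \<Phi>_def)
    qed
  qed
  define Z1 where "Z1 = (\<lambda>t. (y1 t, p1 t))"
  define Z2 where "Z2 = (\<lambda>t. (y2 t, p2 t))"
  have Z1: "ae_deriv 0 T Z1 (\<lambda>t. \<Phi> (Z1 t))" unfolding Z1_def by (rule Z[OF y(1) e(1)])
  have Z2: "ae_deriv 0 T Z2 (\<lambda>t. \<Phi> (Z2 t))" unfolding Z2_def by (rule Z[OF y(2) e(2)])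
  \<comment> \<open>Two compact arcs avoiding \<open>p = 0\<close>, so a single Lipschitz constant
    of the gradient serves for both.\<close>
  define K where "K = Z1 ` {0..T} \<union> Z2 ` {0..T}"
  have "compact K" unfolding K_def
    by (intro compact_Un compact_continuous_image ae_deriv_continuous[OF Z1] ae_deriv_continuous[OF Z2]) auto
  moreover have "K \<subseteq> UNIV \<times> (UNIV - {0})" using e unfolding K_def Z1_def Z2_def extremal_def by auto
  ultimately obtain C where C: "C-lipschitz_on K Dh"
    by (rule C11_with_gradient_lipschitz_on_compact[OF Dh])
  have C0: "0 \<le> C" by (rule lipschitz_on_nonneg[OF C])
  have "norm (Z1 t - Z2 t) \<le> (norm (Z1 0 - Z2 0) + 0 * (T - 0)) * exp (C * (t - 0))"
  proof (rule gronwall_ae_deriv[OF ae_deriv_diff[OF Z1 Z2] C0 order_refl negligible_empty _ t])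
    fix s assume "s \<in> {0<..<T} - {}"
    then have "Z1 s \<in> K" "Z2 s \<in> K" by (auto simp: K_def)
    then have "norm (Dh (Z1 s) - Dh (Z2 s)) \<le> C * norm (Z1 s - Z2 s)"
      using lipschitz_onD[OF C, of "Z1 s" "Z2 s"] by (simp add: dist_norm)
    moreover have "norm (\<Phi> (Z1 s) - \<Phi> (Z2 s)) = norm (Dh (Z1 s) - Dh (Z2 s))"
      by (simp add: \<Phi>_def norm_prod_def norm_minus_commute add.commute)
    ultimately show "norm (\<Phi> (Z1 s) - \<Phi> (Z2 s)) \<le> C * norm (Z1 s - Z2 s) + 0" by simp
  qed
  then have "Z1 t = Z2 t" using 0 by (simp add: Z1_def Z2_def zero_prod_def)
  then show "y1 t = y2 t" "p1 t = p2 t" by (simp_all add: Z1_def Z2_def)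
qed

lemma opt_extremal:
  assumes o: "opt x u y \<tau>" and xS: "x \<notin> S"
  obtains p \<mu> C where "extremal u y p \<mu> \<tau>" "prox_normal C x (p 0) \<mu>" "0 \<le> C" "0 \<le> \<mu>"
proof -
  have xc: "x \<in> closure (- S)" by (rule not_in_S_closure[OF xS])
  have yf: "y \<tau> \<in> frontier S" by (rule hit_frontier[OF optD(2,3)[OF o] xc])
  obtain \<xi> where \<xi>: "inner_normal (y \<tau>) \<xi>" using inner_normal_exists[OF yf] by blast
  obtain c q where c: "0 \<le> c" "supergrad c (y \<tau>) q"
  proof (rule supergrad_exists[of "y \<tau>"])
    fix e c assume "0 < e" "0 \<le> c" and *: "\<And>z. z \<in> frontier S \<Longrightarrow> z \<in> ball (y \<tau>) e \<Longrightarrow>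
      \<exists>q. supergrad c z q \<and> (\<forall>x\<in>ball (y \<tau>) (2 * e). g x \<le> g z + q \<bullet> (x - z) + c * (norm (x - z))\<^sup>2)"
    then show thesis using *[OF yf] that by auto
  qed
  obtain \<mu> where \<mu>: "transversal c (y \<tau>) \<xi> q \<mu>" by (rule transversal_exists[OF o xS \<xi> c(2)])
  obtain p where p: "adj u y \<mu> p \<tau>" "p \<tau> = covec \<mu> q \<xi>" by (rule adj_exists[OF optD(1,2,5)[OF o]])
  obtain C where C: "0 \<le> C" and thA: "\<And>x u y \<tau>' \<xi> q \<mu> p. opt x u y \<tau>' \<Longrightarrow> \<tau>' \<le> \<tau> \<Longrightarrow> x \<in> closure (- S) \<Longrightarrow>
       transversal c (y \<tau>') \<xi> q \<mu> \<Longrightarrow> adj u y \<mu> p \<tau>' \<Longrightarrow> p \<tau>' = covec \<mu> q \<xi> \<Longrightarrow> prox_normal C x (p 0) \<mu>"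
    by (rule prox_normal_optimal[OF optD(5)[OF o] c(1)]) (rule that)
  have pn: "prox_normal C (y t) (p t) \<mu>" if "t \<in> {0..\<tau>}" for t
  proof (rule prox_normal_along[OF o order_refl[of \<tau>] xc \<mu> p])
    show "0 \<le> t" "t \<le> \<tau>" using that by auto
  qed (rule thA)
  have "extremal u y p \<mu> \<tau>" by (rule extremal_exists[OF o order_refl xS \<mu> p C pn])
  moreover have "prox_normal C x (p 0) \<mu>" using thA[OF o order_refl xc \<mu> p] .
  moreover have "0 \<le> \<mu>" using \<mu> by (simp add: transversal_def)
  ultimately show thesis using that C by blast
qed

lemma unique_optimal_trajectory:
  assumes x: "x \<in> reach" "x \<notin> S" and hd: "hypo_differentiable_at S reach V x"
  shows "\<exists>!z. z \<in> optimal_trajectories U S f r g x"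
proof -
  have xc: "x \<in> closure (- S)" by (rule not_in_S_closure[OF x(2)])
  obtain v where v: "frechet_normal_cone (hypo S V) (x, Vr x) = {s *\<^sub>R v |s. s \<ge> 0}"
    using hd unfolding hypo_differentiable_at_def Let_def by blast
  have uniq: "\<tau>1 = \<tau>2 \<and> restrict y1 {0..\<tau>1} = restrict y2 {0..\<tau>2}" if o: "opt x u1 y1 \<tau>1" "opt x u2 y2 \<tau>2" for u1 y1 \<tau>1 u2 y2 \<tau>2
  proof -
    \<comment> \<open>A zero multiple of \<open>v\<close> is excluded because
      \<open>p 0 \<noteq> 0\<close>; strict positivity is what allows dividing by \<open>s\<close>
      below.\<close>
    have ray: "\<exists>s>0. (- p 0, \<mu>) = s *\<^sub>R v"
      if e: "extremal u y p \<mu> \<tau>" and pn: "prox_normal C x (p 0) \<mu>" "0 \<le> C" and \<tau>: "0 \<le> \<tau>" for u y p \<mu> \<tau> C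
    proof -
      obtain s where s: "s \<ge> 0" "(- p 0, \<mu>) = s *\<^sub>R v" using prox_normal_frechet[OF pn] unfolding v by blast
      have "p 0 \<noteq> 0" using e \<tau> unfolding extremal_def by simp
      then have "s \<noteq> 0" using s(2) by (auto simp: zero_prod_def)
      then show ?thesis using s by (intro exI[of _ s]) simp
    qed
    have \<tau>0: "0 \<le> \<tau>1" "0 \<le> \<tau>2" using o by (simp_all add: optD(5))
    obtain p1 \<mu>1 C1 where 1: "extremal u1 y1 p1 \<mu>1 \<tau>1" "prox_normal C1 x (p1 0) \<mu>1" "0 \<le> C1" "0 \<le> \<mu>1"
      by (rule opt_extremal[OF o(1) x(2)])
    obtain p2 \<mu>2 C2 where 2: "extremal u2 y2 p2 \<mu>2 \<tau>2" "prox_normal C2 x (p2 0) \<mu>2" "0 \<le> C2" "0 \<le> \<mu>2"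
      by (rule opt_extremal[OF o(2) x(2)])
    obtain s1 where s1: "s1 > 0" "(- p1 0, \<mu>1) = s1 *\<^sub>R v" using ray[OF 1(1-3) \<tau>0(1)] by blast
    obtain s2 where s2: "s2 > 0" "(- p2 0, \<mu>2) = s2 *\<^sub>R v" using ray[OF 2(1-3) \<tau>0(2)] by blast
    define \<mu> where "\<mu> = snd v"
    have m: "\<mu>1 = s1 * \<mu>" "\<mu>2 = s2 * \<mu>" using arg_cong[OF s1(2), of snd] arg_cong[OF s2(2), of snd] by (simp_all add: \<mu>_def)
    have pv: "p1 0 = - (s1 *\<^sub>R fst v)" "p2 0 = - (s2 *\<^sub>R fst v)"
      using arg_cong[OF s1(2), of fst] arg_cong[OF s2(2), of fst] by (simp_all add: equation_minus_iff[of "p1 0"] equation_minus_iff[of "p2 0"])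
    have \<mu>0: "0 \<le> \<mu>" using m(1) 1(4) s1(1) by (simp add: zero_le_mult_iff)
    \<comment> \<open>Rescaling the two costates by \<open>s / s1\<close> and \<open>s / s2\<close>
      gives them the same initial value and the common multiplier \<open>s * \<mu>\<close>, which is
      0 or 1.\<close>
    define s where "s = (if \<mu> = 0 then 1 else 1 / \<mu>)"
    have s: "0 < s" "s * \<mu> = 0 \<or> s * \<mu> = 1" using \<mu>0 by (auto simp: s_def)
    define T where "T = min \<tau>1 \<tau>2"
    have T: "0 \<le> T" using \<tau>0 by (simp add: T_def)
    have sub: "extremal u y p \<mu> T" if e: "extremal u y p \<mu> \<tau>" and T\<tau>: "T \<le> \<tau>" for u y p \<mu> \<tau>
    proof -
      have ad: "adj u y \<mu> p \<tau>" using e by (simp add: extremal_def)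
      have "adj u y \<mu> p T" unfolding adj_def
        by (rule ae_deriv_subset[OF ad[unfolded adj_def] order_refl T\<tau>])
      moreover have "\<forall>t\<in>{0..T}. p t \<noteq> 0" using e T\<tau> unfolding extremal_def by simp
      moreover obtain E where "negligible E" "\<forall>t\<in>{0<..<\<tau>} - E. maximizer (y t) (p t) \<mu> (u t)"
        using e unfolding extremal_def by blast
      then have "\<exists>E. negligible E \<and> (\<forall>t\<in>{0<..<T} - E. maximizer (y t) (p t) \<mu> (u t))"
        using T\<tau> by (intro exI[of _ E]) simp
      ultimately show ?thesis unfolding extremal_def by blast
    qed
    have e1: "extremal u1 y1 (\<lambda>t. (s / s1) *\<^sub>R p1 t) (s * \<mu>) T"
      using extremal_scale[OF sub[OF 1(1)], of "s / s1"] s(1) s1(1) m(1) by (simp add: T_def)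
    have e2: "extremal u2 y2 (\<lambda>t. (s / s2) *\<^sub>R p2 t) (s * \<mu>) T"
      using extremal_scale[OF sub[OF 2(1)], of "s / s2"] s(1) s2(1) m(2) by (simp add: T_def)
    have "(s / s1) *\<^sub>R p1 0 = (s / s2) *\<^sub>R p2 0" unfolding pv using s1(1) s2(1) by simp
    moreover have "y1 0 = y2 0" using solD(2)[OF optD(2)[OF o(1)]] solD(2)[OF optD(2)[OF o(2)]] by simp
    ultimately have eq: "y1 t = y2 t" if "t \<in> {0..T}" for t
      using extremal_unique(1)[OF s(2) T solD(4)[OF optD(2)[OF o(1)]] solD(4)[OF optD(2)[OF o(2)]] e1 e2 _ _ that] by simp
    \<comment> \<open>The curves are compared only up to the smaller exit time; there one of them is
      in the target while the other, being equal to it, would still be outside.\<close>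
    have "\<tau>1 = \<tau>2"
    proof (rule ccontr)
      assume "\<tau>1 \<noteq> \<tau>2"
      then consider "\<tau>1 < \<tau>2" | "\<tau>2 < \<tau>1" by linarith
      then show False
      proof cases
        assume "\<tau>1 < \<tau>2"
        then have "y2 \<tau>1 \<notin> S" "y1 \<tau>1 = y2 \<tau>1" using optD(8)[OF o(2) \<tau>0(1)] eq[of \<tau>1] \<tau>0 by (simp_all add: T_def)
        then show False using optD(6)[OF o(1)] by simp
      next
        assume "\<tau>2 < \<tau>1"
        then have "y1 \<tau>2 \<notin> S" "y1 \<tau>2 = y2 \<tau>2" using optD(8)[OF o(1) \<tau>0(2)] eq[of \<tau>2] \<tau>0 by (simp_all add: T_def)
        then show False using optD(6)[OF o(2)] by simp
      qed
    qed
    then show ?thesis using eq by (auto simp: T_def restrict_def)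
  qed
  obtain u y \<tau> where o: "opt x u y \<tau>" by (rule opt_exists[OF x(1) xc])
  show ?thesis
  proof (rule ex1I[of _ "(\<tau>, restrict y {0..\<tau>})"])
    show "(\<tau>, restrict y {0..\<tau>}) \<in> optimal_trajectories U S f r g x" using o optimal_trajectories_iff by blast
    fix z assume "z \<in> optimal_trajectories U S f r g x"
    then obtain \<tau>' z' where z: "z = (\<tau>', z')" "(\<tau>', z') \<in> optimal_trajectories U S f r g x" by (cases z) auto
    then obtain u' y' where o': "opt x u' y' \<tau>'" "z' = restrict y' {0..\<tau>'}" using optimal_trajectories_iff by blast
    from uniq[OF o'(1) o] show "z = (\<tau>, restrict y {0..\<tau>})" unfolding z(1) o'(2) by blast
  qed
qed

end

section \<open>Stability of costates\<close>

lemma GDERIV_line: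
  assumes "GDERIV \<phi> (z + t *\<^sub>R d) :> a"
  shows "((\<lambda>s. \<phi> (z + s *\<^sub>R d)) has_real_derivative d \<bullet> a) (at t)"
proof -
  have "((\<lambda>s. z + s *\<^sub>R d) has_derivative (\<lambda>h. h *\<^sub>R d)) (at t)"
    by (auto intro!: derivative_eq_intros)
  from has_derivative_compose[OF this assms[unfolded gderiv_def]]
  show ?thesis by (simp add: has_field_derivative_def mult.commute[of "d \<bullet> a"] mult_commute_abs)
qed

text \<open>The quadratic upper bound minus \<open>g\<close> has a local minimum at
  \<open>z\<close>, so its derivative vanishes there and the supergradient is the gradient.\<close>

lemma supergradient_unique:
  fixes g :: "'a::real_inner \<Rightarrow> real"
  assumes g: "g differentiable (at z)" and r: "0 < \<rho>"
    and q: "\<And>x. x \<in> ball z \<rho> \<Longrightarrow> g x \<le> g z + q \<bullet> (x - z) + c * (norm (x - z))\<^sup>2"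
    and q': "\<And>x. x \<in> ball z \<rho> \<Longrightarrow> g x \<le> g z + q' \<bullet> (x - z) + c' * (norm (x - z))\<^sup>2"
  shows "q = q'"
proof -
  obtain D where D: "(g has_derivative D) (at z)" using g unfolding differentiable_def by blast
  have eq: "q \<bullet> h = D h" if q: "\<And>x. x \<in> ball z \<rho> \<Longrightarrow> g x \<le> g z + q \<bullet> (x - z) + c * (norm (x - z))\<^sup>2" for q c h
  proof -
    define k where "k = (\<lambda>x. g z + q \<bullet> (x - z) + c * ((x - z) \<bullet> (x - z)) - g x)"
    have "(k has_derivative (\<lambda>h. q \<bullet> h - D h)) (at z)"
      unfolding k_def by (auto intro!: derivative_eq_intros D)
    moreover have "\<forall>\<^sub>F x in at z. k z \<le> k x"
      unfolding eventually_at
    proof (intro exI[of _ \<rho>] conjI ballI impI)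
      fix x assume "x \<noteq> z \<and> dist x z < \<rho>"
      then show "k z \<le> k x" using q[of x] by (simp add: k_def dist_commute power2_norm_eq_inner)
    qed (rule r)
    ultimately have "(\<lambda>h. q \<bullet> h - D h) = (\<lambda>h. 0)" by (rule has_derivative_local_min)
    from fun_cong[OF this, of h] show ?thesis by simp
  qed
  have "q \<bullet> h = q' \<bullet> h" for h using eq[OF q, of h] eq[OF q', of h] by simp
  then show ?thesis by (rule vector_eq_rdot[THEN iffD1, OF allI])
qed

section \<open>Normals of a target with smooth boundary\<close>

context exit_time_problem
begin

lemma inner_normal_interior:
  assumes "inner_normal z \<xi>" "1 / (2 * \<rho>\<^sub>0) * (norm h)\<^sup>2 < \<xi> \<bullet> h"
  shows "z + h \<notin> closure (- S)"
proof
  assume "z + h \<in> closure (- S)"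
  then have "\<xi> \<bullet> (z + h - z) \<le> 1 / (2 * \<rho>\<^sub>0) * (norm (z + h - z))\<^sup>2" using assms(1) unfolding inner_normal_def by blast
  then show False using assms(2) by simp
qed

text \<open>
  If \<open>\<xi>\<close> were not parallel to the gradient of a defining function \<open>\<phi>\<close>, a short segment inside
  the ball supporting the target would meet both signs of \<open>\<phi>\<close>, hence the boundary.
\<close>

lemma inner_normal_parallel:
  assumes \<phi>: "open X" "z \<in> X" "C11_with_gradient X \<phi> D\<phi>" "D\<phi> z \<noteq> 0" and fr: "frontier S \<inter> X = {x \<in> X. \<phi> x = 0}"
    and z: "z \<in> frontier S" and \<xi>: "inner_normal z \<xi>"
  shows "\<xi> = sgn (D\<phi> z) \<or> \<xi> = - sgn (D\<phi> z)"
proof -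
  define a where "a = D\<phi> z"
  define n where "n = sgn a"
  have a: "0 < norm a" "a \<noteq> 0" using \<phi>(4) by (simp_all add: a_def)
  have n: "norm n = 1" using a by (simp add: n_def norm_sgn)
  have na: "n \<bullet> a = norm a" using a by (simp add: n_def sgn_div_norm dot_square_norm power2_eq_square)
  have x1: "norm \<xi> = 1" using \<xi> by (simp add: inner_normal_def)
  define \<beta> where "\<beta> = \<xi> \<bullet> n"
  define d where "d = \<xi> - \<beta> *\<^sub>R n"
  have nn: "n \<bullet> n = 1" using n by (simp add: dot_square_norm)
  have dn: "d \<bullet> n = 0" using nn by (simp add: d_def inner_diff_left \<beta>_def)
  have an: "a = norm a *\<^sub>R n" using a by (simp add: n_def sgn_div_norm)
  have da: "d \<bullet> a = 0" by (subst an) (simp add: dn)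
  have b1: "\<bar>\<beta>\<bar> \<le> 1" using Cauchy_Schwarz_ineq2[of \<xi> n] by (simp add: \<beta>_def x1 n)
  have "d = 0"
  proof (rule ccontr)
    assume d0: "d \<noteq> 0"
    define m where "m = d \<bullet> d"
    have m: "0 < m" using d0 by (simp add: m_def)
    have "m = (\<xi> - \<beta> *\<^sub>R n) \<bullet> d" by (simp only: m_def d_def)
    then have xd: "\<xi> \<bullet> d = m" using dn by (simp add: inner_diff_left inner_commute[of n])
    \<comment> \<open>Since \<beta> has modulus at most 1, tilting \<open>d\<close> by up to
      \<epsilon> along \<open>n\<close> leaves at least half of its product with \<xi>.\<close>
    define \<epsilon> where "\<epsilon> = m / 2"
    define M where "M = norm d + \<epsilon>"
    define B where "B = 1 / (2 * \<rho>\<^sub>0)"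
    have B: "0 < B" using pos by (simp add: B_def)
    have M: "0 < M" "0 < \<epsilon>" using m by (simp_all add: M_def \<epsilon>_def add_nonneg_pos)
    have dt: "norm (d + t *\<^sub>R n) \<le> M" "m / 2 \<le> \<xi> \<bullet> (d + t *\<^sub>R n)" if "t \<in> {-\<epsilon>..\<epsilon>}" for t
    proof -
      have t: "\<bar>t\<bar> \<le> \<epsilon>" using that by auto
      show "norm (d + t *\<^sub>R n) \<le> M" using norm_triangle_ineq[of d "t *\<^sub>R n"] t n by (simp add: M_def)
      have "\<bar>t * \<beta>\<bar> \<le> \<epsilon> * 1" unfolding abs_mult using t b1 M by (intro mult_mono) auto
      then show "m / 2 \<le> \<xi> \<bullet> (d + t *\<^sub>R n)" using xd by (simp add: inner_add_right \<beta>_def \<epsilon>_def)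
    qed
    have gz: "GDERIV \<phi> (z + 0 *\<^sub>R v) :> a" for v using \<phi>(2,3) by (simp add: C11_with_gradient_def a_def)
    have \<phi>z: "\<phi> z = 0" using fr z \<phi>(2) by blast
    have "0 < (d + \<epsilon> *\<^sub>R n) \<bullet> a" using da na M a by (simp add: inner_add_left)
    from DERIV_pos_inc_right[OF GDERIV_line[OF gz] this]
    obtain s1 where s1: "s1 > 0" "\<And>s. 0 < s \<Longrightarrow> s < s1 \<Longrightarrow> 0 < \<phi> (z + s *\<^sub>R (d + \<epsilon> *\<^sub>R n))" using \<phi>z by auto
    have "(d + (-\<epsilon>) *\<^sub>R n) \<bullet> a < 0" using da na M a by (simp add: inner_diff_left)
    from DERIV_neg_dec_right[OF GDERIV_line[OF gz] this]
    obtain s2 where s2: "s2 > 0" "\<And>s. 0 < s \<Longrightarrow> s < s2 \<Longrightarrow> \<phi> (z + s *\<^sub>R (d + (-\<epsilon>) *\<^sub>R n)) < 0" using \<phi>z by auto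
    obtain e where e: "0 < e" "ball z e \<subseteq> X" using \<phi>(1,2) open_contains_ball by blast
    \<comment> \<open>In turn: \<phi> keeps its two signs at the ends of the segment, the segment
      stays in \<open>X\<close>, and the linear term in the direction \<xi> beats the quadratic one,
      which puts the segment into the interior of the supporting ball.\<close>
    define s0 where "s0 = min (min s1 s2) (min (e / M) (m / (2 * B * M\<^sup>2)))"
    have "0 < s0" using s1(1) s2(1) e(1) M B m by (simp add: s0_def)
    then obtain s where "0 < s" "s < s0" using dense by blast
    then have s: "0 < s" "s < min (min s1 s2) (min (e / M) (m / (2 * B * M\<^sup>2)))" by (simp_all add: s0_def)
    then have s': "s < s1" "s < s2" "s * M < e" "s * (2 * B * M\<^sup>2) < m"
      using M B by (simp_all add: pos_less_divide_eq)
    have inX: "z + s *\<^sub>R (d + t *\<^sub>R n) \<in> X" if "t \<in> {-\<epsilon>..\<epsilon>}" for t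
    proof -
      have "norm (s *\<^sub>R (d + t *\<^sub>R n)) \<le> s * M" using dt(1)[OF that] s(1) by simp
      then have "z + s *\<^sub>R (d + t *\<^sub>R n) \<in> ball z e" using s'(3) by (simp add: dist_norm)
      then show ?thesis using e(2) by blast
    qed
    have \<phi>c: "continuous_on X \<phi>"
    proof (rule continuous_at_imp_continuous_on, rule ballI)
      fix x assume "x \<in> X"
      then have "GDERIV \<phi> x :> D\<phi> x" using \<phi>(3) by (simp add: C11_with_gradient_def)
      then show "isCont \<phi> x" unfolding gderiv_def by (rule has_derivative_continuous)
    qed
    have "\<exists>t\<ge>-\<epsilon>. t \<le> \<epsilon> \<and> \<phi> (z + s *\<^sub>R (d + t *\<^sub>R n)) = 0"
    proof (rule IVT')
      show "\<phi> (z + s *\<^sub>R (d + (-\<epsilon>) *\<^sub>R n)) \<le> 0" by (rule less_imp_le[OF s2(2)[OF s(1) s'(2)]])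
      show "0 \<le> \<phi> (z + s *\<^sub>R (d + \<epsilon> *\<^sub>R n))" by (rule less_imp_le[OF s1(2)[OF s(1) s'(1)]])
      show "continuous_on {-\<epsilon>..\<epsilon>} (\<lambda>t. \<phi> (z + s *\<^sub>R (d + t *\<^sub>R n)))"
        by (rule continuous_on_compose2[OF \<phi>c]) (use inX in \<open>auto intro!: continuous_intros\<close>)
    qed (use M in simp)
    then obtain t where t: "t \<in> {-\<epsilon>..\<epsilon>}" "\<phi> (z + s *\<^sub>R (d + t *\<^sub>R n)) = 0" by auto
    define h where "h = s *\<^sub>R (d + t *\<^sub>R n)"
    have "z + h \<in> frontier S" using fr inX[OF t(1)] t(2) by (auto simp: h_def)
    then have "z + h \<in> closure (- S)" by (simp add: frontier_closures)
    moreover have "B * (norm h)\<^sup>2 < \<xi> \<bullet> h"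
    proof -
      have "norm h \<le> s * M" using dt(1)[OF t(1)] s(1) by (simp add: h_def)
      then have "B * (norm h)\<^sup>2 \<le> B * (s * M)\<^sup>2" using B by (intro mult_left_mono power_mono) auto
      also have "\<dots> = s * (s * (2 * B * M\<^sup>2)) / 2" by (simp add: power2_eq_square)
      also have "\<dots> < s * m / 2" using s(1) s'(4) by (intro divide_strict_right_mono mult_strict_left_mono) auto
      also have "\<dots> \<le> \<xi> \<bullet> h" using mult_left_mono[OF dt(2)[OF t(1)], of s] s(1) by (simp add: h_def)
      finally show ?thesis .
    qed
    ultimately show False using inner_normal_interior[OF \<xi>, of h] unfolding B_def by blast
  qed
  then have xb: "\<xi> = \<beta> *\<^sub>R n" by (simp add: d_def)
  then have "\<bar>\<beta>\<bar> = 1" using x1 n by simp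
  then have "\<beta> = 1 \<or> \<beta> = - 1" by linarith
  then show ?thesis using xb unfolding n_def a_def by auto
qed

text \<open>
  If both unit normals pointed into the target, a point outside \<open>S\<close> close to \<open>z\<close> would lie between two
  boundary points on a line along which \<open>\<phi>\<close> increases.
\<close>

lemma inner_normal_orientation:
  assumes \<phi>: "open X" "z \<in> X" "C11_with_gradient X \<phi> D\<phi>" "D\<phi> z \<noteq> 0" and fr: "frontier S \<inter> X = {x \<in> X. \<phi> x = 0}"
    and z: "z \<in> frontier S" and n: "inner_normal z (sgn (D\<phi> z))" "inner_normal z (- sgn (D\<phi> z))"
  shows False
proof -
  define a where "a = D\<phi> z"
  define n where "n = sgn a"
  have a: "0 < norm a" "a \<noteq> 0" using \<phi>(4) by (simp_all add: a_def)
  have n1: "norm n = 1" using a by (simp add: n_def norm_sgn)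
  have nn: "n \<bullet> n = 1" using n1 by (simp add: dot_square_norm)
  have na: "n \<bullet> a = norm a" using a by (simp add: n_def sgn_div_norm dot_square_norm power2_eq_square)
  have nor: "inner_normal z n" "inner_normal z (- n)" using n by (simp_all add: n_def a_def)
  define B where "B = 1 / (2 * \<rho>\<^sub>0)"
  have B: "0 < B" using pos by (simp add: B_def)
  obtain e C where e: "0 < e" "C-lipschitz_on (ball z e \<inter> X) D\<phi>"
    using \<phi>(2,3) unfolding C11_with_gradient_def by blast
  obtain e1 where e1: "0 < e1" "ball z e1 \<subseteq> X" using \<phi>(1,2) open_contains_ball by blast
  have C: "0 \<le> C" by (rule lipschitz_on_nonneg[OF e(2)])
  \<comment> \<open>Within this radius the gradient differs from \<open>a\<close> by less than
    \<open>norm a\<close>, so \<phi> strictly increases along \<open>n\<close>.\<close>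
  define \<eta> where "\<eta> = min (min e e1) (norm a / (C + 1))"
  have \<eta>: "0 < \<eta>" using e(1) e1(1) a C by (simp add: \<eta>_def)
  have \<eta>X: "x \<in> X" if "x \<in> ball z \<eta>" for x using that e1(2) by (auto simp: \<eta>_def)
  have der: "0 < n \<bullet> D\<phi> x" if x: "x \<in> ball z \<eta>" for x
  proof -
    have "dist (D\<phi> x) (D\<phi> z) \<le> C * dist x z"
      using x e(1) \<phi>(2) \<eta>X[OF x] by (intro lipschitz_onD[OF e(2)]) (auto simp: \<eta>_def)
    also have "\<dots> \<le> (C + 1) * dist x z" by (intro mult_right_mono) auto
    also have "\<dots> < norm a" using x C by (simp add: \<eta>_def dist_commute pos_less_divide_eq mult.commute)
    finally have "norm (D\<phi> x - a) < norm a" by (simp add: dist_norm a_def)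
    moreover have "\<bar>n \<bullet> (D\<phi> x - a)\<bar> \<le> norm (D\<phi> x - a)" using Cauchy_Schwarz_ineq2[of n "D\<phi> x - a"] by (simp add: n1)
    ultimately show ?thesis using na by (simp add: inner_diff_right)
  qed
  \<comment> \<open>The first bound keeps the segment through \<open>x\<close> in the ball of radius
    \<eta>. The second gives \<open>B * (2 * \<delta>)\<^sup>2 < \<delta> / 2\<close>, so both its
    ends lie strictly inside the opposite supporting balls.\<close>
  have "0 < min (\<eta> / 2) (1 / (8 * B))" using \<eta> B by simp
  then obtain \<delta> where \<delta>: "0 < \<delta>" "\<delta> < min (\<eta> / 2) (1 / (8 * B))" using dense by blast
  then have \<delta>': "2 * \<delta> < \<eta>" "8 * B * \<delta> < 1" using B by (simp_all add: pos_less_divide_eq mult.commute)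
  have "z \<in> closure (- S)" using z by (simp add: frontier_closures)
  then obtain x where x: "x \<notin> S" "dist x z < \<delta> / 2" using \<delta>(1) unfolding closure_approachable by (metis ComplD half_gt_zero)
  have inS: "x + (\<sigma> * \<delta>) *\<^sub>R n \<in> S" if \<sigma>: "\<sigma> = 1 \<or> \<sigma> = - 1" for \<sigma> :: real
  proof -
    define h where "h = (x - z) + (\<sigma> * \<delta>) *\<^sub>R n"
    have xz: "norm (x - z) < \<delta> / 2" using x(2) by (simp add: dist_norm)
    have "norm h \<le> 2 * \<delta>" using norm_triangle_ineq[of "x - z" "(\<sigma> * \<delta>) *\<^sub>R n"] xz \<sigma> \<delta>(1) n1 by (auto simp: h_def)
    then have "B * (norm h)\<^sup>2 \<le> B * (2 * \<delta>)\<^sup>2" using B by (intro mult_left_mono power_mono) auto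
    also have "\<dots> = \<delta> * (8 * B * \<delta>) / 2" by (simp add: power2_eq_square)
    also have "\<dots> < \<delta> * 1 / 2" using \<delta>(1) \<delta>'(2) by (intro divide_strict_right_mono mult_strict_left_mono) auto
    also have "\<dots> \<le> \<delta> - norm (x - z)" using xz by simp
    also have "\<dots> \<le> \<sigma> *\<^sub>R n \<bullet> h"
    proof -
      have "\<bar>n \<bullet> (x - z)\<bar> \<le> norm (x - z)" using Cauchy_Schwarz_ineq2[of n "x - z"] by (simp add: n1)
      then show ?thesis using \<sigma> nn by (auto simp: h_def inner_add_right algebra_simps)
    qed
    finally have "B * (norm h)\<^sup>2 < \<sigma> *\<^sub>R n \<bullet> h" .
    moreover have "inner_normal z (\<sigma> *\<^sub>R n)" using nor \<sigma> by auto
    ultimately have "z + h \<notin> closure (- S)" using inner_normal_interior unfolding B_def by blast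
    then have "z + h \<in> S" using not_in_S_closure by blast
    then show ?thesis by (simp add: h_def)
  qed
  have hit: "\<exists>t. 0 < t \<and> t \<le> \<delta> \<and> x + (\<sigma> * t) *\<^sub>R n \<in> frontier S" if \<sigma>: "\<sigma> = 1 \<or> \<sigma> = - 1" for \<sigma> :: real
  proof -
    define A where "A = (\<lambda>t. x + (\<sigma> * t) *\<^sub>R n) ` {0..\<delta>}"
    have "connected A" unfolding A_def by (intro connected_continuous_image continuous_intros) simp
    moreover have "x + (\<sigma> * \<delta>) *\<^sub>R n \<in> A" unfolding A_def using \<delta>(1) by (intro imageI) simp
    then have "A \<inter> S \<noteq> {}" using inS[OF \<sigma>] by blast
    moreover have "x \<in> A" unfolding A_def using \<delta>(1) by (intro image_eqI[of _ _ 0]) auto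
    then have "A - S \<noteq> {}" using x(1) by blast
    ultimately have "A \<inter> frontier S \<noteq> {}" by (intro connected_Int_frontier)
    then obtain t where t: "t \<in> {0..\<delta>}" "x + (\<sigma> * t) *\<^sub>R n \<in> frontier S" unfolding A_def by blast
    have "t \<noteq> 0" using t(2) x(1) frontier_subset_closed[OF S] by auto
    then show ?thesis using t by (intro exI[of _ t]) simp
  qed
  obtain t1 where t1: "0 < t1" "t1 \<le> \<delta>" "x + t1 *\<^sub>R n \<in> frontier S" using hit[of 1] by auto
  obtain t2 where t2: "0 < t2" "t2 \<le> \<delta>" "x + (- t2) *\<^sub>R n \<in> frontier S" using hit[of "- 1"] by auto
  have bl: "x + t *\<^sub>R n \<in> ball z \<eta>" if "- t2 \<le> t" "t \<le> t1" for t
  proof -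
    have "norm (x - z + t *\<^sub>R n) \<le> norm (x - z) + \<bar>t\<bar>" using norm_triangle_ineq[of "x - z" "t *\<^sub>R n"] n1 by simp
    also have "\<dots> < \<eta>" using that t1(2) t2(2) x(2) \<delta>'(1) \<delta>(1) by (auto simp: dist_norm)
    finally show ?thesis by (simp add: dist_norm norm_minus_commute algebra_simps)
  qed
  have zero: "\<phi> (x + t *\<^sub>R n) = 0" if "x + t *\<^sub>R n \<in> frontier S" "- t2 \<le> t" "t \<le> t1" for t
    using fr that(1) \<eta>X[OF bl[OF that(2,3)]] by blast
  have "\<phi> (x + (- t2) *\<^sub>R n) < \<phi> (x + t1 *\<^sub>R n)"
  proof (rule DERIV_pos_imp_increasing[of "- t2" t1 "\<lambda>t. \<phi> (x + t *\<^sub>R n)"])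
    fix t assume t: "- t2 \<le> t" "t \<le> t1"
    have "GDERIV \<phi> (x + t *\<^sub>R n) :> D\<phi> (x + t *\<^sub>R n)" using \<phi>(3) \<eta>X[OF bl[OF t]] by (simp add: C11_with_gradient_def)
    from GDERIV_line[OF this] der[OF bl[OF t]]
    show "\<exists>y. DERIV (\<lambda>t. \<phi> (x + t *\<^sub>R n)) t :> y \<and> 0 < y" by blast
  qed (use t1 t2 in simp)
  moreover have "\<phi> (x + t1 *\<^sub>R n) = 0" using t1 t2 by (intro zero) auto
  moreover have "\<phi> (x + (- t2) *\<^sub>R n) = 0" using t1 t2 by (intro zero) auto
  ultimately show False by simp
qed

lemma inner_normal_unique:
  assumes S: "C11_boundary S" and z: "z \<in> frontier S" and \<xi>: "inner_normal z \<xi>" "inner_normal z \<xi>'"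
  shows "\<xi> = \<xi>'"
proof -
  obtain X \<phi> D\<phi> where X: "open X" "z \<in> X" "C11_with_gradient X \<phi> D\<phi>" "D\<phi> z \<noteq> 0" "frontier S \<inter> X = {x \<in> X. \<phi> x = 0}"
  proof -
    obtain X \<phi> D\<phi> where *: "open X" "z \<in> X" "C11_with_gradient X \<phi> D\<phi>" "\<forall>z\<in>X. D\<phi> z \<noteq> 0" "frontier S \<inter> X = {x \<in> X. \<phi> x = 0}"
      using bspec[OF S[unfolded C11_boundary_def] z] by (elim exE conjE)
    show thesis by (rule that[OF *(1-3) bspec[OF *(4,2)] *(5)])
  qed
  have "\<xi> = sgn (D\<phi> z) \<or> \<xi> = - sgn (D\<phi> z)" "\<xi>' = sgn (D\<phi> z) \<or> \<xi>' = - sgn (D\<phi> z)"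
    using inner_normal_parallel[OF X z] \<xi> by blast+
  then show ?thesis using inner_normal_orientation[OF X z] \<xi> by auto
qed

section \<open>Closedness of the dual conditions under limits\<close>

lemma tendsto_control:
  assumes "continuous_on (UNIV \<times> U) (\<lambda>(x, \<omega>). \<Phi> x \<omega>)" "X \<longlonglongrightarrow> x" "w \<longlonglongrightarrow> \<omega>" "\<And>n. w n \<in> U" "\<omega> \<in> U"
  shows "(\<lambda>n. \<Phi> (X n) (w n)) \<longlonglongrightarrow> \<Phi> x \<omega>"
  using continuous_on_tendsto_compose[OF assms(1) tendsto_Pair[OF assms(2,3)]] assms(4,5) by simp

lemma maximizer_limit:
  assumes m: "\<And>n. maximizer (X n) (P n) (M n) (w n)" and lim: "X \<longlonglongrightarrow> x" "P \<longlonglongrightarrow> p" "M \<longlonglongrightarrow> \<mu>" "w \<longlonglongrightarrow> \<omega>"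
  shows "maximizer x p \<mu> \<omega>"
proof -
  have wU: "w n \<in> U" for n using m by (simp add: maximizer_def)
  have \<omega>: "\<omega> \<in> U" by (rule closed_sequentially[OF U_closed wU lim(4)])
  have "- (p \<bullet> f x \<omega>') - \<mu> * r x \<omega>' \<le> 0" if "\<omega>' \<in> U" for \<omega>'
  proof (rule LIMSEQ_le_const2)
    show "(\<lambda>n. - (P n \<bullet> f (X n) \<omega>') - M n * r (X n) \<omega>') \<longlonglongrightarrow> - (p \<bullet> f x \<omega>') - \<mu> * r x \<omega>'"
      by (intro tendsto_intros lim tendsto_control[OF f_cont lim(1) tendsto_const] tendsto_control[OF r_cont lim(1) tendsto_const] that)
    show "\<exists>N. \<forall>n\<ge>N. - (P n \<bullet> f (X n) \<omega>') - M n * r (X n) \<omega>' \<le> 0"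
      using m that unfolding maximizer_def ham_le_def by blast
  qed
  moreover have "p \<bullet> f x \<omega> + \<mu> * r x \<omega> = 0"
  proof (rule LIMSEQ_unique)
    show "(\<lambda>n. P n \<bullet> f (X n) (w n) + M n * r (X n) (w n)) \<longlonglongrightarrow> p \<bullet> f x \<omega> + \<mu> * r x \<omega>"
      by (intro tendsto_intros lim tendsto_control[OF f_cont lim(1,4) wU \<omega>] tendsto_control[OF r_cont lim(1,4) wU \<omega>])
    show "(\<lambda>n. P n \<bullet> f (X n) (w n) + M n * r (X n) (w n)) \<longlonglongrightarrow> 0"
      using m by (simp add: maximizer_def)
  qed
  ultimately show ?thesis using \<omega> by (simp add: maximizer_def ham_le_def)
qed

lemma transversal_iff:
  "transversal c z \<xi> q \<mu> \<longleftrightarrow> inner_normal z \<xi> \<and> supergrad c z q \<and> 0 \<le> \<mu> \<and> \<mu> \<le> 1 \<and> (\<exists>\<omega>. maximizer z (covec \<mu> q \<xi>) \<mu> \<omega>)"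
proof -
  have "- (P \<bullet> f z \<omega>) - \<mu> * r z \<omega> = 0 \<longleftrightarrow> P \<bullet> f z \<omega> + \<mu> * r z \<omega> = 0" for P \<omega> by linarith
  then show ?thesis unfolding transversal_def maximizer_def by blast
qed

text \<open>Everything is a closed condition with fixed constants \<open>c\<close>,
  \<open>\<rho>\<^sub>0\<close>, \<open>G\<close>. The attained zero of the Hamiltonian survives
  because the maximizing controls accumulate in the compact set \<open>U\<close>.\<close>

lemma transversal_limit:
  assumes tv: "\<And>n. transversal c (Z n) (\<xi>s n) (qs n) (M n)" and Z: "\<And>n. Z n \<in> frontier S"
    and lim: "Z \<longlonglongrightarrow> z" "\<xi>s \<longlonglongrightarrow> \<xi>" "qs \<longlonglongrightarrow> q" "M \<longlonglongrightarrow> \<mu>"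
  shows "transversal c z \<xi> q \<mu>"
proof -
  have z: "z \<in> frontier S" by (rule closed_sequentially[OF frontier_closed Z lim(1)])
  have "\<forall>n. \<exists>\<omega>. maximizer (Z n) (covec (M n) (qs n) (\<xi>s n)) (M n) \<omega>" using tv unfolding transversal_iff by blast
  then obtain w where w: "\<And>n. maximizer (Z n) (covec (M n) (qs n) (\<xi>s n)) (M n) (w n)" by metis
  then have "\<forall>n. w n \<in> U" by (simp add: maximizer_def)
  then obtain \<omega> k where k: "strict_mono (k :: nat \<Rightarrow> nat)" "(w \<circ> k) \<longlonglongrightarrow> \<omega>"
    using U(2) unfolding compact_def by meson
  note sub = LIMSEQ_subseq_LIMSEQ[OF _ k(1)]
  have "maximizer z (covec \<mu> q \<xi>) \<mu> \<omega>"
  proof (rule maximizer_limit[OF _ sub[OF lim(1)] _ sub[OF lim(4)] k(2)])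
    show "maximizer ((Z \<circ> k) n) (covec (M (k n)) (qs (k n)) (\<xi>s (k n))) ((M \<circ> k) n) ((w \<circ> k) n)" for n
      using w[of "k n"] by simp
    show "(\<lambda>n. covec (M (k n)) (qs (k n)) (\<xi>s (k n))) \<longlonglongrightarrow> covec \<mu> q \<xi>"
      unfolding covec_def using sub[OF lim(2)] sub[OF lim(3)] sub[OF lim(4)] unfolding o_def by (intro tendsto_intros)
  qed
  moreover have "inner_normal z \<xi>"
    unfolding inner_normal_def
  proof (intro conjI ballI)
    have "(\<lambda>n. norm (\<xi>s n)) \<longlonglongrightarrow> norm \<xi>" by (intro tendsto_intros lim)
    moreover have "(\<lambda>n. norm (\<xi>s n)) \<longlonglongrightarrow> 1" using tv by (simp add: transversal_def inner_normal_def)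
    ultimately show "norm \<xi> = 1" by (rule LIMSEQ_unique)
    fix e assume e: "e \<in> closure (- S)"
    show "\<xi> \<bullet> (e - z) \<le> 1 / (2 * \<rho>\<^sub>0) * (norm (e - z))\<^sup>2"
    proof (rule LIMSEQ_le)
      show "(\<lambda>n. \<xi>s n \<bullet> (e - Z n)) \<longlonglongrightarrow> \<xi> \<bullet> (e - z)" by (intro tendsto_intros lim)
      show "(\<lambda>n. 1 / (2 * \<rho>\<^sub>0) * (norm (e - Z n))\<^sup>2) \<longlonglongrightarrow> 1 / (2 * \<rho>\<^sub>0) * (norm (e - z))\<^sup>2" by (intro tendsto_intros lim)
      show "\<exists>N. \<forall>n\<ge>N. \<xi>s n \<bullet> (e - Z n) \<le> 1 / (2 * \<rho>\<^sub>0) * (norm (e - Z n))\<^sup>2"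
        using tv e unfolding transversal_def inner_normal_def by blast
    qed
  qed
  moreover have "supergrad c z q"
    unfolding supergrad_def
  proof (intro conjI ballI)
    show "norm q \<le> G"
      by (rule LIMSEQ_le_const2[OF tendsto_norm[OF lim(3)]]) (use tv in \<open>auto simp: transversal_def supergrad_def\<close>)
    fix e assume e: "e \<in> frontier S"
    show "g e \<le> g z + q \<bullet> (e - z) + c * (norm (e - z))\<^sup>2"
    proof (rule LIMSEQ_le_const)
      have "(\<lambda>n. g (Z n)) \<longlonglongrightarrow> g z"
      proof (rule LIM_zero_cancel, rule Lim_null_comparison)
        show "\<forall>\<^sub>F n in sequentially. norm (g (Z n) - g z) \<le> G * norm (Z n - z)" using g_frontier_lip[OF Z z] by simp
        show "(\<lambda>n. G * norm (Z n - z)) \<longlonglongrightarrow> 0" by (rule tendsto_mult_right_zero[OF tendsto_norm_zero[OF LIM_zero[OF lim(1)]]])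
      qed
      then show "(\<lambda>n. g (Z n) + qs n \<bullet> (e - Z n) + c * (norm (e - Z n))\<^sup>2) \<longlonglongrightarrow> g z + q \<bullet> (e - z) + c * (norm (e - z))\<^sup>2"
        by (intro tendsto_intros lim)
      show "\<exists>N. \<forall>n\<ge>N. g e \<le> g (Z n) + qs n \<bullet> (e - Z n) + c * (norm (e - Z n))\<^sup>2"
        using tv e unfolding transversal_def supergrad_def by blast
    qed
  qed
  moreover have "0 \<le> \<mu>" by (rule LIMSEQ_le_const[OF lim(4)]) (use tv in \<open>auto simp: transversal_def\<close>)
  moreover have "\<mu> \<le> 1" by (rule LIMSEQ_le_const2[OF lim(4)]) (use tv in \<open>auto simp: transversal_def\<close>)
  ultimately show ?thesis unfolding transversal_iff by blast
qed

text \<open>The fixed constant and the global form of the inequality let it pass to the limit for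
  each test point separately; convergence of the values is where continuity of \<open>V\<close> will
  enter.\<close>

lemma prox_normal_limit:
  assumes pn: "\<And>n. prox_normal C (X n) (P n) (M n)" and lim: "X \<longlonglongrightarrow> x" "P \<longlonglongrightarrow> p" "M \<longlonglongrightarrow> \<mu>" "(\<lambda>n. Vr (X n)) \<longlonglongrightarrow> Vr x"
  shows "prox_normal C x p \<mu>"
  unfolding prox_normal_def
proof (intro allI impI)
  fix x' \<beta> assume x': "x' \<in> closure (- S)" "ereal \<beta> \<le> V x'"
  show "- (p \<bullet> (x' - x)) + \<mu> * (\<beta> - Vr x) \<le> C * (norm (x' - x) + \<bar>\<beta> - Vr x\<bar>)\<^sup>2"
  proof (rule LIMSEQ_le)
    show "(\<lambda>n. - (P n \<bullet> (x' - X n)) + M n * (\<beta> - Vr (X n))) \<longlonglongrightarrow> - (p \<bullet> (x' - x)) + \<mu> * (\<beta> - Vr x)"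
      by (intro tendsto_intros lim)
    show "(\<lambda>n. C * (norm (x' - X n) + \<bar>\<beta> - Vr (X n)\<bar>)\<^sup>2) \<longlonglongrightarrow> C * (norm (x' - x) + \<bar>\<beta> - Vr x\<bar>)\<^sup>2"
      by (intro tendsto_intros lim)
    show "\<exists>N. \<forall>n\<ge>N. - (P n \<bullet> (x' - X n)) + M n * (\<beta> - Vr (X n)) \<le> C * (norm (x' - X n) + \<bar>\<beta> - Vr (X n)\<bar>)\<^sup>2"
      using pn x' unfolding prox_normal_def by blast
  qed
qed

end

section \<open>Convergence of adjoint arcs\<close>

context regular_exit_time_problem
begin

text \<open>The controls \<open>w n\<close> may oscillate. Every accumulation point is a maximizer
  at the limit, however, and all maximizers give the same right-hand side, so no subsequence can
  stay away from it.\<close>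

lemma adj_rhs_limit:
  assumes lim: "X \<longlonglongrightarrow> x" "P \<longlonglongrightarrow> p" "M \<longlonglongrightarrow> \<mu>" and p: "p \<noteq> 0" and \<mu>: "0 \<le> \<mu>"
    and ms: "\<And>n. maximizer (X n) (P n) (M n) (w n)" and m: "maximizer x p \<mu> \<omega>"
  shows "(\<lambda>n. blinfun_tr (Df (X n) (w n)) (P n) + M n *\<^sub>R Dr (X n) (w n)) \<longlonglongrightarrow> blinfun_tr (Df x \<omega>) p + \<mu> *\<^sub>R Dr x \<omega>"
    (is "?A \<longlonglongrightarrow> ?a")
proof (rule ccontr)
  assume "\<not> ?A \<longlonglongrightarrow> ?a"
  then obtain e where e: "0 < e" "\<forall>m. \<exists>n\<ge>m. \<not> norm (?A n - ?a) < e" unfolding LIMSEQ_iff by blast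
  then have "infinite {n. \<not> norm (?A n - ?a) < e}" unfolding infinite_nat_iff_unbounded_le by blast
  from infinite_enumerate[OF this] obtain k :: "nat \<Rightarrow> nat" where k: "strict_mono k" "\<forall>n. \<not> norm (?A (k n) - ?a) < e" by blast
  have wU: "w n \<in> U" for n using ms by (simp add: maximizer_def)
  then have "\<forall>n. (w \<circ> k) n \<in> U" by simp
  then obtain \<omega>' j where j: "\<omega>' \<in> U" "strict_mono (j :: nat \<Rightarrow> nat)" "((w \<circ> k) \<circ> j) \<longlonglongrightarrow> \<omega>'"
    using U(2) unfolding compact_def by meson
  define i where "i = k \<circ> j"
  have i: "strict_mono i" unfolding i_def by (rule strict_mono_o[OF k(1) j(2)])
  have X: "(\<lambda>n. X (i n)) \<longlonglongrightarrow> x" and P: "(\<lambda>n. P (i n)) \<longlonglongrightarrow> p" and M: "(\<lambda>n. M (i n)) \<longlonglongrightarrow> \<mu>"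
    using LIMSEQ_subseq_LIMSEQ[OF lim(1) i] LIMSEQ_subseq_LIMSEQ[OF lim(2) i] LIMSEQ_subseq_LIMSEQ[OF lim(3) i] by (simp_all add: o_def)
  have w: "(\<lambda>n. w (i n)) \<longlonglongrightarrow> \<omega>'" using j(3) by (simp add: i_def o_def)
  have m': "maximizer x p \<mu> \<omega>'" by (rule maximizer_limit[OF ms X P M w])
  have "(\<lambda>n. ?A (i n)) \<longlonglongrightarrow> blinfun_tr (Df x \<omega>') p + \<mu> *\<^sub>R Dr x \<omega>'"
    unfolding blinfun_tr_def
    by (intro tendsto_intros P M tendsto_control[OF Dr_cont X w wU j(1)]
        blinfun.tendsto tendsto_control[OF Df_cont X w wU j(1)])
  moreover have "blinfun_tr (Df x \<omega>') p + \<mu> *\<^sub>R Dr x \<omega>' = ?a" using maximizer_feedback[OF p m' m \<mu>] by blast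
  ultimately have "(\<lambda>n. ?A (i n)) \<longlonglongrightarrow> ?a" by simp
  then obtain n where "norm (?A (i n) - ?a) < e" using e(1) unfolding LIMSEQ_iff by blast
  then show False using k(2) by (simp add: i_def)
qed

text \<open>The adjoint equation is passed to the limit in integral form by dominated convergence;
  the pointwise convergence of the integrands comes from \<open>adj_rhs_limit\<close>.\<close>

lemma adj_limit:
  assumes \<sigma>: "0 \<le> \<sigma>" and u: "ctrl u" and y: "continuous_on UNIV y" and pc: "continuous_on {0..\<sigma>} p"
    and us: "\<And>n. ctrl (us n)" and ad: "\<And>n. adj (us n) (ys n) (M n) (ps n) \<sigma>"
    and M: "\<And>n. 0 \<le> M n" "\<And>n. M n \<le> 1" "M \<longlonglongrightarrow> \<mu>"
    and b: "\<And>n t. t \<in> {0..\<sigma>} \<Longrightarrow> norm (ps n t) \<le> B"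
    and lim: "\<And>t. t \<in> {0..\<sigma>} \<Longrightarrow> (\<lambda>n. ys n t) \<longlonglongrightarrow> y t" "\<And>t. t \<in> {0..\<sigma>} \<Longrightarrow> (\<lambda>n. ps n t) \<longlonglongrightarrow> p t"
    and E: "\<And>n. negligible (E n)" "\<And>n t. t \<in> {0<..<\<sigma>} - E n \<Longrightarrow> maximizer (ys n t) (ps n t) (M n) (us n t)"
    and E': "negligible E'" "\<And>t. t \<in> {0<..<\<sigma>} - E' \<Longrightarrow> maximizer (y t) (p t) \<mu> (u t)"
    and p0: "\<And>t. t \<in> {0<..<\<sigma>} - E' \<Longrightarrow> p t \<noteq> 0"
  shows "adj u y \<mu> p \<sigma>"
proof -
  define P where "P t = p (max 0 (min \<sigma> t))" for t
  have P: "P t = p t" if "t \<in> {0..\<sigma>}" for t using that by (simp add: P_def)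
  have "continuous_on UNIV P" unfolding P_def
    by (rule continuous_on_compose2[OF pc]) (use \<sigma> in \<open>auto intro!: continuous_intros\<close>)
  then have Pm: "P \<in> borel_measurable lebesgue"
    using borel_measurable_continuous_onI[of P] by (intro measurable_completion) simp
  define F where "F n t = - (blinfun_tr (Df (ys n t) (us n t)) (ps n t) + M n *\<^sub>R Dr (ys n t) (us n t))" for n t
  define h where "h t = - (blinfun_tr (Df (y t) (u t)) (P t) + \<mu> *\<^sub>R Dr (y t) (u t))" for t
  have hm: "h \<in> borel_measurable lebesgue"
    unfolding h_def by (intro borel_measurable_uminus adj_rhs_measurable[OF y u Pm])
  have \<mu>: "0 \<le> \<mu>" "\<mu> \<le> 1"
    using LIMSEQ_le_const[OF M(3)] LIMSEQ_le_const2[OF M(3)] M(1,2) by blast+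
  define K where "K = L * B + L"
  have Fb: "norm (F n t) \<le> K" if t: "t \<in> {0..\<sigma>}" for n t
  proof -
    have "norm (F n t) \<le> L * norm (ps n t) + L * M n"
      unfolding F_def norm_minus_cancel by (rule adj_rhs_bound[OF ctrlD(1)[OF us] M(1,2)])
    also have "\<dots> \<le> L * B + L * 1" using b[OF t] M(2) pos by (intro add_mono mult_left_mono) auto
    finally show ?thesis by (simp add: K_def)
  qed
  have hb: "norm (h t) \<le> K" if t: "t \<in> {0..\<sigma>}" for t
  proof -
    have "norm (p t) \<le> B" by (rule LIMSEQ_le_const2[OF tendsto_norm[OF lim(2)[OF t]]]) (use b[OF t] in blast)
    then have "L * norm (P t) + L * \<mu> \<le> L * B + L * 1" using P[OF t] \<mu> pos by (intro add_mono mult_left_mono) auto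
    moreover have "norm (h t) \<le> L * norm (P t) + L * \<mu>"
      unfolding h_def norm_minus_cancel by (rule adj_rhs_bound[OF ctrlD(1)[OF u] \<mu>])
    ultimately show ?thesis by (simp add: K_def)
  qed
  \<comment> \<open>One null set outside of which all the maximum conditions hold at once; the
    endpoints are included because the conditions concern open intervals.\<close>
  define Z where "Z = insert 0 (insert \<sigma> (E' \<union> (\<Union>n. E n)))"
  have Z: "negligible Z" unfolding Z_def using E(1) E'(1) negligible_Union_nat[OF E(1)] by (simp add: full_SetCompr_eq)
  have eq: "p t = p 0 + integral {0..t} h" if t: "t \<in> {0..\<sigma>}" for t
  proof -
    have sub: "s \<in> {0..\<sigma>}" if "s \<in> {0..t}" for s using that t by simp
    define F' where "F' n s = (if s \<in> Z then 0 else F n s)" for n s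
    define h' where "h' s = (if s \<in> Z then 0 else h s)" for s
    have I: "(F' n has_integral ps n t - ps n 0) {0..t}" for n
    proof (rule has_integral_spike[OF Z])
      have "ae_deriv 0 t (ps n) (F n)"
        unfolding F_def by (rule ae_deriv_subset[OF ad[unfolded adj_def]]) (use t in simp_all)
      then show "(F n has_integral ps n t - ps n 0) {0..t}" using t by (intro ae_deriv_has_integral) simp_all
    qed (simp add: F'_def)
    have "(\<lambda>n. integral {0..t} (F' n)) \<longlonglongrightarrow> integral {0..t} h'"
    proof (rule dominated_convergence(2)[where h = "\<lambda>_. \<bar>K\<bar>"])
      show "F' n integrable_on {0..t}" for n using I by (rule has_integral_integrable)
      show "norm (F' n s) \<le> \<bar>K\<bar>" if "s \<in> {0..t}" for n s using Fb[OF sub[OF that], of n] unfolding F'_def by (auto intro: order_trans)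
      fix s assume s: "s \<in> {0..t}"
      show "(\<lambda>n. F' n s) \<longlonglongrightarrow> h' s"
      proof (cases "s \<in> Z")
        case False
        then have s': "s \<in> {0<..<\<sigma>} - E'" "\<And>n. s \<in> {0<..<\<sigma>} - E n" "s \<in> {0..\<sigma>}"
          using s t unfolding Z_def by auto
        have "(\<lambda>n. F n s) \<longlonglongrightarrow> - (blinfun_tr (Df (y s) (u s)) (p s) + \<mu> *\<^sub>R Dr (y s) (u s))"
          unfolding F_def
          by (intro tendsto_minus adj_rhs_limit[OF lim(1)[OF s'(3)] lim(2)[OF s'(3)] M(3) p0[OF s'(1)] \<mu>(1) E(2)[OF s'(2)] E'(2)[OF s'(1)]])
        then show ?thesis using False P[OF s'(3)] by (simp add: F'_def h'_def h_def)
      qed (simp add: F'_def h'_def)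
    qed (rule integrable_const_ivl)
    moreover have "integral {0..t} (F' n) = ps n t - ps n 0" for n using I by (rule integral_unique)
    moreover have "integral {0..t} h' = integral {0..t} h" by (rule integral_spike[OF Z]) (simp add: h'_def)
    ultimately have "(\<lambda>n. ps n t - ps n 0) \<longlonglongrightarrow> integral {0..t} h" by simp
    moreover have "(\<lambda>n. ps n t - ps n 0) \<longlonglongrightarrow> p t - p 0" using \<sigma> by (intro tendsto_diff lim(2) t) simp
    ultimately have "integral {0..t} h = p t - p 0" by (rule LIMSEQ_unique)
    then show ?thesis by simp
  qed
  have "ae_deriv 0 \<sigma> (\<lambda>t. p 0 + integral {0..t} h) (\<lambda>t. 0 + h t)"
    by (rule ae_deriv_add[OF ae_deriv_const ae_deriv_integral[OF hm hb]])
  then show ?thesis unfolding adj_def 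
  proof (rule ae_deriv_cong)
    show "p t = p 0 + integral {0..t} h" if "t \<in> {0..\<sigma>}" for t by (rule eq[OF that])
    show "- (blinfun_tr (Df (y t) (u t)) (p t) + \<mu> *\<^sub>R Dr (y t) (u t)) = 0 + h t" if "t \<in> {0<..<\<sigma>}" for t
      using that P[of t] by (simp add: h_def)
  qed
qed

lemma Vr_tendsto:
  assumes "X \<longlonglongrightarrow> x" "\<And>n. X n \<in> reach" "\<And>n. X n \<in> closure (- S)" "x \<in> reach" "x \<in> closure (- S)"
  shows "(\<lambda>n. Vr (X n)) \<longlonglongrightarrow> Vr x"
proof -
  have "(\<lambda>n. V (X n)) \<longlonglongrightarrow> V x"
    by (rule continuous_on_tendsto_compose[OF V_cont assms(1,4)]) (use assms(2) in simp)
  then have "(\<lambda>n. V (X n)) \<longlonglongrightarrow> ereal (Vr x)" using V_finite[OF assms(4,5)] by metis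
  then show ?thesis by (rule lim_real_of_ereal)
qed

text \<open>
  The limit of the costates is again a proximal normal along the limit trajectory, hence satisfies the
  maximum principle. As maximizers determine the right-hand side of the adjoint equation,
  the right-hand sides converge almost everywhere although the controls need not converge.
\<close>

lemma costates_converge:
  assumes o: "opt x u y \<tau>" and xS: "x \<notin> S" and c0: "0 \<le> c"
    and tv: "transversal c (y \<tau>) \<xi> q \<mu>" and ad: "adj u y \<mu> p \<tau>" and pT: "p \<tau> = covec \<mu> q \<xi>"
    and os: "\<And>n. opt (X n) (us n) (ys n) (\<tau>s n)" and XS: "\<And>n. X n \<notin> S"
    and tvs: "\<And>n. transversal c (ys n (\<tau>s n)) (\<xi>s n) (qs n) (M n)"
    and ads: "\<And>n. adj (us n) (ys n) (M n) (ps n) (\<tau>s n)"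
    and pTs: "\<And>n. ps n (\<tau>s n) = covec (M n) (qs n) (\<xi>s n)"
    and \<tau>lim: "\<tau>s \<longlonglongrightarrow> \<tau>" and \<tau>T: "\<And>n. \<tau>s n \<le> T"
    and ylim: "\<And>t. 0 \<le> t \<Longrightarrow> t < \<tau> \<Longrightarrow> (\<lambda>n. ys n t) \<longlonglongrightarrow> y t"
    and clim: "(\<lambda>n. covec (M n) (qs n) (\<xi>s n)) \<longlonglongrightarrow> covec \<mu> q \<xi>" and Mlim: "M \<longlonglongrightarrow> \<mu>"
  obtains C k where "0 \<le> C" "\<And>n. prox_normal C (X n) (ps n 0) (M n)"
    "strict_mono (k :: nat \<Rightarrow> nat)" "(\<lambda>n. ps (k n) 0) \<longlonglongrightarrow> p 0"
proof -
  have Xc: "X n \<in> closure (- S)" for n by (rule not_in_S_closure[OF XS])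
  have xc: "x \<in> closure (- S)" by (rule not_in_S_closure[OF xS])
  have \<tau>0: "0 < \<tau>" by (rule opt_time_pos[OF o xS])
  have \<tau>s0: "0 < \<tau>s n" for n by (rule opt_time_pos[OF os XS])
  have T0: "0 \<le> T" using \<tau>s0[of 0] \<tau>T[of 0] by simp
  have \<tau>T': "\<tau> \<le> T" by (rule LIMSEQ_le_const2[OF \<tau>lim]) (use \<tau>T in blast)
  have \<mu>: "0 \<le> \<mu>" using tv by (simp add: transversal_def)
  have M: "0 \<le> M n" "M n \<le> 1" for n using tvs[of n] by (simp_all add: transversal_def)
  have usU: "us n t \<in> U" for n t by (rule ctrlD(1)[OF optD(1)[OF os]])
  obtain C where C: "0 \<le> C" and thA: "\<And>x u y \<tau> \<xi> q \<mu> p. opt x u y \<tau> \<Longrightarrow> \<tau> \<le> T \<Longrightarrow> x \<in> closure (- S) \<Longrightarrow>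
       transversal c (y \<tau>) \<xi> q \<mu> \<Longrightarrow> adj u y \<mu> p \<tau> \<Longrightarrow> p \<tau> = covec \<mu> q \<xi> \<Longrightarrow> prox_normal C x (p 0) \<mu>"
    by (rule prox_normal_optimal[OF T0 c0]) (rule that)
  have pns: "prox_normal C (ys n t) (ps n t) (M n)" if t: "t \<in> {0..\<tau>s n}" for n t
  proof (rule prox_normal_along[OF os \<tau>T Xc tvs ads pTs])
    show "0 \<le> t" "t \<le> \<tau>s n" using t by auto
  qed (rule thA)
  have ext: "extremal (us n) (ys n) (ps n) (M n) (\<tau>s n)" for n
    by (rule extremal_exists[OF os \<tau>T XS tvs ads pTs C pns])
  define B where "B = (G + 1 + L * T) * exp (L * T)"
  have B: "norm (ps n t) \<le> B" if t: "t \<in> {0..\<tau>s n}" for n t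
  proof -
    have "norm (ps n t) \<le> (norm (ps n (\<tau>s n)) + L * M n * \<tau>s n) * exp (L * \<tau>s n)"
      by (rule adj_bound[OF ads optD(1)[OF os] M t])
    also have "\<dots> \<le> B"
      unfolding B_def
    proof (rule mult_mono, rule add_mono)
      show "norm (ps n (\<tau>s n)) \<le> G + 1" unfolding pTs by (rule norm_covec[OF tvs])
      have "M n * \<tau>s n \<le> 1 * T" using M \<tau>T \<tau>s0[of n] by (intro mult_mono) auto
      then show "L * M n * \<tau>s n \<le> L * T" using pos mult_left_mono[of "M n * \<tau>s n" T L] by (simp add: mult.assoc)
      show "exp (L * \<tau>s n) \<le> exp (L * T)" using \<tau>T pos by simp
    qed (use G T0 pos in auto)
    finally show ?thesis .
  qed
  define K where "K = L * B + L"
  have B0: "0 \<le> B" using G T0 pos by (simp add: B_def)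
  have K0: "0 \<le> K" using B0 pos by (simp add: K_def)
  have rhsb: "norm (- (blinfun_tr (Df (ys n s) (us n s)) (ps n s) + M n *\<^sub>R Dr (ys n s) (us n s))) \<le> K" if s: "s \<in> {0..\<tau>s n}" for n s
  proof -
    have "norm (- (blinfun_tr (Df (ys n s) (us n s)) (ps n s) + M n *\<^sub>R Dr (ys n s) (us n s))) \<le> L * norm (ps n s) + L * M n"
      unfolding norm_minus_cancel by (rule adj_rhs_bound[OF usU M])
    also have "\<dots> \<le> L * B + L * 1" using B[OF s] M pos by (intro add_mono mult_left_mono) auto
    finally show ?thesis by (simp add: K_def)
  qed
  have Klip': "norm (ps n t - ps n s) \<le> K * (t - s)" if "0 \<le> s" "s \<le> t" "t \<le> \<tau>s n" for n s t
  proof (rule ae_deriv_norm_le[OF that(2) ae_deriv_subset[OF ads[unfolded adj_def] that(1,3)] negligible_empty])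
    fix r assume "r \<in> {s<..<t} - {}"
    then have "r \<in> {0..\<tau>s n}" using that by auto
    then show "norm (- (blinfun_tr (Df (ys n r) (us n r)) (ps n r) + M n *\<^sub>R Dr (ys n r) (us n r))) \<le> K" by (rule rhsb)
  qed
  \<comment> \<open>The exit times vary with \<open>n\<close>. Freezing each costate at its terminal
    value after the exit puts all of them on the common interval up to \<open>T\<close> with the
    same Lipschitz constant.\<close>
  define \<pi> where "\<pi> n t = ps n (min t (\<tau>s n))" for n t
  have \<pi>B: "norm (\<pi> n t) \<le> B" if "t \<in> {0..T}" for n t
    unfolding \<pi>_def by (rule B) (use that \<tau>s0[of n] in auto)
  have \<pi>L': "norm (\<pi> n t - \<pi> n s) \<le> K * (t - s)" if "0 \<le> s" "s \<le> t" for n s t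
  proof -
    have "norm (\<pi> n t - \<pi> n s) \<le> K * (min t (\<tau>s n) - min s (\<tau>s n))"
      unfolding \<pi>_def using that \<tau>s0[of n] by (intro Klip') auto
    also have "\<dots> \<le> K * (t - s)" using K0 that by (intro mult_left_mono) auto
    finally show ?thesis .
  qed
  have \<pi>L: "norm (\<pi> n t - \<pi> n s) \<le> K * \<bar>t - s\<bar>" if "0 \<le> s" "0 \<le> t" for n s t
  proof (cases "s \<le> t")
    case True then show ?thesis using \<pi>L'[OF that(1), of t n] by simp
  next
    case False then show ?thesis using \<pi>L'[OF that(2), of s n] by (simp add: norm_minus_commute)
  qed
  obtain \<gamma> k where k: "continuous_on {0..T} \<gamma>" "strict_mono (k :: nat \<Rightarrow> nat)"
    "\<And>e. 0 < e \<Longrightarrow> \<exists>N. \<forall>n t. n \<ge> N \<and> t \<in> {0..T} \<longrightarrow> norm (\<pi> (k n) t - \<gamma> t) < e"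
  proof (rule Arzela_Ascoli[of "{0..T}" \<pi> B])
    fix t and e :: real assume t: "t \<in> {0..T}" and e: "0 < e"
    show "\<exists>d>0. \<forall>n s. s \<in> {0..T} \<and> norm (t - s) < d \<longrightarrow> norm (\<pi> n t - \<pi> n s) < e"
    proof (intro exI[of _ "e / (K + 1)"] conjI allI impI)
      show "0 < e / (K + 1)" using e K0 by simp
      fix n s assume s: "s \<in> {0..T} \<and> norm (t - s) < e / (K + 1)"
      have "norm (\<pi> n t - \<pi> n s) \<le> K * \<bar>t - s\<bar>" using s t by (intro \<pi>L) auto
      also have "\<dots> \<le> (K + 1) * \<bar>t - s\<bar>" by (intro mult_right_mono) auto
      also have "\<dots> < (K + 1) * (e / (K + 1))" using s K0 by (intro mult_strict_left_mono) auto
      also have "\<dots> = e" using K0 by simp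
      finally show "norm (\<pi> n t - \<pi> n s) < e" .
    qed
  qed (use \<pi>B in auto)
  have \<gamma>: "(\<lambda>n. \<pi> (k n) t) \<longlonglongrightarrow> \<gamma> t" if "t \<in> {0..T}" for t
    unfolding LIMSEQ_iff using k(3) that by blast
  note subs = LIMSEQ_subseq_LIMSEQ[OF _ k(2), unfolded o_def]
  have \<gamma>\<tau>: "\<gamma> \<tau> = covec \<mu> q \<xi>"
  proof (rule LIMSEQ_unique)
    show "(\<lambda>n. covec (M (k n)) (qs (k n)) (\<xi>s (k n))) \<longlonglongrightarrow> covec \<mu> q \<xi>" by (rule subs[OF clim])
    have "(\<lambda>n. \<pi> (k n) (\<tau>s (k n)) - \<pi> (k n) \<tau>) \<longlonglongrightarrow> 0"
    proof (rule Lim_null_comparison)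
      show "\<forall>\<^sub>F n in sequentially. norm (\<pi> (k n) (\<tau>s (k n)) - \<pi> (k n) \<tau>) \<le> K * norm (\<tau>s (k n) - \<tau>)"
        using \<pi>L \<tau>0 \<tau>s0 by (simp add: less_imp_le)
      show "(\<lambda>n. K * norm (\<tau>s (k n) - \<tau>)) \<longlonglongrightarrow> 0"
        by (rule tendsto_mult_right_zero[OF tendsto_norm_zero[OF LIM_zero[OF subs[OF \<tau>lim]]]])
    qed
    moreover have "(\<lambda>n. \<pi> (k n) \<tau>) \<longlonglongrightarrow> \<gamma> \<tau>" using \<tau>0 \<tau>T' by (intro \<gamma>) simp
    ultimately have "(\<lambda>n. (\<pi> (k n) (\<tau>s (k n)) - \<pi> (k n) \<tau>) + \<pi> (k n) \<tau>) \<longlonglongrightarrow> 0 + \<gamma> \<tau>" by (rule tendsto_add)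
    then show "(\<lambda>n. covec (M (k n)) (qs (k n)) (\<xi>s (k n))) \<longlonglongrightarrow> \<gamma> \<tau>" by (simp add: \<pi>_def pTs)
  qed
  \<comment> \<open>On an interval ending strictly before \<tau> the arcs are genuine, not frozen,
    from some index \<open>m\<close> on. This is why limits are taken on such intervals and the
    endpoint is reached by continuity.\<close>
  have tail: "\<exists>m. \<forall>n\<ge>m. \<sigma> < \<tau>s (k n)" if "\<sigma> < \<tau>" for \<sigma>
    using order_tendstoD(1)[OF subs[OF \<tau>lim] that] unfolding eventually_sequentially .
  have sub2: "(\<lambda>n. Y (k (n + m))) \<longlonglongrightarrow> l" if "Y \<longlonglongrightarrow> l" for Y :: "nat \<Rightarrow> 'c::topological_space" and l m
    using LIMSEQ_ignore_initial_segment[OF LIMSEQ_subseq_LIMSEQ[OF that k(2)], of m] by (simp add: o_def)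
  have plim: "(\<lambda>n. ps (k (n + m)) t) \<longlonglongrightarrow> \<gamma> t" if m: "\<forall>n\<ge>m. \<sigma> < \<tau>s (k n)" and t: "0 \<le> t" "t \<le> \<sigma>" "\<sigma> < \<tau>" for m \<sigma> t
  proof -
    have "(\<lambda>n. \<pi> (k (n + m)) t) \<longlonglongrightarrow> \<gamma> t"
      by (rule LIMSEQ_ignore_initial_segment[OF \<gamma>]) (use t \<tau>T' in auto)
    moreover have "\<pi> (k (n + m)) t = ps (k (n + m)) t" for n using m[rule_format, of "n + m"] t by (simp add: \<pi>_def min_def)
    ultimately show ?thesis by simp
  qed
  have pn: "prox_normal C (y t) (\<gamma> t) \<mu>" if t: "0 \<le> t" "t < \<tau>" for t
  proof -
    obtain m where m: "\<forall>n\<ge>m. t < \<tau>s (k n)" using tail[OF t(2)] by blast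
    have mt: "t \<in> {0..\<tau>s (k (n + m))}" for n using m[rule_format, of "n + m"] t(1) by simp
    show ?thesis
    proof (rule prox_normal_limit)
      show "prox_normal C (ys (k (n + m)) t) (ps (k (n + m)) t) (M (k (n + m)))" for n by (rule pns[OF mt])
      show yl: "(\<lambda>n. ys (k (n + m)) t) \<longlonglongrightarrow> y t" by (rule sub2[OF ylim[OF t]])
      show "(\<lambda>n. ps (k (n + m)) t) \<longlonglongrightarrow> \<gamma> t" by (rule plim[OF m t(1) order_refl t(2)])
      show "(\<lambda>n. M (k (n + m))) \<longlonglongrightarrow> \<mu>" by (rule sub2[OF Mlim])
      show "(\<lambda>n. Vr (ys (k (n + m)) t)) \<longlonglongrightarrow> Vr (y t)"
      proof (rule Vr_tendsto[OF yl])
        show "ys (k (n + m)) t \<in> reach" for n using mt[of n] by (intro opt_V(2)[OF os]) auto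
        show "ys (k (n + m)) t \<in> closure (- S)" for n using mt[of n] by (intro opt_in_closure[OF os Xc]) auto
        show "y t \<in> reach" using t by (intro opt_V(2)[OF o]) auto
        show "y t \<in> closure (- S)" using t by (intro opt_in_closure[OF o xc]) auto
      qed
    qed
  qed
  obtain E0 where E0: "negligible E0" "\<And>t. 0 \<le> t \<Longrightarrow> t < \<tau> \<Longrightarrow> ham_le (y t) (\<gamma> t) \<mu>"
    "\<And>t. t \<in> {0<..<\<tau>} - E0 \<Longrightarrow> \<gamma> t \<bullet> f (y t) (u t) + \<mu> * r (y t) (u t) = 0"
    by (rule maximum_principle[OF o _ C, of \<gamma> \<mu>]) (use pn in auto)
  have uU: "u t \<in> U" for t by (rule ctrlD(1)[OF optD(1)[OF o]])
  have max: "maximizer (y t) (\<gamma> t) \<mu> (u t)" if "t \<in> {0<..<\<tau>} - E0" for t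
    using E0(2)[of t] E0(3)[OF that] that uU by (simp add: maximizer_def)
  \<comment> \<open>A zero of the limit forces \<mu> = 0 by the maximum principle. Gronwall's
    inequality for the approximating costates, from \<open>t\<close> to their exit times, then makes
    the terminal covector vanish in the limit, although it is a unit vector.\<close>
  have ne: "\<gamma> t \<noteq> 0" if t: "t \<in> {0<..<\<tau>} - E0" for t
  proof
    assume g0: "\<gamma> t = 0"
    then have "\<mu> * r (y t) (u t) = 0" using E0(3)[OF t] by simp
    moreover have "0 < r (y t) (u t)" using r_lower[OF uU, of "y t" t] pos by linarith
    ultimately have \<mu>0: "\<mu> = 0" by simp
    have t': "0 \<le> t" "t < \<tau>" using t by auto
    obtain m where m: "\<forall>n\<ge>m. t < \<tau>s (k n)" using tail[OF t'(2)] by blast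
    have "norm (ps (k (n + m)) (\<tau>s (k (n + m)))) \<le> (norm (ps (k (n + m)) t) + L * M (k (n + m)) * (\<tau>s (k (n + m)) - t)) * exp (L * (\<tau>s (k (n + m)) - t))" for n
    proof -
      define i where "i = k (n + m)"
      have ti: "t < \<tau>s i" unfolding i_def using m[rule_format, of "n + m"] by simp
      have "ae_deriv t (\<tau>s i) (ps i) (\<lambda>s. - (blinfun_tr (Df (ys i s) (us i s)) (ps i s) + M i *\<^sub>R Dr (ys i s) (us i s)))"
        by (rule ae_deriv_subset[OF ads[unfolded adj_def] t'(1) order_refl])
      then have "norm (ps i (\<tau>s i)) \<le> (norm (ps i t) + L * M i * (\<tau>s i - t)) * exp (L * (\<tau>s i - t))"
      proof (rule gronwall_ae_deriv[OF _ _ _ negligible_empty])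
        show "norm (- (blinfun_tr (Df (ys i s) (us i s)) (ps i s) + M i *\<^sub>R Dr (ys i s) (us i s))) \<le> L * norm (ps i s) + L * M i" for s
          unfolding norm_minus_cancel by (rule adj_rhs_bound[OF usU M])
      qed (use pos M ti in auto)
      then show ?thesis by (simp add: i_def)
    qed
    moreover have "(\<lambda>n. norm (ps (k (n + m)) (\<tau>s (k (n + m))))) \<longlonglongrightarrow> norm (covec \<mu> q \<xi>)"
      unfolding pTs by (intro tendsto_norm sub2[OF clim])
    moreover have "(\<lambda>n. (norm (ps (k (n + m)) t) + L * M (k (n + m)) * (\<tau>s (k (n + m)) - t)) * exp (L * (\<tau>s (k (n + m)) - t)))
        \<longlonglongrightarrow> (norm (\<gamma> t) + L * \<mu> * (\<tau> - t)) * exp (L * (\<tau> - t))"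
      by (intro tendsto_intros plim[OF m t'(1) order_refl t'(2)] sub2[OF Mlim] sub2[OF \<tau>lim])
    ultimately have "norm (covec \<mu> q \<xi>) \<le> (norm (\<gamma> t) + L * \<mu> * (\<tau> - t)) * exp (L * (\<tau> - t))"
      by (intro LIMSEQ_le) auto
    then have "norm (covec \<mu> q \<xi>) \<le> 0" using g0 \<mu>0 by simp
    then show False using \<mu>0 tv by (auto simp: covec_def transversal_def inner_normal_def)
  qed
  have "\<forall>n. \<exists>E. negligible E \<and> (\<forall>t\<in>{0<..<\<tau>s n} - E. maximizer (ys n t) (ps n t) (M n) (us n t))"
    using ext unfolding extremal_def by blast
  then obtain E where E: "\<And>n. negligible (E n)" "\<And>n t. t \<in> {0<..<\<tau>s n} - E n \<Longrightarrow> maximizer (ys n t) (ps n t) (M n) (us n t)"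
    by metis
  have adl: "adj u y \<mu> \<gamma> \<sigma>" if \<sigma>: "0 \<le> \<sigma>" "\<sigma> < \<tau>" for \<sigma>
  proof -
    obtain m where m: "\<forall>n\<ge>m. \<sigma> < \<tau>s (k n)" using tail[OF \<sigma>(2)] by blast
    have mm: "\<sigma> < \<tau>s (k (n + m))" for n using m by simp
    show ?thesis
    proof (rule adj_limit[OF \<sigma>(1) optD(1)[OF o] solD(1)[OF optD(2)[OF o]], where us = "\<lambda>n. us (k (n + m))" and ys = "\<lambda>n. ys (k (n + m))"
          and ps = "\<lambda>n. ps (k (n + m))" and M = "\<lambda>n. M (k (n + m))" and E = "\<lambda>n. E (k (n + m))" and E' = E0 and B = B])
      show "continuous_on {0..\<sigma>} \<gamma>" by (rule continuous_on_subset[OF k(1)]) (use \<sigma> \<tau>T' in auto)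
      show "ctrl (us (k (n + m)))" for n by (rule optD(1)[OF os])
      show "adj (us (k (n + m))) (ys (k (n + m))) (M (k (n + m))) (ps (k (n + m))) \<sigma>" for n
        unfolding adj_def by (rule ae_deriv_subset[OF ads[unfolded adj_def] order_refl less_imp_le[OF mm]])
      show "(\<lambda>n. M (k (n + m))) \<longlonglongrightarrow> \<mu>" by (rule sub2[OF Mlim])
      show "norm (ps (k (n + m)) t) \<le> B" if "t \<in> {0..\<sigma>}" for n t using that mm[of n] by (intro B) auto
      show "(\<lambda>n. ys (k (n + m)) t) \<longlonglongrightarrow> y t" if "t \<in> {0..\<sigma>}" for t using that \<sigma> by (intro sub2[OF ylim]) auto
      show "(\<lambda>n. ps (k (n + m)) t) \<longlonglongrightarrow> \<gamma> t" if "t \<in> {0..\<sigma>}" for t using that \<sigma> by (intro plim[OF m]) auto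
      show "maximizer (ys (k (n + m)) t) (ps (k (n + m)) t) (M (k (n + m))) (us (k (n + m)) t)" if "t \<in> {0<..<\<sigma>} - E (k (n + m))" for n t
        using that mm[of n] by (intro E(2)) auto
      show "maximizer (y t) (\<gamma> t) \<mu> (u t)" if "t \<in> {0<..<\<sigma>} - E0" for t using that \<sigma> by (intro max) auto
      show "\<gamma> t \<noteq> 0" if "t \<in> {0<..<\<sigma>} - E0" for t using that \<sigma> by (intro ne) auto
    qed (rule M E(1) E0(1))+
  qed
  have pc: "continuous_on {0..\<tau>} p" using ad unfolding adj_def by (rule ae_deriv_continuous)
  have \<gamma>c: "continuous_on {0..\<tau>} \<gamma>" by (rule continuous_on_subset[OF k(1)]) (use \<tau>T' in auto)
  \<comment> \<open>The limit and \<open>p\<close> satisfy the same affine equation up to every time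
    before \<tau>, so their initial difference is bounded by their difference at that time; letting
    it tend to \<tau>, both equal the terminal covector.\<close>
  have "norm (\<gamma> 0 - p 0) - norm (\<gamma> \<tau> - p \<tau>) * exp (L * \<tau>) \<le> 0"
  proof (rule continuous_le_off_negligible[OF _ \<tau>0 negligible_empty,
        where \<phi> = "\<lambda>\<sigma>. norm (\<gamma> 0 - p 0) - norm (\<gamma> \<sigma> - p \<sigma>) * exp (L * \<sigma>)"])
    show "continuous_on {0..\<tau>} (\<lambda>\<sigma>. norm (\<gamma> 0 - p 0) - norm (\<gamma> \<sigma> - p \<sigma>) * exp (L * \<sigma>))"
      by (intro continuous_intros pc \<gamma>c)
    fix \<sigma> assume "\<sigma> \<in> {0<..<\<tau>} - {}"
    then have \<sigma>: "0 \<le> \<sigma>" "\<sigma> < \<tau>" by auto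
    have "ae_deriv 0 \<sigma> (\<lambda>t. \<gamma> t - p t) (\<lambda>t. - (blinfun_tr (Df (y t) (u t)) (\<gamma> t) + \<mu> *\<^sub>R Dr (y t) (u t)) - - (blinfun_tr (Df (y t) (u t)) (p t) + \<mu> *\<^sub>R Dr (y t) (u t)))"
      by (rule ae_deriv_diff[OF adl[OF \<sigma>, unfolded adj_def] ae_deriv_subset[OF ad[unfolded adj_def] order_refl less_imp_le[OF \<sigma>(2)]]])
    then have "norm (\<gamma> 0 - p 0) \<le> (norm (\<gamma> \<sigma> - p \<sigma>) + 0 * \<sigma>) * exp (L * \<sigma>)"
    proof (rule gronwall_ae_deriv_backward)
      fix t
      have "norm (- (blinfun_tr (Df (y t) (u t)) (\<gamma> t) + \<mu> *\<^sub>R Dr (y t) (u t)) - - (blinfun_tr (Df (y t) (u t)) (p t) + \<mu> *\<^sub>R Dr (y t) (u t)))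
        = norm (blinfun_tr (Df (y t) (u t)) (\<gamma> t - p t))" by (simp add: blinfun_tr_diff norm_minus_commute)
      also have "\<dots> \<le> L * norm (\<gamma> t - p t)"
        using norm_blinfun_tr[of "Df (y t) (u t)" "\<gamma> t - p t"] mult_right_mono[OF Df_bound[OF uU] norm_ge_zero[of "\<gamma> t - p t"]]
        by (rule order_trans)
      finally show "norm (- (blinfun_tr (Df (y t) (u t)) (\<gamma> t) + \<mu> *\<^sub>R Dr (y t) (u t)) - - (blinfun_tr (Df (y t) (u t)) (p t) + \<mu> *\<^sub>R Dr (y t) (u t)))
        \<le> L * norm (\<gamma> t - p t) + 0" by simp
    qed (use pos \<sigma> in auto)
    then show "norm (\<gamma> 0 - p 0) - norm (\<gamma> \<sigma> - p \<sigma>) * exp (L * \<sigma>) \<le> 0" by simp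
  qed (use \<tau>0 in simp)
  then have "\<gamma> 0 = p 0" using \<gamma>\<tau> pT by simp
  moreover have "(\<lambda>n. \<pi> (k n) 0) \<longlonglongrightarrow> \<gamma> 0" using T0 by (intro \<gamma>) simp
  moreover have "\<pi> n 0 = ps n 0" for n using \<tau>s0[of n] by (simp add: \<pi>_def)
  ultimately have "(\<lambda>n. ps (k n) 0) \<longlonglongrightarrow> p 0" by simp
  moreover have "prox_normal C (X n) (ps n 0) (M n)" for n
    using pns[of 0 n] \<tau>s0[of n] solD(2)[OF optD(2)[OF os], of n] by simp
  ultimately show thesis using that[OF C _ k(2)] by blast
qed

end

section \<open>Differentiability of the hypograph\<close>

text \<open>The component \<open>d\<close> of \<open>v\<close> orthogonal to \<open>w\<close> is on
  the boundary of the half space; pushing it inside by a small multiple of \<open>w\<close> shows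
  that \<open>d\<close> has no length.\<close>

lemma polar_of_halfspace:
  fixes w :: "'a::real_inner"
  assumes w: "w \<noteq> 0" and le: "\<And>\<zeta>. w \<bullet> \<zeta> < 0 \<Longrightarrow> v \<bullet> \<zeta> \<le> 0"
  obtains s where "0 \<le> s" "v = s *\<^sub>R w"
proof -
  have ww: "0 < w \<bullet> w" using w by simp
  define s where "s = (v \<bullet> w) / (w \<bullet> w)"
  have "v \<bullet> - w \<le> 0" by (rule le) (use ww in simp)
  then have s: "0 \<le> s" using ww by (simp add: s_def)
  define d where "d = v - s *\<^sub>R w"
  have wd: "w \<bullet> d = 0" using ww by (simp add: d_def s_def inner_diff_right inner_commute)
  have "d \<bullet> d = v \<bullet> d - s * (w \<bullet> d)" by (simp add: d_def inner_diff_left)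
  then have dd: "d \<bullet> d = v \<bullet> d" using wd by simp
  have "d \<bullet> d \<le> 0"
  proof (rule tendsto_lowerbound)
    show "((\<lambda>e. e * (v \<bullet> w)) \<longlongrightarrow> 0) (at_right 0)" by (auto intro!: tendsto_eq_intros)
    have "d \<bullet> d \<le> e * (v \<bullet> w)" if "0 < e" for e
    proof -
      have "v \<bullet> (d - e *\<^sub>R w) \<le> 0" by (rule le) (use wd ww that in \<open>simp add: inner_diff_right\<close>)
      then show ?thesis by (simp add: inner_diff_right dd)
    qed
    then show "\<forall>\<^sub>F e in at_right 0. d \<bullet> d \<le> e * (v \<bullet> w)" by (rule eventually_mono[OF eventually_at_right_less])
  qed simp
  then have "d = 0" using inner_ge_zero[of d] by simp
  then have "v = s *\<^sub>R w" by (simp add: d_def)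
  then show thesis using s that by blast
qed

lemma frechet_normal_cone_scaleR:
  assumes "v \<in> frechet_normal_cone Q q" "0 \<le> a"
  shows "a *\<^sub>R v \<in> frechet_normal_cone Q q"
  unfolding frechet_normal_cone_iff
proof (intro allI impI)
  fix \<epsilon> :: real assume \<epsilon>: "0 < \<epsilon>"
  then have "0 < \<epsilon> / (a + 1)" using assms(2) by simp
  then obtain \<delta> where \<delta>: "\<delta> > 0" "\<forall>q'\<in>Q. norm (q' - q) < \<delta> \<longrightarrow> v \<bullet> (q' - q) \<le> \<epsilon> / (a + 1) * norm (q' - q)"
    using assms(1) unfolding frechet_normal_cone_iff by blast
  have "a *\<^sub>R v \<bullet> (q' - q) \<le> \<epsilon> * norm (q' - q)" if "q' \<in> Q" "norm (q' - q) < \<delta>" for q'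
  proof -
    have "a * (v \<bullet> (q' - q)) \<le> a * (\<epsilon> / (a + 1) * norm (q' - q))" using \<delta>(2) that assms(2) by (intro mult_left_mono) auto
    also have "\<dots> = (a / (a + 1)) * (\<epsilon> * norm (q' - q))" by simp
    also have "\<dots> \<le> 1 * (\<epsilon> * norm (q' - q))" using assms(2) \<epsilon> by (intro mult_right_mono) auto
    finally show ?thesis by simp
  qed
  then show "\<exists>\<delta>>0. \<forall>q'\<in>Q. norm (q' - q) < \<delta> \<longrightarrow> a *\<^sub>R v \<bullet> (q' - q) \<le> \<epsilon> * norm (q' - q)" using \<delta>(1) by blast
qed

section \<open>The converse for smooth data\<close>

context regular_exit_time_problem
begin

text \<open>Compactness produces limits of trajectory, normal, supergradient and multiplier along a
  subsequence. Each is then identified: by uniqueness of the optimal trajectory, smoothness of the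
  boundary, differentiability of \<open>g\<close>, and uniqueness of the multiplier.\<close>

lemma costate_limit:
  assumes o: "opt x u y \<tau>" and xS: "x \<notin> S"
    and uniq: "\<And>u' y' \<tau>'. opt x u' y' \<tau>' \<Longrightarrow> \<tau>' = \<tau> \<and> (\<forall>t\<in>{0..\<tau>}. y' t = y t)"
    and smooth: "C11_boundary S" and gd: "g differentiable (at (y \<tau>))" and e: "0 < e" and c0: "0 \<le> c"
    and sg: "\<And>z. z \<in> frontier S \<Longrightarrow> z \<in> ball (y \<tau>) e \<Longrightarrow>
      \<exists>q. supergrad c z q \<and> (\<forall>x\<in>ball (y \<tau>) (2 * e). g x \<le> g z + q \<bullet> (x - z) + c * (norm (x - z))\<^sup>2)"
    and tv: "transversal c (y \<tau>) \<xi> q \<mu>" and ad: "adj u y \<mu> p \<tau>" and pT: "p \<tau> = covec \<mu> q \<xi>"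
    and ql: "\<And>x. x \<in> ball (y \<tau>) (2 * e) \<Longrightarrow> g x \<le> g (y \<tau>) + q \<bullet> (x - y \<tau>) + c * (norm (x - y \<tau>))\<^sup>2"
    and X: "X \<longlonglongrightarrow> x" "\<And>n. X n \<in> reach" "\<And>n. X n \<notin> S"
  obtains C k P M where "0 \<le> C" "strict_mono (k :: nat \<Rightarrow> nat)" "\<And>n. prox_normal C (X (k n)) (P n) (M n)"
    "P \<longlonglongrightarrow> p 0" "M \<longlonglongrightarrow> \<mu>"
proof -
  have xc: "x \<in> closure (- S)" by (rule not_in_S_closure[OF xS])
  have Xc: "X n \<in> closure (- S)" for n by (rule not_in_S_closure[OF X(3)])
  have "\<forall>n. \<exists>u y \<tau>. opt (X n) u y \<tau>" using opt_exists[OF X(2) Xc] by metis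
  then obtain us ys \<tau>s where os: "\<And>n. opt (X n) (us n) (ys n) (\<tau>s n)" by metis
  have "Vr (X n) = R (us n) (ys n) (\<tau>s n) + g (ys n (\<tau>s n))" for n using optD(4)[OF os, of n] by simp
  then have cl: "(\<lambda>n. R (us n) (ys n) (\<tau>s n) + g (ys n (\<tau>s n))) \<longlonglongrightarrow> Vr x"
    using Vr_tendsto[OF X(1,2) Xc optD(7)[OF o] xc] by simp
  have l: "ereal (Vr x) \<le> V x" using V_finite[OF optD(7)[OF o] xc] by (rule eq_refl[OF sym])
  obtain u' y' \<tau>' k0 T where o': "opt x u' y' \<tau>'" and k0: "strict_mono (k0 :: nat \<Rightarrow> nat)" and \<tau>l': "(\<lambda>n. \<tau>s (k0 n)) \<longlonglongrightarrow> \<tau>'"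
    and Zl': "(\<lambda>n. ys (k0 n) (\<tau>s (k0 n))) \<longlonglongrightarrow> y' \<tau>'" and \<tau>T: "\<And>n. \<tau>s n \<le> T" and \<tau>T': "\<tau>' \<le> T" and "0 \<le> T"
    and unif: "\<And>e. 0 < e \<Longrightarrow> \<exists>M. \<forall>n\<ge>M. \<forall>t\<in>{0..T}. norm (ys (k0 n) t - y' t) < e"
    by (rule opt_limit[OF X(1) xc Xc optD(1)[OF os] optD(2)[OF os] optD(3)[OF os] cl l]) (rule that)
  have \<tau>\<tau>: "\<tau>' = \<tau>" and yy: "\<And>t. t \<in> {0..\<tau>} \<Longrightarrow> y' t = y t" using uniq[OF o'] by auto
  have \<tau>0: "0 \<le> \<tau>" by (rule optD(5)[OF o])
  have \<tau>l: "(\<lambda>n. \<tau>s (k0 n)) \<longlonglongrightarrow> \<tau>" using \<tau>l' by (simp add: \<tau>\<tau>)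
  have Zl: "(\<lambda>n. ys (k0 n) (\<tau>s (k0 n))) \<longlonglongrightarrow> y \<tau>" using Zl' yy[of \<tau>] \<tau>0 by (simp add: \<tau>\<tau>)
  have yl: "(\<lambda>n. ys (k0 n) t) \<longlonglongrightarrow> y t" if t: "0 \<le> t" "t < \<tau>" for t
  proof -
    have "(\<lambda>n. ys (k0 n) t) \<longlonglongrightarrow> y' t"
      unfolding LIMSEQ_iff using unif t \<tau>T' \<tau>\<tau> by (metis atLeastAtMost_iff less_imp_le order_trans)
    then show ?thesis using yy[of t] t by simp
  qed
  have fr: "ys n (\<tau>s n) \<in> frontier S" for n by (rule hit_frontier[OF optD(2,3)[OF os] Xc])
  have yf: "y \<tau> \<in> frontier S" by (rule hit_frontier[OF optD(2,3)[OF o] xc])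
  obtain m where m: "\<And>n. n \<ge> m \<Longrightarrow> ys (k0 n) (\<tau>s (k0 n)) \<in> ball (y \<tau>) e"
    using topological_tendstoD[OF Zl open_ball, of "y \<tau>" e] e unfolding eventually_sequentially by auto
  \<comment> \<open>The initial indices are dropped so that all exit points lie in the ball where
    supergradients with the common constant \<open>c\<close> are available.\<close>
  define k1 where "k1 n = k0 (n + m)" for n
  have k1: "strict_mono k1" using k0 by (simp add: k1_def strict_mono_def)
  define Z where "Z n = ys (k1 n) (\<tau>s (k1 n))" for n
  have Zf: "Z n \<in> frontier S" for n using fr by (simp add: Z_def)
  have Zb: "Z n \<in> ball (y \<tau>) e" for n using m[of "n + m"] by (simp add: Z_def k1_def)
  have "\<exists>\<xi> q \<mu> p. transversal c (Z n) \<xi> q \<mu> \<and> (\<forall>x\<in>ball (y \<tau>) (2 * e). g x \<le> g (Z n) + q \<bullet> (x - Z n) + c * (norm (x - Z n))\<^sup>2) \<and>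
      adj (us (k1 n)) (ys (k1 n)) \<mu> p (\<tau>s (k1 n)) \<and> p (\<tau>s (k1 n)) = covec \<mu> q \<xi>" for n
  proof -
    obtain q where q: "supergrad c (Z n) q" "\<forall>x\<in>ball (y \<tau>) (2 * e). g x \<le> g (Z n) + q \<bullet> (x - Z n) + c * (norm (x - Z n))\<^sup>2"
      using sg[OF Zf Zb] by blast
    obtain \<xi> where \<xi>: "inner_normal (Z n) \<xi>" using inner_normal_exists[OF Zf] by blast
    obtain \<mu> where \<mu>: "transversal c (Z n) \<xi> q \<mu>"
      by (rule transversal_exists[OF os X(3) \<xi>[unfolded Z_def] q(1)[unfolded Z_def]]) (simp add: Z_def)
    obtain p where "adj (us (k1 n)) (ys (k1 n)) \<mu> p (\<tau>s (k1 n))" "p (\<tau>s (k1 n)) = covec \<mu> q \<xi>"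
      by (rule adj_exists[OF optD(1,2,5)[OF os]])
    then show ?thesis using \<mu> q(2) by blast
  qed
  then obtain \<xi>s qs Ms ps where tvs: "\<And>n. transversal c (Z n) (\<xi>s n) (qs n) (Ms n)"
    and qls: "\<And>n x. x \<in> ball (y \<tau>) (2 * e) \<Longrightarrow> g x \<le> g (Z n) + qs n \<bullet> (x - Z n) + c * (norm (x - Z n))\<^sup>2"
    and ads: "\<And>n. adj (us (k1 n)) (ys (k1 n)) (Ms n) (ps n) (\<tau>s (k1 n))"
    and pTs: "\<And>n. ps n (\<tau>s (k1 n)) = covec (Ms n) (qs n) (\<xi>s n)" by metis
  have "compact (cball (0::'a) 1 \<times> cball (0::'a) G \<times> {0..1::real})" by (intro compact_Times) auto
  moreover have "\<forall>n. (\<xi>s n, qs n, Ms n) \<in> cball (0::'a) 1 \<times> cball (0::'a) G \<times> {0..1::real}"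
    using tvs by (auto simp: transversal_def inner_normal_def supergrad_def)
  ultimately obtain a k2 where k2: "strict_mono (k2 :: nat \<Rightarrow> nat)" "((\<lambda>n. (\<xi>s n, qs n, Ms n)) \<circ> k2) \<longlonglongrightarrow> a"
    unfolding compact_def by meson
  obtain \<xi>' q' \<mu>' where a: "a = (\<xi>', q', \<mu>')" by (cases a)
  have \<xi>l: "(\<lambda>n. \<xi>s (k2 n)) \<longlonglongrightarrow> \<xi>'" and ql': "(\<lambda>n. qs (k2 n)) \<longlonglongrightarrow> q'" and Ml: "(\<lambda>n. Ms (k2 n)) \<longlonglongrightarrow> \<mu>'"
    using tendsto_fst[OF k2(2)] tendsto_fst[OF tendsto_snd[OF k2(2)]] tendsto_snd[OF tendsto_snd[OF k2(2)]] by (simp_all add: a o_def)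
  have sub: "(\<lambda>n. Y (k1 (k2 n))) \<longlonglongrightarrow> l" if "(\<lambda>n. Y (k0 n)) \<longlonglongrightarrow> l" for Y :: "nat \<Rightarrow> 'c::topological_space" and l
    using LIMSEQ_subseq_LIMSEQ[OF LIMSEQ_ignore_initial_segment[OF that, of m] k2(1)] by (simp add: k1_def o_def)
  have Zl2: "(\<lambda>n. Z (k2 n)) \<longlonglongrightarrow> y \<tau>" unfolding Z_def by (rule sub[OF Zl])
  have tv': "transversal c (y \<tau>) \<xi>' q' \<mu>'" by (rule transversal_limit[OF tvs Zf Zl2 \<xi>l ql' Ml])
  have \<xi>\<xi>: "\<xi>' = \<xi>"
    by (rule inner_normal_unique[OF smooth yf]) (use tv tv' in \<open>simp_all add: transversal_def\<close>)
  have gZ: "(\<lambda>n. g (Z (k2 n))) \<longlonglongrightarrow> g (y \<tau>)"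
  proof (rule LIM_zero_cancel, rule Lim_null_comparison)
    show "\<forall>\<^sub>F n in sequentially. norm (g (Z (k2 n)) - g (y \<tau>)) \<le> G * norm (Z (k2 n) - y \<tau>)" using g_frontier_lip[OF Zf yf] by simp
    show "(\<lambda>n. G * norm (Z (k2 n) - y \<tau>)) \<longlonglongrightarrow> 0" by (rule tendsto_mult_right_zero[OF tendsto_norm_zero[OF LIM_zero[OF Zl2]]])
  qed
  \<comment> \<open>The supergradient inequality on the full ball passes to the limit; comparison on
    the boundary alone would leave the normal component of \<open>q\<close> undetermined.\<close>
  have "q' = q"
  proof (rule supergradient_unique[OF gd])
    show "0 < 2 * e" using e by simp
    fix x assume x: "x \<in> ball (y \<tau>) (2 * e)"
    show "g x \<le> g (y \<tau>) + q \<bullet> (x - y \<tau>) + c * (norm (x - y \<tau>))\<^sup>2" by (rule ql[OF x])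
    show "g x \<le> g (y \<tau>) + q' \<bullet> (x - y \<tau>) + c * (norm (x - y \<tau>))\<^sup>2"
    proof (rule LIMSEQ_le_const)
      show "(\<lambda>n. g (Z (k2 n)) + qs (k2 n) \<bullet> (x - Z (k2 n)) + c * (norm (x - Z (k2 n)))\<^sup>2)
          \<longlonglongrightarrow> g (y \<tau>) + q' \<bullet> (x - y \<tau>) + c * (norm (x - y \<tau>))\<^sup>2"
        by (intro tendsto_intros gZ ql' Zl2)
    qed (use qls[OF x] in blast)
  qed
  moreover have "\<mu>' = \<mu>" using tv' tv unfolding \<xi>\<xi> \<open>q' = q\<close> by (rule transversal_unique)
  ultimately have Ml2: "(\<lambda>n. Ms (k2 n)) \<longlonglongrightarrow> \<mu>" and cl2: "(\<lambda>n. covec (Ms (k2 n)) (qs (k2 n)) (\<xi>s (k2 n))) \<longlonglongrightarrow> covec \<mu> q \<xi>"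
    using Ml \<xi>l ql' \<xi>\<xi> unfolding covec_def by (auto intro!: tendsto_intros)
  define i where "i n = k1 (k2 n)" for n
  obtain C k3 where *: "0 \<le> C" "\<And>n. prox_normal C (X (i n)) (ps (k2 n) 0) (Ms (k2 n))"
    "strict_mono (k3 :: nat \<Rightarrow> nat)" "(\<lambda>n. ps (k2 (k3 n)) 0) \<longlonglongrightarrow> p 0"
  proof (rule costates_converge[OF o xS c0 tv ad pT, where X = "\<lambda>n. X (i n)" and us = "\<lambda>n. us (i n)" and ys = "\<lambda>n. ys (i n)"
        and \<tau>s = "\<lambda>n. \<tau>s (i n)" and \<xi>s = "\<lambda>n. \<xi>s (k2 n)" and qs = "\<lambda>n. qs (k2 n)" and M = "\<lambda>n. Ms (k2 n)" and ps = "\<lambda>n. ps (k2 n)" and T = T])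
    show "opt (X (i n)) (us (i n)) (ys (i n)) (\<tau>s (i n))" "X (i n) \<notin> S" "\<tau>s (i n) \<le> T" for n by (rule os X(3) \<tau>T)+
    show "transversal c (ys (i n) (\<tau>s (i n))) (\<xi>s (k2 n)) (qs (k2 n)) (Ms (k2 n))" for n using tvs[of "k2 n"] by (simp add: Z_def i_def)
    show "adj (us (i n)) (ys (i n)) (Ms (k2 n)) (ps (k2 n)) (\<tau>s (i n))"
      "ps (k2 n) (\<tau>s (i n)) = covec (Ms (k2 n)) (qs (k2 n)) (\<xi>s (k2 n))" for n unfolding i_def by (rule ads pTs)+
    show "(\<lambda>n. \<tau>s (i n)) \<longlonglongrightarrow> \<tau>" unfolding i_def by (rule sub[OF \<tau>l])
    show "(\<lambda>n. ys (i n) t) \<longlonglongrightarrow> y t" if "0 \<le> t" "t < \<tau>" for t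
      unfolding i_def using sub[of "\<lambda>n. ys n t", OF yl[OF that]] .
    show "(\<lambda>n. Ms (k2 n)) \<longlonglongrightarrow> \<mu>" "(\<lambda>n. covec (Ms (k2 n)) (qs (k2 n)) (\<xi>s (k2 n))) \<longlonglongrightarrow> covec \<mu> q \<xi>" by (rule Ml2 cl2)+
  qed (rule that)
  show thesis
  proof (rule that[OF *(1)])
    show "strict_mono (i \<circ> k3)" unfolding i_def o_def using k1 k2(1) *(3) by (simp add: strict_mono_def)
    show "prox_normal C (X ((i \<circ> k3) n)) (ps (k2 (k3 n)) 0) (Ms (k2 (k3 n)))" for n using *(2)[of "k3 n"] by simp
    show "(\<lambda>n. ps (k2 (k3 n)) 0) \<longlonglongrightarrow> p 0" by (rule *(4))
    show "(\<lambda>n. Ms (k2 (k3 n))) \<longlonglongrightarrow> \<mu>" using LIMSEQ_subseq_LIMSEQ[OF Ml2 *(3)] by (simp add: o_def)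
  qed
qed

text \<open>The proximal inequality at \<open>x\<close> makes \<open>w\<close> a normal and bounds
  \<open>V\<close> above. The inequalities at nearby points, whose costates converge, are read with
  \<open>x\<close> as test point and bound \<open>V\<close> below; both the ray property and the
  expansion follow from this pair.\<close>

lemma hypo_differentiable:
  assumes x: "x \<in> reach" "x \<notin> S" and smooth: "C11_boundary S" and gd: "\<And>z. z \<in> frontier S \<Longrightarrow> g differentiable (at z)"
    and un: "\<exists>!z. z \<in> optimal_trajectories U S f r g x"
  shows "hypo_differentiable_at S reach V x"
proof -
  have xc: "x \<in> closure (- S)" by (rule not_in_S_closure[OF x(2)])
  have Vx: "ereal (Vr x) = V x" using V_finite[OF x(1) xc] by (rule sym)
  obtain u y \<tau> where o: "opt x u y \<tau>" by (rule opt_exists[OF x(1) xc])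
  have uniq: "\<tau>' = \<tau> \<and> (\<forall>t\<in>{0..\<tau>}. y' t = y t)" if o': "opt x u' y' \<tau>'" for u' y' \<tau>'
  proof -
    have "(\<tau>', restrict y' {0..\<tau>'}) \<in> optimal_trajectories U S f r g x" "(\<tau>, restrict y {0..\<tau>}) \<in> optimal_trajectories U S f r g x"
      using o o' optimal_trajectories_iff by blast+
    then have "(\<tau>', restrict y' {0..\<tau>'}) = (\<tau>, restrict y {0..\<tau>})" using un by blast
    then have "\<tau>' = \<tau>" and eq: "restrict y' {0..\<tau>} = restrict y {0..\<tau>}" by auto
    have "y' t = y t" if "t \<in> {0..\<tau>}" for t using fun_cong[OF eq, of t] that by simp
    then show ?thesis using \<open>\<tau>' = \<tau>\<close> by blast
  qed
  have yf: "y \<tau> \<in> frontier S" by (rule hit_frontier[OF optD(2,3)[OF o] xc])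
  obtain e c where e: "0 < e" "0 \<le> c" and sg: "\<And>z. z \<in> frontier S \<Longrightarrow> z \<in> ball (y \<tau>) e \<Longrightarrow>
      \<exists>q. supergrad c z q \<and> (\<forall>x\<in>ball (y \<tau>) (2 * e). g x \<le> g z + q \<bullet> (x - z) + c * (norm (x - z))\<^sup>2)"
    by (rule supergrad_exists[of "y \<tau>"]) (rule that)
  obtain q where q: "supergrad c (y \<tau>) q" and ql: "\<And>x. x \<in> ball (y \<tau>) (2 * e) \<Longrightarrow> g x \<le> g (y \<tau>) + q \<bullet> (x - y \<tau>) + c * (norm (x - y \<tau>))\<^sup>2"
    using sg[OF yf] e(1) by auto
  obtain \<xi> where \<xi>: "inner_normal (y \<tau>) \<xi>" using inner_normal_exists[OF yf] by blast
  obtain \<mu> where \<mu>: "transversal c (y \<tau>) \<xi> q \<mu>" by (rule transversal_exists[OF o x(2) \<xi> q])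
  obtain p where p: "adj u y \<mu> p \<tau>" "p \<tau> = covec \<mu> q \<xi>" by (rule adj_exists[OF optD(1,2,5)[OF o]])
  obtain C0 where C0: "0 \<le> C0" and thA: "\<And>x u y \<tau>' \<xi> q \<mu> p. opt x u y \<tau>' \<Longrightarrow> \<tau>' \<le> \<tau> \<Longrightarrow> x \<in> closure (- S) \<Longrightarrow>
       transversal c (y \<tau>') \<xi> q \<mu> \<Longrightarrow> adj u y \<mu> p \<tau>' \<Longrightarrow> p \<tau>' = covec \<mu> q \<xi> \<Longrightarrow> prox_normal C0 x (p 0) \<mu>"
    by (rule prox_normal_optimal[OF optD(5)[OF o] e(2)]) (rule that)
  have pnt: "prox_normal C0 (y t) (p t) \<mu>" if "t \<in> {0..\<tau>}" for t
  proof (rule prox_normal_along[OF o order_refl[of \<tau>] xc \<mu> p])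
    show "0 \<le> t" "t \<le> \<tau>" using that by auto
  qed (rule thA)
  have "extremal u y p \<mu> \<tau>" by (rule extremal_exists[OF o order_refl x(2) \<mu> p C0 pnt])
  then have p0: "p 0 \<noteq> 0" using optD(5)[OF o] unfolding extremal_def by simp
  have pn: "prox_normal C0 x (p 0) \<mu>" by (rule thA[OF o order_refl xc \<mu> p])
  define w where "w = (- p 0, \<mu>)"
  have w0: "w \<noteq> 0" using p0 by (simp add: w_def zero_prod_def)
  have wN: "w \<in> frechet_normal_cone (hypo S V) (x, Vr x)" unfolding w_def by (rule prox_normal_frechet[OF pn C0])
  have cl: "\<exists>C k P M. 0 \<le> C \<and> strict_mono (k :: nat \<Rightarrow> nat) \<and> (\<forall>n. prox_normal C (X (k n)) (P n) (M n)) \<and> P \<longlonglongrightarrow> p 0 \<and> M \<longlonglongrightarrow> \<mu>"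
    if "X \<longlonglongrightarrow> x" "\<And>n. X n \<in> reach" "\<And>n. X n \<notin> S" for X
    by (rule costate_limit[OF o x(2) uniq smooth gd[OF yf] e sg \<mu> p ql that]) (assumption | intro exI conjI allI)+
  have "open (- S)" using S by (simp add: open_Compl)
  then obtain \<rho> where \<rho>: "0 < \<rho>" "ball x \<rho> \<subseteq> - S" using x(2) open_contains_ball[of "- S"] by blast
  \<comment> \<open>Every direction strictly on the negative side of \<open>w\<close> enters the
    hypograph. Otherwise there are points arbitrarily close to \<open>x\<close>, in that direction,
    where \<open>V\<close> is too small, and their costates lead to a contradiction.\<close>
  have inj: "\<exists>\<delta>>0. \<forall>t. 0 < t \<and> t < \<delta> \<longrightarrow> (x, Vr x) + t *\<^sub>R \<zeta> \<in> hypo S V" if neg: "w \<bullet> \<zeta> < 0" for \<zeta>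
  proof (rule ccontr)
    assume non: "\<not> (\<exists>\<delta>>0. \<forall>t. 0 < t \<and> t < \<delta> \<longrightarrow> (x, Vr x) + t *\<^sub>R \<zeta> \<in> hypo S V)"
    obtain h \<eta> where \<zeta>: "\<zeta> = (h, \<eta>)" by (cases \<zeta>)
    have "\<exists>t>0. t < 1 / Suc n \<and> t * norm h < \<rho> \<and> (x, Vr x) + t *\<^sub>R \<zeta> \<notin> hypo S V" for n
    proof -
      have pos: "0 < min (1 / Suc n) (\<rho> / (norm h + 1))" using \<rho>(1) by (simp add: add_nonneg_pos)
      then obtain t where t: "0 < t" "t < 1 / Suc n" "t < \<rho> / (norm h + 1)" "(x, Vr x) + t *\<^sub>R \<zeta> \<notin> hypo S V" using non by fastforce
      have "t * norm h \<le> t * (norm h + 1)" using t(1) by (intro mult_left_mono) auto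
      also have "\<dots> < \<rho>" using t(3) by (simp add: pos_less_divide_eq add_nonneg_pos)
      finally show ?thesis using t by blast
    qed
    then obtain t where t: "\<And>n. 0 < t n" "\<And>n. t n < 1 / Suc n" "\<And>n. t n * norm h < \<rho>" "\<And>n. (x, Vr x) + t n *\<^sub>R \<zeta> \<notin> hypo S V" by metis
    define X where "X n = x + t n *\<^sub>R h" for n
    have tl: "t \<longlonglongrightarrow> 0"
    proof (rule tendsto_sandwich[OF _ _ tendsto_const LIMSEQ_inverse_real_of_nat])
      show "\<forall>\<^sub>F n in sequentially. 0 \<le> t n" using t(1) by (intro always_eventually allI less_imp_le)
      show "\<forall>\<^sub>F n in sequentially. t n \<le> inverse (real (Suc n))"
        using t(2) by (intro always_eventually allI less_imp_le) (simp add: inverse_eq_divide)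
    qed
    have "X \<longlonglongrightarrow> x + 0 *\<^sub>R h" unfolding X_def by (intro tendsto_intros tl)
    then have Xl: "X \<longlonglongrightarrow> x" by simp
    have "X n \<in> ball x \<rho>" for n using t(1)[of n] t(3)[of n] by (simp add: X_def dist_norm)
    then have XS: "X n \<notin> S" for n using \<rho>(2) by blast
    have Xc: "X n \<in> closure (- S)" for n by (rule not_in_S_closure[OF XS])
    have Vlt: "V (X n) < ereal (Vr x + t n * \<eta>)" for n using t(4)[of n] Xc[of n] by (simp add: X_def \<zeta> hypo_def not_le)
    \<comment> \<open>Reachability comes from the failure itself: \<open>V\<close> lies below a real
      number there and so cannot be infinite.\<close>
    have Xr: "X n \<in> reach" for n
    proof (rule ccontr)
      assume "X n \<notin> reach"
      then have "V (X n) = \<infinity>" by (rule V_infinite)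
      then show False using Vlt[of n] by simp
    qed
    obtain C k P M where C: "0 \<le> C" and k: "strict_mono (k :: nat \<Rightarrow> nat)" and pns: "\<And>n. prox_normal C (X (k n)) (P n) (M n)"
      and Pl: "P \<longlonglongrightarrow> p 0" and Ml: "M \<longlonglongrightarrow> \<mu>" using cl[OF Xl Xr XS] by blast
    define D where "D = norm h + \<bar>\<eta>\<bar>"
    have le: "P n \<bullet> h - M n * \<eta> \<le> C * t (k n) * D\<^sup>2" for n
    proof -
      define s where "s = t (k n)"
      have s: "0 < s" using t(1) by (simp add: s_def)
      have "ereal (Vr (X (k n))) < ereal (Vr x + s * \<eta>)" using Vlt[of "k n"] V_finite[OF Xr Xc, of "k n"] by (simp add: s_def)
      \<comment> \<open>Since the displaced point lies above the graph at \<open>X (k n)\<close>,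
        shifting back by \<open>s\<close> times the direction lands below the graph at
        \<open>x\<close>. This is the test point for the proximal inequality at
        \<open>X (k n)\<close>.\<close>
      then have "ereal (Vr (X (k n)) - s * \<eta>) \<le> ereal (Vr x)" by simp
      then have "ereal (Vr (X (k n)) - s * \<eta>) \<le> V x" unfolding Vx .
      then have "- (P n \<bullet> (x - X (k n))) + M n * ((Vr (X (k n)) - s * \<eta>) - Vr (X (k n)))
          \<le> C * (norm (x - X (k n)) + \<bar>(Vr (X (k n)) - s * \<eta>) - Vr (X (k n))\<bar>)\<^sup>2"
        using pns[of n] xc unfolding prox_normal_def by blast
      then have "s * (P n \<bullet> h - M n * \<eta>) \<le> C * (s * D)\<^sup>2"
        using s by (simp add: X_def s_def[symmetric] D_def abs_mult algebra_simps)
      also have "\<dots> = s * (C * s * D\<^sup>2)" by (simp add: power2_eq_square)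
      finally show ?thesis using s by (simp add: s_def)
    qed
    have "p 0 \<bullet> h - \<mu> * \<eta> \<le> C * 0 * D\<^sup>2"
    proof (rule LIMSEQ_le)
      show "(\<lambda>n. P n \<bullet> h - M n * \<eta>) \<longlonglongrightarrow> p 0 \<bullet> h - \<mu> * \<eta>" by (intro tendsto_intros Pl Ml)
      show "(\<lambda>n. C * t (k n) * D\<^sup>2) \<longlonglongrightarrow> C * 0 * D\<^sup>2"
        using LIMSEQ_subseq_LIMSEQ[OF tl k] by (intro tendsto_intros) (simp add: o_def)
    qed (use le in blast)
    then show False using neg by (simp add: w_def \<zeta> inner_prod_def)
  qed
  \<comment> \<open>A Frechet normal cannot have a positive product with a direction that enters the
    set, so it lies in the polar of the open half space determined by \<open>w\<close>.\<close>
  have sub: "\<exists>s\<ge>0. v = s *\<^sub>R w" if v: "v \<in> frechet_normal_cone (hypo S V) (x, Vr x)" for v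
  proof -
    have "v \<bullet> \<zeta> \<le> 0" if neg: "w \<bullet> \<zeta> < 0" for \<zeta>
    proof (rule ccontr)
      assume "\<not> v \<bullet> \<zeta> \<le> 0"
      then have vz: "0 < v \<bullet> \<zeta>" by simp
      have z0: "\<zeta> \<noteq> 0" using neg by auto
      then have nz: "0 < norm \<zeta>" by simp
      have "0 < v \<bullet> \<zeta> / (2 * norm \<zeta>)" using vz nz by simp
      then obtain \<delta> where \<delta>: "\<delta> > 0" "\<And>q'. q' \<in> hypo S V \<Longrightarrow> norm (q' - (x, Vr x)) < \<delta> \<Longrightarrow>
          v \<bullet> (q' - (x, Vr x)) \<le> v \<bullet> \<zeta> / (2 * norm \<zeta>) * norm (q' - (x, Vr x))"
        using v unfolding frechet_normal_cone_iff by blast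
      obtain \<delta>' where \<delta>': "\<delta>' > 0" "\<And>t. 0 < t \<Longrightarrow> t < \<delta>' \<Longrightarrow> (x, Vr x) + t *\<^sub>R \<zeta> \<in> hypo S V" using inj[OF neg] by blast
      obtain t where t: "0 < t" "t < min \<delta>' (\<delta> / norm \<zeta>)" using dense[of 0 "min \<delta>' (\<delta> / norm \<zeta>)"] \<delta>(1) \<delta>'(1) nz by auto
      then have "t * norm \<zeta> < \<delta>" using nz by (simp add: pos_less_divide_eq)
      then have "v \<bullet> (t *\<^sub>R \<zeta>) \<le> v \<bullet> \<zeta> / (2 * norm \<zeta>) * norm (t *\<^sub>R \<zeta>)"
        using \<delta>(2)[OF \<delta>'(2)[OF t(1)]] t by simp
      also have "\<dots> = t * (v \<bullet> \<zeta>) / 2" using nz t(1) by simp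
      finally have "t * (v \<bullet> \<zeta>) \<le> 0" by simp
      then show False using t(1) vz by (simp add: mult_le_0_iff)
    qed
    then show ?thesis using polar_of_halfspace[OF w0] by metis
  qed
  define v where "v = sgn w"
  have wn: "0 < norm w" using w0 by simp
  have wv: "w = norm w *\<^sub>R v" using w0 by (simp add: v_def sgn_div_norm)
  have "frechet_normal_cone (hypo S V) (x, Vr x) = {s *\<^sub>R v |s. s \<ge> 0}"
  proof (intro equalityI subsetI)
    fix v' assume "v' \<in> frechet_normal_cone (hypo S V) (x, Vr x)"
    then obtain s where s: "s \<ge> 0" "v' = s *\<^sub>R w" using sub by blast
    have "v' = (s * norm w) *\<^sub>R v" unfolding s(2) by (subst wv) simp
    moreover have "0 \<le> s * norm w" using s(1) by simp
    ultimately show "v' \<in> {s *\<^sub>R v |s. s \<ge> 0}" by blast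
  next
    fix v' assume "v' \<in> {s *\<^sub>R v |s. s \<ge> 0}"
    then obtain s where s: "s \<ge> 0" "v' = s *\<^sub>R v" by blast
    have "v' = (s / norm w) *\<^sub>R w" unfolding s(2) v_def sgn_div_norm by (simp add: divide_inverse)
    then show "v' \<in> frechet_normal_cone (hypo S V) (x, Vr x)" using frechet_normal_cone_scaleR[OF wN, of "s / norm w"] s(1) by simp
  qed
  moreover have "\<exists>\<delta>>0. \<forall>z \<in> closure (- S) \<inter> reach. norm (z - x) + \<bar>Vr z - Vr x\<bar> < \<delta> \<longrightarrow>
      \<bar>v \<bullet> (z - x, Vr z - Vr x)\<bar> \<le> \<epsilon> * (norm (z - x) + \<bar>Vr z - Vr x\<bar>)" if \<epsilon>: "0 < \<epsilon>" for \<epsilon>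
  proof (rule ccontr)
    define \<theta> where "\<theta> z = norm (z - x) + \<bar>Vr z - Vr x\<bar>" for z
    assume "\<not> ?thesis"
    then have non: "\<exists>z \<in> closure (- S) \<inter> reach. \<theta> z < \<delta> \<and> \<not> \<bar>v \<bullet> (z - x, Vr z - Vr x)\<bar> \<le> \<epsilon> * \<theta> z" if "0 < \<delta>" for \<delta>
      using that unfolding \<theta>_def by blast
    have "\<exists>z. z \<in> closure (- S) \<and> z \<in> reach \<and> \<theta> z < \<rho> \<and> \<theta> z < 1 / Suc n \<and> \<epsilon> * \<theta> z < \<bar>v \<bullet> (z - x, Vr z - Vr x)\<bar>" for n
      using non[of "min \<rho> (1 / Suc n)"] \<rho>(1) by (auto simp: not_le)
    then obtain X where X: "\<And>n. X n \<in> closure (- S)" "\<And>n. X n \<in> reach" "\<And>n. \<theta> (X n) < \<rho>" "\<And>n. \<theta> (X n) < 1 / Suc n"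
      "\<And>n. \<epsilon> * \<theta> (X n) < \<bar>v \<bullet> (X n - x, Vr (X n) - Vr x)\<bar>" by metis
    have \<theta>0: "0 \<le> \<theta> z" for z by (simp add: \<theta>_def)
    have \<theta>l: "(\<lambda>n. \<theta> (X n)) \<longlonglongrightarrow> 0"
    proof (rule tendsto_sandwich[OF _ _ tendsto_const LIMSEQ_inverse_real_of_nat])
      show "\<forall>\<^sub>F n in sequentially. 0 \<le> \<theta> (X n)" using \<theta>0 by simp
      show "\<forall>\<^sub>F n in sequentially. \<theta> (X n) \<le> inverse (real (Suc n))"
        using X(4) by (intro always_eventually allI less_imp_le) (simp add: inverse_eq_divide)
    qed
    have Xl: "X \<longlonglongrightarrow> x"
    proof (rule LIM_zero_cancel, rule Lim_null_comparison[OF _ \<theta>l])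
      show "\<forall>\<^sub>F n in sequentially. norm (X n - x) \<le> \<theta> (X n)" by (simp add: \<theta>_def)
    qed
    have XS: "X n \<notin> S" for n
    proof -
      have "norm (X n - x) < \<rho>" using X(3)[of n] unfolding \<theta>_def by linarith
      then have "X n \<in> ball x \<rho>" by (simp add: dist_norm norm_minus_commute)
      then show ?thesis using \<rho>(2) by blast
    qed
    obtain C k P M where C: "0 \<le> C" and k: "strict_mono (k :: nat \<Rightarrow> nat)" and pns: "\<And>n. prox_normal C (X (k n)) (P n) (M n)"
      and Pl: "P \<longlonglongrightarrow> p 0" and Ml: "M \<longlonglongrightarrow> \<mu>" using cl[OF Xl X(2) XS] by blast
    define Q where "Q n = norm (w - (- P n, M n))" for n
    have "(\<lambda>n. (- P n, M n)) \<longlonglongrightarrow> w" unfolding w_def by (intro tendsto_intros Pl Ml)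
    then have Ql: "Q \<longlonglongrightarrow> norm (w - w)" unfolding Q_def by (intro tendsto_intros)
    \<comment> \<open>The upper bound for \<open>w \<bullet> d\<close> comes from \<open>x\<close>,
      the lower one from \<open>z\<close> with the nearby normal, and \<open>Q n\<close> measures
      the difference of the two normals. Dividing by \<theta> leaves a bound that tends to 0,
      against the fixed \<epsilon>.\<close>
    have main: "\<epsilon> * norm w \<le> (C0 + C) * \<theta> (X (k n)) + Q n" for n
    proof -
      define z where "z = X (k n)"
      define d where "d = (z - x, Vr z - Vr x)"
      have dle: "norm d \<le> \<theta> z" unfolding d_def \<theta>_def using norm_Pair_le[of "z - x" "Vr z - Vr x"] by simp
      have zc: "z \<in> closure (- S)" and zr: "z \<in> reach" using X(1,2) by (simp_all add: z_def)
      have Vz: "ereal (Vr z) \<le> V z" using V_finite[OF zr zc] by (rule eq_refl[OF sym])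
      have vd: "\<epsilon> * \<theta> z < \<bar>v \<bullet> d\<bar>" using X(5)[of "k n"] by (simp add: z_def d_def)
      then have "d \<noteq> 0" using mult_nonneg_nonneg[OF less_imp_le[OF \<epsilon>] \<theta>0[of z]] by auto
      then have \<theta>p: "0 < \<theta> z" using dle by (metis less_le_trans zero_less_norm_iff)
      have up: "w \<bullet> d \<le> C0 * (\<theta> z)\<^sup>2"
        using pn zc Vz unfolding prox_normal_def \<theta>_def w_def d_def by (simp add: inner_prod_def)
      have "- (P n \<bullet> (x - z)) + M n * (Vr x - Vr z) \<le> C * (norm (x - z) + \<bar>Vr x - Vr z\<bar>)\<^sup>2"
        using pns[of n] xc Vx unfolding prox_normal_def z_def by (metis order_refl)
      then have lo: "- (C * (\<theta> z)\<^sup>2) \<le> (- P n, M n) \<bullet> d"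
        by (simp add: \<theta>_def d_def inner_prod_def norm_minus_commute abs_minus_commute inner_diff_right right_diff_distrib)
      have "\<bar>(w - (- P n, M n)) \<bullet> d\<bar> \<le> Q n * norm d" unfolding Q_def by (rule Cauchy_Schwarz_ineq2)
      also have "\<dots> \<le> Q n * \<theta> z" using dle by (intro mult_left_mono) (simp_all add: Q_def)
      finally have "\<bar>w \<bullet> d - (- P n, M n) \<bullet> d\<bar> \<le> Q n * \<theta> z" by (simp add: inner_diff_left)
      moreover have "0 \<le> C0 * (\<theta> z)\<^sup>2" "0 \<le> C * (\<theta> z)\<^sup>2" "0 \<le> Q n * \<theta> z" using C0 C \<theta>0 by (simp_all add: Q_def)
      ultimately have "\<bar>w \<bullet> d\<bar> \<le> C0 * (\<theta> z)\<^sup>2 + C * (\<theta> z)\<^sup>2 + Q n * \<theta> z" using up lo by linarith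
      moreover have "\<bar>w \<bullet> d\<bar> = norm w * \<bar>v \<bullet> d\<bar>" by (subst wv) (simp add: abs_mult)
      moreover have "norm w * (\<epsilon> * \<theta> z) \<le> norm w * \<bar>v \<bullet> d\<bar>" using vd by (intro mult_left_mono) auto
      ultimately have "norm w * (\<epsilon> * \<theta> z) \<le> C0 * (\<theta> z)\<^sup>2 + C * (\<theta> z)\<^sup>2 + Q n * \<theta> z" by linarith
      then have "(\<epsilon> * norm w) * \<theta> z \<le> ((C0 + C) * \<theta> z + Q n) * \<theta> z" by (simp add: power2_eq_square algebra_simps)
      then show ?thesis using \<theta>p by (simp add: z_def)
    qed
    have "\<epsilon> * norm w \<le> (C0 + C) * 0 + norm (w - w)"
    proof (rule LIMSEQ_le_const)
      show "(\<lambda>n. (C0 + C) * \<theta> (X (k n)) + Q n) \<longlonglongrightarrow> (C0 + C) * 0 + norm (w - w)"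
        using LIMSEQ_subseq_LIMSEQ[OF \<theta>l k] by (intro tendsto_intros Ql) (simp add: o_def)
    qed (use main in blast)
    then show False using \<epsilon> wn by (simp add: mult_le_0_iff)
  qed
  moreover have "norm v = 1" using w0 by (simp add: v_def norm_sgn)
  ultimately show ?thesis unfolding hypo_differentiable_at_def Let_def by blast
qed

end

theorem proposition4p5:
  fixes U :: "(real ^ 'm) set"
    and S :: "(real ^ 'd) set"
    and f :: "real ^ 'd \<Rightarrow> real ^ 'm \<Rightarrow> real ^ 'd"
    and r :: "real ^ 'd \<Rightarrow> real ^ 'm \<Rightarrow> real"
    and g :: "real ^ 'd \<Rightarrow> real"
    and N L r\<^sub>0 \<rho>\<^sub>0 :: real
  assumes "U \<noteq> {}" and "compact U"
    and "S \<noteq> {}" and "closed S"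
    and "N > 0" and "L > 0" and "r\<^sub>0 > 0" and "\<rho>\<^sub>0 > 0"
    and "convexity_hyp U f r"
    and "dynamics_hyp U f N L"
    and "running_cost_hyp U r L r\<^sub>0"
    and "terminal_cost_hyp S g N r\<^sub>0"
    and "inner_ball_hyp S \<rho>\<^sub>0"
    and "locally_semiconcave g"
    and "continuous_on (reachable_set U S f) (value_function U S f r g)"
    and "C11_on (UNIV \<times> (UNIV - {0})) (\<lambda>(x, p). hamiltonian U f r x p)"
    and "C11_on (UNIV \<times> (UNIV - {0})) (\<lambda>(x, p). hamiltonian0 U f x p)"
  shows "\<forall>x \<in> reachable_set U S f - S.
     (hypo_differentiable_at S (reachable_set U S f) (value_function U S f r g) x
        \<longrightarrow> (\<exists>!y. y \<in> optimal_trajectories U S f r g x)) \<and>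
     (C11_boundary S \<and> (\<forall>z\<in>frontier S. g differentiable (at z))
        \<longrightarrow> (\<exists>!y. y \<in> optimal_trajectories U S f r g x)
        \<longrightarrow> hypo_differentiable_at S (reachable_set U S f) (value_function U S f r g) x)"
proof -
  obtain Df :: "real ^ 'd \<Rightarrow> real ^ 'm \<Rightarrow> (real ^ 'd) \<Rightarrow>\<^sub>L (real ^ 'd)" where Df:
    "\<And>x \<omega>. \<omega> \<in> U \<Longrightarrow> ((\<lambda>z. f z \<omega>) has_derivative blinfun_apply (Df x \<omega>)) (at x)"
    "continuous_on (UNIV \<times> U) (\<lambda>(x, \<omega>). Df x \<omega>)"
    "\<And>x y \<omega>. \<omega> \<in> U \<Longrightarrow> norm (Df y \<omega> - Df x \<omega>) \<le> L * norm (y - x)"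
    using assms(10) unfolding dynamics_hyp_def by blast
  obtain Dr where Dr: "\<And>x \<omega>. \<omega> \<in> U \<Longrightarrow> GDERIV (\<lambda>z. r z \<omega>) x :> Dr x \<omega>"
    "continuous_on (UNIV \<times> U) (\<lambda>(x, \<omega>). Dr x \<omega>)"
    "\<And>x y \<omega>. \<omega> \<in> U \<Longrightarrow> \<bar>r y \<omega> - r x \<omega>\<bar> + norm (Dr y \<omega> - Dr x \<omega>) \<le> L * norm (y - x)"
    using assms(11) unfolding running_cost_hyp_def by blast
  obtain W G where W: "open W" "frontier S \<subseteq> W" "0 \<le> G" "G < r\<^sub>0 / N" "\<And>x y. x \<in> W \<Longrightarrow> y \<in> W \<Longrightarrow> \<bar>g y - g x\<bar> \<le> G * norm (y - x)"
    using assms(12) unfolding terminal_cost_hyp_def by blast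
  interpret exit_time_problem U S f r g N L r\<^sub>0 \<rho>\<^sub>0 G Df Dr W
  proof
    show "convex {(v, \<mu>). \<exists>\<omega>\<in>U. v = f x \<omega> \<and> r x \<omega> \<le> \<mu>}" for x using assms(9) unfolding convexity_hyp_def by blast
    show "G * N < r\<^sub>0" using W(4) assms(5) by (simp add: pos_less_divide_eq)
  qed (use assms Df Dr W in \<open>auto simp: dynamics_hyp_def running_cost_hyp_def\<close>)
  have "ham 1 = (\<lambda>(x, p). hamiltonian U f r x p)" "ham 0 = (\<lambda>(x, p). hamiltonian0 U f x p)"
    by (auto simp: ham_def hamiltonian_def hamiltonian0_def fun_eq_iff)
  then interpret regular_exit_time_problem U S f r g N L r\<^sub>0 \<rho>\<^sub>0 G Df Dr W
    by unfold_locales (use assms in simp_all)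
  show ?thesis using unique_optimal_trajectory hypo_differentiable by blast
qed

end
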